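(* Let $n\ge 2$, let $X=\mathbb A^n$ and $S=\mathbb A^1$ over $\mathbb C$, and let $f:X\to S$ be a non-constant polynomial map with at most isolated singularities (i.e. the set of critical points of $f$ in $X$ is finite). For $c\in\mathbb C$ put $$\mathcal L_{f,c}=\mathrm{Ker}\Bigl(\mathcal G_{f,c}^{(0),\mathrm{an}}\to\bigoplus_{f(x)=c}\mathcal G_{f,x}^{(0)}\Bigr).$$ Then, as submodules of $\mathcal G_{f,c}^{\mathrm{an}}$, $$\mathcal L_{f,c}=\mathrm{Ker}\Bigl(\mathcal G_{f,c}^{\mathrm{an}}\to\bigoplus_{f(x)=c}\mathcal G_{f,x}\Bigr).$$
   Context: $t$ is the coordinate of $S$; $\Omega^p=\Gamma(X,\Omega_X^p)$ denotes algebraic differential forms. The algebraic Gauss-Manin system $G_f$ is the module of global sections of $\mathcal G_f=\mathcal H^0 f_+\mathcal O_X$ ($f_+$ the direct image of algebraic left $\mathcal D$-modules); explicitly $$G_f=\Omega^n[\partial_t]\big/\{\,d\eta-\partial_t(df\wedge\eta):\eta\in\Omega^{n-1}[\partial_t]\,\},$$ where $d$ and $df\wedge$ act on coefficients, $\partial_t$ acts by $\omega\partial_t^j\mapsto\omega\partial_t^{j+1}$ and $t(\omega\partial_t^j)=f\omega\,\partial_t^j-j\,\omega\,\partial_t^{j-1}$. The algebraic Brieskorn module is $G_f^{(0)}=\Omega^n/df\wedge d\Omega^{n-2}$; the natural map $\omega\mapsto\omega\partial_t^0$ is injective and identifies it with a $\mathbb C[t]$-submodule of $G_f$. The analytic stalks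 are $\mathcal G_{f,c}^{\mathrm{an}}=\mathbb C\{t-c\}\otimes_{\mathbb C[t]}G_f$ and $\mathcal G_{f,c}^{(0),\mathrm{an}}=\mathbb C\{t-c\}\otimes_{\mathbb C[t]}G_f^{(0)}\subset\mathcal G_{f,c}^{\mathrm{an}}$. For $x\in X$ with $f(x)=c$, the local analytic Brieskorn lattice is $\mathcal G_{f,x}^{(0)}=\Omega^n_{X^{\mathrm{an}},x}/df\wedge d\Omega^{n-2}_{X^{\mathrm{an}},x}$ with $t$ acting by multiplication by $f$ (zero unless $x$ is a critical point); it has the injective operator $\partial_t^{-1}$, $\partial_t^{-1}[d\eta]=[df\wedge\eta]$. The local analytic Gauss-Manin system $\mathcal G_{f,x}$ is the localization of $\mathcal G_{f,x}^{(0)}$ by $\partial_t^{-1}$. The maps $\mathcal G_{f,c}^{(0),\mathrm{an}}\to\mathcal G_{f,x}^{(0)}$ and $\mathcal G_{f,c}^{\mathrm{an}}\to\mathcal G_{f,x}$ are the $\mathbb C\{t-c\}$-linear maps induced by $\omega\partial_t^j\mapsto\partial_t^j[\omega_x]$, with $\omega_x$ the germ of $\omega$ at $x$. *)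

theory Defs
  imports
    "HOL-Analysis.Analysis"
    "HOL-Library.Function_Algebras"
    "HOL-Algebra.Module"
    "HOL-Algebra.AbelCoset"
    "HOL-Algebra.Product_Groups"
    "HOL-Algebra.Free_Abelian_Groups"
begin

section \<open>Quotients, tensor products and induced maps of modules\<close>

text \<open>
  Modules are records of HOL-Algebra; the ring operations \<open>mult\<close> and \<open>one\<close> of a record that is
  only used as a module are left undefined.
\<close>

definition quot_module :: "('r, 'a, 'm) module_scheme \<Rightarrow> 'a set \<Rightarrow> ('r, 'a set) module" where
  "quot_module M N =
    \<lparr>carrier = a_rcosets\<^bsub>M\<^esub> N, monoid.mult = undefined, one = undefined,
     ring.zero = N, add = (\<lambda>X Y. X <+>\<^bsub>M\<^esub> Y),
     module.smult = (\<lambda>a X. \<Union>x\<in>X. N +>\<^bsub>M\<^esub> (a \<odot>\<^bsub>M\<^esub> x))\<rparr>"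

text \<open>
  \<open>B \<otimes>\<^sub>R M\<close> for an \<open>R\<close>-algebra \<open>B\<close> and an \<open>R\<close>-module \<open>M\<close>: the free abelian group on
  \<open>B \<times> M\<close> modulo the subgroup generated by the usual relations, with \<open>B\<close> acting on the left factor.
\<close>

definition tensor_relations ::
  "('r, 'k) ring_scheme \<Rightarrow> ('r, 'b) module \<Rightarrow> ('r, 'a) module \<Rightarrow> ('b \<times> 'a \<Rightarrow>\<^sub>0 int) set" where
  "tensor_relations R B M =
     {frag_of (b \<oplus>\<^bsub>B\<^esub> b', m) - frag_of (b, m) - frag_of (b', m) |b b' m.
        b \<in> carrier B \<and> b' \<in> carrier B \<and> m \<in> carrier M}
   \<union> {frag_of (b, m \<oplus>\<^bsub>M\<^esub> m') - frag_of (b, m) - frag_of (b, m') |b m m'.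
        b \<in> carrier B \<and> m \<in> carrier M \<and> m' \<in> carrier M}
   \<union> {frag_of (r \<odot>\<^bsub>B\<^esub> b, m) - frag_of (b, r \<odot>\<^bsub>M\<^esub> m) |r b m.
        r \<in> carrier R \<and> b \<in> carrier B \<and> m \<in> carrier M}"

definition tensor_null ::
  "('r, 'k) ring_scheme \<Rightarrow> ('r, 'b) module \<Rightarrow> ('r, 'a) module \<Rightarrow> ('b \<times> 'a \<Rightarrow>\<^sub>0 int) set" where
  "tensor_null R B M =
     generate (free_Abelian_group (carrier B \<times> carrier M)) (tensor_relations R B M)"

definition tensor_class ::
  "('r, 'k) ring_scheme \<Rightarrow> ('r, 'b) module \<Rightarrow> ('r, 'a) module \<Rightarrow>
   ('b \<times> 'a \<Rightarrow>\<^sub>0 int) \<Rightarrow> ('b \<times> 'a \<Rightarrow>\<^sub>0 int) set" where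
  "tensor_class R B M F =
     tensor_null R B M #>\<^bsub>free_Abelian_group (carrier B \<times> carrier M)\<^esub> F"

definition base_change ::
  "('r, 'k) ring_scheme \<Rightarrow> ('r, 'b) module \<Rightarrow> ('r, 'a) module \<Rightarrow>
   ('b, ('b \<times> 'a \<Rightarrow>\<^sub>0 int) set) module" where
  "base_change R B M =
    \<lparr>carrier = rcosets\<^bsub>free_Abelian_group (carrier B \<times> carrier M)\<^esub> (tensor_null R B M),
     monoid.mult = undefined, one = undefined,
     ring.zero = tensor_null R B M,
     add = set_mult (free_Abelian_group (carrier B \<times> carrier M)),
     module.smult = (\<lambda>b X. \<Union>F\<in>X.
        tensor_class R B M (frag_extend (\<lambda>(b', m). frag_of (b \<otimes>\<^bsub>B\<^esub> b', m)) F))\<rparr>"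

text \<open>
  The \<open>B\<close>-linear map \<open>B \<otimes>\<^sub>R M \<rightarrow> N\<close>, \<open>b \<otimes> m \<mapsto> b \<phi>(m)\<close>, induced by an \<open>R\<close>-linear map \<open>\<phi>\<close> from
  \<open>M\<close> to a \<open>B\<close>-module \<open>N\<close>.  As for the other maps out of quotients below, the value on a class
  is the common value on all its representatives.
\<close>

definition base_change_lift ::
  "('b, 'c) module \<Rightarrow> ('a \<Rightarrow> 'c) \<Rightarrow> ('b \<times> 'a \<Rightarrow>\<^sub>0 int) set \<Rightarrow> 'c" where
  "base_change_lift N \<phi> X = the_elem
     ((\<lambda>F. \<Oplus>\<^bsub>N\<^esub>p\<in>Poly_Mapping.keys F.
              [Poly_Mapping.lookup F p] \<cdot>\<^bsub>N\<^esub> (fst p \<odot>\<^bsub>N\<^esub> \<phi> (snd p))) ` X)"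


section \<open>Differential forms in coordinates\<close>

text \<open>
  A form \<open>\<Sum>\<^sub>I \<omega>\<^sub>I dx\<^sub>I\<close> on \<open>\<complex>\<^sup>n\<close>, with \<open>n = CARD('n)\<close>, is given by its coefficient functions, where
  \<open>dx\<^sub>I = dx\<^bsub>i\<^sub>1\<^esub> \<and> \<dots> \<and> dx\<^bsub>i\<^sub>p\<^esub>\<close> for \<open>I = {i\<^sub>1 < \<dots> < i\<^sub>p}\<close>; the linear order on the index type serves
  only to fix the signs.  Regular functions on affine space over \<open>\<complex>\<close> are identified with
  polynomial functions.
\<close>

type_synonym 'n aff = "complex ^ 'n"
type_synonym 'n form = "'n set \<Rightarrow> 'n aff \<Rightarrow> complex"

definition partial :: "'n::finite \<Rightarrow> ('n aff \<Rightarrow> complex) \<Rightarrow> 'n aff \<Rightarrow> complex" where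
  "partial i h y = deriv (\<lambda>z. h (y + axis i z)) 0"

text \<open>\<open>dx\<^sub>i \<and> dx\<^bsub>J - {i}\<^esub> = dx_sign i J \<cdot> dx\<^sub>J\<close> for \<open>i \<in> J\<close>\<close>

definition dx_sign :: "'n::{finite,linorder} \<Rightarrow> 'n set \<Rightarrow> complex" where
  "dx_sign i J = (- 1) ^ card {j \<in> J. j < i}"

definition ext_d :: "'n::{finite,linorder} form \<Rightarrow> 'n form" where
  "ext_d \<omega> = (\<lambda>J y. \<Sum>i\<in>J. dx_sign i J * partial i (\<omega> (J - {i})) y)"

definition df_wedge :: "('n::{finite,linorder} aff \<Rightarrow> complex) \<Rightarrow> 'n form \<Rightarrow> 'n form" where
  "df_wedge f \<omega> = (\<lambda>J y. \<Sum>i\<in>J. dx_sign i J * partial i f y * \<omega> (J - {i}) y)"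

definition polynomial_map :: "('n::finite aff \<Rightarrow> complex) \<Rightarrow> bool" where
  "polynomial_map h \<longleftrightarrow>
     (\<exists>(A :: ('n \<Rightarrow> nat) set) a. finite A \<and> h = (\<lambda>x. \<Sum>m\<in>A. a m * (\<Prod>i\<in>UNIV. (x $ i) ^ m i)))"

definition critical_points :: "('n::finite aff \<Rightarrow> complex) \<Rightarrow> ('n aff) set" where
  "critical_points f = {x. \<forall>i. partial i f x = 0}"

definition alg_forms :: "nat \<Rightarrow> 'n::finite form set" where
  "alg_forms p = {\<omega>. (\<forall>I. polynomial_map (\<omega> I)) \<and> (\<forall>I. card I \<noteq> p \<longrightarrow> \<omega> I = 0)}"

text \<open>Holomorphic means complex differentiable at every point of an open set.\<close>

definition holomorphic_near :: "'n::finite aff \<Rightarrow> ('n aff \<Rightarrow> complex) \<Rightarrow> bool" where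
  "holomorphic_near x h \<longleftrightarrow>
     (\<exists>U. open U \<and> x \<in> U \<and>
        (\<forall>y\<in>U. \<exists>D. (h has_derivative D) (at y) \<and> (\<forall>a v. D (a *s v) = a * D v)))"

definition an_forms :: "nat \<Rightarrow> 'n::finite aff \<Rightarrow> 'n form set" where
  "an_forms p x = {\<omega>. (\<forall>I. holomorphic_near x (\<omega> I)) \<and> (\<forall>I. card I \<noteq> p \<longrightarrow> \<omega> I = 0)}"


section \<open>The algebraic Gauss-Manin system and Brieskorn module\<close>

definition Ct :: "complex poly ring" where
  "Ct = \<lparr>carrier = UNIV, monoid.mult = (*), one = 1, ring.zero = 0, add = (+)\<rparr>"

text \<open>An element \<open>\<Sum>\<^sub>j \<omega>\<^sub>j \<partial>\<^sub>t\<^sup>j\<close> of \<open>\<Omega>\<^sup>p[\<partial>\<^sub>t]\<close> is the finitely supported sequence of the \<open>\<omega>\<^sub>j\<close>.\<close>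

definition dt_forms :: "nat \<Rightarrow> (nat \<Rightarrow> 'n::finite form) set" where
  "dt_forms p = {W. (\<forall>j. W j \<in> alg_forms p) \<and> finite {j. W j \<noteq> 0}}"

definition dt_mult :: "(nat \<Rightarrow> 'n::finite form) \<Rightarrow> nat \<Rightarrow> 'n form" where
  "dt_mult W = (\<lambda>j. case j of 0 \<Rightarrow> 0 | Suc i \<Rightarrow> W i)"

text \<open>\<open>t (\<omega> \<partial>\<^sub>t\<^sup>j) = f \<omega> \<partial>\<^sub>t\<^sup>j - j \<omega> \<partial>\<^bsub>t\<^esub>\<^bsup>j-1\<^esup>\<close>, read off at the coefficient of \<open>\<partial>\<^sub>t\<^sup>j\<close>\<close>

definition t_mult :: "('n::finite aff \<Rightarrow> complex) \<Rightarrow> (nat \<Rightarrow> 'n form) \<Rightarrow> nat \<Rightarrow> 'n form" where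
  "t_mult f W = (\<lambda>j I y. f y * W j I y - of_nat (Suc j) * W (Suc j) I y)"

definition dt_forms_module ::
  "('n::finite aff \<Rightarrow> complex) \<Rightarrow> (complex poly, nat \<Rightarrow> 'n form) module" where
  "dt_forms_module f =
    \<lparr>carrier = dt_forms CARD('n), monoid.mult = undefined, one = undefined,
     ring.zero = 0, add = (+),
     module.smult = (\<lambda>p W. \<Sum>k\<le>degree p. (\<lambda>j I y. coeff p k * (t_mult f ^^ k) W j I y))\<rparr>"

definition gauss_manin_relations ::
  "('n::{finite,linorder} aff \<Rightarrow> complex) \<Rightarrow> (nat \<Rightarrow> 'n form) set" where
  "gauss_manin_relations f =
     {(\<lambda>j. ext_d (H j)) - dt_mult (\<lambda>j. df_wedge f (H j)) |H. H \<in> dt_forms (CARD('n) - 1)}"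

definition gauss_manin ::
  "('n::{finite,linorder} aff \<Rightarrow> complex) \<Rightarrow> (complex poly, (nat \<Rightarrow> 'n form) set) module" where
  "gauss_manin f = quot_module (dt_forms_module f) (gauss_manin_relations f)"

definition alg_forms_module ::
  "('n::finite aff \<Rightarrow> complex) \<Rightarrow> (complex poly, 'n form) module" where
  "alg_forms_module f =
    \<lparr>carrier = alg_forms CARD('n), monoid.mult = undefined, one = undefined,
     ring.zero = 0, add = (+),
     module.smult = (\<lambda>p \<omega> I y. poly p (f y) * \<omega> I y)\<rparr>"

definition brieskorn ::
  "('n::{finite,linorder} aff \<Rightarrow> complex) \<Rightarrow> (complex poly, 'n form set) module" where
  "brieskorn f = quot_module (alg_forms_module f)
     {df_wedge f (ext_d \<eta>) |\<eta>. \<eta> \<in> alg_forms (CARD('n) - 2)}"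

text \<open>The natural map from the Brieskorn module to the Gauss-Manin system, \<open>[\<omega>] \<mapsto> [\<omega> \<partial>\<^sub>t\<^sup>0]\<close>\<close>

definition brieskorn_to_gauss_manin ::
  "('n::{finite,linorder} aff \<Rightarrow> complex) \<Rightarrow> 'n form set \<Rightarrow> (nat \<Rightarrow> 'n form) set" where
  "brieskorn_to_gauss_manin f X = the_elem
     ((\<lambda>\<omega>. gauss_manin_relations f +>\<^bsub>dt_forms_module f\<^esub> (\<lambda>j. if j = 0 then \<omega> else 0)) ` X)"


section \<open>The analytic stalks\<close>

text \<open>
  \<open>\<complex>{t-c}\<close>, as a \<open>\<complex>[t]\<close>-algebra: convergent power series in the formal variable \<open>t - c\<close>, so that a
  polynomial in \<open>t\<close> is re-expanded at \<open>c\<close>.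
\<close>

definition conv_series :: "complex \<Rightarrow> (complex poly, complex fps) module" where
  "conv_series c =
    \<lparr>carrier = {g. fps_conv_radius g > 0}, monoid.mult = (*), one = 1,
     ring.zero = 0, add = (+),
     module.smult = (\<lambda>p g. fps_of_poly (pcompose p [:c, 1:]) * g)\<rparr>"

definition gauss_manin_an ::
  "('n::{finite,linorder} aff \<Rightarrow> complex) \<Rightarrow> complex \<Rightarrow>
   (complex fps, (complex fps \<times> (nat \<Rightarrow> 'n form) set \<Rightarrow>\<^sub>0 int) set) module" where
  "gauss_manin_an f c = base_change Ct (conv_series c) (gauss_manin f)"

definition brieskorn_an ::
  "('n::{finite,linorder} aff \<Rightarrow> complex) \<Rightarrow> complex \<Rightarrow>
   (complex fps, (complex fps \<times> 'n form set \<Rightarrow>\<^sub>0 int) set) module" where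
  "brieskorn_an f c = base_change Ct (conv_series c) (brieskorn f)"

text \<open>
  The inclusion of \<open>brieskorn_an f c\<close> into \<open>gauss_manin_an f c\<close>, that is, the base change of
  \<open>brieskorn_to_gauss_manin f\<close>: \<open>g \<otimes> m \<mapsto> g \<otimes> [m] = g \<cdot> (1 \<otimes> [m])\<close>.
\<close>

definition brieskorn_an_incl ::
  "('n::{finite,linorder} aff \<Rightarrow> complex) \<Rightarrow> complex \<Rightarrow>
   (complex fps \<times> 'n form set \<Rightarrow>\<^sub>0 int) set \<Rightarrow>
   (complex fps \<times> (nat \<Rightarrow> 'n form) set \<Rightarrow>\<^sub>0 int) set" where
  "brieskorn_an_incl f c = base_change_lift (gauss_manin_an f c)
     (\<lambda>m. tensor_class Ct (conv_series c) (gauss_manin f)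
        (frag_of (\<one>\<^bsub>conv_series c\<^esub>, brieskorn_to_gauss_manin f m)))"


section \<open>The local analytic Brieskorn lattice and Gauss-Manin system\<close>

text \<open>
  Germs at \<open>x\<close> of holomorphic \<open>n\<close>-forms: forms holomorphic near \<open>x\<close> modulo those vanishing near \<open>x\<close>.
  A convergent power series \<open>g\<close> in \<open>t - f x\<close> acts by multiplication by \<open>g(f - f x)\<close>.  This is
  meaningful only near \<open>x\<close>, so that \<open>an_forms_module f x\<close> satisfies the axioms of a module over
  \<open>conv_series (f x)\<close> only after passing to germs.
\<close>

definition an_forms_module ::
  "('n::finite aff \<Rightarrow> complex) \<Rightarrow> 'n aff \<Rightarrow> (complex fps, 'n form) module" where
  "an_forms_module f x =
    \<lparr>carrier = an_forms CARD('n) x, monoid.mult = undefined, one = undefined,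
     ring.zero = 0, add = (+),
     module.smult = (\<lambda>g \<omega> I y. eval_fps g (f y - f x) * \<omega> I y)\<rparr>"

definition null_forms :: "'n::finite aff \<Rightarrow> 'n form set" where
  "null_forms x = {\<omega> \<in> an_forms CARD('n) x. \<forall>I. eventually (\<lambda>y. \<omega> I y = 0) (nhds x)}"

definition form_germs ::
  "('n::finite aff \<Rightarrow> complex) \<Rightarrow> 'n aff \<Rightarrow> (complex fps, 'n form set) module" where
  "form_germs f x = quot_module (an_forms_module f x) (null_forms x)"

definition germ :: "('n::finite aff \<Rightarrow> complex) \<Rightarrow> 'n aff \<Rightarrow> 'n form \<Rightarrow> 'n form set" where
  "germ f x \<omega> = null_forms x +>\<^bsub>an_forms_module f x\<^esub> \<omega>"

definition local_brieskorn_relations ::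
  "('n::{finite,linorder} aff \<Rightarrow> complex) \<Rightarrow> 'n aff \<Rightarrow> 'n form set set" where
  "local_brieskorn_relations f x =
     {germ f x (df_wedge f (ext_d \<eta>)) |\<eta>. \<eta> \<in> an_forms (CARD('n) - 2) x}"

definition local_brieskorn ::
  "('n::{finite,linorder} aff \<Rightarrow> complex) \<Rightarrow> 'n aff \<Rightarrow>
   (complex fps, 'n form set set) module" where
  "local_brieskorn f x = quot_module (form_germs f x) (local_brieskorn_relations f x)"

definition local_class ::
  "('n::{finite,linorder} aff \<Rightarrow> complex) \<Rightarrow> 'n aff \<Rightarrow> 'n form \<Rightarrow> 'n form set set" where
  "local_class f x \<omega> = local_brieskorn_relations f x +>\<^bsub>form_germs f x\<^esub> germ f x \<omega>"

text \<open>\<open>\<partial>\<^sub>t\<^sup>-\<^sup>1 [d\<eta>] = [df \<and> \<eta>]\<close>; every germ of an \<open>n\<close>-form is some \<open>d\<eta>\<close> by the Poincare lemma.\<close>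

definition local_dt_inv ::
  "('n::{finite,linorder} aff \<Rightarrow> complex) \<Rightarrow> 'n aff \<Rightarrow>
   'n form set set \<Rightarrow> 'n form set set" where
  "local_dt_inv f x X = (THE Y. \<exists>\<eta>\<in>an_forms (CARD('n) - 1) x.
     X = local_class f x (ext_d \<eta>) \<and> Y = local_class f x (df_wedge f \<eta>))"

text \<open>
  Localization of a module by an additive operator \<open>s = \<partial>\<^sub>t\<^sup>-\<^sup>1\<close>: fractions \<open>\<partial>\<^sub>t\<^sup>k m = m / s\<^sup>k\<close>,
  represented by pairs \<open>(m, k)\<close>.
\<close>

definition dt_rel ::
  "('r, 'a) module \<Rightarrow> ('a \<Rightarrow> 'a) \<Rightarrow> (('a \<times> nat) \<times> ('a \<times> nat)) set" where
  "dt_rel M s = {((m, k), (m', k')). m \<in> carrier M \<and> m' \<in> carrier M \<and>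
     (\<exists>l. (s ^^ (l + k')) m = (s ^^ (l + k)) m')}"

definition dt_class ::
  "('r, 'a) module \<Rightarrow> ('a \<Rightarrow> 'a) \<Rightarrow> 'a \<Rightarrow> nat \<Rightarrow> ('a \<times> nat) set" where
  "dt_class M s m k = dt_rel M s `` {(m, k)}"

text \<open>
  The action of power series in \<open>t - c\<close> does not commute with \<open>\<partial>\<^sub>t\<close>; from \<open>g \<partial>\<^sub>t = \<partial>\<^sub>t g - g'\<close>, which is
  the rule \<open>t \<partial>\<^sub>t\<^sup>j = \<partial>\<^sub>t\<^sup>j t - j \<partial>\<^bsub>t\<^esub>\<^bsup>j-1\<^esup>\<close> of the algebraic system when \<open>g = t\<close>, one gets
  \<open>g \<partial>\<^sub>t\<^sup>k = \<Sum>\<^bsub>i\<le>k\<^esub> (-1)\<^sup>i (k choose i) \<partial>\<^bsub>t\<^esub>\<^bsup>k-i\<^esup> g\<^bsup>(i)\<^esup>\<close>, where \<open>\<partial>\<^bsub>t\<^esub>\<^bsup>k-i\<^esup> = \<partial>\<^sub>t\<^sup>k s\<^sup>i\<close>.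
\<close>

definition dt_localization ::
  "(complex fps, 'a) module \<Rightarrow> ('a \<Rightarrow> 'a) \<Rightarrow> (complex fps, ('a \<times> nat) set) module" where
  "dt_localization M s =
    \<lparr>carrier = (carrier M \<times> UNIV) // dt_rel M s, monoid.mult = undefined, one = undefined,
     ring.zero = dt_class M s \<zero>\<^bsub>M\<^esub> 0,
     add = (\<lambda>X Y. \<Union>(m, k)\<in>X. \<Union>(m', k')\<in>Y.
        dt_class M s ((s ^^ k') m \<oplus>\<^bsub>M\<^esub> (s ^^ k) m') (k + k')),
     module.smult = (\<lambda>g X. \<Union>(m, k)\<in>X.
        dt_class M s
          (\<Oplus>\<^bsub>M\<^esub>i\<in>{..k}. [((- 1) ^ i * int (k choose i))] \<cdot>\<^bsub>M\<^esub>
             (s ^^ i) ((fps_deriv ^^ i) g \<odot>\<^bsub>M\<^esub> m)) k)\<rparr>"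

definition local_gauss_manin ::
  "('n::{finite,linorder} aff \<Rightarrow> complex) \<Rightarrow> 'n aff \<Rightarrow>
   (complex fps, ('n form set set \<times> nat) set) module" where
  "local_gauss_manin f x = dt_localization (local_brieskorn f x) (local_dt_inv f x)"


section \<open>The maps to the local objects and their kernels\<close>

definition brieskorn_to_local ::
  "('n::{finite,linorder} aff \<Rightarrow> complex) \<Rightarrow> 'n aff \<Rightarrow>
   'n form set \<Rightarrow> 'n form set set" where
  "brieskorn_to_local f x X = the_elem (local_class f x ` X)"

text \<open>\<open>[\<Sum>\<^sub>j \<omega>\<^sub>j \<partial>\<^sub>t\<^sup>j] \<mapsto> \<Sum>\<^sub>j \<partial>\<^sub>t\<^sup>j [\<omega>\<^sub>j]\<close>\<close>

definition gauss_manin_to_local ::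
  "('n::{finite,linorder} aff \<Rightarrow> complex) \<Rightarrow> 'n aff \<Rightarrow>
   (nat \<Rightarrow> 'n form) set \<Rightarrow> ('n form set set \<times> nat) set" where
  "gauss_manin_to_local f x X = the_elem
     ((\<lambda>W. \<Oplus>\<^bsub>local_gauss_manin f x\<^esub>j\<in>{j. W j \<noteq> 0}.
              dt_class (local_brieskorn f x) (local_dt_inv f x) (local_class f x (W j)) j) ` X)"

definition brieskorn_an_to_locals ::
  "('n::{finite,linorder} aff \<Rightarrow> complex) \<Rightarrow> complex \<Rightarrow>
   (complex fps \<times> 'n form set \<Rightarrow>\<^sub>0 int) set \<Rightarrow> 'n aff \<Rightarrow> 'n form set set" where
  "brieskorn_an_to_locals f c u =
     (\<lambda>x\<in>{x. f x = c}. base_change_lift (local_brieskorn f x) (brieskorn_to_local f x) u)"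

definition gauss_manin_an_to_locals ::
  "('n::{finite,linorder} aff \<Rightarrow> complex) \<Rightarrow> complex \<Rightarrow>
   (complex fps \<times> (nat \<Rightarrow> 'n form) set \<Rightarrow>\<^sub>0 int) set \<Rightarrow>
   'n aff \<Rightarrow> ('n form set set \<times> nat) set" where
  "gauss_manin_an_to_locals f c u =
     (\<lambda>x\<in>{x. f x = c}. base_change_lift (local_gauss_manin f x) (gauss_manin_to_local f x) u)"

text \<open>\<open>\<L>\<^bsub>f,c\<^esub>\<close>, as a subset of \<open>brieskorn_an f c\<close>; \<open>sum_group\<close> is the direct sum.\<close>

definition brieskorn_kernel ::
  "('n::{finite,linorder} aff \<Rightarrow> complex) \<Rightarrow> complex \<Rightarrow>
   (complex fps \<times> 'n form set \<Rightarrow>\<^sub>0 int) set set" where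
  "brieskorn_kernel f c =
     kernel (add_monoid (brieskorn_an f c))
       (sum_group {x. f x = c} (\<lambda>x. add_monoid (local_brieskorn f x)))
       (brieskorn_an_to_locals f c)"

end

theory Submission
  imports
    Defs
    "HOL-Complex_Analysis.Cauchy_Integral_Formula"
    "HOL-Computational_Algebra.Fundamental_Theorem_Algebra"
begin

text \<open>
  The inclusion from left to right holds because the local maps are compatible with the natural
  map from the Brieskorn stalk to the Gauss-Manin stalk (\<open>lift_incl\<close>).  For the converse, let \<open>u\<close>
  be an element of the Gauss-Manin stalk at \<open>c\<close> that vanishes at every \<open>x\<close> with \<open>f x = c\<close>.  It has
  finite order in \<open>\<partial>\<^sub>t\<close>, and the point is that the order can be lowered step by step
  (\<open>filt_descend\<close>) until it is \<open>0\<close>.  Then \<open>u\<close> comes from the Brieskorn stalk, and it comes from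
  the kernel there because a local lattice embeds into its localization: \<open>\<partial>\<^sub>t\<^sup>-\<^sup>1\<close> is injective.

  One step of the descent goes as follows.  As \<open>f\<close> has only finitely many critical points, the
  Nullstellensatz gives a polynomial \<open>Q \<noteq> 0\<close> such that \<open>Q(f)\<close> lies in the Jacobian ideal.  Write the
  power series coefficients of an element \<open>u\<close> of order at most \<open>k + 1\<close> as \<open>P + Q h\<close> with polynomials
  \<open>P\<close>.  The relation \<open>df \<and> \<eta> \<partial>\<^sub>t\<^bsup>k+1\<^esup> = d\<eta> \<partial>\<^sub>t\<^sup>k\<close> lowers the order of the part with \<open>Q\<close>, hence
  \<open>u = 1 \<otimes> \<omega> \<partial>\<^sub>t\<^bsup>k+1\<^esup> + v\<close> for one algebraic form \<open>\<omega>\<close> and some \<open>v\<close> of order at most \<open>k\<close> (\<open>filt_top\<close>).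
  The vanishing of \<open>u\<close> at \<open>x\<close> says that \<open>[\<omega>]\<close> is in the image of \<open>\<partial>\<^sub>t\<^sup>-\<^sup>1\<close>, that is, \<open>\<omega> = df \<and> \<theta>\<close> for
  a germ \<open>\<theta>\<close> at \<open>x\<close>.  So the coefficient of \<open>\<omega>\<close> lies in the Jacobian ideal analytically at all
  points over \<open>c\<close>, and therefore algebraically after multiplication with \<open>Q(f)\<close> for some polynomial
  \<open>Q\<close> with \<open>Q(c) \<noteq> 0\<close> (\<open>critical_value_annihilator\<close>).  As such a \<open>Q\<close> is a unit in \<open>\<complex>{t-c}\<close>, the
  relation above lowers the order of \<open>1 \<otimes> \<omega> \<partial>\<^sub>t\<^bsup>k+1\<^esup>\<close> as well.

  Two groups of results make this work.  On the local side, \<open>\<partial>\<^sub>t\<^sup>-\<^sup>1\<close> is well defined by the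
  holomorphic Poincare lemma (\<open>poincare_ball\<close>) and injective by the exactness of the Koszul complex
  of \<open>df\<close> in degree \<open>n - 1\<close> (\<open>koszul_exact\<close>).  On the algebraic side, the Nullstellensatz
  (\<open>nullstellensatz\<close>) is combined with a comparison of germs with polynomials
  (\<open>analytic_to_algebraic\<close>).
\<close>

section \<open>Holomorphic functions of several variables\<close>

text \<open>
  The gradient is kept as data, so that the rules of differentiation compute partial derivatives.
\<close>

definition has_grad :: "('n::finite aff \<Rightarrow> complex) \<Rightarrow> ('n \<Rightarrow> complex) \<Rightarrow> 'n aff \<Rightarrow> bool" where
  "has_grad h c y \<longleftrightarrow> (h has_derivative (\<lambda>v. \<Sum>i\<in>UNIV. c i * v $ i)) (at y)"

definition holo_on :: "'n::finite aff set \<Rightarrow> ('n aff \<Rightarrow> complex) \<Rightarrow> bool" where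
  "holo_on U h \<longleftrightarrow> open U \<and> (\<forall>y\<in>U. has_grad h (\<lambda>i. partial i h y) y)"

lemma linear_axis: "bounded_linear (axis i :: complex \<Rightarrow> 'n::finite aff)"
  by (intro linear_conv_bounded_linear[THEN iffD1] linearI) (auto simp: vec_eq_iff axis_def)

lemma has_grad_line:
  assumes "has_grad h c (y + axis i z)"
  shows "((\<lambda>z. h (y + axis i z)) has_field_derivative c i) (at z)"
proof -
  have "((\<lambda>z. y + axis i z) has_derivative axis i) (at z)"
    using has_derivative_add[OF has_derivative_const bounded_linear_imp_has_derivative[OF linear_axis]]
    by simp
  from has_derivative_compose[OF this assms[unfolded has_grad_def]]
  have "((\<lambda>z. h (y + axis i z)) has_derivative (\<lambda>z. \<Sum>j\<in>UNIV. c j * (axis i z :: 'a aff) $ j)) (at z)" .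
  moreover have "(\<lambda>z. \<Sum>j\<in>UNIV. c j * (axis i z :: 'a aff) $ j) = (*) (c i)"
  proof
    fix z :: complex
    have "(\<Sum>j\<in>UNIV. c j * (axis i z :: 'a aff) $ j) = (\<Sum>j\<in>UNIV. if j = i then c j * z else 0)"
      by (intro sum.cong) (auto simp: axis_def)
    then show "(\<Sum>j\<in>UNIV. c j * (axis i z :: 'a aff) $ j) = c i * z" by simp
  qed
  ultimately show ?thesis by (simp add: has_field_derivative_def)
qed

lemma has_grad_partial: "has_grad h c y \<Longrightarrow> partial i h y = c i"
  unfolding partial_def using has_grad_line[of h c y i 0] by (intro DERIV_imp_deriv) (simp add: axis_def zero_vec_def[symmetric])

lemma linear_grad:
  fixes D :: "'n::finite aff \<Rightarrow> complex"
  assumes "linear D" "\<And>a v. D (a *s v) = a * D v"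
  shows "D v = (\<Sum>i\<in>UNIV. D (axis i 1) * v $ i)"
proof -
  have "v = (\<Sum>i\<in>UNIV. v $ i *s axis i 1)"
    by (simp add: vec_eq_iff axis_def if_distrib cong: if_cong)
  then have "D v = D (\<Sum>i\<in>UNIV. v $ i *s axis i 1)" by simp
  also have "\<dots> = (\<Sum>i\<in>UNIV. D (v $ i *s axis i 1))" by (rule linear_sum[OF assms(1)])
  also have "\<dots> = (\<Sum>i\<in>UNIV. D (axis i 1) * v $ i)" by (simp add: assms(2) mult.commute)
  finally show ?thesis .
qed

lemma holo_on_iff:
  "holo_on U h \<longleftrightarrow> open U \<and>
     (\<forall>y\<in>U. \<exists>D. (h has_derivative D) (at y) \<and> (\<forall>a v. D (a *s v) = a * D v))"
proof (intro iffI conjI ballI)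
  assume h: "holo_on U h"
  then show "open U" by (simp add: holo_on_def)
  fix y assume "y \<in> U"
  then have "has_grad h (\<lambda>i. partial i h y) y" using h by (simp add: holo_on_def)
  then show "\<exists>D. (h has_derivative D) (at y) \<and> (\<forall>a v. D (a *s v) = a * D v)"
    unfolding has_grad_def
    by (intro exI conjI allI) (assumption, simp add: sum_distrib_left algebra_simps)
next
  assume *: "open U \<and> (\<forall>y\<in>U. \<exists>D. (h has_derivative D) (at y) \<and> (\<forall>a v. D (a *s v) = a * D v))"
  show "holo_on U h" unfolding holo_on_def
  proof (intro conjI ballI)
    show "open U" using * by blast
    fix y assume "y \<in> U"
    then obtain D where D: "(h has_derivative D) (at y)" "\<And>a v. D (a *s v) = a * D v" using * by blast
    have "D = (\<lambda>v. \<Sum>i\<in>UNIV. D (axis i 1) * v $ i)"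
      using linear_grad[of D] D has_derivative_linear by blast
    then have "has_grad h (\<lambda>i. D (axis i 1)) y" using D(1) unfolding has_grad_def by simp
    then show "has_grad h (\<lambda>i. partial i h y) y" using has_grad_partial by (metis (no_types, lifting) ext)
  qed
qed

lemma holo_onI: "open U \<Longrightarrow> (\<And>y. y \<in> U \<Longrightarrow> has_grad h (c y) y) \<Longrightarrow> holo_on U h"
  unfolding holo_on_def using has_grad_partial by (metis (no_types, lifting) ext)

lemma holo_onD: "holo_on U h \<Longrightarrow> y \<in> U \<Longrightarrow> has_grad h (\<lambda>i. partial i h y) y"
  by (simp add: holo_on_def)

lemma holo_on_open: "holo_on U h \<Longrightarrow> open U" by (simp add: holo_on_def)

lemma holo_on_subset: "holo_on U h \<Longrightarrow> open V \<Longrightarrow> V \<subseteq> U \<Longrightarrow> holo_on V h"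
  by (auto simp: holo_on_def)

lemma has_grad_cong:
  assumes "has_grad h c y" "eventually (\<lambda>z. h z = h' z) (nhds y)"
  shows "has_grad h' c y"
proof -
  have "eventually (\<lambda>z. h z = h' z) (at y)" "h y = h' y"
    using assms(2) eventually_nhds_x_imp_x[OF assms(2)] by (auto simp: eventually_at_filter elim: eventually_mono)
  then show ?thesis using assms(1) unfolding has_grad_def
    using has_derivative_transform_eventually[of h _ y UNIV h'] by auto
qed

lemma partial_cong: "holo_on U h \<Longrightarrow> y \<in> U \<Longrightarrow> (\<And>z. z \<in> U \<Longrightarrow> h z = h' z) \<Longrightarrow> partial i h' y = partial i h y"
  by (rule has_grad_partial[OF has_grad_cong[OF holo_onD]])
     (auto simp: eventually_nhds holo_on_def)

lemma has_grad_const: "has_grad (\<lambda>y. a) (\<lambda>i. 0) y"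
  by (simp add: has_grad_def)

lemma has_grad_coord: "has_grad (\<lambda>y. y $ j) (\<lambda>i. if i = j then 1 else 0) y"
proof -
  have "((\<lambda>y. y $ j) has_derivative (\<lambda>v. v $ j)) (at y)"
    by (rule bounded_linear_imp_has_derivative[OF bounded_linear_vec_nth])
  moreover have "(\<Sum>i\<in>UNIV. (if i = j then 1 else 0) * v $ i) = v $ j" for v :: "'a aff"
    by (simp add: if_distrib[of "\<lambda>c. c * _"] cong: if_cong)
  ultimately show ?thesis unfolding has_grad_def by simp
qed

lemma has_grad_add: "has_grad h c y \<Longrightarrow> has_grad h' c' y \<Longrightarrow> has_grad (\<lambda>y. h y + h' y) (\<lambda>i. c i + c' i) y"
  unfolding has_grad_def by (drule (1) has_derivative_add) (simp add: algebra_simps sum.distrib)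

lemma has_grad_mult: "has_grad h c y \<Longrightarrow> has_grad h' c' y \<Longrightarrow>
  has_grad (\<lambda>y. h y * h' y) (\<lambda>i. h y * c' i + c i * h' y) y"
  unfolding has_grad_def by (drule (1) has_derivative_mult)
    (simp add: algebra_simps sum.distrib sum_distrib_left sum_distrib_right)

lemma has_grad_cmult: "has_grad h c y \<Longrightarrow> has_grad (\<lambda>y. a * h y) (\<lambda>i. a * c i) y"
  using has_grad_mult[OF has_grad_const[of a y]] by fastforce

lemma has_grad_sum: "finite A \<Longrightarrow> (\<And>a. a \<in> A \<Longrightarrow> has_grad (h a) (c a) y) \<Longrightarrow>
   has_grad (\<lambda>y. \<Sum>a\<in>A. h a y) (\<lambda>i. \<Sum>a\<in>A. c a i) y"
  by (induction A rule: finite_induct) (auto intro: has_grad_const has_grad_add)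

lemma has_grad_comp: "has_grad h c y \<Longrightarrow> (g has_field_derivative g') (at (h y)) \<Longrightarrow>
   has_grad (\<lambda>y. g (h y)) (\<lambda>i. g' * c i) y"
  unfolding has_grad_def has_field_derivative_def
  by (drule (1) has_derivative_compose) (simp add: sum_distrib_left mult.assoc)

definition daff :: "'n::finite aff \<Rightarrow> ('n \<Rightarrow> complex) \<Rightarrow> 'n aff \<Rightarrow> 'n aff" where
  "daff p l y = p + (\<chi> j. l j * y $ j)"

lemma daff_nth [simp]: "daff p l y $ j = p $ j + l j * y $ j" by (simp add: daff_def)

lemma bounded_linear_diag: "bounded_linear (\<lambda>v. (\<chi> j. l j * v $ j) :: 'n::finite aff)"
  by (intro linear_conv_bounded_linear[THEN iffD1] linearI) (auto simp: vec_eq_iff algebra_simps)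

lemma has_grad_daff: "has_grad h c (daff p l y) \<Longrightarrow> has_grad (\<lambda>y. h (daff p l y)) (\<lambda>i. c i * l i) y"
proof -
  assume *: "has_grad h c (daff p l y)"
  have "(daff p l has_derivative (\<lambda>v. (\<chi> j. l j * v $ j))) (at y)"
    unfolding daff_def[abs_def]
    using has_derivative_add[OF has_derivative_const bounded_linear_imp_has_derivative[OF bounded_linear_diag]]
    by simp
  from has_derivative_compose[OF this *[unfolded has_grad_def]]
  show ?thesis unfolding has_grad_def by (simp add: mult.assoc)
qed

lemma holo_on_continuous: "holo_on U h \<Longrightarrow> continuous_on U h"
  unfolding holo_on_def has_grad_def
  by (meson continuous_at_imp_continuous_on has_derivative_continuous)

lemma continuous_on_daff [continuous_intros]:
  fixes l :: "'a::topological_space \<Rightarrow> 'n::finite \<Rightarrow> complex"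
  assumes "continuous_on S p" "\<And>j. continuous_on S (\<lambda>s. l s j)" "continuous_on S y"
  shows "continuous_on S (\<lambda>s. daff (p s) (l s) (y s))"
  unfolding daff_def using assms by (intro continuous_intros)

text \<open>
  Differentiation under the integral sign for the substitutions \<open>daff\<close>.  Translations occur in
  Cauchy's formula for partial derivatives, contractions towards a point in the homotopies below.
\<close>

lemma has_grad_param_integral:
  fixes p :: "real \<Rightarrow> 'n::finite aff" and l :: "real \<Rightarrow> 'n \<Rightarrow> complex"
  assumes g: "holo_on V g" and cg: "\<And>i. continuous_on V (partial i g)"
    and U: "convex U" "open U"
    and p: "continuous_on {0..1} p" and l: "\<And>j. continuous_on {0..1} (\<lambda>s. l s j)"
    and w: "continuous_on {0..1} w"
    and sub: "\<And>s y. s \<in> {0..1} \<Longrightarrow> y \<in> U \<Longrightarrow> daff (p s) (l s) y \<in> V"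
    and y0: "y0 \<in> U"
  shows "has_grad (\<lambda>y. integral {0..1} (\<lambda>s. w s * g (daff (p s) (l s) y)))
     (\<lambda>i. integral {0..1} (\<lambda>s. w s * l s i * partial i g (daff (p s) (l s) y0))) y0"
proof -
  define P :: "'n \<Rightarrow> 'n aff \<Rightarrow>\<^sub>L complex" where "P i = Blinfun (\<lambda>v. v $ i)" for i
  have P: "blinfun_apply (P i) v = v $ i" for i v
    unfolding P_def by (simp add: bounded_linear_Blinfun_apply bounded_linear_vec_nth)
  define a where "a y s i = w s * l s i * partial i g (daff (p s) (l s) y)" for y s i
  define fx where "fx y s = (\<Sum>i\<in>UNIV. blinfun_mult_right (a y s i) o\<^sub>L P i)" for y s
  have fx: "blinfun_apply (fx y s) v = (\<Sum>i\<in>UNIV. a y s i * v $ i)" for y s v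
    unfolding fx_def by (simp add: blinfun.sum_left P)
  have c1: "continuous_on (U \<times> {0..1}) (\<lambda>x. h (snd x))" if "continuous_on {0..1} h" for h :: "real \<Rightarrow> 'z::topological_space"
    by (rule continuous_on_compose2[OF that]) (auto intro: continuous_intros)
  have cd: "continuous_on (U \<times> {0..1}) (\<lambda>x. daff (p (snd x)) (l (snd x)) (fst x))"
    by (intro continuous_intros c1 p l)
  have ca: "continuous_on (U \<times> {0..1}) (\<lambda>x. a (fst x) (snd x) i)" for i
    unfolding a_def
    by (intro continuous_intros c1 w l continuous_on_compose2[OF cg[of i] cd]) (auto intro: sub)
  have cg0: "continuous_on V g" using g by (rule holo_on_continuous)
  have ci: "continuous_on {0..1} (\<lambda>s. h s y)" if "continuous_on (U \<times> {0..1}) (\<lambda>x. h (snd x) (fst x))" "y \<in> U"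
     for y and h :: "real \<Rightarrow> 'n aff \<Rightarrow> 'z::topological_space"
    using continuous_on_compose2[OF that(1), of "{0..1}" "\<lambda>s. (y, s)"] that(2)
      continuous_on_Pair[OF continuous_on_const continuous_on_id, of "{0..1::real}" y] by fastforce
  have "((\<lambda>y. integral (cbox 0 1) (\<lambda>s. w s * g (daff (p s) (l s) y))) has_derivative
     blinfun_apply (integral (cbox 0 1) (fx y0))) (at y0 within U)"
  proof (rule leibniz_rule[OF _ _ _ y0 U(1)])
    fix y s assume y: "y \<in> U" and "s \<in> cbox (0::real) 1"
    then have "daff (p s) (l s) y \<in> V" using sub by auto
    from has_grad_cmult[OF has_grad_daff[OF holo_onD[OF g this]], of "w s"]
    have "((\<lambda>y. w s * g (daff (p s) (l s) y)) has_derivative fx y s) (at y)"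
      unfolding has_grad_def fx a_def by (simp add: fx a_def mult.assoc mult.commute mult.left_commute)
    then show "((\<lambda>y. w s * g (daff (p s) (l s) y)) has_derivative fx y s) (at y within U)"
      by (rule has_derivative_at_withinI)
  next
    fix y assume y: "y \<in> U"
    show "(\<lambda>s. w s * g (daff (p s) (l s) y)) integrable_on cbox 0 1"
      using y by (intro integrable_continuous) (auto intro!: continuous_intros w p l continuous_on_compose2[OF cg0] sub)
  next
    show "continuous_on (U \<times> cbox 0 1) (\<lambda>(x, t). fx x t)"
      unfolding fx_def case_prod_beta using ca by (auto intro!: continuous_intros)
  qed
  moreover have "blinfun_apply (integral {0..1} (fx y0)) = (\<lambda>v. \<Sum>i\<in>UNIV. integral {0..1} (\<lambda>s. a y0 s i) * v $ i)"
  proof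
    fix v
    show "blinfun_apply (integral {0..1} (fx y0)) v = (\<Sum>i\<in>UNIV. integral {0..1} (\<lambda>s. a y0 s i) * v $ i)" for v
  proof -
    have cay: "continuous_on {0..1} (\<lambda>s. a y0 s i)" for i using ci[OF ca y0] by simp
    have "continuous_on {0..1} (fx y0)"
      unfolding fx_def by (auto intro!: continuous_intros cay)
    then have int: "fx y0 integrable_on {0..1}" by (rule integrable_continuous_interval)
    have "blinfun_apply (integral {0..1} (fx y0)) v = integral {0..1} (\<lambda>s. blinfun_apply (fx y0 s) v)"
      using integral_linear[OF int, of "\<lambda>b. blinfun_apply b v"]
      by (simp add: o_def blinfun.bounded_linear_left)
    also have "\<dots> = integral {0..1} (\<lambda>s. \<Sum>i\<in>UNIV. a y0 s i * v $ i)" by (simp add: fx)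
    also have "\<dots> = (\<Sum>i\<in>UNIV. integral {0..1} (\<lambda>s. a y0 s i * v $ i))"
      by (rule integral_sum) (auto intro!: integrable_continuous_interval continuous_intros cay)
    also have "\<dots> = (\<Sum>i\<in>UNIV. integral {0..1} (\<lambda>s. a y0 s i) * v $ i)" by simp
    finally show ?thesis by simp
    qed
  qed
  ultimately show ?thesis unfolding has_grad_def a_def
    using at_within_open[OF y0 U(2)] by simp
qed

text \<open>
  Cauchy's formula exhibits the derivative as a weighted mean of values on a circle; with the circle
  parametrized by \<open>[0, 1]\<close> this is an integral to which \<open>has_grad_param_integral\<close> applies.
\<close>

lemma deriv_circle_mean:
  assumes "F holomorphic_on ball 0 R" "0 < r" "r < R"
  shows "deriv F 0 = integral {0..1} (\<lambda>s. exp (- (2 * of_real pi * \<i> * of_real s)) / of_real r * F (of_real r * exp (2 * of_real pi * \<i> * of_real s)))"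
proof -
  have c: "continuous_on (cball 0 r) F" "F holomorphic_on ball 0 r"
    using assms by (auto intro!: holomorphic_on_imp_continuous_on intro: holomorphic_on_subset)
  have "(F has_field_derivative (1 / (2 * of_real pi * \<i>) * contour_integral (circlepath 0 r) (\<lambda>u. F u / (u - 0)^2))) (at 0)"
    by (rule Cauchy_derivative_integral_circlepath(2)[OF c]) (use assms in auto)
  then have "deriv F 0 = 1 / (2 * of_real pi * \<i>) * contour_integral (circlepath 0 r) (\<lambda>u. F u / (u - 0)^2)"
    by (rule DERIV_imp_deriv)
  also have "\<dots> = 1 / (2 * of_real pi * \<i>) * integral {0..1} (\<lambda>s. F (circlepath 0 r s) / (circlepath 0 r s)^2 * vector_derivative (circlepath 0 r) (at s))"
    by (simp add: contour_integral_integral)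
  also have "\<dots> = integral {0..1} (\<lambda>s. 1 / (2 * of_real pi * \<i>) * (F (circlepath 0 r s) / (circlepath 0 r s)^2 * vector_derivative (circlepath 0 r) (at s)))"
    by (rule integral_mult_right[symmetric])
  also have "\<dots> = integral {0..1} (\<lambda>s. exp (- (2 * of_real pi * \<i> * of_real s)) / of_real r * F (of_real r * exp (2 * of_real pi * \<i> * of_real s)))"
    unfolding vector_derivative_circlepath using \<open>0 < r\<close>
    by (intro integral_cong) (simp add: circlepath exp_minus field_simps power2_eq_square)
  finally show ?thesis .
qed

abbreviation circ_wt :: "real \<Rightarrow> real \<Rightarrow> complex" where
  "circ_wt r s \<equiv> exp (- (2 * of_real pi * \<i> * of_real s)) / of_real r"

abbreviation circ_shift :: "'n::finite \<Rightarrow> real \<Rightarrow> real \<Rightarrow> 'n aff" where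
  "circ_shift i r s \<equiv> axis i (of_real r * exp (2 * of_real pi * \<i> * of_real s))"

lemma daff_one: "daff p (\<lambda>_. 1) y = y + p"
  by (simp add: vec_eq_iff)

lemma norm_axis: "norm (axis i z :: 'n::finite aff) = norm z"
  by (simp add: norm_eq_sqrt_inner inner_axis_axis)

lemma partial_circle_mean:
  assumes g: "holo_on U g" and U: "ball y R \<subseteq> U" and r: "0 < r" "r < R"
  shows "partial i g y = integral {0..1} (\<lambda>s. circ_wt r s * g (daff (circ_shift i r s) (\<lambda>_. 1) y))"
proof -
  have "(\<lambda>z. g (y + axis i z)) holomorphic_on ball 0 R"
  proof (rule holomorphic_onI)
    fix z :: complex assume "z \<in> ball 0 R"
    then have "y + axis i z \<in> U" using U by (auto simp: dist_norm norm_axis subset_iff)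
    from has_grad_line[OF holo_onD[OF g this]]
    show "(\<lambda>z. g (y + axis i z)) field_differentiable at z within ball 0 R"
      using field_differentiable_at_within field_differentiable_def by blast
  qed
  from deriv_circle_mean[OF this r] show ?thesis by (simp add: partial_def daff_one)
qed

text \<open>
  One radius serves for all points near \<open>y0\<close>, all directions and all functions on \<open>U\<close>.  This
  uniformity allows the mean to be differentiated in \<open>y\<close> and to be applied to \<open>partial j g\<close> as well.
\<close>

lemma circle_mean_setup:
  fixes y0 :: "'n::finite aff"
  assumes g: "holo_on U g" and y0: "y0 \<in> U"
  shows "\<exists>e>0. \<exists>r>0. ball y0 (2 * e) \<subseteq> U \<and>
    (\<forall>y\<in>ball y0 e. \<forall>s i. daff (circ_shift i r s) (\<lambda>_. 1) y \<in> ball y0 (2 * e)) \<and>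
    (\<forall>y\<in>ball y0 e. \<forall>i h. holo_on U h \<longrightarrow>
      partial i h y = integral {0..1} (\<lambda>s. circ_wt r s * h (daff (circ_shift i r s) (\<lambda>_. 1) y)))"
proof -
  from g y0 obtain d where d: "d > 0" "ball y0 d \<subseteq> U"
    using holo_on_open openE by blast
  define e where "e = d / 2"
  have e: "e > 0" "ball y0 (2 * e) \<subseteq> U" using d by (auto simp: e_def)
  show ?thesis
  proof (rule exI[of _ e], intro conjI exI[of _ "e/2"] ballI allI impI)
    show "e > 0" "e/2 > 0" "ball y0 (2 * e) \<subseteq> U" using e by auto
  next
    fix s y i assume y: "y \<in> ball y0 e"
    have "norm (circ_shift i (e / 2) s :: 'n aff) = e / 2"
      using e by (simp add: norm_axis norm_mult)
    then have "dist y0 (y + circ_shift i (e / 2) s) < e + e/2"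
      using y norm_triangle_ineq[of "y - y0" "circ_shift i (e / 2) s"]
      by (simp add: dist_norm norm_minus_commute algebra_simps)
    then show "daff (circ_shift i (e / 2) s) (\<lambda>_. 1) y \<in> ball y0 (2 * e)" using e by (simp add: daff_one)
  next
    fix y i h assume y: "y \<in> ball y0 e" and h: "holo_on U h"
    have "ball y e \<subseteq> ball y0 (2 * e)"
      using y by (simp add: ball_subset_ball_iff dist_commute)
    then have "ball y e \<subseteq> U" using e by blast
    then show "partial i h y = integral {0..1} (\<lambda>s. circ_wt (e/2) s * h (daff (circ_shift i (e/2) s) (\<lambda>_. 1) y))"
      using e by (intro partial_circle_mean[OF h]) auto
  qed
qed

lemma continuous_on_circ:
  "continuous_on S (\<lambda>s. circ_wt r s)" "continuous_on S (\<lambda>s. circ_shift i r s)" if "r > 0"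
  using that
  by (auto intro!: continuous_intros bounded_linear.continuous_on[OF linear_axis])

lemma continuous_on_partial:
  assumes g: "holo_on U g" shows "continuous_on U (partial i g)"
proof (rule continuous_at_imp_continuous_on, rule ballI)
  fix y0 assume "y0 \<in> U"
  from circle_mean_setup[OF g this] obtain e r where e: "e > 0" "r > 0" "ball y0 (2 * e) \<subseteq> U"
    and sub: "\<And>s y i. y \<in> ball y0 e \<Longrightarrow> daff (circ_shift i r s) (\<lambda>_. 1) y \<in> ball y0 (2 * e)"
    and eq: "\<And>y i h. y \<in> ball y0 e \<Longrightarrow> holo_on U h \<Longrightarrow>
      partial i h y = integral {0..1} (\<lambda>s. circ_wt r s * h (daff (circ_shift i r s) (\<lambda>_. 1) y))"
    by blast
  have c: "continuous_on (ball y0 e \<times> {0..1}) (\<lambda>x. h (snd x))" if "continuous_on {0..1} h" for h :: "real \<Rightarrow> 'z::topological_space"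
    by (rule continuous_on_compose2[OF that]) (auto intro: continuous_intros)
  have "continuous_on (ball y0 e \<times> cbox 0 1) (\<lambda>(y, s). circ_wt r s * g (daff (circ_shift i r s) (\<lambda>_. 1) y))"
    unfolding case_prod_beta cbox_interval
    by (intro continuous_on_mult c continuous_on_circ continuous_on_compose2[OF holo_on_continuous[OF g]] continuous_on_daff
        continuous_intros)
      (use e sub in auto)
  from integral_continuous_on_param[OF this]
  have "continuous_on (ball y0 e) (partial i g)"
    by (rule continuous_on_eq) (use eq[OF _ g] in \<open>simp only: cbox_interval\<close>)
  then show "isCont (partial i g) y0"
    using e by (simp add: continuous_on_eq_continuous_at)
qed

text \<open>
  A partial derivative is a mean of translates of \<open>g\<close>, and such a mean can be differentiated under the
  integral; hence it is again holomorphic.  Its \<open>j\<close>-th derivative is the mean of \<open>partial j g\<close>, which is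
  \<open>partial i (partial j g)\<close> once \<open>partial j g\<close> is known to be holomorphic: partial derivatives commute.
\<close>

lemma partial_has_grad:
  assumes g: "holo_on U g" and y: "y \<in> U"
  shows "has_grad (partial i g) (\<lambda>j. partial i (partial j g) y) y"
    and "has_grad (partial i g) (\<lambda>j. partial j (partial i g) y) y"
proof -
  have 1: "\<exists>c. has_grad (partial i g) c y0 \<and> ((\<forall>j. holo_on U (partial j g)) \<longrightarrow> (\<forall>j. c j = partial i (partial j g) y0))" if y0: "y0 \<in> U" for i y0
  proof -
    from circle_mean_setup[OF g y0] obtain e r where e: "e > 0" "r > 0" "ball y0 (2 * e) \<subseteq> U"
      and sub: "\<And>s y i. y \<in> ball y0 e \<Longrightarrow> daff (circ_shift i r s) (\<lambda>_. 1) y \<in> ball y0 (2 * e)"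
      and eq: "\<And>y i h. y \<in> ball y0 e \<Longrightarrow> holo_on U h \<Longrightarrow>
        partial i h y = integral {0..1} (\<lambda>s. circ_wt r s * h (daff (circ_shift i r s) (\<lambda>_. 1) y))"
      by blast
    define c where "c j = integral {0..1} (\<lambda>s. circ_wt r s * 1 * partial j g (daff (circ_shift i r s) (\<lambda>_. 1) y0))" for j
    have "has_grad (\<lambda>y. integral {0..1} (\<lambda>s. circ_wt r s * g (daff (circ_shift i r s) (\<lambda>_. 1) y))) c y0"
      unfolding c_def
      by (rule has_grad_param_integral[OF g continuous_on_partial[OF g], where U = "ball y0 e"])
        (use e sub in \<open>auto intro!: continuous_on_circ\<close>)
    then have 2: "has_grad (partial i g) c y0"
      by (rule has_grad_cong) (use e eq[OF _ g] in \<open>auto simp: eventually_nhds intro!: exI[of _ "ball y0 e"]\<close>)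
    have "c j = partial i (partial j g) y0" if "\<forall>j. holo_on U (partial j g)" for j
      using eq[of y0 "partial j g" i] e that by (simp add: c_def)
    with 2 show ?thesis by blast
  qed
  then have h: "holo_on U (partial i g)" for i
    by (intro holo_onI[OF holo_on_open[OF g], where c = "\<lambda>y. SOME c. has_grad (partial i g) c y"]) (use 1 in \<open>blast intro: someI_ex[where P = "\<lambda>c. has_grad (partial i g) c _"]\<close>)
  from 1[OF y, of i] h obtain c where c: "has_grad (partial i g) c y" "c = (\<lambda>j. partial i (partial j g) y)" by blast
  then show "has_grad (partial i g) (\<lambda>j. partial i (partial j g) y) y" by simp
  show "has_grad (partial i g) (\<lambda>j. partial j (partial i g) y) y" by (rule holo_onD[OF h y])
qed

lemma holo_on_partial: "holo_on U g \<Longrightarrow> holo_on U (partial i g)"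
  by (rule holo_onI[OF holo_on_open partial_has_grad(1)])

lemma partial_commute: "holo_on U g \<Longrightarrow> y \<in> U \<Longrightarrow> partial j (partial i g) y = partial i (partial j g) y"
  using has_grad_partial[OF partial_has_grad(1)] by metis

section \<open>Integral means along rays\<close>

text \<open>
  The coordinates in \<open>S\<close> are contracted towards those of \<open>x\<close>.  The Poincare lemma uses all coordinates,
  and division by one coordinate function uses a single one.
\<close>

definition contract :: "'n::finite set \<Rightarrow> 'n aff \<Rightarrow> complex \<Rightarrow> 'n aff \<Rightarrow> 'n aff" where
  "contract S x z y = (\<chi> j. if j \<in> S then x $ j + z * (y $ j - x $ j) else y $ j)"

definition ray_mean :: "'n::finite set \<Rightarrow> nat \<Rightarrow> 'n aff \<Rightarrow> ('n aff \<Rightarrow> complex) \<Rightarrow> 'n aff \<Rightarrow> complex" where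
  "ray_mean S m x g y = integral {0..1} (\<lambda>s. of_real s ^ m * g (contract S x (of_real s) y))"

lemma contract_daff: "contract S x z = daff (\<chi> j. if j \<in> S then (1 - z) * x $ j else 0) (\<lambda>j. if j \<in> S then z else 1)"
  by (auto simp: contract_def vec_eq_iff algebra_simps)

lemma contract_1 [simp]: "contract S x 1 y = y"
  by (simp add: contract_def vec_eq_iff)

lemma contract_in_ball: "y \<in> ball x r \<Longrightarrow> norm z \<le> 1 \<Longrightarrow> contract S x z y \<in> ball x r"
proof -
  assume *: "y \<in> ball x r" "norm z \<le> 1"
  have "norm (contract S x z y - x) \<le> norm (y - x)"
    using * by (intro norm_le_componentwise_cart) (auto simp: contract_def norm_mult mult_left_le_one_le)
  with * show ?thesis by (auto simp: dist_norm norm_minus_commute)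
qed

lemma ray_mean_grad:
  assumes g: "holo_on (ball x r) g" and y: "y \<in> ball x r"
  shows "has_grad (ray_mean S m x g) (\<lambda>j. if j \<in> S then ray_mean S (Suc m) x (partial j g) y else ray_mean S m x (partial j g) y) y"
proof -
  have "has_grad (\<lambda>y. integral {0..1} (\<lambda>s. of_real s ^ m * g (daff (\<chi> j. if j \<in> S then (1 - of_real s) * x $ j else 0) (\<lambda>j. if j \<in> S then of_real s else 1) y)))
     (\<lambda>i. integral {0..1} (\<lambda>s. of_real s ^ m * (if i \<in> S then of_real s else 1) * partial i g (daff (\<chi> j. if j \<in> S then (1 - of_real s) * x $ j else 0) (\<lambda>j. if j \<in> S then of_real s else 1) y))) y"
  proof (rule has_grad_param_integral[OF g continuous_on_partial[OF g], where U = "ball x r"])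
    show "continuous_on {0..1} (\<lambda>s. \<chi> j. if j \<in> S then (1 - complex_of_real s) * x $ j else 0)"
      by (intro continuous_on_vec_lambda, rename_tac j, case_tac "j \<in> S") (auto intro!: continuous_intros)
    show "continuous_on {0..1} (\<lambda>s. if j \<in> S then complex_of_real s else 1)" for j
      by (cases "j \<in> S") (auto intro!: continuous_intros)
    show "daff (\<chi> j. if j \<in> S then (1 - complex_of_real s) * x $ j else 0)
       (\<lambda>j. if j \<in> S then complex_of_real s else 1) y \<in> ball x r" if "s \<in> {0..1}" "y \<in> ball x r" for s y
      using contract_in_ball[of y x r "of_real s" S] that unfolding contract_daff by simp
  qed (use y in \<open>auto intro!: continuous_intros\<close>)
  then show ?thesis
    unfolding ray_mean_def contract_daff
    by (rule back_subst[of "\<lambda>c. has_grad _ c y"]) (auto simp: fun_eq_iff mult.assoc mult.left_commute intro!: integral_cong)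
qed

lemma holo_on_ray_mean: "holo_on (ball x r) g \<Longrightarrow> holo_on (ball x r) (ray_mean S m x g)"
  by (rule holo_onI[OF open_ball ray_mean_grad])

lemma ray_mean_integrable:
  assumes g: "holo_on (ball x r) g" and y: "y \<in> ball x r"
  shows "(\<lambda>s. of_real s ^ m * g (contract S x (of_real s) y)) integrable_on {0..1}"
proof (rule integrable_continuous_interval)
  have "continuous_on {0..1} (\<lambda>s. contract S x (complex_of_real s) y)"
    unfolding contract_def by (intro continuous_on_vec_lambda, rename_tac j, case_tac "j \<in> S") (auto intro!: continuous_intros)
  then show "continuous_on {0..1} (\<lambda>s. of_real s ^ m * g (contract S x (of_real s) y))"
    by (intro continuous_intros continuous_on_compose2[OF holo_on_continuous[OF g]])
       (use contract_in_ball[OF y] in auto)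
qed

text \<open>
  The fundamental theorem of calculus for \<open>s \<mapsto> s\<^sup>m g (contract S x s y)\<close>.  The value at \<open>s = 0\<close>
  survives only for \<open>m = 0\<close>, where the identity is Hadamard's lemma.
\<close>

lemma ray_mean_FTC:
  assumes g: "holo_on (ball x r) g" and y: "y \<in> ball x r"
  shows "g y - 0 ^ m * g (contract S x 0 y) =
    of_nat m * ray_mean S (m - 1) x g y + (\<Sum>j\<in>S. (y $ j - x $ j) * ray_mean S m x (partial j g) y)"
proof -
  have cd: "((\<lambda>z. contract S x z y) has_derivative (\<lambda>t. \<chi> j. if j \<in> S then t * (y $ j - x $ j) else 0)) (at z)" for z
  proof -
    have "bounded_linear (\<lambda>t. (\<chi> j. if j \<in> S then t * (y $ j - x $ j) else 0) :: 'a aff)"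
      by (intro linear_conv_bounded_linear[THEN iffD1] linearI) (auto simp: vec_eq_iff algebra_simps)
    from has_derivative_add[OF has_derivative_const bounded_linear_imp_has_derivative[OF this]]
    have "((\<lambda>z. (\<chi> j. if j \<in> S then x $ j else y $ j) + (\<chi> j. if j \<in> S then z * (y $ j - x $ j) else 0)) has_derivative
       (\<lambda>t. \<chi> j. if j \<in> S then t * (y $ j - x $ j) else 0)) (at z)" by simp
    moreover have "(\<lambda>z. (\<chi> j. if j \<in> S then x $ j else y $ j) + (\<chi> j. if j \<in> S then z * (y $ j - x $ j) else 0)) = (\<lambda>z. contract S x z y)"
      by (auto simp: contract_def fun_eq_iff vec_eq_iff)
    ultimately show ?thesis by simp
  qed
  have "((\<lambda>z. z ^ m * g (contract S x z y)) has_field_derivative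
     (of_nat m * (z ^ (m - 1) * g (contract S x z y)) + (\<Sum>j\<in>S. (y $ j - x $ j) * (z ^ m * partial j g (contract S x z y))))) (at z)"
    if "norm z \<le> 1" for z
  proof -
    have "contract S x z y \<in> ball x r" using contract_in_ball[OF y that] .
    from has_derivative_compose[OF cd holo_onD[OF g this, unfolded has_grad_def]]
    have "((\<lambda>z. g (contract S x z y)) has_derivative (\<lambda>t. \<Sum>i\<in>UNIV. partial i g (contract S x z y) * (if i \<in> S then t * (y $ i - x $ i) else 0))) (at z)"
      by simp
    moreover have "(\<Sum>i\<in>UNIV. partial i g (contract S x z y) * (if i \<in> S then t * (y $ i - x $ i) else 0)) =
        (\<Sum>j\<in>S. (y $ j - x $ j) * partial j g (contract S x z y)) * t" for t
      by (simp add: if_distrib sum.If_cases sum_distrib_left sum_distrib_right algebra_simps cong: if_cong)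
    ultimately have "((\<lambda>z. g (contract S x z y)) has_field_derivative (\<Sum>j\<in>S. (y $ j - x $ j) * partial j g (contract S x z y))) (at z)"
      by (simp add: has_field_derivative_def)
    from DERIV_mult[OF DERIV_power[OF DERIV_ident, of m] this] show ?thesis
      by (rule back_subst[of "\<lambda>c. (_ has_field_derivative c) (at z)"]) (simp add: algebra_simps sum_distrib_left)
  qed
  from has_vector_derivative_real_field[OF this]
  have *: "((\<lambda>s. of_real s ^ m * g (contract S x (of_real s) y)) has_vector_derivative
     (of_nat m * (of_real s ^ (m - 1) * g (contract S x (of_real s) y)) + (\<Sum>j\<in>S. (y $ j - x $ j) * (of_real s ^ m * partial j g (contract S x (of_real s) y))))) (at s within {0..1})"
    if "s \<in> {0..1}" for s :: real
    using that by simp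
  have "((\<lambda>s. of_nat m * (of_real s ^ (m - 1) * g (contract S x (of_real s) y)) + (\<Sum>j\<in>S. (y $ j - x $ j) * (of_real s ^ m * partial j g (contract S x (of_real s) y))))
     has_integral (of_real 1 ^ m * g (contract S x (of_real 1) y) - of_real 0 ^ m * g (contract S x (of_real 0) y))) {0..1::real}"
    by (rule fundamental_theorem_of_calculus[OF _ *]) simp
  moreover have "((\<lambda>s. of_nat m * (of_real s ^ (m - 1) * g (contract S x (of_real s) y)) + (\<Sum>j\<in>S. (y $ j - x $ j) * (of_real s ^ m * partial j g (contract S x (of_real s) y))))
     has_integral (of_nat m * ray_mean S (m - 1) x g y + (\<Sum>j\<in>S. (y $ j - x $ j) * ray_mean S m x (partial j g) y))) {0..1::real}"
    unfolding ray_mean_def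
    by (intro has_integral_add has_integral_mult_right has_integral_sum integrable_integral
        ray_mean_integrable[OF g y] ray_mean_integrable[OF holo_on_partial[OF g] y]) auto
  ultimately have "of_real 1 ^ m * g (contract S x (of_real 1) y) - of_real 0 ^ m * g (contract S x (of_real 0) y) =
    of_nat m * ray_mean S (m - 1) x g y + (\<Sum>j\<in>S. (y $ j - x $ j) * ray_mean S m x (partial j g) y)"
    by (rule has_integral_unique)
  then show ?thesis by simp
qed

section \<open>Signs and the contraction of forms\<close>

lemma dx_sign_sq [simp]: "dx_sign i J * dx_sign i J = 1"
  by (simp add: dx_sign_def flip: power_mult_distrib)

lemma dx_sign_sq' [simp]: "dx_sign i J * (dx_sign i J * a) = a"
  by (simp flip: mult.assoc)

lemma dx_sign_swap_aux:
  fixes i j :: "'n::{finite,linorder}"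
  assumes "i < j" "i \<in> J" "j \<in> J"
  shows "dx_sign i J * dx_sign j (J - {i}) = - (dx_sign j J * dx_sign i (J - {j}))"
proof -
  have "{k \<in> J - {j}. k < i} = {k \<in> J. k < i}" using assms by auto
  moreover have "{k \<in> J. k < j} = insert i {k \<in> J - {i}. k < j}" using assms by auto
  then have "card {k \<in> J. k < j} = Suc (card {k \<in> J - {i}. k < j})" by simp
  ultimately show ?thesis by (simp add: dx_sign_def)
qed

lemma dx_sign_swap:
  fixes i j :: "'n::{finite,linorder}"
  assumes "i \<noteq> j" "i \<in> J" "j \<in> J"
  shows "dx_sign i J * dx_sign j (J - {i}) = - (dx_sign j J * dx_sign i (J - {j}))"
  using dx_sign_swap_aux[of i j J] dx_sign_swap_aux[of j i J] assms by (cases i j rule: linorder_cases) auto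

lemma sum_offdiag_swap:
  fixes J :: "'n::finite set"
  shows "(\<Sum>i\<in>J. \<Sum>j\<in>J - {i}. b i j) = (\<Sum>i\<in>J. \<Sum>j\<in>J - {i}. b j i)"
proof -
  have "(\<Sum>i\<in>J. \<Sum>j\<in>J - {i}. b i j) = (\<Sum>i\<in>J. \<Sum>j\<in>J. if i \<noteq> j then b i j else (0::'b::comm_monoid_add))" for b
    by (intro sum.cong refl sum.mono_neutral_cong_left) auto
  note * = this
  show ?thesis unfolding * by (subst sum.swap) (auto intro!: sum.cong)
qed

lemma sum_sign_swap:
  fixes c :: "'n::{finite,linorder} \<Rightarrow> 'n \<Rightarrow> complex"
  shows "(\<Sum>i\<in>J. \<Sum>j\<in>J - {i}. dx_sign i J * dx_sign j (J - {i}) * c i j) =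
    - (\<Sum>i\<in>J. \<Sum>j\<in>J - {i}. dx_sign i J * dx_sign j (J - {i}) * c j i)"
proof -
  have "dx_sign j J * dx_sign i (J - {j}) * c j i = - (dx_sign i J * dx_sign j (J - {i}) * c j i)"
    if "i \<in> J" "j \<in> J - {i}" for i j
    using dx_sign_swap[of j i J] that by auto
  then show ?thesis
    by (subst sum_offdiag_swap, unfold sum_negf[symmetric], intro sum.cong refl) auto
qed

text \<open>
  The signs are antisymmetric in the two indices.  With products of first derivatives of \<open>f\<close> this gives
  \<open>df \<and> df \<and> \<omega> = 0\<close>, with second derivatives \<open>d d \<omega> = 0\<close>.
\<close>

lemma sum_sign_sym:
  fixes c :: "'n::{finite,linorder} \<Rightarrow> 'n \<Rightarrow> complex"
  assumes "\<And>i j. i \<in> J \<Longrightarrow> j \<in> J \<Longrightarrow> c i j = c j i"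
  shows "(\<Sum>i\<in>J. \<Sum>j\<in>J - {i}. dx_sign i J * dx_sign j (J - {i}) * c i j) = 0"
proof -
  have "(\<Sum>i\<in>J. \<Sum>j\<in>J - {i}. dx_sign i J * dx_sign j (J - {i}) * c i j) =
    - (\<Sum>i\<in>J. \<Sum>j\<in>J - {i}. dx_sign i J * dx_sign j (J - {i}) * c i j)"
    by (subst sum_sign_swap, intro arg_cong[where f=uminus] sum.cong refl) (use assms in auto)
  then show ?thesis by simp
qed

text \<open>
  The combinatorial part of Cartan's formula: the terms with \<open>i \<noteq> j\<close> cancel.  It serves both for the
  contraction of \<open>df \<and> \<omega>\<close> and for that of \<open>d\<omega>\<close>.
\<close>

lemma sign_homotopy:
  fixes c :: "'n::{finite,linorder} \<Rightarrow> 'n \<Rightarrow> 'n set \<Rightarrow> complex"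
  shows "(\<Sum>j\<in>- J. dx_sign j (insert j J) * (\<Sum>i\<in>insert j J. dx_sign i (insert j J) * c i j (insert j J - {i})))
   + (\<Sum>i\<in>J. dx_sign i J * (\<Sum>j\<in>- (J - {i}). dx_sign j (insert j (J - {i})) * c i j (insert j (J - {i}))))
   = (\<Sum>i\<in>UNIV. c i i J)"
proof -
  have 1: "dx_sign j (insert j J) * (\<Sum>i\<in>insert j J. dx_sign i (insert j J) * c i j (insert j J - {i}))
    = c j j J + (\<Sum>i\<in>J. dx_sign j (insert j J) * dx_sign i (insert j J) * c i j (insert j J - {i}))" if "j \<in> - J" for j
    using that by (subst sum.insert) (auto simp: algebra_simps sum_distrib_left)
  have 2: "dx_sign i J * (\<Sum>j\<in>- (J - {i}). dx_sign j (insert j (J - {i})) * c i j (insert j (J - {i})))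
    = c i i J + (\<Sum>j\<in>- J. dx_sign i J * dx_sign j (insert j (J - {i})) * c i j (insert j (J - {i})))" if "i \<in> J" for i
  proof -
    have "- (J - {i}) = insert i (- J)" "insert i J = J" using that by auto
    then show ?thesis using that by (auto simp: algebra_simps sum_distrib_left)
  qed
  have 3: "dx_sign j (insert j J) * dx_sign i (insert j J) = - (dx_sign i J * dx_sign j (insert j (J - {i})))"
    if "j \<in> - J" "i \<in> J" for i j
  proof -
    have ij: "i \<noteq> j" "insert j J - {i} = insert j (J - {i})" "insert j J - {j} = J" using that by auto
    have A: "dx_sign i (insert j J) * dx_sign j (insert j (J - {i})) = - (dx_sign j (insert j J) * dx_sign i J)"
      using dx_sign_swap[of i j "insert j J"] that ij by auto
    have "dx_sign j (insert j J) * dx_sign i (insert j J) * (dx_sign j (insert j (J - {i})) * dx_sign j (insert j (J - {i})))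
       = dx_sign j (insert j J) * (dx_sign i (insert j J) * dx_sign j (insert j (J - {i}))) * dx_sign j (insert j (J - {i}))"
      by (simp only: mult.assoc)
    also have "\<dots> = - (dx_sign i J * dx_sign j (insert j (J - {i})))" by (subst A) (simp add: mult.assoc)
    finally show ?thesis by (simp only: dx_sign_sq mult_1_right)
  qed
  have "(\<Sum>j\<in>- J. \<Sum>i\<in>J. dx_sign j (insert j J) * dx_sign i (insert j J) * c i j (insert j J - {i}))
     = - (\<Sum>i\<in>J. \<Sum>j\<in>- J. dx_sign i J * dx_sign j (insert j (J - {i})) * c i j (insert j (J - {i})))"
    unfolding sum_negf[symmetric]
  proof (subst sum.swap, intro sum.cong refl)
    fix i j assume ij: "i \<in> J" "j \<in> - J"
    then have "insert j J - {i} = insert j (J - {i})" by auto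
    then show "dx_sign j (insert j J) * dx_sign i (insert j J) * c i j (insert j J - {i}) =
        - (dx_sign i J * dx_sign j (insert j (J - {i})) * c i j (insert j (J - {i})))"
      using 3[OF ij(2,1)] by simp
  qed
  moreover have "(\<Sum>i\<in>UNIV. c i i J) = (\<Sum>j\<in>- J. c j j J) + (\<Sum>i\<in>J. c i i J)"
    using sum.subset_diff[of J UNIV "\<lambda>i. c i i J"] by (simp add: Compl_eq_Diff_UNIV)
  moreover have "(\<Sum>j\<in>- J. dx_sign j (insert j J) * (\<Sum>i\<in>insert j J. dx_sign i (insert j J) * c i j (insert j J - {i})))
    = (\<Sum>j\<in>- J. c j j J + (\<Sum>i\<in>J. dx_sign j (insert j J) * dx_sign i (insert j J) * c i j (insert j J - {i})))"
    by (intro sum.cong refl 1)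
  moreover have "(\<Sum>i\<in>J. dx_sign i J * (\<Sum>j\<in>- (J - {i}). dx_sign j (insert j (J - {i})) * c i j (insert j (J - {i}))))
    = (\<Sum>i\<in>J. c i i J + (\<Sum>j\<in>- J. dx_sign i J * dx_sign j (insert j (J - {i})) * c i j (insert j (J - {i}))))"
    by (intro sum.cong refl 2)
  ultimately show ?thesis by (simp only: sum.distrib) simp
qed

text \<open>
  The interior product with the vector field \<open>v\<close>.
\<close>

definition contraction :: "('n::{finite,linorder} \<Rightarrow> 'n aff \<Rightarrow> complex) \<Rightarrow> 'n form \<Rightarrow> 'n form" where
  "contraction v \<omega> = (\<lambda>J y. \<Sum>j\<in>- J. dx_sign j (insert j J) * (v j y * \<omega> (insert j J) y))"

text \<open>
  Multiplication by \<open>v(f)\<close> is null-homotopic on the Koszul complex of \<open>df\<close>.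
\<close>

lemma contraction_df_wedge:
  "contraction v (df_wedge f \<omega>) J y + df_wedge f (contraction v \<omega>) J y = (\<Sum>i\<in>UNIV. v i y * partial i f y) * \<omega> J y"
proof -
  have "contraction v (df_wedge f \<omega>) J y = (\<Sum>j\<in>- J. dx_sign j (insert j J) * (\<Sum>i\<in>insert j J. dx_sign i (insert j J) * (v j y * partial i f y * \<omega> (insert j J - {i}) y)))"
    unfolding contraction_def df_wedge_def by (intro sum.cong refl) (simp add: sum_distrib_left algebra_simps)
  moreover have "df_wedge f (contraction v \<omega>) J y = (\<Sum>i\<in>J. dx_sign i J * (\<Sum>j\<in>- (J - {i}). dx_sign j (insert j (J - {i})) * (v j y * partial i f y * \<omega> (insert j (J - {i})) y)))"
    unfolding contraction_def df_wedge_def by (intro sum.cong refl) (simp add: sum_distrib_left algebra_simps)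
  ultimately show ?thesis
    using sign_homotopy[of J "\<lambda>i j K. v j y * partial i f y * \<omega> K y"] by (simp add: sum_distrib_right)
qed

section \<open>Germs of holomorphic functions\<close>

lemma holomorphic_near_iff: "holomorphic_near x h \<longleftrightarrow> (\<exists>r>0. holo_on (ball x r) h)"
proof
  assume "holomorphic_near x h"
  then obtain U where "open U" "x \<in> U" "holo_on U h"
    unfolding holomorphic_near_def holo_on_iff by blast
  then show "\<exists>r>0. holo_on (ball x r) h"
    by (meson holo_on_subset open_ball openE)
next
  assume "\<exists>r>0. holo_on (ball x r) h"
  then show "holomorphic_near x h"
    unfolding holomorphic_near_def holo_on_iff by (meson centre_in_ball)
qed

lemma holo_on_ball_mono: "holo_on (ball x r) h \<Longrightarrow> r' \<le> r \<Longrightarrow> holo_on (ball x r') h"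
  by (rule holo_on_subset) auto

lemma finite_common_radius:
  fixes P :: "'i::finite \<Rightarrow> real \<Rightarrow> bool"
  assumes "\<And>i. \<exists>r>0. P i r" "\<And>i r r'. P i r \<Longrightarrow> r' \<le> r \<Longrightarrow> P i r'"
  shows "\<exists>r>0. \<forall>i. P i r"
proof -
  from assms(1) obtain r where r: "\<And>i. r i > 0" "\<And>i. P i (r i)" by metis
  have "Min (range r) > 0" using r(1) by (subst Min_gr_iff) auto
  moreover have "P i (Min (range r))" for i by (rule assms(2)[OF r(2)]) simp
  ultimately show ?thesis by blast
qed

lemma holo_on_const: "open U \<Longrightarrow> holo_on U (\<lambda>y. a)"
  by (erule holo_onI) (rule has_grad_const)

lemma holo_on_coord: "open U \<Longrightarrow> holo_on U (\<lambda>y. y $ j)"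
  by (erule holo_onI) (rule has_grad_coord)

lemma holo_on_add: "holo_on U h \<Longrightarrow> holo_on U h' \<Longrightarrow> holo_on U (\<lambda>y. h y + h' y)"
  by (rule holo_onI[OF holo_on_open has_grad_add[OF holo_onD holo_onD]])

lemma holo_on_mult: "holo_on U h \<Longrightarrow> holo_on U h' \<Longrightarrow> holo_on U (\<lambda>y. h y * h' y)"
  by (rule holo_onI[OF holo_on_open has_grad_mult[OF holo_onD holo_onD]])

lemma holo_on_cmult: "holo_on U h \<Longrightarrow> holo_on U (\<lambda>y. a * h y)"
  by (rule holo_onI[OF holo_on_open has_grad_cmult[OF holo_onD]])

lemma holo_on_minus: "holo_on U h \<Longrightarrow> holo_on U (\<lambda>y. - h y)"
  using holo_on_cmult[of U h "-1"] by simp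

lemma holo_on_diff: "holo_on U h \<Longrightarrow> holo_on U h' \<Longrightarrow> holo_on U (\<lambda>y. h y - h' y)"
  using holo_on_add[OF _ holo_on_minus] by fastforce

lemma holo_on_sum: "finite A \<Longrightarrow> open U \<Longrightarrow> (\<And>a. a \<in> A \<Longrightarrow> holo_on U (h a)) \<Longrightarrow> holo_on U (\<lambda>y. \<Sum>a\<in>A. h a y)"
  by (induction A rule: finite_induct) (auto intro: holo_on_const holo_on_add)

lemma holo_on_power: "holo_on U h \<Longrightarrow> holo_on U (\<lambda>y. h y ^ n)"
  by (induction n) (auto intro: holo_on_const holo_on_mult holo_on_open)

lemma holo_on_comp: "holo_on U h \<Longrightarrow> g holomorphic_on T \<Longrightarrow> open T \<Longrightarrow> h ` U \<subseteq> T \<Longrightarrow> holo_on U (\<lambda>y. g (h y))"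
  by (rule holo_onI[OF holo_on_open has_grad_comp[OF holo_onD]])
     (auto intro!: holomorphic_derivI[of g T])

lemmas holo_on_intros = holo_on_const holo_on_coord holo_on_add holo_on_mult holo_on_minus
  holo_on_diff holo_on_sum holo_on_power holo_on_partial

lemma holomorphic_near2:
  assumes "holomorphic_near x h" "holomorphic_near x h'"
  obtains r where "r > 0" "holo_on (ball x r) h" "holo_on (ball x r) h'"
proof -
  from assms obtain r r' where r: "r > 0" "holo_on (ball x r) h" "r' > 0" "holo_on (ball x r') h'"
    unfolding holomorphic_near_iff by blast
  show ?thesis by (rule that[of "min r r'"]) (use r in \<open>auto intro: holo_on_ball_mono\<close>)
qed

lemma holomorphic_near_family:
  fixes h :: "'i::finite \<Rightarrow> _"
  assumes "\<And>i. holomorphic_near x (h i)"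
  obtains r where "r > 0" "\<And>i. holo_on (ball x r) (h i)"
  using finite_common_radius[of "\<lambda>i r. holo_on (ball x r) (h i)"] assms holo_on_ball_mono
  unfolding holomorphic_near_iff by blast

lemma holomorphic_near_const: "holomorphic_near x (\<lambda>y. a)"
  unfolding holomorphic_near_iff using holo_on_const open_ball zero_less_one by blast

lemma holomorphic_near_coord: "holomorphic_near x (\<lambda>y. y $ j)"
  unfolding holomorphic_near_iff using holo_on_coord open_ball zero_less_one by blast

lemma holomorphic_near_add: "holomorphic_near x h \<Longrightarrow> holomorphic_near x h' \<Longrightarrow> holomorphic_near x (\<lambda>y. h y + h' y)"
  by (erule (1) holomorphic_near2) (auto simp: holomorphic_near_iff intro: holo_on_add)

lemma holomorphic_near_mult: "holomorphic_near x h \<Longrightarrow> holomorphic_near x h' \<Longrightarrow> holomorphic_near x (\<lambda>y. h y * h' y)"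
  by (erule (1) holomorphic_near2) (auto simp: holomorphic_near_iff intro: holo_on_mult)

lemma holomorphic_near_minus: "holomorphic_near x h \<Longrightarrow> holomorphic_near x (\<lambda>y. - h y)"
  by (auto simp: holomorphic_near_iff intro: holo_on_minus)

lemma holomorphic_near_diff: "holomorphic_near x h \<Longrightarrow> holomorphic_near x h' \<Longrightarrow> holomorphic_near x (\<lambda>y. h y - h' y)"
  by (erule (1) holomorphic_near2) (auto simp: holomorphic_near_iff intro: holo_on_diff)

lemma holomorphic_near_sum: "finite A \<Longrightarrow> (\<And>a. a \<in> A \<Longrightarrow> holomorphic_near x (h a)) \<Longrightarrow> holomorphic_near x (\<lambda>y. \<Sum>a\<in>A. h a y)"
  by (induction A rule: finite_induct) (auto intro: holomorphic_near_const holomorphic_near_add)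

lemma holomorphic_near_power: "holomorphic_near x h \<Longrightarrow> holomorphic_near x (\<lambda>y. h y ^ n)"
  by (induction n) (auto intro: holomorphic_near_const holomorphic_near_mult)

lemma holomorphic_near_partial: "holomorphic_near x h \<Longrightarrow> holomorphic_near x (partial i h)"
  by (auto simp: holomorphic_near_iff intro: holo_on_partial)

lemmas holomorphic_near_intros = holomorphic_near_const holomorphic_near_coord holomorphic_near_add
  holomorphic_near_mult holomorphic_near_minus holomorphic_near_diff holomorphic_near_sum
  holomorphic_near_power holomorphic_near_partial

lemma holomorphic_near_ray_mean: "holomorphic_near x h \<Longrightarrow> holomorphic_near x (ray_mean S m x h)"
  by (auto simp: holomorphic_near_iff intro: holo_on_ray_mean)

lemma partial_const [simp]: "partial i (\<lambda>y. a) y = 0"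
  by (rule has_grad_partial[OF has_grad_const])

lemma partial_zero [simp]: "partial i (\<lambda>y. 0) y = 0" "partial i 0 y = 0"
  using has_grad_partial[OF has_grad_const] by (auto simp: zero_fun_def)

lemma ray_mean_zero [simp]: "ray_mean S m x (\<lambda>y. 0) y = 0" "ray_mean S m x 0 y = 0"
  by (auto simp: ray_mean_def)

lemma ray_mean_zero_fun [simp]: "ray_mean S m x 0 = 0"
  by (intro ext) simp

definition slice :: "'n::finite set \<Rightarrow> 'n aff \<Rightarrow> 'n aff set" where
  "slice K x = {y. \<forall>i\<in>K. y $ i = x $ i}"

lemma slice_empty [simp]: "slice {} x = UNIV" by (simp add: slice_def)

text \<open>
  Division by a coordinate function on a slice: the contraction of \<open>y\<close> along the \<open>i\<close>-th axis ends where
  \<open>g\<close> vanishes, and \<open>ray_mean_FTC\<close> expresses \<open>g y\<close> by the derivative along the way.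
\<close>

lemma hadamard_division:
  assumes g: "holomorphic_near x g"
    and 0: "eventually (\<lambda>y. y \<in> slice (insert i K) x \<longrightarrow> g y = 0) (nhds x)"
  shows "eventually (\<lambda>y. y \<in> slice K x \<longrightarrow> g y = (y $ i - x $ i) * ray_mean {i} 0 x (partial i g) y) (nhds x)"
proof -
  from g obtain r where r: "r > 0" "holo_on (ball x r) g" unfolding holomorphic_near_iff by blast
  from 0 obtain d where d: "d > 0" "\<And>y. y \<in> ball x d \<Longrightarrow> y \<in> slice (insert i K) x \<Longrightarrow> g y = 0"
    unfolding eventually_nhds_metric by (auto simp: dist_commute)
  show ?thesis unfolding eventually_nhds_metric
  proof (intro exI[of _ "min r d"] conjI allI impI)
    show "min r d > 0" using r d by simp
    fix y assume "dist y x < min r d" and y: "y \<in> slice K x"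
    then have yr: "y \<in> ball x r" "y \<in> ball x d" by (auto simp: dist_commute)
    have "contract {i} x 0 y \<in> ball x d" using contract_in_ball[OF yr(2), of 0] by simp
    moreover have "contract {i} x 0 y \<in> slice (insert i K) x"
      using y by (auto simp: slice_def contract_def)
    ultimately have "g (contract {i} x 0 y) = 0" by (rule d(2))
    with ray_mean_FTC[OF r(2) yr(1), of 0 "{i}"]
    show "g y = (y $ i - x $ i) * ray_mean {i} 0 x (partial i g) y" by simp
  qed
qed

text \<open>
  The factor can be cancelled off the hyperplane where the \<open>i\<close>-th coordinate is that of \<open>x\<close>, and the
  points on the hyperplane are limits of points off it within the same slice.
\<close>

lemma slice_cancel:
  assumes u: "holomorphic_near x u" and v: "holomorphic_near x v" and i: "i \<notin> K"
    and eq: "eventually (\<lambda>y. y \<in> slice K x \<longrightarrow> (y $ i - x $ i) * u y = (y $ i - x $ i) * v y) (nhds x)"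
  shows "eventually (\<lambda>y. y \<in> slice K x \<longrightarrow> u y = v y) (nhds x)"
proof -
  from holomorphic_near2[OF u v] obtain r where r: "r > 0" "holo_on (ball x r) u" "holo_on (ball x r) v" .
  from eq obtain d where d: "d > 0" "\<And>y. y \<in> ball x d \<Longrightarrow> y \<in> slice K x \<Longrightarrow> (y $ i - x $ i) * u y = (y $ i - x $ i) * v y"
    unfolding eventually_nhds_metric by (auto simp: dist_commute)
  show ?thesis unfolding eventually_nhds_metric
  proof (intro exI[of _ "min r d"] conjI allI impI)
    show "min r d > 0" using r d by simp
    fix y assume "dist y x < min r d" and y: "y \<in> slice K x"
    then have yr: "y \<in> ball x r" "y \<in> ball x d" by (auto simp: dist_commute)
    show "u y = v y"
    proof (cases "y $ i = x $ i")
      case False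
      then show ?thesis using d(2)[OF yr(2) y] by simp
    next
      case True
      define \<gamma> where "\<gamma> t = y + axis i t" for t :: complex
      have "(\<gamma> \<longlongrightarrow> y + axis i 0) (at 0)"
        unfolding \<gamma>_def by (intro tendsto_add tendsto_const bounded_linear.tendsto[OF linear_axis] tendsto_ident_at)
      moreover have "y + axis i 0 = y" by (simp add: vec_eq_iff axis_def)
      ultimately have \<gamma>: "(\<gamma> \<longlongrightarrow> y) (at 0)" by simp
      have cu: "((\<lambda>t. h (\<gamma> t)) \<longlongrightarrow> h y) (at 0)" if "holo_on (ball x r) h" for h
        using holo_on_continuous[OF that] yr(1) \<gamma>
        by (intro isCont_tendsto_compose[of y h]) (auto simp: continuous_on_eq_continuous_at)
      have "eventually (\<lambda>t. \<gamma> t \<in> ball x d) (at 0)"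
        using \<gamma> yr(2) topological_tendstoD open_ball by blast
      moreover have "eventually (\<lambda>t::complex. t \<noteq> 0) (at 0)" by (simp add: eventually_at_filter)
      ultimately have "eventually (\<lambda>t. u (\<gamma> t) = v (\<gamma> t)) (at 0)"
      proof eventually_elim
        case (elim t)
        have "\<gamma> t \<in> slice K x" using y i by (auto simp: \<gamma>_def slice_def axis_def)
        from d(2)[OF elim(1) this] show ?case using elim(2) True by (simp add: \<gamma>_def axis_def)
      qed
      then have "((\<lambda>t. v (\<gamma> t)) \<longlongrightarrow> u y) (at 0)"
        using cu[OF r(2)] tendsto_cong by fastforce
      with cu[OF r(3)] show ?thesis using tendsto_unique[OF at_neq_bot] by blast
    qed
  qed
qed

section \<open>Exterior calculus in coordinates\<close>

definition germ_eq :: "'n::finite aff \<Rightarrow> 'n form \<Rightarrow> 'n form \<Rightarrow> bool" where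
  "germ_eq x \<omega> \<eta> \<longleftrightarrow> eventually (\<lambda>y. \<forall>I. \<omega> I y = \<eta> I y) (nhds x)"

abbreviation fmul :: "('n::finite aff \<Rightarrow> complex) \<Rightarrow> 'n form \<Rightarrow> 'n form" where
  "fmul u \<omega> \<equiv> (\<lambda>I y. u y * \<omega> I y)"

definition forms_on :: "'n::finite aff set \<Rightarrow> nat \<Rightarrow> 'n form set" where
  "forms_on U p = {\<omega>. (\<forall>I. holo_on U (\<omega> I)) \<and> (\<forall>I. card I \<noteq> p \<longrightarrow> \<omega> I = 0)}"

lemma an_forms_iff: "\<omega> \<in> an_forms p x \<longleftrightarrow> (\<exists>r>0. \<omega> \<in> forms_on (ball x r) p)"
  unfolding an_forms_def forms_on_def using holomorphic_near_family[of x \<omega>]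
  by (auto simp: holomorphic_near_iff) metis

lemma ext_d_forms_on: "\<omega> \<in> forms_on U p \<Longrightarrow> ext_d \<omega> \<in> forms_on U (Suc p)"
proof -
  assume w: "\<omega> \<in> forms_on U p"
  have "open U" using w holo_on_open by (auto simp: forms_on_def)
  then have "holo_on U (ext_d \<omega> J)" for J
    using w unfolding ext_d_def forms_on_def
    by (intro holo_on_sum holo_on_cmult holo_on_partial) auto
  moreover have "ext_d \<omega> J = 0" if "card J \<noteq> Suc p" for J
  proof -
    have "\<omega> (J - {i}) = 0" if "i \<in> J" for i
      using w that \<open>card J \<noteq> Suc p\<close> card_Suc_Diff1[of J i] by (auto simp: forms_on_def)
    then show ?thesis by (intro ext) (simp add: ext_d_def)
  qed
  ultimately show ?thesis by (simp add: forms_on_def)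
qed

lemma df_wedge_forms_on: "\<omega> \<in> forms_on U p \<Longrightarrow> holo_on U f \<Longrightarrow> df_wedge f \<omega> \<in> forms_on U (Suc p)"
proof -
  assume w: "\<omega> \<in> forms_on U p" and f: "holo_on U f"
  have "holo_on U (df_wedge f \<omega> J)" for J
    using w f unfolding df_wedge_def forms_on_def
    by (intro holo_on_sum holo_on_mult holo_on_cmult holo_on_partial) (auto intro: holo_on_open)
  moreover have "df_wedge f \<omega> J = 0" if "card J \<noteq> Suc p" for J
  proof -
    have "\<omega> (J - {i}) = 0" if "i \<in> J" for i
      using w that \<open>card J \<noteq> Suc p\<close> card_Suc_Diff1[of J i] by (auto simp: forms_on_def)
    then show ?thesis by (intro ext) (simp add: df_wedge_def)
  qed
  ultimately show ?thesis by (simp add: forms_on_def)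
qed

lemma ext_d_add: "(\<And>I. holo_on U (\<omega> I)) \<Longrightarrow> (\<And>I. holo_on U (\<eta> I)) \<Longrightarrow> y \<in> U \<Longrightarrow> ext_d (\<omega> + \<eta>) J y = ext_d \<omega> J y + ext_d \<eta> J y"
proof -
  assume *: "\<And>I. holo_on U (\<omega> I)" "\<And>I. holo_on U (\<eta> I)" "y \<in> U"
  have "partial i ((\<omega> + \<eta>) I) y = partial i (\<omega> I) y + partial i (\<eta> I) y" for i I
    using has_grad_partial[OF has_grad_add[OF holo_onD[OF *(1)] holo_onD[OF *(2)]]] *(3) by (simp add: plus_fun_def)
  then show ?thesis by (simp add: ext_d_def algebra_simps sum.distrib)
qed

lemma ext_d_fmul:
  assumes "\<And>I. holo_on U (\<omega> I)" "holo_on U u" "y \<in> U"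
  shows "ext_d (fmul u \<omega>) J y = df_wedge u \<omega> J y + u y * ext_d \<omega> J y"
proof -
  have "partial i (fmul u \<omega> I) y = u y * partial i (\<omega> I) y + partial i u y * \<omega> I y" for i I
    by (rule has_grad_partial[OF has_grad_mult[OF holo_onD[OF assms(2,3)] holo_onD[OF assms(1,3)]]])
  then show ?thesis
    by (simp add: ext_d_def df_wedge_def algebra_simps sum.distrib sum_distrib_left)
qed

lemma df_wedge_add: "df_wedge f (\<omega> + \<eta>) J y = df_wedge f \<omega> J y + df_wedge f \<eta> J y"
  by (simp add: df_wedge_def algebra_simps sum.distrib)

lemma df_wedge_diff: "df_wedge f (\<omega> - \<eta>) J y = df_wedge f \<omega> J y - df_wedge f \<eta> J y"
  by (simp add: df_wedge_def algebra_simps sum_subtractf)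

lemma df_wedge_fmul: "df_wedge f (fmul u \<omega>) J y = u y * df_wedge f \<omega> J y"
  by (simp add: df_wedge_def algebra_simps sum_distrib_left)

lemma df_wedge_df_wedge: "df_wedge f (df_wedge f \<omega>) J y = 0"
proof -
  have "df_wedge f (df_wedge f \<omega>) J y =
    (\<Sum>i\<in>J. \<Sum>j\<in>J - {i}. dx_sign i J * dx_sign j (J - {i}) * (partial i f y * partial j f y * \<omega> (J - {i} - {j}) y))"
    unfolding df_wedge_def by (intro sum.cong refl) (simp add: sum_distrib_left algebra_simps)
  also have "\<dots> = 0" by (intro sum_sign_sym) (simp add: Diff_insert2 [symmetric] insert_commute mult.commute)
  finally show ?thesis .
qed

text \<open>
  Both \<open>d d \<omega>\<close> and \<open>d (df \<and> \<omega>)\<close> are derivatives of signed sums of this shape.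
\<close>

lemma ext_d_expand:
  assumes "\<And>I j. holo_on U (c I j)" "y \<in> U" "\<And>I z. z \<in> U \<Longrightarrow> \<omega> I z = (\<Sum>j\<in>I. dx_sign j I * c I j z)"
  shows "ext_d \<omega> J y = (\<Sum>i\<in>J. \<Sum>j\<in>J - {i}. dx_sign i J * dx_sign j (J - {i}) * partial i (c (J - {i}) j) y)"
proof -
  have "has_grad (\<lambda>z. \<Sum>j\<in>I. dx_sign j I * c I j z) (\<lambda>i. \<Sum>j\<in>I. dx_sign j I * partial i (c I j) y) y" for I
    by (intro has_grad_sum has_grad_cmult holo_onD[OF assms(1)] assms(2)) auto
  moreover have "eventually (\<lambda>z. (\<Sum>j\<in>I. dx_sign j I * c I j z) = \<omega> I z) (nhds y)" for I
    unfolding eventually_nhds using assms holo_on_open[OF assms(1)] by (intro exI[of _ U]) auto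
  ultimately have "partial i (\<omega> I) y = (\<Sum>j\<in>I. dx_sign j I * partial i (c I j) y)" for i I
    by (intro has_grad_partial) (rule has_grad_cong)
  then show ?thesis unfolding ext_d_def by (intro sum.cong refl) (simp add: sum_distrib_left mult.assoc)
qed

lemma ext_d_ext_d:
  assumes w: "\<And>I. holo_on U (\<omega> I)" and y: "y \<in> U"
  shows "ext_d (ext_d \<omega>) J y = 0"
proof -
  have "ext_d (ext_d \<omega>) J y = (\<Sum>i\<in>J. \<Sum>j\<in>J - {i}. dx_sign i J * dx_sign j (J - {i}) * partial i (partial j (\<omega> (J - {i} - {j}))) y)"
    by (rule ext_d_expand[OF _ y]) (auto intro: holo_on_partial w simp: ext_d_def)
  also have "\<dots> = 0" by (intro sum_sign_sym) (simp add: Diff_insert2 [symmetric] insert_commute partial_commute[OF w y])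
  finally show ?thesis .
qed

lemma ext_d_df_wedge:
  assumes w: "\<And>I. holo_on U (\<omega> I)" and f: "holo_on U f" and y: "y \<in> U"
  shows "ext_d (df_wedge f \<omega>) J y = - df_wedge f (ext_d \<omega>) J y"
proof -
  have "ext_d (df_wedge f \<omega>) J y = (\<Sum>i\<in>J. \<Sum>j\<in>J - {i}. dx_sign i J * dx_sign j (J - {i}) * partial i (\<lambda>z. partial j f z * \<omega> (J - {i} - {j}) z) y)"
    by (rule ext_d_expand[OF _ y]) (auto intro!: holo_on_partial holo_on_mult w f simp: df_wedge_def mult.assoc)
  also have "\<dots> = (\<Sum>i\<in>J. \<Sum>j\<in>J - {i}. dx_sign i J * dx_sign j (J - {i}) * (partial j f y * partial i (\<omega> (J - {i} - {j})) y))
     + (\<Sum>i\<in>J. \<Sum>j\<in>J - {i}. dx_sign i J * dx_sign j (J - {i}) * (partial i (partial j f) y * \<omega> (J - {i} - {j}) y))"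
  proof -
    have "partial i (\<lambda>z. partial j f z * \<omega> I z) y = partial j f y * partial i (\<omega> I) y + partial i (partial j f) y * \<omega> I y" for i j I
      by (rule has_grad_partial[OF has_grad_mult[OF holo_onD[OF holo_on_partial[OF f] y] holo_onD[OF w y]]])
    then show ?thesis by (simp only: distrib_left sum.distrib)
  qed
  also have "(\<Sum>i\<in>J. \<Sum>j\<in>J - {i}. dx_sign i J * dx_sign j (J - {i}) * (partial i (partial j f) y * \<omega> (J - {i} - {j}) y)) = 0"
    by (intro sum_sign_sym) (simp add: Diff_insert2 [symmetric] insert_commute partial_commute[OF f y])
  also have "(\<Sum>i\<in>J. \<Sum>j\<in>J - {i}. dx_sign i J * dx_sign j (J - {i}) * (partial j f y * partial i (\<omega> (J - {i} - {j})) y))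
    = - (\<Sum>i\<in>J. \<Sum>j\<in>J - {i}. dx_sign i J * dx_sign j (J - {i}) * (partial i f y * partial j (\<omega> (J - {i} - {j})) y))"
    by (subst sum_sign_swap) (simp add: Diff_insert2 [symmetric] insert_commute)
  also have "(\<Sum>i\<in>J. \<Sum>j\<in>J - {i}. dx_sign i J * dx_sign j (J - {i}) * (partial i f y * partial j (\<omega> (J - {i} - {j})) y)) = df_wedge f (ext_d \<omega>) J y"
    unfolding df_wedge_def ext_d_def by (intro sum.cong refl) (simp add: sum_distrib_left algebra_simps)
  finally show ?thesis by simp
qed

lemma contraction_forms_on:
  assumes w: "\<omega> \<in> forms_on U p" and v: "\<And>j. holo_on U (v j)" and U: "open U"
  shows "contraction v \<omega> \<in> forms_on U (p - 1)" "p = 0 \<Longrightarrow> contraction v \<omega> = 0"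
proof -
  have 0: "contraction v \<omega> J = 0" if "Suc (card J) \<noteq> p" for J
    using that w by (auto simp: contraction_def forms_on_def fun_eq_iff)
  moreover have "holo_on U (contraction v \<omega> J)" for J
    using w unfolding contraction_def forms_on_def
    by (intro holo_on_sum holo_on_cmult holo_on_mult v U) auto
  ultimately show "contraction v \<omega> \<in> forms_on U (p - 1)" by (auto simp: forms_on_def)
  show "contraction v \<omega> = 0" if "p = 0" using 0 that by (auto simp: fun_eq_iff)
qed

text \<open>
  The cone construction: \<open>\<eta>\<close> is the contraction of the Euler field \<open>y - x\<close> with the mean \<open>R\<close> of \<open>\<omega>\<close> along
  the segments to \<open>x\<close>, weighted by \<open>s\<^bsup>p-1\<^esup>\<close>.  By \<open>sign_homotopy\<close> the identity \<open>d\<eta> = \<omega>\<close> becomes the case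
  \<open>m = p\<close> of \<open>ray_mean_FTC\<close>.
\<close>

lemma poincare_ball:
  assumes w: "\<omega> \<in> forms_on (ball x r) p" and p: "p \<ge> 1"
    and closed: "\<And>J y. y \<in> ball x r \<Longrightarrow> ext_d \<omega> J y = 0"
  shows "\<exists>\<eta>\<in>forms_on (ball x r) (p - 1). \<forall>J. \<forall>y\<in>ball x r. ext_d \<eta> J y = \<omega> J y"
proof -
  let ?U = "ball x r"
  have wh: "holo_on ?U (\<omega> I)" for I using w by (simp add: forms_on_def)
  define R where "R = (\<lambda>I. ray_mean UNIV (p - 1) x (\<omega> I))"
  define E where "E = (\<lambda>j (y :: 'a aff). y $ j - x $ j)"
  have E: "holo_on ?U (E j)" for j unfolding E_def by (intro holo_on_intros open_ball)
  have gE: "has_grad (E j) (\<lambda>i. if i = j then 1 else 0) y" for j y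
    using has_grad_add[OF has_grad_coord has_grad_const[of "- (x $ j)"]] by (simp add: E_def)
  have R: "R \<in> forms_on ?U p"
    using w by (auto simp: R_def forms_on_def intro: holo_on_ray_mean)
  have gR: "has_grad (R I) (\<lambda>j. ray_mean UNIV p x (partial j (\<omega> I)) y) y" if "y \<in> ?U" for I y
    using ray_mean_grad[OF wh that, of UNIV "p - 1" I] p by (simp add: R_def)
  define \<eta> where "\<eta> = contraction E R"
  have "\<eta> \<in> forms_on ?U (p - 1)" unfolding \<eta>_def by (rule contraction_forms_on(1)[OF R E open_ball])
  moreover have "ext_d \<eta> J y = \<omega> J y" if y: "y \<in> ?U" for J y
  proof (cases "card J = p")
    case False
    have "ext_d \<eta> \<in> forms_on ?U p" using ext_d_forms_on[OF calculation] p by simp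
    then show ?thesis using False w by (auto simp: forms_on_def)
  next
    case True
    define c where "c i j K = E j y * ray_mean UNIV p x (partial i (\<omega> K)) y" for i j K
    have pE: "partial i (\<eta> I) y = (\<Sum>j\<in>- I. dx_sign j (insert j I) * (E j y * ray_mean UNIV p x (partial i (\<omega> (insert j I))) y
         + (if i = j then 1 else 0) * R (insert j I) y))" for i I
      unfolding \<eta>_def contraction_def
      by (rule has_grad_partial[OF has_grad_sum[OF _ has_grad_cmult[OF has_grad_mult[OF gE gR[OF y]]]]]) simp
    have "dx_sign i J * partial i (\<eta> (J - {i})) y =
        dx_sign i J * (\<Sum>j\<in>- (J - {i}). dx_sign j (insert j (J - {i})) * c i j (insert j (J - {i}))) + R J y" if "i \<in> J" for i
    proof -
      have "(\<Sum>j\<in>- (J - {i}). dx_sign j (insert j (J - {i})) * ((if i = j then 1 else 0) * R (insert j (J - {i})) y))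
         = (\<Sum>j\<in>{i}. dx_sign j (insert j (J - {i})) * ((if i = j then 1 else 0) * R (insert j (J - {i})) y))"
        by (rule sum.mono_neutral_right) auto
      also have "\<dots> = dx_sign i J * R J y" using that by (simp add: insert_absorb)
      finally show ?thesis unfolding pE c_def by (simp only: distrib_left sum.distrib) simp
    qed
    then have 1: "ext_d \<eta> J y = (\<Sum>i\<in>J. dx_sign i J * (\<Sum>j\<in>- (J - {i}). dx_sign j (insert j (J - {i})) * c i j (insert j (J - {i})))) + of_nat p * R J y"
      by (simp add: ext_d_def sum.distrib True)
    have 2: "(\<Sum>j\<in>- J. dx_sign j (insert j J) * (\<Sum>i\<in>insert j J. dx_sign i (insert j J) * c i j (insert j J - {i}))) = 0"
    proof (intro sum.neutral ballI)
      fix j assume "j \<in> - J"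
      have "(\<Sum>i\<in>insert j J. dx_sign i (insert j J) * ray_mean UNIV p x (partial i (\<omega> (insert j J - {i}))) y)
        = integral {0..1} (\<lambda>s. \<Sum>i\<in>insert j J. dx_sign i (insert j J) * (of_real s ^ p * partial i (\<omega> (insert j J - {i})) (contract UNIV x (of_real s) y)))"
        unfolding ray_mean_def
        by (subst integral_sum) (auto intro!: integrable_on_mult_right ray_mean_integrable[OF holo_on_partial[OF wh] y] sum.cong)
      also have "\<dots> = integral {0..1} (\<lambda>s. of_real s ^ p * ext_d \<omega> (insert j J) (contract UNIV x (of_real s) y))"
        by (intro integral_cong) (simp add: ext_d_def sum_distrib_left algebra_simps)
      also have "\<dots> = integral {0..1::real} (\<lambda>s. 0)"
        by (intro integral_cong) (simp add: closed[OF contract_in_ball[OF y]])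
      finally show "dx_sign j (insert j J) * (\<Sum>i\<in>insert j J. dx_sign i (insert j J) * c i j (insert j J - {i})) = 0"
        by (simp add: c_def mult.left_commute[of _ "E j y"] sum_distrib_left[symmetric])
    qed
    have "(\<Sum>i\<in>UNIV. c i i J) = \<omega> J y - of_nat p * R J y"
      using ray_mean_FTC[OF wh[of J] y, of p UNIV] p by (simp add: c_def E_def R_def power_0_left)
    with 1 2 sign_homotopy[of J c] show ?thesis by simp
  qed
  ultimately show ?thesis by blast
qed


section \<open>Germs of forms\<close>

lemma an_forms2:
  assumes "\<omega> \<in> an_forms p x" "\<eta> \<in> an_forms q x"
  obtains r where "r > 0" "\<omega> \<in> forms_on (ball x r) p" "\<eta> \<in> forms_on (ball x r) q"
proof -
  from assms obtain r r' where r: "r > 0" "\<omega> \<in> forms_on (ball x r) p" "r' > 0" "\<eta> \<in> forms_on (ball x r') q"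
    unfolding an_forms_iff by blast
  show ?thesis
    by (rule that[of "min r r'"]) (use r in \<open>auto simp: forms_on_def intro: holo_on_ball_mono\<close>)
qed

lemma an_formsD: "\<omega> \<in> an_forms p x \<Longrightarrow> holomorphic_near x (\<omega> I)"
  by (simp add: an_forms_def)

lemma an_forms_zero [simp]: "0 \<in> an_forms p x"
  by (auto simp: an_forms_def zero_fun_def intro: holomorphic_near_const)

lemma an_forms_add: "\<omega> \<in> an_forms p x \<Longrightarrow> \<eta> \<in> an_forms p x \<Longrightarrow> \<omega> + \<eta> \<in> an_forms p x"
  by (auto simp: an_forms_def plus_fun_def zero_fun_def intro: holomorphic_near_add)

lemma an_forms_uminus: "\<omega> \<in> an_forms p x \<Longrightarrow> - \<omega> \<in> an_forms p x"
  by (auto simp: an_forms_def fun_Compl_def zero_fun_def intro: holomorphic_near_minus)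

lemma an_forms_diff: "\<omega> \<in> an_forms p x \<Longrightarrow> \<eta> \<in> an_forms p x \<Longrightarrow> \<omega> - \<eta> \<in> an_forms p x"
  by (auto simp: an_forms_def fun_diff_def zero_fun_def intro: holomorphic_near_diff)

lemma an_forms_fmul: "\<omega> \<in> an_forms p x \<Longrightarrow> holomorphic_near x u \<Longrightarrow> fmul u \<omega> \<in> an_forms p x"
  by (auto simp: an_forms_def zero_fun_def intro: holomorphic_near_mult)

lemma an_forms_ext_d: "\<omega> \<in> an_forms p x \<Longrightarrow> ext_d \<omega> \<in> an_forms (Suc p) x"
  unfolding an_forms_iff using ext_d_forms_on by blast

lemma an_forms_df_wedge:
  assumes "\<omega> \<in> an_forms p x" "holomorphic_near x f" shows "df_wedge f \<omega> \<in> an_forms (Suc p) x"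
proof -
  obtain r where "r > 0" "\<omega> \<in> forms_on (ball x r) p" using assms(1) an_forms_iff by blast
  moreover obtain r' where "r' > 0" "holo_on (ball x r') f" using assms(2) holomorphic_near_iff by blast
  ultimately have "\<omega> \<in> forms_on (ball x (min r r')) p" "holo_on (ball x (min r r')) f" "min r r' > 0"
    by (auto simp: forms_on_def intro: holo_on_ball_mono)
  then show ?thesis unfolding an_forms_iff using df_wedge_forms_on by blast
qed

lemma an_forms_contraction:
  assumes w: "\<omega> \<in> an_forms p x" and v: "\<And>j. holomorphic_near x (v j)"
  shows "contraction v \<omega> \<in> an_forms (p - 1) x" "p = 0 \<Longrightarrow> contraction v \<omega> = 0"
proof -
  obtain r where r: "r > 0" "\<omega> \<in> forms_on (ball x r) p" using w an_forms_iff by blast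
  obtain r' where r': "r' > 0" "\<And>j. holo_on (ball x r') (v j)" using holomorphic_near_family[of x v, OF v] by metis
  have "\<omega> \<in> forms_on (ball x (min r r')) p" "min r r' > 0"
    using r r' by (auto simp: forms_on_def intro: holo_on_ball_mono)
  moreover have "holo_on (ball x (min r r')) (v j)" for j
    by (rule holo_on_ball_mono[OF r'(2)]) simp
  ultimately show "contraction v \<omega> \<in> an_forms (p - 1) x" "p = 0 \<Longrightarrow> contraction v \<omega> = 0"
    unfolding an_forms_iff using contraction_forms_on[OF _ _ open_ball] by blast+
qed

lemma germ_eq_ball: "germ_eq x \<omega> \<eta> \<longleftrightarrow> (\<exists>r>0. \<forall>I. \<forall>y\<in>ball x r. \<omega> I y = \<eta> I y)"
  unfolding germ_eq_def eventually_nhds_metric by (auto simp: dist_commute)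

lemma germ_eq_onI: "r > 0 \<Longrightarrow> (\<And>I y. y \<in> ball x r \<Longrightarrow> \<omega> I y = \<eta> I y) \<Longrightarrow> germ_eq x \<omega> \<eta>"
  unfolding germ_eq_ball by blast

lemma germ_eq_refl [simp]: "germ_eq x \<omega> \<omega>" by (simp add: germ_eq_def)

lemma germ_eq_sym: "germ_eq x \<omega> \<eta> \<Longrightarrow> germ_eq x \<eta> \<omega>"
  unfolding germ_eq_def by (simp add: eq_commute)

lemma germ_eq_trans [trans]: "germ_eq x \<omega> \<eta> \<Longrightarrow> germ_eq x \<eta> \<zeta> \<Longrightarrow> germ_eq x \<omega> \<zeta>"
  unfolding germ_eq_def by (erule (1) eventually_elim2) simp

lemma germ_eq_add: "germ_eq x \<omega> \<omega>' \<Longrightarrow> germ_eq x \<eta> \<eta>' \<Longrightarrow> germ_eq x (\<omega> + \<eta>) (\<omega>' + \<eta>')"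
  unfolding germ_eq_def by (erule (1) eventually_elim2) simp

lemma germ_eq_fmul: "eventually (\<lambda>y. u y = u' y) (nhds x) \<Longrightarrow> germ_eq x \<omega> \<omega>' \<Longrightarrow> germ_eq x (fmul u \<omega>) (fmul u' \<omega>')"
  unfolding germ_eq_def by (erule (1) eventually_elim2) simp

lemma germ_eq_df_wedge: "germ_eq x \<omega> \<omega>' \<Longrightarrow> germ_eq x (df_wedge f \<omega>) (df_wedge f \<omega>')"
  unfolding germ_eq_def by (erule eventually_mono) (simp add: df_wedge_def)

lemma germ_eq_ext_d:
  assumes "\<omega> \<in> an_forms p x" "germ_eq x \<omega> \<eta>" shows "germ_eq x (ext_d \<omega>) (ext_d \<eta>)"
proof -
  obtain r where r: "r > 0" "\<And>I. holo_on (ball x r) (\<omega> I)"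
    using assms(1) unfolding an_forms_iff forms_on_def by blast
  obtain d where d: "d > 0" "\<And>I y. y \<in> ball x d \<Longrightarrow> \<omega> I y = \<eta> I y"
    using assms(2) unfolding germ_eq_ball by blast
  show ?thesis
  proof (rule germ_eq_onI[of "min r d"])
    show "min r d > 0" using r d by simp
    fix J y assume "y \<in> ball x (min r d)"
    moreover have "partial i (\<eta> I) y = partial i (\<omega> I) y" for i I
      by (rule partial_cong[OF holo_on_ball_mono[OF r(2), of "min r d"] calculation]) (use d in auto)
    ultimately show "ext_d \<omega> J y = ext_d \<eta> J y" by (simp add: ext_d_def)
  qed
qed

lemma germ_ext_d_add:
  assumes "\<omega> \<in> an_forms p x" "\<eta> \<in> an_forms q x" shows "germ_eq x (ext_d (\<omega> + \<eta>)) (ext_d \<omega> + ext_d \<eta>)"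
proof -
  obtain r where r: "r > 0" "\<omega> \<in> forms_on (ball x r) p" "\<eta> \<in> forms_on (ball x r) q" using an_forms2[OF assms] .
  show ?thesis by (rule germ_eq_onI[OF r(1)]) (use r in \<open>auto simp: forms_on_def intro!: ext_d_add\<close>)
qed

lemma germ_ext_d_fmul:
  assumes "\<omega> \<in> an_forms p x" "holomorphic_near x u"
  shows "germ_eq x (ext_d (fmul u \<omega>)) (df_wedge u \<omega> + fmul u (ext_d \<omega>))"
proof -
  obtain r where r: "r > 0" "\<omega> \<in> forms_on (ball x r) p" using assms(1) an_forms_iff by blast
  obtain r' where r': "r' > 0" "holo_on (ball x r') u" using assms(2) holomorphic_near_iff by blast
  have *: "\<And>I. holo_on (ball x (min r r')) (\<omega> I)" "holo_on (ball x (min r r')) u" "min r r' > 0"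
    using r r' by (auto simp: forms_on_def intro: holo_on_ball_mono)
  show ?thesis by (rule germ_eq_onI[OF *(3)]) (simp only: ext_d_fmul[OF *(1,2)] plus_fun_apply)
qed

lemma germ_ext_d_uminus:
  assumes "\<omega> \<in> an_forms p x" shows "germ_eq x (ext_d (- \<omega>)) (- ext_d \<omega>)"
proof -
  have "fmul (\<lambda>y. -1) \<omega> = - \<omega>" "df_wedge (\<lambda>y. -1) \<omega> + fmul (\<lambda>y. -1) (ext_d \<omega>) = - ext_d \<omega>"
    by (auto simp: fun_eq_iff df_wedge_def)
  then show ?thesis using germ_ext_d_fmul[OF assms holomorphic_near_const[of x "-1"]] by simp
qed

lemma germ_ext_d_ext_d: "\<omega> \<in> an_forms p x \<Longrightarrow> germ_eq x (ext_d (ext_d \<omega>)) 0"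
  unfolding an_forms_iff forms_on_def by (auto intro!: germ_eq_onI ext_d_ext_d)

lemma germ_ext_d_df_wedge:
  assumes "\<omega> \<in> an_forms p x" "holomorphic_near x f"
  shows "germ_eq x (ext_d (df_wedge f \<omega>)) (- df_wedge f (ext_d \<omega>))"
proof -
  obtain r where r: "r > 0" "\<omega> \<in> forms_on (ball x r) p" using assms(1) an_forms_iff by blast
  obtain r' where r': "r' > 0" "holo_on (ball x r') f" using assms(2) holomorphic_near_iff by blast
  have *: "\<And>I. holo_on (ball x (min r r')) (\<omega> I)" "holo_on (ball x (min r r')) f" "min r r' > 0"
    using r r' by (auto simp: forms_on_def intro: holo_on_ball_mono)
  show ?thesis by (rule germ_eq_onI[OF *(3)]) (simp add: ext_d_df_wedge[OF *(1,2)])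
qed

lemma df_wedge_df_wedge_fun [simp]: "df_wedge f (df_wedge f \<omega>) = 0"
  by (intro ext) (simp add: df_wedge_df_wedge)

lemma poincare_germ:
  assumes w: "\<omega> \<in> an_forms p x" and p: "p \<ge> 1" and closed: "germ_eq x (ext_d \<omega>) 0"
  shows "\<exists>\<eta>\<in>an_forms (p - 1) x. germ_eq x (ext_d \<eta>) \<omega>"
proof -
  obtain r where r: "r > 0" "\<omega> \<in> forms_on (ball x r) p" using w an_forms_iff by blast
  obtain d where d: "d > 0" "\<And>I y. y \<in> ball x d \<Longrightarrow> ext_d \<omega> I y = 0"
    using closed unfolding germ_eq_ball by auto
  define e where "e = min r d"
  have e: "e > 0" "\<omega> \<in> forms_on (ball x e) p" "\<And>I y. y \<in> ball x e \<Longrightarrow> ext_d \<omega> I y = 0"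
    using r d by (auto simp: e_def forms_on_def intro: holo_on_ball_mono)
  from poincare_ball[OF e(2) p e(3)] obtain \<eta> where "\<eta> \<in> forms_on (ball x e) (p - 1)" "\<And>J y. y \<in> ball x e \<Longrightarrow> ext_d \<eta> J y = \<omega> J y"
    by blast
  then show ?thesis using e(1) by (auto simp: an_forms_iff intro!: germ_eq_onI bexI[of _ \<eta>])
qed

section \<open>Exactness of the local Koszul complex\<close>

text \<open>
  The factor \<open>(y $ i - x $ i)\<^sup>m\<close> is removed one power at a time.  On the smaller slice where the \<open>i\<close>-th
  coordinate is that of \<open>x\<close>, the form \<open>df \<and> \<eta>\<close> vanishes, so \<open>\<eta> = df \<and> \<gamma>\<close> there by exactness in lower
  degree.  Then \<open>\<eta> - df \<and> \<gamma>\<close> is divisible by \<open>y $ i - x $ i\<close> and has the same product with \<open>df\<close>.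
  Only \<open>df \<and> \<gamma>\<close> is required to be a form, which covers \<open>p = 1\<close> with \<open>\<gamma> = 0\<close>.
\<close>

lemma koszul_slice_step:
  assumes f: "holomorphic_near x f" and i: "i \<notin> K" and p: "p \<ge> 1"
    and IH: "\<And>\<eta>. \<eta> \<in> an_forms (p - 1) x \<Longrightarrow>
       eventually (\<lambda>y. y \<in> slice (insert i K) x \<longrightarrow> (\<forall>J. df_wedge f \<eta> J y = 0)) (nhds x) \<Longrightarrow>
       \<exists>\<gamma>. df_wedge f \<gamma> \<in> an_forms (p - 1) x \<and> eventually (\<lambda>y. y \<in> slice (insert i K) x \<longrightarrow> (\<forall>J. \<eta> J y = df_wedge f \<gamma> J y)) (nhds x)"
    and w: "\<omega> \<in> an_forms p x"
  shows "\<eta> \<in> an_forms (p - 1) x \<Longrightarrow>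
      eventually (\<lambda>y. y \<in> slice K x \<longrightarrow> (\<forall>J. (y $ i - x $ i) ^ m * \<omega> J y = df_wedge f \<eta> J y)) (nhds x) \<Longrightarrow>
      \<exists>\<eta>\<in>an_forms (p - 1) x. eventually (\<lambda>y. y \<in> slice K x \<longrightarrow> (\<forall>J. \<omega> J y = df_wedge f \<eta> J y)) (nhds x)"
proof (induction m arbitrary: \<eta>)
  case 0
  then show ?case by auto
next
  case (Suc m)
  have "eventually (\<lambda>y. y \<in> slice (insert i K) x \<longrightarrow> (\<forall>J. df_wedge f \<eta> J y = 0)) (nhds x)"
    using Suc.prems(2) by (rule eventually_mono) (auto simp: slice_def)
  from IH[OF Suc.prems(1) this] obtain \<gamma> where g: "df_wedge f \<gamma> \<in> an_forms (p - 1) x"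
    "eventually (\<lambda>y. y \<in> slice (insert i K) x \<longrightarrow> (\<forall>J. \<eta> J y = df_wedge f \<gamma> J y)) (nhds x)" by blast
  \<comment> \<open>\<open>\<zeta>\<close> has the same product with \<open>df\<close> as \<open>\<eta>\<close> and vanishes on the smaller slice\<close>
  define \<zeta> where "\<zeta> = \<eta> - df_wedge f \<gamma>"
  have z: "\<zeta> \<in> an_forms (p - 1) x" unfolding \<zeta>_def by (intro an_forms_diff Suc.prems g)
  define \<delta> where "\<delta> = (\<lambda>J. ray_mean {i} 0 x (partial i (\<zeta> J)))"
  have "partial i (0 :: 'a aff \<Rightarrow> complex) = 0" by (intro ext) simp
  then have d: "\<delta> \<in> an_forms (p - 1) x"
    using z by (auto simp: an_forms_def \<delta>_def intro!: holomorphic_near_ray_mean holomorphic_near_partial)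
  have "eventually (\<lambda>y. y \<in> slice K x \<longrightarrow> \<zeta> J y = (y $ i - x $ i) * \<delta> J y) (nhds x)" for J
    unfolding \<delta>_def by (rule hadamard_division[OF an_formsD[OF z]], rule eventually_mono[OF g(2)]) (simp add: \<zeta>_def)
  then have zd: "eventually (\<lambda>y. \<forall>J. y \<in> slice K x \<longrightarrow> \<zeta> J y = (y $ i - x $ i) * \<delta> J y) (nhds x)"
    by (rule eventually_all_finite)
  have "eventually (\<lambda>y. y \<in> slice K x \<longrightarrow> (y $ i - x $ i) * ((y $ i - x $ i) ^ m * \<omega> J y) = (y $ i - x $ i) * df_wedge f \<delta> J y) (nhds x)" for J
    using Suc.prems(2) zd
  proof eventually_elim
    case (elim y)
    show ?case
    proof
      assume y: "y \<in> slice K x"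
      have "df_wedge f \<eta> J y = df_wedge f \<zeta> J y" by (simp add: \<zeta>_def df_wedge_diff df_wedge_df_wedge)
      also have "\<dots> = (y $ i - x $ i) * df_wedge f \<delta> J y"
      proof -
        have "\<zeta> I y = (y $ i - x $ i) * \<delta> I y" for I using elim(2) y by blast
        then show ?thesis by (simp add: df_wedge_def sum_distrib_left mult_ac)
      qed
      finally show "(y $ i - x $ i) * ((y $ i - x $ i) ^ m * \<omega> J y) = (y $ i - x $ i) * df_wedge f \<delta> J y"
        using elim(1) y by (simp add: mult.assoc)
    qed
  qed
  then have "eventually (\<lambda>y. y \<in> slice K x \<longrightarrow> (y $ i - x $ i) ^ m * \<omega> J y = df_wedge f \<delta> J y) (nhds x)" for J
    by (rule slice_cancel[rotated 3])
       (auto intro!: holomorphic_near_intros an_formsD[OF w] an_formsD[OF an_forms_df_wedge[OF d f]] i)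
  then have "eventually (\<lambda>y. \<forall>J. y \<in> slice K x \<longrightarrow> (y $ i - x $ i) ^ m * \<omega> J y = df_wedge f \<delta> J y) (nhds x)"
    by (rule eventually_all_finite)
  then show ?case by (intro Suc.IH[OF d]) (simp add: eventually_mono)
qed

lemma slice_cancel_power:
  assumes u: "holomorphic_near x u" and i: "i \<notin> K"
  shows "eventually (\<lambda>y. y \<in> slice K x \<longrightarrow> (y $ i - x $ i) ^ m * u y = 0) (nhds x) \<Longrightarrow>
    eventually (\<lambda>y. y \<in> slice K x \<longrightarrow> u y = 0) (nhds x)"
proof (induction m)
  case (Suc m)
  have "eventually (\<lambda>y. y \<in> slice K x \<longrightarrow> (y $ i - x $ i) ^ m * u y = 0) (nhds x)"
    by (rule slice_cancel[OF _ _ i]) (use Suc.prems in \<open>auto intro!: holomorphic_near_intros u simp: mult.assoc\<close>)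
  then show ?case by (rule Suc.IH)
qed simp

text \<open>
  Induction on the number of free coordinates of the slice.  Contraction with \<open>h\<close> shows that
  \<open>(y $ i - x $ i)\<^sup>N \<omega> = df \<and> contraction h \<omega>\<close> for a free coordinate \<open>i\<close>, and the previous step removes the
  power at the price of freezing this coordinate and lowering the degree by one.  In degree \<open>0\<close> the
  right hand side vanishes, and so does \<open>\<omega>\<close>.
\<close>

lemma koszul_exact_slice:
  fixes x :: "'n::{finite,linorder} aff"
  assumes f: "holomorphic_near x f"
    and primary: "\<And>i. \<exists>h N. (\<forall>j. holomorphic_near x (h j)) \<and>
       eventually (\<lambda>y. (y $ i - x $ i) ^ N = (\<Sum>j\<in>UNIV. h j y * partial j f y)) (nhds x)"
  shows "p + card K < CARD('n) \<Longrightarrow> \<omega> \<in> an_forms p x \<Longrightarrow>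
     eventually (\<lambda>y. y \<in> slice K x \<longrightarrow> (\<forall>J. df_wedge f \<omega> J y = 0)) (nhds x) \<Longrightarrow>
     \<exists>\<eta>. (p \<ge> 1 \<longrightarrow> \<eta> \<in> an_forms (p - 1) x) \<and> (p = 0 \<longrightarrow> \<eta> = 0) \<and>
       eventually (\<lambda>y. y \<in> slice K x \<longrightarrow> (\<forall>J. \<omega> J y = df_wedge f \<eta> J y)) (nhds x)"
proof (induction "CARD('n) - card K" arbitrary: K p \<omega>)
  case 0
  then show ?case by simp
next
  case (Suc k)
  have "K \<noteq> UNIV" using Suc.hyps(2) by auto
  then obtain i where i: "i \<notin> K" by blast
  from primary obtain h N where h: "\<And>j. holomorphic_near x (h j)"
    "eventually (\<lambda>y. (y $ i - x $ i) ^ N = (\<Sum>j\<in>UNIV. h j y * partial j f y)) (nhds x)" by blast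
  note w = \<open>\<omega> \<in> an_forms p x\<close>
  have eq: "eventually (\<lambda>y. y \<in> slice K x \<longrightarrow> (\<forall>J. (y $ i - x $ i) ^ N * \<omega> J y = df_wedge f (contraction h \<omega>) J y)) (nhds x)"
    using h(2) Suc.prems(3)
  proof eventually_elim
    case (elim y)
    show ?case
    proof (intro impI allI)
      fix J assume "y \<in> slice K x"
      then have "contraction h (df_wedge f \<omega>) J y = 0" using elim(2) by (simp add: contraction_def)
      with contraction_df_wedge[of h f \<omega> J y] elim(1)
      show "(y $ i - x $ i) ^ N * \<omega> J y = df_wedge f (contraction h \<omega>) J y" by simp
    qed
  qed
  show ?case
  proof (cases "p = 0")
    case True
    then have 0: "contraction h \<omega> = 0" using an_forms_contraction(2)[OF w h(1)] by simp
    have "eventually (\<lambda>y. y \<in> slice K x \<longrightarrow> (y $ i - x $ i) ^ N * \<omega> J y = 0) (nhds x)" for J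
      by (rule eventually_mono[OF eq]) (auto simp: 0 df_wedge_def)
    then have "eventually (\<lambda>y. y \<in> slice K x \<longrightarrow> \<omega> J y = 0) (nhds x)" for J
      by (rule slice_cancel_power[OF an_formsD[OF w] i])
    then have "eventually (\<lambda>y. \<forall>J. y \<in> slice K x \<longrightarrow> \<omega> J y = 0) (nhds x)" by (rule eventually_all_finite)
    then show ?thesis using True by (intro exI[of _ 0]) (auto simp: df_wedge_def elim: eventually_mono)
  next
    case False
    have c: "card (insert i K) = Suc (card K)" using i by simp
    have "\<exists>\<eta>\<in>an_forms (p - 1) x. eventually (\<lambda>y. y \<in> slice K x \<longrightarrow> (\<forall>J. \<omega> J y = df_wedge f \<eta> J y)) (nhds x)"
    proof (rule koszul_slice_step[OF f i _ _ w an_forms_contraction(1)[OF w h(1)] eq])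
      show "p \<ge> 1" using False by simp
      fix \<eta> assume e: "\<eta> \<in> an_forms (p - 1) x"
        "eventually (\<lambda>y. y \<in> slice (insert i K) x \<longrightarrow> (\<forall>J. df_wedge f \<eta> J y = 0)) (nhds x)"
      have "\<exists>\<gamma>. (p - 1 \<ge> 1 \<longrightarrow> \<gamma> \<in> an_forms (p - 1 - 1) x) \<and> (p - 1 = 0 \<longrightarrow> \<gamma> = 0) \<and>
         eventually (\<lambda>y. y \<in> slice (insert i K) x \<longrightarrow> (\<forall>J. \<eta> J y = df_wedge f \<gamma> J y)) (nhds x)"
        by (rule Suc.hyps(1)) (use Suc.hyps(2) Suc.prems(1) c False e in auto)
      then obtain \<gamma> where g: "p - 1 \<ge> 1 \<longrightarrow> \<gamma> \<in> an_forms (p - 1 - 1) x" "p - 1 = 0 \<longrightarrow> \<gamma> = 0"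
         "eventually (\<lambda>y. y \<in> slice (insert i K) x \<longrightarrow> (\<forall>J. \<eta> J y = df_wedge f \<gamma> J y)) (nhds x)"
        by (elim exE conjE)
      have "df_wedge f \<gamma> \<in> an_forms (p - 1) x"
      proof (cases "p - 1 = 0")
        case True
        have "df_wedge f 0 = 0" by (intro ext) (simp add: df_wedge_def)
        then show ?thesis using g(2) True by simp
      next
        case False
        then have "\<gamma> \<in> an_forms (p - 1 - 1) x" using g(1) by simp
        moreover have "Suc (p - 1 - 1) = p - 1" using False by simp
        ultimately show ?thesis using an_forms_df_wedge[OF _ f] by metis
      qed
      with g(3) show "\<exists>\<gamma>. df_wedge f \<gamma> \<in> an_forms (p - 1) x \<and> eventually (\<lambda>y. y \<in> slice (insert i K) x \<longrightarrow> (\<forall>J. \<eta> J y = df_wedge f \<gamma> J y)) (nhds x)"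
        by (intro exI[of _ \<gamma>] conjI)
    qed
    then show ?thesis using False by auto
  qed
qed

text \<open>
  Powers of the coordinates lie in the ideal generated by the partial derivatives in the ring of germs.
  At an isolated critical point this is the analytic Nullstellensatz; at a noncritical point it holds
  with \<open>N = 0\<close>.
\<close>

definition isolated_at :: "('n::finite aff \<Rightarrow> complex) \<Rightarrow> 'n aff \<Rightarrow> bool" where
  "isolated_at f x \<longleftrightarrow> holomorphic_near x f \<and> (\<forall>i. \<exists>h N. (\<forall>j. holomorphic_near x (h j)) \<and>
       eventually (\<lambda>y. (y $ i - x $ i) ^ N = (\<Sum>j\<in>UNIV. h j y * partial j f y)) (nhds x))"

lemma koszul_exact:
  fixes x :: "'n::{finite,linorder} aff"
  assumes f: "isolated_at f x" and n: "CARD('n) \<ge> 2"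
    and w: "\<omega> \<in> an_forms (CARD('n) - 1) x" and 0: "germ_eq x (df_wedge f \<omega>) 0"
  shows "\<exists>\<eta>\<in>an_forms (CARD('n) - 2) x. germ_eq x \<omega> (df_wedge f \<eta>)"
proof -
  have "\<exists>\<eta>. (CARD('n) - 1 \<ge> 1 \<longrightarrow> \<eta> \<in> an_forms (CARD('n) - 1 - 1) x) \<and> (CARD('n) - 1 = 0 \<longrightarrow> \<eta> = 0) \<and>
       eventually (\<lambda>y. y \<in> slice {} x \<longrightarrow> (\<forall>J. \<omega> J y = df_wedge f \<eta> J y)) (nhds x)"
  proof (rule koszul_exact_slice)
    show "holomorphic_near x f" using f by (simp add: isolated_at_def)
    show "\<exists>h N. (\<forall>j. holomorphic_near x (h j)) \<and> eventually (\<lambda>y. (y $ i - x $ i) ^ N = (\<Sum>j\<in>UNIV. h j y * partial j f y)) (nhds x)" for i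
      using f by (simp only: isolated_at_def)
    show "CARD('n) - 1 + card ({} :: 'n set) < CARD('n)" using n by simp
    show "eventually (\<lambda>y. y \<in> slice {} x \<longrightarrow> (\<forall>J. df_wedge f \<omega> J y = 0)) (nhds x)"
      using 0 by (simp add: germ_eq_def)
  qed (rule w)
  then obtain \<eta> where e: "CARD('n) - 1 \<ge> 1 \<longrightarrow> \<eta> \<in> an_forms (CARD('n) - 1 - 1) x"
    "eventually (\<lambda>y. y \<in> slice {} x \<longrightarrow> (\<forall>J. \<omega> J y = df_wedge f \<eta> J y)) (nhds x)"
    by (elim exE conjE)
  have "\<eta> \<in> an_forms (CARD('n) - 2) x" using e(1) n by (simp add: numeral_2_eq_2)
  moreover have "germ_eq x \<omega> (df_wedge f \<eta>)" using e(2) by (simp add: germ_eq_def)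
  ultimately show ?thesis by blast
qed

section \<open>Polynomial functions\<close>

lemma polynomial_map_const: "polynomial_map (\<lambda>y. a)"
  unfolding polynomial_map_def by (intro exI[of _ "{\<lambda>_. 0}"] exI[of _ "\<lambda>_. a"]) simp

lemma polynomial_map_monomial: "polynomial_map (\<lambda>y :: 'n::finite aff. a * (\<Prod>i\<in>UNIV. (y $ i) ^ m i))"
  unfolding polynomial_map_def by (intro exI[of _ "{m}"] exI[of _ "\<lambda>_. a"]) simp

lemma polynomial_map_add: "polynomial_map h \<Longrightarrow> polynomial_map h' \<Longrightarrow> polynomial_map (\<lambda>y :: 'n::finite aff. h y + h' y)"
proof -
  assume "polynomial_map h" "polynomial_map h'"
  then obtain A a B b where h: "finite A" "h = (\<lambda>x. \<Sum>m\<in>A. a m * (\<Prod>i\<in>UNIV. (x $ i) ^ m i))"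
    and h': "finite B" "h' = (\<lambda>x. \<Sum>m\<in>B. b m * (\<Prod>i\<in>UNIV. (x $ i) ^ m i))"
    unfolding polynomial_map_def by blast
  define c where "c m = (if m \<in> A then a m else 0) + (if m \<in> B then b m else 0)" for m
  have "h y + h' y = (\<Sum>m\<in>A \<union> B. c m * (\<Prod>i\<in>UNIV. (y $ i) ^ m i))" for y
  proof -
    have "h y = (\<Sum>m\<in>A \<union> B. (if m \<in> A then a m else 0) * (\<Prod>i\<in>UNIV. (y $ i) ^ m i))"
      unfolding h(2) using h(1) h'(1) by (intro sum.mono_neutral_cong_left) auto
    moreover have "h' y = (\<Sum>m\<in>A \<union> B. (if m \<in> B then b m else 0) * (\<Prod>i\<in>UNIV. (y $ i) ^ m i))"
      unfolding h'(2) using h(1) h'(1) by (intro sum.mono_neutral_cong_left) auto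
    ultimately show ?thesis by (simp add: c_def algebra_simps sum.distrib)
  qed
  then show ?thesis unfolding polynomial_map_def using h(1) h'(1) by blast
qed

lemma polynomial_map_sum: "finite A \<Longrightarrow> (\<And>a. a \<in> A \<Longrightarrow> polynomial_map (h a)) \<Longrightarrow> polynomial_map (\<lambda>y. \<Sum>a\<in>A. h a y)"
  by (induction A rule: finite_induct) (auto intro: polynomial_map_const polynomial_map_add)

lemma polynomial_map_mult: "polynomial_map h \<Longrightarrow> polynomial_map h' \<Longrightarrow> polynomial_map (\<lambda>y :: 'n::finite aff. h y * h' y)"
proof -
  assume "polynomial_map h" "polynomial_map h'"
  then obtain A a B b where h: "finite A" "h = (\<lambda>x. \<Sum>m\<in>A. a m * (\<Prod>i\<in>UNIV. (x $ i) ^ m i))"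
    and h': "finite B" "h' = (\<lambda>x. \<Sum>m\<in>B. b m * (\<Prod>i\<in>UNIV. (x $ i) ^ m i))"
    unfolding polynomial_map_def by blast
  have eq: "(\<lambda>y. h y * h' y) = (\<lambda>y. \<Sum>m\<in>A. \<Sum>k\<in>B. (a m * b k) * (\<Prod>i\<in>UNIV. (y $ i) ^ (m i + k i)))"
    by (simp add: h h' sum_product power_add prod.distrib algebra_simps)
  show ?thesis unfolding eq by (intro polynomial_map_sum polynomial_map_monomial h h')
qed

lemma polynomial_map_coord: "polynomial_map (\<lambda>y :: 'n::finite aff. y $ j)"
proof -
  have "(\<Prod>i\<in>UNIV. (y $ i) ^ (if i = j then 1 else 0)) = y $ j" for y :: "'n aff"
    by (simp add: if_distrib[of "\<lambda>k. _ ^ k"] cong: if_cong)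
  then show ?thesis using polynomial_map_monomial[of 1 "\<lambda>i. if i = j then 1 else 0"] by simp
qed

lemma polynomial_map_power: "polynomial_map h \<Longrightarrow> polynomial_map (\<lambda>y. h y ^ n)"
  by (induction n) (auto intro: polynomial_map_const polynomial_map_mult)

lemma polynomial_map_prod: "finite A \<Longrightarrow> (\<And>a. a \<in> A \<Longrightarrow> polynomial_map (h a)) \<Longrightarrow> polynomial_map (\<lambda>y. \<Prod>a\<in>A. h a y)"
  by (induction A rule: finite_induct) (auto intro: polynomial_map_const polynomial_map_mult)

lemma polynomial_map_uminus: "polynomial_map h \<Longrightarrow> polynomial_map (\<lambda>y. - h y)"
  using polynomial_map_mult[OF polynomial_map_const[of "-1"]] by fastforce

lemma polynomial_map_diff: "polynomial_map h \<Longrightarrow> polynomial_map h' \<Longrightarrow> polynomial_map (\<lambda>y. h y - h' y)"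
  using polynomial_map_add[OF _ polynomial_map_uminus] by fastforce

lemma polynomial_map_induct [consumes 1, case_names const coord add mult]:
  fixes h :: "'n::finite aff \<Rightarrow> complex"
  assumes "polynomial_map h"
    and const: "\<And>a. P (\<lambda>y. a)" and coord: "\<And>j. P (\<lambda>y. y $ j)"
    and add: "\<And>h h'. polynomial_map h \<Longrightarrow> polynomial_map h' \<Longrightarrow> P h \<Longrightarrow> P h' \<Longrightarrow> P (\<lambda>y. h y + h' y)"
    and mult: "\<And>h h'. polynomial_map h \<Longrightarrow> polynomial_map h' \<Longrightarrow> P h \<Longrightarrow> P h' \<Longrightarrow> P (\<lambda>y. h y * h' y)"
  shows "P h"
proof -
  obtain A a where h: "finite A" "h = (\<lambda>x. \<Sum>m\<in>A. a m * (\<Prod>i\<in>UNIV. (x $ i) ^ m i))"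
    using assms(1) unfolding polynomial_map_def by blast
  have pow: "P (\<lambda>y. y $ i ^ k)" for i k
  proof (induction k)
    case (Suc k)
    from mult[OF polynomial_map_coord polynomial_map_power[OF polynomial_map_coord] coord this]
    show ?case by simp
  qed (simp add: const)
  have prod: "P (\<lambda>y. \<Prod>i\<in>S. y $ i ^ m i)" if "finite S" for S m
    using that
  proof (induction S rule: finite_induct)
    case (insert i S)
    have "polynomial_map (\<lambda>y. \<Prod>i\<in>S. y $ i ^ m i)"
      by (intro polynomial_map_prod polynomial_map_power polynomial_map_coord insert)
    from mult[OF polynomial_map_power[OF polynomial_map_coord] this pow insert.IH] insert.hyps
    show ?case by simp
  qed (simp add: const)
  have "P (\<lambda>x. \<Sum>m\<in>A. a m * (\<Prod>i\<in>UNIV. (x $ i) ^ m i))"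
    using h(1)
  proof (induction A rule: finite_induct)
    case (insert m A)
    have "P (\<lambda>x. a m * (\<Prod>i\<in>UNIV. x $ i ^ m i))"
      by (intro mult polynomial_map_const const prod polynomial_map_prod polynomial_map_power polynomial_map_coord finite)
    moreover have "polynomial_map (\<lambda>x. \<Sum>m\<in>A. a m * (\<Prod>i\<in>UNIV. x $ i ^ m i))"
      by (intro polynomial_map_sum polynomial_map_monomial insert)
    ultimately show ?case using add[OF polynomial_map_monomial _ _ insert.IH] insert.hyps by simp
  qed (simp add: const)
  then show ?thesis by (simp add: h)
qed

lemma polynomial_map_holo: "polynomial_map h \<Longrightarrow> holo_on UNIV h"
  by (induction h rule: polynomial_map_induct) (auto intro: holo_on_intros)

lemma polynomial_map_holo': "polynomial_map h \<Longrightarrow> open U \<Longrightarrow> holo_on U h"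
  using holo_on_subset polynomial_map_holo by blast

lemma polynomial_map_near: "polynomial_map h \<Longrightarrow> holomorphic_near x h"
  unfolding holomorphic_near_iff using polynomial_map_holo' open_ball zero_less_one by blast

lemma polynomial_map_partial: "polynomial_map h \<Longrightarrow> polynomial_map (partial i h)"
proof (induction h rule: polynomial_map_induct)
  case (const a)
  have "partial i (\<lambda>y. a) = (\<lambda>y :: 'a aff. 0)" by (intro ext) simp
  then show ?case by (simp add: polynomial_map_const)
next
  case (coord j)
  have "partial i (\<lambda>y. y $ j) = (\<lambda>y :: 'a aff. if i = j then 1 else 0)"
    by (intro ext) (rule has_grad_partial[OF has_grad_coord])
  then show ?case by (simp add: polynomial_map_const)
next
  case (add h h')
  have "partial i (\<lambda>y. h y + h' y) = (\<lambda>y. partial i h y + partial i h' y)"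
    by (intro ext) (rule has_grad_partial[OF has_grad_add[OF holo_onD[OF polynomial_map_holo[OF add(1)] UNIV_I] holo_onD[OF polynomial_map_holo[OF add(2)] UNIV_I]]])
  then show ?case using add by (simp add: polynomial_map_add)
next
  case (mult h h')
  have "partial i (\<lambda>y. h y * h' y) = (\<lambda>y. h y * partial i h' y + partial i h y * h' y)"
    by (intro ext) (rule has_grad_partial[OF has_grad_mult[OF holo_onD[OF polynomial_map_holo[OF mult(1)] UNIV_I] holo_onD[OF polynomial_map_holo[OF mult(2)] UNIV_I]]])
  then show ?case using mult by (simp add: polynomial_map_add polynomial_map_mult)
qed

lemmas polynomial_map_intros = polynomial_map_const polynomial_map_coord polynomial_map_add
  polynomial_map_mult polynomial_map_sum polynomial_map_prod polynomial_map_power polynomial_map_uminus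
  polynomial_map_diff polynomial_map_partial

lemma polynomial_map_poly: "polynomial_map g \<Longrightarrow> polynomial_map (\<lambda>y. poly p (g y))"
  by (induction p) (auto intro: polynomial_map_intros)

lemma polynomial_map_contract: "polynomial_map h \<Longrightarrow> polynomial_map (\<lambda>y. h (contract S x z y))"
proof (induction h rule: polynomial_map_induct)
  case (coord j)
  show ?case by (cases "j \<in> S") (auto simp: contract_def intro!: polynomial_map_intros)
qed (auto intro: polynomial_map_intros)

text \<open>
  The algebraic counterpart of \<open>hadamard_division\<close>.
\<close>

lemma polynomial_division:
  "polynomial_map h \<Longrightarrow> \<exists>q. polynomial_map q \<and> (\<forall>y. h y = h (contract {i} x 0 y) + (y $ i - x $ i) * q y)"
proof (induction h rule: polynomial_map_induct)
  case (const a)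
  show ?case by (intro exI[of _ "\<lambda>y. 0"]) (simp add: polynomial_map_const)
next
  case (coord j)
  show ?case by (intro exI[of _ "\<lambda>y. if j = i then 1 else 0"]) (simp add: polynomial_map_const contract_def)
next
  case (add h h')
  then obtain q q' where q: "polynomial_map q" "polynomial_map q'"
    "\<And>y. h y = h (contract {i} x 0 y) + (y $ i - x $ i) * q y"
    "\<And>y. h' y = h' (contract {i} x 0 y) + (y $ i - x $ i) * q' y" by metis
  show ?case
    by (intro exI[of _ "\<lambda>y. q y + q' y"] conjI polynomial_map_add q allI, subst q(3), subst q(4)) (simp add: algebra_simps)
next
  case (mult h h')
  then obtain q q' where q: "polynomial_map q" "polynomial_map q'"
    "\<And>y. h y = h (contract {i} x 0 y) + (y $ i - x $ i) * q y"
    "\<And>y. h' y = h' (contract {i} x 0 y) + (y $ i - x $ i) * q' y" by metis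
  have "h y * h' y = h (contract {i} x 0 y) * h' (contract {i} x 0 y) +
     (y $ i - x $ i) * (q y * h' y + h (contract {i} x 0 y) * q' y)" for y
  proof -
    have "h y * h' y = h (contract {i} x 0 y) * h' y + (y $ i - x $ i) * q y * h' y"
      by (subst q(3)) (simp add: algebra_simps)
    also have "h (contract {i} x 0 y) * h' y = h (contract {i} x 0 y) * h' (contract {i} x 0 y) + (y $ i - x $ i) * (h (contract {i} x 0 y) * q' y)"
      by (subst q(4)) (simp add: algebra_simps)
    finally show ?thesis by (simp add: algebra_simps)
  qed
  moreover have "polynomial_map (\<lambda>y. q y * h' y + h (contract {i} x 0 y) * q' y)"
    by (intro polynomial_map_add polynomial_map_mult polynomial_map_contract q mult)
  ultimately show ?case by blast
qed

text \<open>
  On the complex line through \<open>x\<close> and \<open>y\<close> the function is a polynomial in one variable with infinitely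
  many zeros near \<open>x\<close>.
\<close>

lemma polynomial_identity:
  assumes h: "polynomial_map h" and 0: "eventually (\<lambda>y. h y = 0) (nhds x)"
  shows "h y = 0"
proof -
  have "\<exists>p. \<forall>t. h (contract UNIV x t y) = poly p t" using h
  proof (induction h rule: polynomial_map_induct)
    case (const a)
    show ?case by (intro exI[of _ "[:a:]"]) simp
  next
    case (coord j)
    show ?case by (intro exI[of _ "[:x $ j, y $ j - x $ j:]"]) (simp add: contract_def)
  next
    case (add h h')
    then show ?case by (metis poly_add)
  next
    case (mult h h')
    then show ?case by (metis poly_mult)
  qed
  then obtain p where p: "\<And>t. h (contract UNIV x t y) = poly p t" by blast
  obtain d where d: "d > 0" "\<And>y. dist y x < d \<Longrightarrow> h y = 0"
    using 0 unfolding eventually_nhds_metric by blast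
  define e where "e = d / (norm (y - x) + 1)"
  have e: "e > 0" using d(1) by (simp add: e_def add_nonneg_pos)
  have "poly p t = 0" if "t \<in> complex_of_real ` {0..e/2}" for t
  proof -
    obtain s where s: "t = of_real s" "0 \<le> s" "s < e" using \<open>t \<in> _\<close> e by auto
    have "contract UNIV x t y - x = s *\<^sub>R (y - x)" by (simp add: s contract_def vec_eq_iff) (simp add: scaleR_conv_of_real)
    then have "dist (contract UNIV x t y) x = s * norm (y - x)" using s by (simp add: dist_norm)
    also have "\<dots> \<le> s * (norm (y - x) + 1)" using s by (simp add: mult_left_mono)
    also have "\<dots> < e * (norm (y - x) + 1)" using s by (intro mult_strict_right_mono) (auto simp: add_nonneg_pos)
    also have "\<dots> = d" by (simp add: e_def add_nonneg_pos add_nonneg_eq_0_iff)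
    finally show ?thesis using d(2) p by metis
  qed
  then have "complex_of_real ` {0..e/2} \<subseteq> {t. poly p t = 0}" by blast
  moreover have "infinite (complex_of_real ` {0..e/2})"
    using e by (simp add: finite_image_iff inj_on_def)
  ultimately have "p = 0" using poly_roots_finite finite_subset by blast
  then show ?thesis using p[of 1] by simp
qed

section \<open>The Nullstellensatz\<close>

text \<open>
  Ideals of the ring of polynomial functions.
\<close>

definition pideal :: "('n::finite aff \<Rightarrow> complex) set \<Rightarrow> bool" where
  "pideal I \<longleftrightarrow> I \<subseteq> Collect polynomial_map \<and> (\<lambda>y. 0) \<in> I \<and> (\<forall>a\<in>I. \<forall>b\<in>I. (\<lambda>y. a y + b y) \<in> I) \<and>
     (\<forall>a\<in>I. \<forall>b. polynomial_map b \<longrightarrow> (\<lambda>y. b y * a y) \<in> I)"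

lemma pidealD:
  assumes "pideal I"
  shows "a \<in> I \<Longrightarrow> polynomial_map a" "(\<lambda>y. 0) \<in> I" "a \<in> I \<Longrightarrow> b \<in> I \<Longrightarrow> (\<lambda>y. a y + b y) \<in> I"
    "a \<in> I \<Longrightarrow> polynomial_map b \<Longrightarrow> (\<lambda>y. b y * a y) \<in> I"
  using assms unfolding pideal_def by auto

lemma pideal_diff: "pideal I \<Longrightarrow> a \<in> I \<Longrightarrow> b \<in> I \<Longrightarrow> (\<lambda>y. a y - b y) \<in> I"
  using pidealD(3)[OF _ _ pidealD(4)[OF _ _ polynomial_map_const[of "-1"]]] by fastforce

lemma pideal_sum: "pideal I \<Longrightarrow> finite A \<Longrightarrow> (\<And>a. a \<in> A \<Longrightarrow> h a \<in> I) \<Longrightarrow> (\<lambda>y. \<Sum>a\<in>A. h a y) \<in> I"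
  by (rotate_tac 1, induction A rule: finite_induct) (auto intro: pidealD)

lemma sum_fun_apply: "(\<Sum>a\<in>A. h a) y = (\<Sum>a\<in>A. h a y)"
  by (induction A rule: infinite_finite_induct) auto

text \<open>
  Each exponent is bounded separately; these finite sets exhaust all monomials, so that the ring of
  polynomial functions has countable dimension.
\<close>

definition monomials_upto :: "nat \<Rightarrow> ('n::finite aff \<Rightarrow> complex) set" where
  "monomials_upto d = (\<lambda>m y. \<Prod>i\<in>UNIV. (y $ i) ^ m i) ` {m. \<forall>i. m i \<le> d}"

lemma finite_monomials_upto: "finite (monomials_upto d :: ('n::finite aff \<Rightarrow> complex) set)"
proof -
  have "{m :: 'n \<Rightarrow> nat. \<forall>i. m i \<le> d} = PiE UNIV (\<lambda>_. {..d})" by (auto simp: PiE_UNIV_domain)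
  then have "finite {m :: 'n \<Rightarrow> nat. \<forall>i. m i \<le> d}" by (simp add: finite_PiE)
  then show ?thesis by (simp add: monomials_upto_def)
qed

interpretation fun_vs: vector_space "\<lambda>(a :: complex) (h :: 'n::finite aff \<Rightarrow> complex) y. a * h y"
  by unfold_locales (auto simp: fun_eq_iff algebra_simps)

lemma polynomial_map_span:
  assumes "polynomial_map h" shows "\<exists>d. h \<in> fun_vs.span (monomials_upto d)"
proof -
  obtain A a where h: "finite A" "h = (\<lambda>x. \<Sum>m\<in>A. a m * (\<Prod>i\<in>UNIV. (x $ i) ^ m i))"
    using assms unfolding polynomial_map_def by blast
  define d where "d = Max (insert 0 ((\<lambda>(m, i). m i) ` (A \<times> UNIV)))"
  have "m i \<le> d" if "m \<in> A" for m i
    unfolding d_def using that h(1) by (intro Max_ge) (auto intro!: image_eqI[where x = "(m, i)"])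
  then have "(\<lambda>y. \<Prod>i\<in>UNIV. (y $ i) ^ m i) \<in> fun_vs.span (monomials_upto d)" if "m \<in> A" for m
    using that by (intro fun_vs.span_base) (auto simp: monomials_upto_def)
  then have "(\<Sum>m\<in>A. (\<lambda>y. a m * (\<Prod>i\<in>UNIV. (y $ i) ^ m i))) \<in> fun_vs.span (monomials_upto d)"
    by (intro fun_vs.span_sum fun_vs.span_scale[where x = "\<lambda>y. \<Prod>i\<in>UNIV. (y $ i) ^ _ i"]) auto
  also have "(\<Sum>m\<in>A. (\<lambda>y. a m * (\<Prod>i\<in>UNIV. (y $ i) ^ m i))) = h"
    unfolding h(2) by (intro ext) (simp add: sum_fun_apply)
  finally show ?thesis by blast
qed

text \<open>
  The family may take the same value twice, in which case the dependence is trivial.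
\<close>

lemma family_dependent:
  fixes q :: "'l \<Rightarrow> 'n::finite aff \<Rightarrow> complex"
  assumes "finite L" "card L > card T" "finite T" "\<And>l. l \<in> L \<Longrightarrow> q l \<in> fun_vs.span T"
  shows "\<exists>c. (\<exists>l\<in>L. c l \<noteq> 0) \<and> (\<forall>y. (\<Sum>l\<in>L. c l * q l y) = 0)"
proof (cases "inj_on q L")
  case True
  have "\<not> fun_vs.independent (q ` L)"
    using fun_vs.independent_span_bound[OF assms(3), of "q ` L"] assms card_image[OF True] by auto
  then obtain u where u: "\<exists>v\<in>q ` L. u v \<noteq> 0" "(\<Sum>v\<in>q ` L. (\<lambda>y. u v * v y)) = 0"
    using fun_vs.dependent_finite[of "q ` L"] assms(1) by auto
  have "(\<Sum>l\<in>L. u (q l) * q l y) = 0" for y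
    using fun_cong[OF u(2), of y] by (simp add: sum.reindex[OF True] sum_fun_apply)
  with u(1) show ?thesis by (intro exI[of _ "\<lambda>l. u (q l)"]) auto
next
  case False
  then obtain l l' where l: "l \<in> L" "l' \<in> L" "l \<noteq> l'" "q l = q l'" by (auto simp: inj_on_def)
  have "(\<Sum>j\<in>L. (if j = l then 1 else if j = l' then -1 else 0) * q j y) = (\<Sum>j\<in>{l, l'}. (if j = l then 1 else if j = l' then -1 else 0) * q j y)" for y
    using assms(1) l by (intro sum.mono_neutral_right) auto
  then show ?thesis using l by (intro exI[of _ "\<lambda>j. if j = l then 1 else if j = l' then -1 else 0"]) auto
qed

text \<open>
  The usual argument: an ideal that is maximal among those containing no power of \<open>h\<close> is prime, since
  adjoining any \<open>g\<close> outside of it produces a power of \<open>h\<close>.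
\<close>

lemma maximal_avoiding_prime:
  assumes M: "pideal M" and avoid: "\<And>k. (\<lambda>y. h y ^ k) \<notin> M" and h: "polynomial_map h"
    and max: "\<And>X. pideal X \<Longrightarrow> M \<subseteq> X \<Longrightarrow> (\<And>k. (\<lambda>y. h y ^ k) \<notin> X) \<Longrightarrow> X = M"
  shows "polynomial_map g \<Longrightarrow> g \<notin> M \<Longrightarrow> \<exists>k q m. polynomial_map q \<and> m \<in> M \<and> (\<forall>y. h y ^ k = m y + q y * g y)"
    and "polynomial_map a \<Longrightarrow> polynomial_map b \<Longrightarrow> (\<lambda>y. a y * b y) \<in> M \<Longrightarrow> a \<in> M \<or> b \<in> M"
proof -
  show 1: "\<exists>k q m. polynomial_map q \<and> m \<in> M \<and> (\<forall>y. h y ^ k = m y + q y * g y)" if g: "polynomial_map g" "g \<notin> M" for g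
  proof (rule ccontr)
    assume *: "\<not> ?thesis"
    define X where "X = {u. \<exists>q m. polynomial_map q \<and> m \<in> M \<and> u = (\<lambda>y. m y + q y * g y)}"
    have "pideal X" unfolding pideal_def
    proof (intro conjI ballI allI impI)
      show "X \<subseteq> Collect polynomial_map"
      proof
        fix u assume "u \<in> X"
        then obtain q m where "polynomial_map q" "m \<in> M" "u = (\<lambda>y. m y + q y * g y)" unfolding X_def by blast
        then show "u \<in> Collect polynomial_map"
          using polynomial_map_add[OF pidealD(1)[OF M] polynomial_map_mult[OF _ g(1)]] by simp
      qed
      show "(\<lambda>y. 0) \<in> X" unfolding X_def using pidealD(2)[OF M]
        by (auto intro!: exI[of _ "\<lambda>y. 0"] polynomial_map_intros)
    next
      fix a b assume "a \<in> X" "b \<in> X"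
      then obtain q m q' m' where q: "polynomial_map q" "m \<in> M" "a = (\<lambda>y. m y + q y * g y)"
         "polynomial_map q'" "m' \<in> M" "b = (\<lambda>y. m' y + q' y * g y)" unfolding X_def by blast
      then show "(\<lambda>y. a y + b y) \<in> X" unfolding X_def
        by (intro CollectI exI[of _ "\<lambda>y. q y + q' y"] exI[of _ "\<lambda>y. m y + m' y"])
           (auto intro!: polynomial_map_intros pidealD(3)[OF M] simp: algebra_simps)
    next
      fix a b :: "'a aff \<Rightarrow> complex" assume "a \<in> X" and b: "polynomial_map b"
      then obtain q m where q: "polynomial_map q" "m \<in> M" "a = (\<lambda>y. m y + q y * g y)" unfolding X_def by blast
      then show "(\<lambda>y. b y * a y) \<in> X" unfolding X_def
        by (intro CollectI exI[of _ "\<lambda>y. b y * q y"] exI[of _ "\<lambda>y. b y * m y"])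
           (auto intro!: polynomial_map_intros pidealD(4)[OF M] b simp: algebra_simps)
    qed
    moreover have "M \<subseteq> X"
    proof
      fix u assume "u \<in> M"
      then show "u \<in> X" unfolding X_def
        by (intro CollectI exI[of _ "\<lambda>y. 0"] exI[of _ u] conjI polynomial_map_const) auto
    qed
    moreover have "(\<lambda>y. h y ^ k) \<notin> X" for k
      using * unfolding X_def by (auto simp: fun_eq_iff)
    ultimately have "X = M" by (rule max)
    moreover have "g \<in> X" unfolding X_def using pidealD(2)[OF M]
      by (intro CollectI exI[of _ "\<lambda>y. 1"] exI[of _ "\<lambda>y. 0"]) (auto intro: polynomial_map_intros)
    ultimately show False using g by simp
  qed
  show "a \<in> M \<or> b \<in> M" if ab: "polynomial_map a" "polynomial_map b" "(\<lambda>y. a y * b y) \<in> M"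
  proof (rule ccontr)
    assume no: "\<not> (a \<in> M \<or> b \<in> M)"
    from 1[of a] ab no obtain k q m where q: "polynomial_map q" "m \<in> M" "\<And>y. h y ^ k = m y + q y * a y"
      by blast
    from 1[of b] ab no obtain k' q' m' where q': "polynomial_map q'" "m' \<in> M" "\<And>y. h y ^ k' = m' y + q' y * b y"
      by blast
    have "(\<lambda>y. h y ^ (k + k')) = (\<lambda>y. (m' y + q' y * b y) * m y + ((q y * a y) * m' y + (q y * q' y) * (a y * b y)))"
      by (intro ext) (simp add: power_add q(3) q'(3) algebra_simps)
    also have "\<dots> \<in> M"
      by (intro pidealD(3)[OF M] pidealD(4)[OF M] q q' ab polynomial_map_intros pidealD(1)[OF M])
    finally show False using avoid by blast
  qed
qed

lemma prime_linear_factor: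
  assumes M: "pideal M" and prime: "\<And>a b. polynomial_map a \<Longrightarrow> polynomial_map b \<Longrightarrow> (\<lambda>y. a y * b y) \<in> M \<Longrightarrow> a \<in> M \<or> b \<in> M"
    and one: "(\<lambda>y. 1) \<notin> M" and g: "polynomial_map g"
  shows "R \<noteq> 0 \<Longrightarrow> (\<lambda>y. poly R (g y)) \<in> M \<Longrightarrow> \<exists>z. (\<lambda>y. g y - z) \<in> M"
proof (induction "Polynomial.degree R" arbitrary: R)
  case 0
  then obtain a where a: "R = [:a:]" "a \<noteq> 0" by (metis degree_0_id pCons_0_0)
  have "(\<lambda>y. inverse a * poly R (g y)) \<in> M" by (rule pidealD(4)[OF M 0(3) polynomial_map_const])
  then show ?case using one a by simp
next
  case (Suc k)
  obtain z where "poly R z = 0" using Fundamental_Theorem_Algebra.fundamental_theorem_of_algebra[of R] Suc.hyps(2) by (metis constant_degree nat.distinct(1))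
  then obtain S where S: "R = [:-z, 1:] * S" using poly_eq_0_iff_dvd by (metis dvdE)
  have "S \<noteq> 0" using S Suc.prems(1) by auto
  then have "Polynomial.degree R = Polynomial.degree [:-z, 1:] + Polynomial.degree S"
    unfolding S by (intro degree_mult_eq) auto
  then have d: "k = Polynomial.degree S" using Suc.hyps(2) by simp
  have "(\<lambda>y. (g y - z) * poly S (g y)) \<in> M" using Suc.prems(2) by (simp add: S algebra_simps)
  then have "(\<lambda>y. g y - z) \<in> M \<or> (\<lambda>y. poly S (g y)) \<in> M"
    by (intro prime polynomial_map_intros polynomial_map_poly g)
  then show ?case using Suc.hyps(1)[OF d \<open>S \<noteq> 0\<close>] by blast
qed

lemma infinite_fibre:
  fixes F :: "complex \<Rightarrow> 'b::countable"
  shows "\<exists>b. infinite {z. F z = b}"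
proof (rule ccontr)
  assume "\<not> ?thesis"
  then have "countable (\<Union>b. {z. F z = b})" by (intro countable_UN) (auto intro: countable_finite)
  moreover have "(\<Union>b. {z. F z = b}) = UNIV" by auto
  ultimately show False using uncountable_UNIV_complex by simp
qed

text \<open>
  The field \<open>\<complex>\<close> is uncountable, while polynomial functions have countable dimension.  If no \<open>g - z\<close> lay
  in \<open>M\<close>, then \<open>h\<^sup>k \<equiv> q\<^sub>z (g - z)\<close> modulo \<open>M\<close> for every \<open>z\<close>, with infinitely many \<open>z\<close> sharing \<open>k\<close> and a
  bound for the degree of \<open>q\<^sub>z\<close>.  A linear dependence among finitely many of these \<open>q\<^sub>z\<close>, multiplied with
  the product of the factors \<open>g - z\<close>, puts \<open>h\<^sup>k R(g)\<close> into the prime ideal \<open>M\<close> for a polynomial \<open>R \<noteq> 0\<close>.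
\<close>

lemma maximal_avoiding_linear:
  assumes M: "pideal M" and avoid: "\<And>k. (\<lambda>y. h y ^ k) \<notin> M" and h: "polynomial_map h"
    and max: "\<And>X. pideal X \<Longrightarrow> M \<subseteq> X \<Longrightarrow> (\<And>k. (\<lambda>y. h y ^ k) \<notin> X) \<Longrightarrow> X = M"
    and g: "polynomial_map g"
  shows "\<exists>z. (\<lambda>y. g y - z) \<in> M"
proof (rule ccontr)
  assume no: "\<nexists>z. (\<lambda>y. g y - z) \<in> M"
  note prime = maximal_avoiding_prime(2)[OF M avoid h max]
  have "\<exists>k q m d. polynomial_map q \<and> m \<in> M \<and> (\<forall>y. h y ^ k = m y + q y * (g y - z)) \<and> q \<in> fun_vs.span (monomials_upto d)" for z
  proof -
    have "polynomial_map (\<lambda>y. g y - z)" by (intro polynomial_map_intros g)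
    from maximal_avoiding_prime(1)[OF M avoid h max this] no obtain k q m where
      "polynomial_map q" "m \<in> M" "\<forall>y. h y ^ k = m y + q y * (g y - z)" by blast
    then show ?thesis using polynomial_map_span by blast
  qed
  then obtain k q m d where kqm: "\<And>z. polynomial_map (q z)" "\<And>z. m z \<in> M"
    "\<And>z y. h y ^ k z = m z y + q z y * (g y - z)" "\<And>z. q z \<in> fun_vs.span (monomials_upto (d z))" by metis
  \<comment> \<open>uncountably many \<open>z\<close>, but only countably many pairs of an exponent and a degree bound\<close>
  obtain b where "infinite {z. (k z, d z) = b}" using infinite_fibre[of "\<lambda>z. (k z, d z)"] by blast
  then obtain L where L: "finite L" "card L = Suc (card (monomials_upto (snd b) :: ('a aff \<Rightarrow> complex) set))" "L \<subseteq> {z. (k z, d z) = b}"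
    using infinite_arbitrarily_large by blast
  define K where "K = fst b"
  have k: "k z = K" and d: "d z = snd b" if "z \<in> L" for z using that L(3) by (auto simp: K_def)
  have "\<exists>c. (\<exists>l\<in>L. c l \<noteq> 0) \<and> (\<forall>y. (\<Sum>l\<in>L. c l * q l y) = 0)"
    by (rule family_dependent[OF L(1) _ finite_monomials_upto[of "snd b"]]) (use L(2) kqm(4) d in \<open>auto, metis\<close>)
  then obtain c l0 where c: "l0 \<in> L" "c l0 \<noteq> 0" "\<And>y. (\<Sum>l\<in>L. c l * q l y) = 0" by blast
  \<comment> \<open>the dependence \<open>\<Sum> c\<^sub>l q\<^sub>l = 0\<close> with the denominators \<open>g - l\<close> cleared; \<open>R\<close> does not vanish at \<open>l0\<close>\<close>
  define R where "R = (\<Sum>l\<in>L. Polynomial.smult (c l) (\<Prod>u\<in>L - {l}. [:- u, 1:]))"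
  have pR: "poly R t = (\<Sum>l\<in>L. c l * (\<Prod>u\<in>L - {l}. t - u))" for t
    by (simp add: R_def poly_sum poly_prod)
  have "poly R l0 = c l0 * (\<Prod>u\<in>L - {l0}. l0 - u)"
    unfolding pR using L(1) c(1) by (subst sum.remove[OF L(1) c(1)]) (auto intro!: sum.neutral prod_zero)
  then have R0: "R \<noteq> 0" using c L(1) by (auto simp: prod_zero_iff)
  have "(\<lambda>y. h y ^ K * poly R (g y)) = (\<lambda>y. \<Sum>l\<in>L. (c l * (\<Prod>u\<in>L - {l}. g y - u)) * m l y)"
  proof
    fix y
    have "h y ^ K * poly R (g y) = (\<Sum>l\<in>L. c l * (\<Prod>u\<in>L - {l}. g y - u) * h y ^ K)"
      by (simp add: pR sum_distrib_left mult_ac)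
    also have "\<dots> = (\<Sum>l\<in>L. (c l * (\<Prod>u\<in>L - {l}. g y - u)) * m l y + (\<Prod>u\<in>L. g y - u) * (c l * q l y))"
    proof (intro sum.cong refl)
      fix l assume l: "l \<in> L"
      have A: "h y ^ K = m l y + q l y * (g y - l)" using kqm(3)[of y l] k[OF l] by simp
      have B: "(\<Prod>u\<in>L. g y - u) = (g y - l) * (\<Prod>u\<in>L - {l}. g y - u)" by (rule prod.remove[OF L(1) l])
      show "c l * (\<Prod>u\<in>L - {l}. g y - u) * h y ^ K = (c l * (\<Prod>u\<in>L - {l}. g y - u)) * m l y + (\<Prod>u\<in>L. g y - u) * (c l * q l y)"
        unfolding A B by (simp add: algebra_simps)
    qed
    also have "\<dots> = (\<Sum>l\<in>L. (c l * (\<Prod>u\<in>L - {l}. g y - u)) * m l y)"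
      using c(3)[of y] by (simp add: sum.distrib sum_distrib_left[symmetric])
    finally show "h y ^ K * poly R (g y) = (\<Sum>l\<in>L. (c l * (\<Prod>u\<in>L - {l}. g y - u)) * m l y)" .
  qed
  also have "\<dots> \<in> M"
    by (intro pideal_sum[OF M L(1)] pidealD(4)[OF M] kqm polynomial_map_intros g) (use L(1) in auto)
  finally have "(\<lambda>y. h y ^ K) \<in> M \<or> (\<lambda>y. poly R (g y)) \<in> M"
    by (intro prime polynomial_map_power polynomial_map_poly g h)
  then have "(\<lambda>y. poly R (g y)) \<in> M" using avoid by blast
  moreover have "(\<lambda>y. 1) \<notin> M" using avoid[of 0] by simp
  ultimately show False using prime_linear_factor[OF M prime _ g R0] no by blast
qed

text \<open>
  Let \<open>M\<close> be maximal among the ideals that contain \<open>I\<close> and no power of \<open>h\<close>.  Each coordinate function is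
  congruent to a constant modulo \<open>M\<close>, and these constants are the coordinates of a point \<open>x\<close> with
  \<open>a \<equiv> a x\<close> modulo \<open>M\<close> for all \<open>a\<close>.  As \<open>1 \<notin> M\<close>, every element of \<open>M\<close> vanishes at \<open>x\<close>; hence \<open>h x = 0\<close>
  and \<open>h \<in> M\<close>, a contradiction.
\<close>

theorem nullstellensatz:
  assumes I: "pideal I" and h: "polynomial_map h" and van: "\<And>y. (\<And>a. a \<in> I \<Longrightarrow> a y = 0) \<Longrightarrow> h y = 0"
  shows "\<exists>k. (\<lambda>y. h y ^ k) \<in> I"
proof (rule ccontr)
  assume no: "\<nexists>k. (\<lambda>y. h y ^ k) \<in> I"
  define A where "A = {M. pideal M \<and> I \<subseteq> M \<and> (\<forall>k. (\<lambda>y. h y ^ k) \<notin> M)}"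
  have "\<exists>M\<in>A. \<forall>X\<in>A. M \<subseteq> X \<longrightarrow> X = M"
  proof (rule subset_Zorn_nonempty)
    show "A \<noteq> {}" using I no by (auto simp: A_def)
    fix C assume C: "C \<noteq> {}" "subset.chain A C"
    then have CA: "C \<subseteq> A" and lin: "\<And>X Y. X \<in> C \<Longrightarrow> Y \<in> C \<Longrightarrow> X \<subseteq> Y \<or> Y \<subseteq> X"
      by (auto simp: subset.chain_def)
    have pid: "pideal X" if "X \<in> C" for X using that CA by (auto simp: A_def)
    have "pideal (\<Union>C)" unfolding pideal_def
    proof (intro conjI ballI allI impI)
      show "\<Union>C \<subseteq> Collect polynomial_map" using pid pidealD(1) by blast
      show "(\<lambda>y. 0) \<in> \<Union>C" using C(1) pid pidealD(2) by blast
    next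
      fix a b assume "a \<in> \<Union>C" "b \<in> \<Union>C"
      then obtain X where "X \<in> C" "a \<in> X" "b \<in> X" using lin by blast
      then show "(\<lambda>y. a y + b y) \<in> \<Union>C" using pid pidealD(3) by blast
    next
      fix a b :: "'a aff \<Rightarrow> complex" assume "a \<in> \<Union>C" "polynomial_map b"
      then show "(\<lambda>y. b y * a y) \<in> \<Union>C" using pid pidealD(4) by blast
    qed
    then show "\<Union>C \<in> A" using C(1) CA by (auto simp: A_def)
  qed
  then obtain M where "M \<in> A" and max: "\<And>X. X \<in> A \<Longrightarrow> M \<subseteq> X \<Longrightarrow> X = M" by blast
  then have M: "pideal M" "I \<subseteq> M" "\<And>k. (\<lambda>y. h y ^ k) \<notin> M" by (auto simp: A_def)
  have max': "X = M" if "pideal X" "M \<subseteq> X" "\<And>k. (\<lambda>y. h y ^ k) \<notin> X" for X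
    using max[of X] that M(2) by (auto simp: A_def)
  have "\<exists>z. (\<lambda>y. y $ i - z) \<in> M" for i
    by (rule maximal_avoiding_linear[OF M(1) M(3) h max' polynomial_map_coord])
  then obtain z where z: "\<And>i. (\<lambda>y. y $ i - z i) \<in> M" by metis
  define x where "x = (\<chi> i. z i)"
  have res: "(\<lambda>y. a y - a x) \<in> M" if "polynomial_map a" for a using that
  proof (induction a rule: polynomial_map_induct)
    case (const a) then show ?case using pidealD(2)[OF M(1)] by simp
  next
    case (coord j) then show ?case using z[of j] by (simp add: x_def)
  next
    case (add h h')
    then show ?case using pidealD(3)[OF M(1) add(3,4)] by (simp add: algebra_simps)
  next
    case (mult h h')
    have "(\<lambda>y. h y * h' y - h x * h' x) = (\<lambda>y. h' y * (h y - h x) + h x * (h' y - h' x))"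
      by (simp add: algebra_simps)
    also have "\<dots> \<in> M" by (intro pidealD(3,4)[OF M(1)] mult polynomial_map_const)
    finally show ?case .
  qed
  have "a x = 0" if "a \<in> M" for a
  proof (rule ccontr)
    assume "a x \<noteq> 0"
    have "(\<lambda>y. a y - (a y - a x)) \<in> M"
      by (rule pideal_diff[OF M(1) that res[OF pidealD(1)[OF M(1) that]]])
    from pidealD(4)[OF M(1) this polynomial_map_const[of "inverse (a x)"]]
    show False using M(3)[of 0] \<open>a x \<noteq> 0\<close> by simp
  qed
  then have "h x = 0" using van M(2) by blast
  then have "h \<in> M" using res[OF h] by simp
  then show False using M(3)[of 1] by simp
qed

section \<open>The Jacobian ideal\<close>

definition jacobian_ideal :: "('n::finite aff \<Rightarrow> complex) \<Rightarrow> ('n aff \<Rightarrow> complex) set" where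
  "jacobian_ideal f = {h. \<exists>a. (\<forall>i. polynomial_map (a i)) \<and> h = (\<lambda>y. \<Sum>i\<in>UNIV. a i y * partial i f y)}"

lemma jacobian_idealI: "(\<And>i. polynomial_map (a i)) \<Longrightarrow> (\<And>y. h y = (\<Sum>i\<in>UNIV. a i y * partial i f y)) \<Longrightarrow> h \<in> jacobian_ideal f"
  unfolding jacobian_ideal_def by blast

lemma partial_in_jacobian_ideal: "partial i f \<in> jacobian_ideal f"
  by (rule jacobian_idealI[of "\<lambda>j y. if j = i then 1 else 0"])
     (auto simp: polynomial_map_const if_distrib[of "\<lambda>c. c * _"] cong: if_cong)

lemma pideal_jacobian_ideal:
  fixes f :: "'n::finite aff \<Rightarrow> complex"
  assumes f: "polynomial_map f" shows "pideal (jacobian_ideal f)"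
  unfolding pideal_def
proof (intro conjI ballI allI impI)
  show "jacobian_ideal f \<subseteq> Collect polynomial_map"
    unfolding jacobian_ideal_def using f by (auto intro!: polynomial_map_intros)
  show "(\<lambda>y. 0) \<in> jacobian_ideal f"
    by (rule jacobian_idealI[of "\<lambda>i y. 0"]) (auto intro: polynomial_map_intros)
next
  fix a b assume "a \<in> jacobian_ideal f" "b \<in> jacobian_ideal f"
  then obtain a' b' where "\<And>i. polynomial_map (a' i)" "a = (\<lambda>y. \<Sum>i\<in>UNIV. a' i y * partial i f y)"
    "\<And>i. polynomial_map (b' i)" "b = (\<lambda>y. \<Sum>i\<in>UNIV. b' i y * partial i f y)"
    unfolding jacobian_ideal_def by blast
  then show "(\<lambda>y. a y + b y) \<in> jacobian_ideal f"
    by (intro jacobian_idealI[of "\<lambda>i y. a' i y + b' i y"]) (auto intro!: polynomial_map_add simp: algebra_simps sum.distrib)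
next
  fix a b :: "'n aff \<Rightarrow> complex" assume "a \<in> jacobian_ideal f" and b: "polynomial_map b"
  then obtain a' where "\<And>i. polynomial_map (a' i)" "a = (\<lambda>y. \<Sum>i\<in>UNIV. a' i y * partial i f y)"
    unfolding jacobian_ideal_def by blast
  then show "(\<lambda>y. b y * a y) \<in> jacobian_ideal f"
    by (intro jacobian_idealI[of "\<lambda>i y. b y * a' i y"]) (auto intro!: polynomial_map_mult b simp: algebra_simps sum_distrib_left)
qed

lemma jacobian_zeros: "(\<And>a. a \<in> jacobian_ideal f \<Longrightarrow> a y = 0) \<Longrightarrow> y \<in> critical_points f"
  by (simp add: critical_points_def partial_in_jacobian_ideal)

text \<open>
  The factor \<open>e\<close> removes the other critical points: it vanishes at all of them but not at \<open>x\<close>.  Then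
  \<open>e (y $ i - x $ i)\<close> vanishes at all critical points, and the Nullstellensatz applies.
\<close>

lemma jacobian_primary:
  fixes f :: "'n::finite aff \<Rightarrow> complex"
  assumes f: "polynomial_map f" and fin: "finite (critical_points f)"
  shows "\<exists>e N. polynomial_map e \<and> e x \<noteq> 0 \<and> (\<forall>i. (\<lambda>y. e y * (y $ i - x $ i) ^ N) \<in> jacobian_ideal f)"
proof -
  note J = pideal_jacobian_ideal[OF f]
  have "\<exists>i. z $ i \<noteq> x $ i" if "z \<noteq> x" for z :: "'n aff" using that by (simp add: vec_eq_iff)
  then obtain s where s: "\<And>z. z \<noteq> x \<Longrightarrow> z $ s z \<noteq> x $ s z" by metis
  \<comment> \<open>\<open>s z\<close> is a coordinate that separates \<open>z\<close> from \<open>x\<close>\<close>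
  define e0 where "e0 y = (\<Prod>z\<in>critical_points f - {x}. y $ s z - z $ s z)" for y
  have e0: "polynomial_map e0" unfolding e0_def[abs_def]
    by (intro polynomial_map_intros) (use fin in auto)
  have ex: "e0 x \<noteq> 0"
  proof -
    have "x $ s z - z $ s z \<noteq> 0" if "z \<in> critical_points f - {x}" for z
    proof
      assume "x $ s z - z $ s z = 0"
      then have "z $ s z = x $ s z" by simp
      with s[of z] that show False by blast
    qed
    then show ?thesis unfolding e0_def using fin by (simp add: prod_zero_iff)
  qed
  have "\<exists>k. (\<lambda>y. (e0 y * (y $ i - x $ i)) ^ k) \<in> jacobian_ideal f" for i
  proof (rule nullstellensatz[OF J])
    show "polynomial_map (\<lambda>y. e0 y * (y $ i - x $ i))" by (intro polynomial_map_intros e0)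
    fix y assume "\<And>a. a \<in> jacobian_ideal f \<Longrightarrow> a y = 0"
    then have "y \<in> critical_points f" by (rule jacobian_zeros)
    then show "e0 y * (y $ i - x $ i) = 0" using fin by (cases "y = x") (auto simp: e0_def)
  qed
  then obtain k where k: "\<And>i. (\<lambda>y. (e0 y * (y $ i - x $ i)) ^ k i) \<in> jacobian_ideal f" by metis
  define N where "N = (\<Sum>i\<in>UNIV. k i)"
  have "(\<lambda>y. e0 y ^ N * (y $ i - x $ i) ^ N) \<in> jacobian_ideal f" for i
  proof -
    have "k i \<le> N" unfolding N_def by (rule member_le_sum) auto
    then have eq: "e0 y ^ N * (y $ i - x $ i) ^ N = (e0 y * (y $ i - x $ i)) ^ (N - k i) * (e0 y * (y $ i - x $ i)) ^ k i" for y
      by (simp add: power_mult_distrib[symmetric] power_add[symmetric])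
    show ?thesis unfolding eq by (intro pidealD(4)[OF J k] polynomial_map_intros e0)
  qed
  then show ?thesis using ex e0 by (intro exI[of _ "\<lambda>y. e0 y ^ N"] exI[of _ N]) (auto intro: polynomial_map_power)
qed

lemma holomorphic_near_inverse:
  assumes "holomorphic_near x u" "u x \<noteq> 0" shows "holomorphic_near x (\<lambda>y. inverse (u y))"
    and "eventually (\<lambda>y. u y \<noteq> 0) (nhds x)"
proof -
  obtain r where r: "r > 0" "holo_on (ball x r) u" using assms(1) holomorphic_near_iff by blast
  then have "isCont u x" using holo_on_continuous[OF r(2)] by (simp add: continuous_on_eq_continuous_at)
  then show ev: "eventually (\<lambda>y. u y \<noteq> 0) (nhds x)"
    using assms(2) unfolding eventually_nhds_conv_at isCont_def by (auto intro: tendsto_imp_eventually_ne)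
  then obtain d where d: "d > 0" "\<And>y. y \<in> ball x d \<Longrightarrow> u y \<noteq> 0"
    unfolding eventually_nhds_metric by (auto simp: dist_commute)
  have "holo_on (ball x (min r d)) (\<lambda>y. inverse (u y))"
    by (rule holo_on_comp[where T = "- {0}", OF holo_on_ball_mono[OF r(2)]])
       (use d in \<open>auto intro!: holomorphic_intros\<close>)
  then show "holomorphic_near x (\<lambda>y. inverse (u y))"
    unfolding holomorphic_near_iff using r d by (intro exI[of _ "min r d"]) auto
qed

lemma isolated_at_polynomial:
  fixes f :: "'n::finite aff \<Rightarrow> complex"
  assumes f: "polynomial_map f" and fin: "finite (critical_points f)"
  shows "isolated_at f x"
proof -
  obtain e N where e: "polynomial_map e" "e x \<noteq> 0" "\<And>i. (\<lambda>y. e y * (y $ i - x $ i) ^ N) \<in> jacobian_ideal f"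
    using jacobian_primary[OF assms] by blast
  note inv = holomorphic_near_inverse[OF polynomial_map_near[OF e(1)] e(2)]
  have "\<exists>h N. (\<forall>j. holomorphic_near x (h j)) \<and>
       eventually (\<lambda>y. (y $ i - x $ i) ^ N = (\<Sum>j\<in>UNIV. h j y * partial j f y)) (nhds x)" for i
  proof -
    obtain a where a: "\<And>j. polynomial_map (a j)" "(\<lambda>y. e y * (y $ i - x $ i) ^ N) = (\<lambda>y. \<Sum>j\<in>UNIV. a j y * partial j f y)"
      using e(3)[of i] unfolding jacobian_ideal_def by blast
    have "eventually (\<lambda>y. (y $ i - x $ i) ^ N = (\<Sum>j\<in>UNIV. (inverse (e y) * a j y) * partial j f y)) (nhds x)"
      using inv(2)
    proof eventually_elim
      case (elim y)
      have "(y $ i - x $ i) ^ N = inverse (e y) * (e y * (y $ i - x $ i) ^ N)" using elim by simp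
      also have "e y * (y $ i - x $ i) ^ N = (\<Sum>j\<in>UNIV. a j y * partial j f y)" by (rule fun_cong[OF a(2)])
      finally show ?case by (simp only: sum_distrib_left mult.assoc)
    qed
    then show ?thesis
      by (intro exI[of _ "\<lambda>j y. inverse (e y) * a j y"] exI[of _ N]) (use holomorphic_near_mult[OF inv(1) polynomial_map_near[OF a(1)]] in auto)
  qed
  then show ?thesis unfolding isolated_at_def using polynomial_map_near[OF f] by blast
qed

section \<open>From germs to polynomials in the Jacobian ideal\<close>

lemma sum_insert_remove_single:
  fixes g :: "'n::finite \<Rightarrow> complex"
  shows "i \<in> K \<Longrightarrow> (\<Sum>k\<in>K. g k) = g i + (\<Sum>k\<in>K - {i}. g k)"
  by (rule sum.remove) auto

text \<open>
  Modulo powers of the coordinate functions every germ is a polynomial.  The induction treats all slices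
  and exponents at once: restrict to the hyperplane of one coordinate, divide the difference by this
  coordinate, and continue with the quotient and an exponent lowered by one.
\<close>

lemma analytic_division:
  fixes x :: "'n::finite aff"
  shows "holomorphic_near x a \<Longrightarrow> \<exists>P q. polynomial_map P \<and> (\<forall>k. holomorphic_near x (q k)) \<and>
    eventually (\<lambda>y. y \<in> slice (- K) x \<longrightarrow> a y = P y + (\<Sum>k\<in>K. (y $ k - x $ k) ^ v k * q k y)) (nhds x)"
proof (induction "card K + (\<Sum>k\<in>K. v k)" arbitrary: K v a rule: less_induct)
  case less
  consider "K = {}" | k where "k \<in> K" "v k = 0" | i where "i \<in> K" "\<forall>k\<in>K. v k \<noteq> 0" by blast
  then show ?case
  proof cases
    case 1
    then have "slice (- K) x = {x}" by (auto simp: slice_def vec_eq_iff)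
    then show ?thesis using 1
      by (intro exI[of _ "\<lambda>y. a x"] exI[of _ "\<lambda>k y. 0"]) (auto intro: polynomial_map_const holomorphic_near_const)
  next
    case (2 k)
    have "(\<Sum>j\<in>K. (y $ j - x $ j) ^ v j * (if j = k then a else (\<lambda>y. 0)) y) = (\<Sum>j\<in>K. if j = k then a y else 0)" for y
      using 2 by (intro sum.cong) auto
    then have "(\<Sum>j\<in>K. (y $ j - x $ j) ^ v j * (if j = k then a else (\<lambda>y. 0)) y) = a y" for y
      using 2 by simp
    then show ?thesis using less.prems
      by (intro exI[of _ "\<lambda>y. 0"] exI[of _ "\<lambda>j. if j = k then a else (\<lambda>y. 0)"])
         (auto intro: polynomial_map_const holomorphic_near_const)
  next
    case (3 i)
    have "card (K - {i}) + (\<Sum>k\<in>K - {i}. v k) < card K + (\<Sum>k\<in>K. v k)"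
      using 3 by (intro add_less_le_mono psubset_card_mono sum_mono2) auto
    from less.hyps[OF this less.prems] obtain P q where P: "polynomial_map P" "\<And>k. holomorphic_near x (q k)"
      "eventually (\<lambda>y. y \<in> slice (- (K - {i})) x \<longrightarrow> a y = P y + (\<Sum>k\<in>K - {i}. (y $ k - x $ k) ^ v k * q k y)) (nhds x)"
      by blast
    define g where "g y = a y - P y - (\<Sum>k\<in>K - {i}. (y $ k - x $ k) ^ v k * q k y)" for y
    have g: "holomorphic_near x g" unfolding g_def[abs_def]
      by (intro holomorphic_near_intros less.prems polynomial_map_near P) auto
    have ins: "- (K - {i}) = insert i (- K)" using 3 by auto
    have gd: "eventually (\<lambda>y. y \<in> slice (- K) x \<longrightarrow> g y = (y $ i - x $ i) * ray_mean {i} 0 x (partial i g) y) (nhds x)"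
      by (rule hadamard_division[OF g], rule eventually_mono[OF P(3)]) (simp add: ins g_def)
    define v' where "v' = v(i := v i - 1)"
    have "(\<Sum>k\<in>K. v' k) < (\<Sum>k\<in>K. v k)"
      using 3 by (intro sum_strict_mono_ex1) (auto simp: v'_def)
    then have lt: "card K + (\<Sum>k\<in>K. v' k) < card K + (\<Sum>k\<in>K. v k)" by simp
    have "holomorphic_near x (ray_mean {i} 0 x (partial i g))"
      by (intro holomorphic_near_ray_mean holomorphic_near_partial g)
    from less.hyps[OF lt this] obtain P' q' where P': "polynomial_map P'" "\<And>k. holomorphic_near x (q' k)"
      "eventually (\<lambda>y. y \<in> slice (- K) x \<longrightarrow> ray_mean {i} 0 x (partial i g) y = P' y + (\<Sum>k\<in>K. (y $ k - x $ k) ^ v' k * q' k y)) (nhds x)"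
      by blast
    define q'' where "q'' k = (\<lambda>y. if k = i then q' i y else q k y + (y $ i - x $ i) * q' k y)" for k
    have "holomorphic_near x (q'' k)" for k
      unfolding q''_def by (cases "k = i") (auto intro!: holomorphic_near_intros P P')
    moreover have "polynomial_map (\<lambda>y. P y + (y $ i - x $ i) * P' y)" by (intro polynomial_map_intros P P')
    moreover have "eventually (\<lambda>y. y \<in> slice (- K) x \<longrightarrow> a y = P y + (y $ i - x $ i) * P' y + (\<Sum>k\<in>K. (y $ k - x $ k) ^ v k * q'' k y)) (nhds x)"
      using gd P'(3)
    proof eventually_elim
      case (elim y)
      show ?case
      proof
        assume y: "y \<in> slice (- K) x"
        have vi: "(y $ i - x $ i) * (y $ i - x $ i) ^ v' i = (y $ i - x $ i) ^ v i"
          using 3 by (cases "v i") (auto simp: v'_def)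
        have "(\<Sum>k\<in>K. (y $ k - x $ k) ^ v k * q'' k y) = (y $ i - x $ i) ^ v i * q' i y +
           (\<Sum>k\<in>K - {i}. (y $ k - x $ k) ^ v k * q k y + (y $ i - x $ i) * ((y $ k - x $ k) ^ v' k * q' k y))"
          unfolding sum_insert_remove_single[OF 3(1)] by (auto simp: q''_def v'_def algebra_simps intro!: sum.cong)
        also have "\<dots> = (\<Sum>k\<in>K - {i}. (y $ k - x $ k) ^ v k * q k y) + (y $ i - x $ i) * (\<Sum>k\<in>K. (y $ k - x $ k) ^ v' k * q' k y)"
          unfolding sum_insert_remove_single[OF 3(1)] vi[symmetric] by (simp only: sum.distrib sum_distrib_left distrib_left mult_ac add_ac)
        finally have 1: "(\<Sum>k\<in>K. (y $ k - x $ k) ^ v k * q'' k y) =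
          (\<Sum>k\<in>K - {i}. (y $ k - x $ k) ^ v k * q k y) + (y $ i - x $ i) * (\<Sum>k\<in>K. (y $ k - x $ k) ^ v' k * q' k y)" .
        have "a y = g y + P y + (\<Sum>k\<in>K - {i}. (y $ k - x $ k) ^ v k * q k y)" by (simp add: g_def)
        also have "g y = (y $ i - x $ i) * (P' y + (\<Sum>k\<in>K. (y $ k - x $ k) ^ v' k * q' k y))" using elim y by simp
        finally show "a y = P y + (y $ i - x $ i) * P' y + (\<Sum>k\<in>K. (y $ k - x $ k) ^ v k * q'' k y)"
          unfolding 1 by (simp only: distrib_left add_ac)
      qed
    qed
    ultimately show ?thesis by blast
  qed
qed

lemma holomorphic_near_contract:
  assumes "holomorphic_near x q" shows "holomorphic_near x (\<lambda>y. q (contract S x 0 y))"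
proof -
  obtain r where r: "r > 0" "holo_on (ball x r) q" using assms holomorphic_near_iff by blast
  have "holo_on (ball x r) (\<lambda>y. q (contract S x 0 y))"
    unfolding contract_daff
    by (rule holo_onI[OF open_ball has_grad_daff[OF holo_onD[OF r(2)]]])
       (use contract_in_ball[of _ x r 0 S] in \<open>simp add: contract_daff\<close>)
  then show ?thesis using r(1) holomorphic_near_iff by blast
qed

lemma eventually_contract:
  assumes "eventually P (nhds x)" shows "eventually (\<lambda>y. P (contract S x 0 y)) (nhds x)"
proof -
  obtain d where d: "d > 0" "\<And>y. y \<in> ball x d \<Longrightarrow> P y"
    using assms unfolding eventually_nhds_metric by (auto simp: dist_commute)
  then show ?thesis unfolding eventually_nhds_metric
    using contract_in_ball[of _ x d 0 S] by (intro exI[of _ d]) (auto simp: dist_commute)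
qed

text \<open>
  A polynomial that is a combination of powers of coordinate functions with holomorphic coefficients is
  one with polynomial coefficients.  The induction is that of \<open>analytic_division\<close>.
\<close>

lemma polynomial_in_box_ideal:
  fixes x :: "'n::finite aff"
  shows "polynomial_map h \<Longrightarrow> (\<And>k. holomorphic_near x (q k)) \<Longrightarrow>
    eventually (\<lambda>y. h y = (\<Sum>k\<in>K. (y $ k - x $ k) ^ v k * q k y)) (nhds x) \<Longrightarrow>
    \<exists>q'. (\<forall>k. polynomial_map (q' k)) \<and> (\<forall>y. h y = (\<Sum>k\<in>K. (y $ k - x $ k) ^ v k * q' k y))"
proof (induction "card K + (\<Sum>k\<in>K. v k)" arbitrary: K v h q rule: less_induct)
  case less
  consider "K = {}" | k where "k \<in> K" "v k = 0" | i where "i \<in> K" "\<forall>k\<in>K. v k \<noteq> 0" by blast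
  then show ?case
  proof cases
    case 1
    then have "h y = 0" for y using polynomial_identity[OF less.prems(1)] less.prems(3) by simp
    then show ?thesis using 1 by (intro exI[of _ "\<lambda>k y. 0"]) (auto intro: polynomial_map_const)
  next
    case (2 k)
    have "(\<Sum>j\<in>K. (y $ j - x $ j) ^ v j * (if j = k then h else (\<lambda>y. 0)) y) = (\<Sum>j\<in>K. if j = k then h y else 0)" for y
      using 2 by (intro sum.cong) auto
    then have "(\<Sum>j\<in>K. (y $ j - x $ j) ^ v j * (if j = k then h else (\<lambda>y. 0)) y) = h y" for y
      using 2 by simp
    then show ?thesis using less.prems
      by (intro exI[of _ "\<lambda>j. if j = k then h else (\<lambda>y. 0)"]) (auto intro: polynomial_map_const)
  next
    case (3 i)
    let ?c = "contract {i} x 0"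
    have ck: "?c y $ k = (if k = i then x $ i else y $ k)" for y k by (simp add: contract_def)
    obtain \<rho> where \<rho>: "polynomial_map \<rho>" "\<And>y. h y = h (?c y) + (y $ i - x $ i) * \<rho> y"
      using polynomial_division[OF less.prems(1)] by blast
    have "card (K - {i}) + (\<Sum>k\<in>K - {i}. v k) < card K + (\<Sum>k\<in>K. v k)"
      using 3 by (intro add_less_le_mono psubset_card_mono sum_mono2) auto
    moreover have hc: "eventually (\<lambda>y. h (?c y) = (\<Sum>k\<in>K - {i}. (y $ k - x $ k) ^ v k * q k (?c y))) (nhds x)"
      using eventually_contract[OF less.prems(3), of "{i}"]
    proof (rule eventually_mono)
      fix y assume "h (?c y) = (\<Sum>k\<in>K. (?c y $ k - x $ k) ^ v k * q k (?c y))"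
      also have "\<dots> = (\<Sum>k\<in>K - {i}. (y $ k - x $ k) ^ v k * q k (?c y))"
        unfolding sum_insert_remove_single[OF 3(1)] using 3 by (auto simp: ck intro!: sum.cong)
      finally show "h (?c y) = (\<Sum>k\<in>K - {i}. (y $ k - x $ k) ^ v k * q k (?c y))" .
    qed
    ultimately obtain q1 where q1: "\<And>k. polynomial_map (q1 k)" "\<And>y. h (?c y) = (\<Sum>k\<in>K - {i}. (y $ k - x $ k) ^ v k * q1 k y)"
      using less.hyps[of "K - {i}" v "\<lambda>y. h (?c y)" "\<lambda>k y. q k (?c y)"]
        polynomial_map_contract[OF less.prems(1)] holomorphic_near_contract[OF less.prems(2)] by blast
    define \<delta> where "\<delta> k = ray_mean {i} 0 x (partial i (\<lambda>y. q k y - q k (?c y)))" for k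
    have qc: "holomorphic_near x (\<lambda>y. q k y - q k (?c y))" for k
      by (intro holomorphic_near_diff holomorphic_near_contract less.prems)
    have \<delta>: "holomorphic_near x (\<delta> k)" for k
      unfolding \<delta>_def by (intro holomorphic_near_ray_mean holomorphic_near_partial qc)
    have "eventually (\<lambda>y. y \<in> slice {} x \<longrightarrow> q k y - q k (?c y) = (y $ i - x $ i) * \<delta> k y) (nhds x)" for k
      unfolding \<delta>_def
    proof (rule hadamard_division[OF qc])
      have "?c y = y" if "y \<in> slice {i} x" for y using that by (auto simp: slice_def vec_eq_iff ck)
      then show "eventually (\<lambda>y. y \<in> slice {i} x \<longrightarrow> q k y - q k (?c y) = 0) (nhds x)" by simp
    qed
    then have q\<delta>: "eventually (\<lambda>y. \<forall>k. q k y - q k (?c y) = (y $ i - x $ i) * \<delta> k y) (nhds x)"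
      by (intro eventually_all_finite) simp
    define v' where "v' = v(i := v i - 1)"
    define q' where "q' k = (if k = i then q i else \<delta> k)" for k
    have q': "holomorphic_near x (q' k)" for k using \<delta> less.prems(2) by (simp add: q'_def)
    have vi: "(y $ i - x $ i) * (y $ i - x $ i) ^ v' i = (y $ i - x $ i) ^ v i" for y :: "'n aff"
      using 3 by (cases "v i") (auto simp: v'_def)
    have "eventually (\<lambda>y. y \<in> slice {} x \<longrightarrow> (y $ i - x $ i) * \<rho> y = (y $ i - x $ i) * (\<Sum>k\<in>K. (y $ k - x $ k) ^ v' k * q' k y)) (nhds x)"
      using less.prems(3) hc q\<delta>
    proof eventually_elim
      case (elim y)
      have "(y $ i - x $ i) * \<rho> y = h y - h (?c y)" using \<rho>(2)[of y] by simp
      also have "\<dots> = (y $ i - x $ i) ^ v i * q i y + (\<Sum>k\<in>K - {i}. (y $ k - x $ k) ^ v k * (q k y - q k (?c y)))"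
        unfolding elim(1,2) sum_insert_remove_single[OF 3(1)] by (simp add: sum_subtractf algebra_simps)
      also have "(\<Sum>k\<in>K - {i}. (y $ k - x $ k) ^ v k * (q k y - q k (?c y))) = (\<Sum>k\<in>K - {i}. (y $ i - x $ i) * ((y $ k - x $ k) ^ v' k * q' k y))"
        using elim(3) by (intro sum.cong) (auto simp: v'_def q'_def)
      also have "(y $ i - x $ i) ^ v i * q i y = (y $ i - x $ i) * ((y $ i - x $ i) ^ v' i * q' i y)"
        unfolding vi[symmetric] by (simp add: q'_def)
      finally show ?case unfolding sum_insert_remove_single[OF 3(1)] by (simp add: distrib_left sum_distrib_left)
    qed
    from slice_cancel[OF polynomial_map_near[OF \<rho>(1)] _ _ this]
    have "eventually (\<lambda>y. \<rho> y = (\<Sum>k\<in>K. (y $ k - x $ k) ^ v' k * q' k y)) (nhds x)"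
      using q' by (simp add: holomorphic_near_intros)
    moreover have "(\<Sum>k\<in>K. v' k) < (\<Sum>k\<in>K. v k)"
      using 3 by (intro sum_strict_mono_ex1) (auto simp: v'_def)
    then have "card K + (\<Sum>k\<in>K. v' k) < card K + (\<Sum>k\<in>K. v k)" by simp
    ultimately obtain q2 where q2: "\<And>k. polynomial_map (q2 k)" "\<And>y. \<rho> y = (\<Sum>k\<in>K. (y $ k - x $ k) ^ v' k * q2 k y)"
      using less.hyps[of K v' \<rho> q'] \<rho>(1) q' by blast
    define q3 where "q3 k = (\<lambda>y. if k = i then q2 i y else q1 k y + (y $ i - x $ i) * q2 k y)" for k
    have "polynomial_map (q3 k)" for k
      unfolding q3_def by (cases "k = i") (auto intro!: polynomial_map_intros q1 q2)
    moreover have "h y = (\<Sum>k\<in>K. (y $ k - x $ k) ^ v k * q3 k y)" for y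
    proof -
      have "(\<Sum>k\<in>K. (y $ k - x $ k) ^ v k * q3 k y) = (y $ i - x $ i) ^ v i * q2 i y +
           (\<Sum>k\<in>K - {i}. (y $ k - x $ k) ^ v k * q1 k y + (y $ i - x $ i) * ((y $ k - x $ k) ^ v' k * q2 k y))"
        unfolding sum_insert_remove_single[OF 3(1)] by (auto simp: q3_def v'_def algebra_simps intro!: sum.cong)
      also have "\<dots> = (\<Sum>k\<in>K - {i}. (y $ k - x $ k) ^ v k * q1 k y) + (y $ i - x $ i) * (\<Sum>k\<in>K. (y $ k - x $ k) ^ v' k * q2 k y)"
        unfolding sum_insert_remove_single[OF 3(1)] vi[symmetric] by (simp only: sum.distrib sum_distrib_left distrib_left mult_ac add_ac)
      also have "\<dots> = h y" using \<rho>(2)[of y] q1(2)[of y] q2(2)[of y] by simp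
      finally show ?thesis by simp
    qed
    ultimately show ?thesis by blast
  qed
qed

text \<open>
  The coefficients \<open>a j\<close> may be replaced by polynomials modulo \<open>N\<close>-th powers of the coordinates.  The
  error is a polynomial that lies in the ideal of these powers analytically, hence algebraically, and
  \<open>e\<close> maps this ideal into the Jacobian ideal.
\<close>

lemma analytic_to_algebraic:
  fixes f :: "'n::finite aff \<Rightarrow> complex"
  assumes f: "polynomial_map f" and fin: "finite (critical_points f)" and w: "polynomial_map w"
    and a: "\<And>j. holomorphic_near x (a j)" "eventually (\<lambda>y. w y = (\<Sum>j\<in>UNIV. a j y * partial j f y)) (nhds x)"
  shows "\<exists>e. polynomial_map e \<and> e x \<noteq> 0 \<and> (\<lambda>y. e y * w y) \<in> jacobian_ideal f"
proof -
  note J = pideal_jacobian_ideal[OF f]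
  obtain e N where e: "polynomial_map e" "e x \<noteq> 0" "\<And>i. (\<lambda>y. e y * (y $ i - x $ i) ^ N) \<in> jacobian_ideal f"
    using jacobian_primary[OF f fin] by blast
  define good where "good j P q \<longleftrightarrow> polynomial_map P \<and> (\<forall>k. holomorphic_near x (q k)) \<and>
    eventually (\<lambda>y. a j y = P y + (\<Sum>k\<in>UNIV. (y $ k - x $ k) ^ N * q k y)) (nhds x)" for j P q
  have "\<forall>j. \<exists>P q. good j P q"
    unfolding good_def using analytic_division[OF a(1), where K = UNIV and v = "\<lambda>_. N"] by simp
  then obtain P q where good: "\<And>j. good j (P j) (q j)" by metis
  then have P: "\<And>j. polynomial_map (P j)" "\<And>j k. holomorphic_near x (q j k)"
    "\<And>j. eventually (\<lambda>y. a j y = P j y + (\<Sum>k\<in>UNIV. (y $ k - x $ k) ^ N * q j k y)) (nhds x)"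
    unfolding good_def by auto
  define \<rho> where "\<rho> y = w y - (\<Sum>j\<in>UNIV. P j y * partial j f y)" for y
  have \<rho>: "polynomial_map \<rho>" unfolding \<rho>_def[abs_def] by (intro polynomial_map_intros w P f) auto
  have "eventually (\<lambda>y. \<forall>j. a j y = P j y + (\<Sum>k\<in>UNIV. (y $ k - x $ k) ^ N * q j k y)) (nhds x)"
    by (rule eventually_all_finite[OF P(3)])
  with a(2) have "eventually (\<lambda>y. \<rho> y = (\<Sum>k\<in>UNIV. (y $ k - x $ k) ^ N * (\<Sum>j\<in>UNIV. q j k y * partial j f y))) (nhds x)"
  proof eventually_elim
    case (elim y)
    have "\<rho> y = (\<Sum>j\<in>UNIV. (\<Sum>k\<in>UNIV. (y $ k - x $ k) ^ N * q j k y) * partial j f y)"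
      unfolding \<rho>_def elim(1) using elim(2) by (simp add: algebra_simps sum.distrib)
    also have "\<dots> = (\<Sum>j\<in>UNIV. \<Sum>k\<in>UNIV. (y $ k - x $ k) ^ N * (q j k y * partial j f y))"
      by (simp add: sum_distrib_right mult.assoc)
    also have "\<dots> = (\<Sum>k\<in>UNIV. (y $ k - x $ k) ^ N * (\<Sum>j\<in>UNIV. q j k y * partial j f y))"
      by (subst sum.swap) (simp add: sum_distrib_left)
    finally show ?case .
  qed
  moreover have "holomorphic_near x (\<lambda>y. \<Sum>j\<in>UNIV. q j k y * partial j f y)" for k
    by (intro holomorphic_near_sum holomorphic_near_mult holomorphic_near_partial P polynomial_map_near[OF f]) auto
  ultimately obtain Q where Q: "\<And>k. polynomial_map (Q k)" "\<And>y. \<rho> y = (\<Sum>k\<in>UNIV. (y $ k - x $ k) ^ N * Q k y)"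
    using polynomial_in_box_ideal[OF \<rho>, where x = x and q = "\<lambda>k y. \<Sum>j\<in>UNIV. q j k y * partial j f y" and K = UNIV and v = "\<lambda>_. N"] by blast
  have "(\<lambda>y. (\<Sum>k\<in>UNIV. Q k y * (e y * (y $ k - x $ k) ^ N)) + (\<Sum>j\<in>UNIV. (e y * P j y) * partial j f y)) \<in> jacobian_ideal f"
    by (rule pidealD(3)[OF J pideal_sum[OF J finite pidealD(4)[OF J e(3) Q(1)]]
        pideal_sum[OF J finite pidealD(4)[OF J partial_in_jacobian_ideal polynomial_map_mult[OF e(1) P(1)]]]])
  also have "(\<lambda>y. (\<Sum>k\<in>UNIV. Q k y * (e y * (y $ k - x $ k) ^ N)) + (\<Sum>j\<in>UNIV. (e y * P j y) * partial j f y)) = (\<lambda>y. e y * w y)"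
  proof
    fix y
    have "w y = \<rho> y + (\<Sum>j\<in>UNIV. P j y * partial j f y)" by (simp add: \<rho>_def)
    then show "(\<Sum>k\<in>UNIV. Q k y * (e y * (y $ k - x $ k) ^ N)) + (\<Sum>j\<in>UNIV. (e y * P j y) * partial j f y) = e y * w y"
      unfolding Q(2) by (simp add: distrib_left sum_distrib_left mult_ac)
  qed
  finally show ?thesis using e by blast
qed

text \<open>
  The zeros of the ideal quotient \<open>I\<close> of the Jacobian ideal by \<open>w\<close> are critical points of \<open>f\<close> at which
  \<open>w\<close> is not in the Jacobian ideal analytically.  By assumption their critical values violate \<open>P\<close>.  So
  the polynomial \<open>R\<close> with these values as roots has \<open>R(f)\<close> vanishing on the zeros of \<open>I\<close>, and a power
  of \<open>R(f)\<close> is in \<open>I\<close>.  Below \<open>P\<close> is either always false or singles out the value \<open>c\<close>.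
\<close>

lemma critical_value_annihilator:
  fixes f :: "'n::finite aff \<Rightarrow> complex"
  assumes f: "polynomial_map f" and fin: "finite (critical_points f)" and w: "polynomial_map w"
    and loc: "\<And>x. x \<in> critical_points f \<Longrightarrow> P (f x) \<Longrightarrow>
      \<exists>a. (\<forall>j. holomorphic_near x (a j)) \<and> eventually (\<lambda>y. w y = (\<Sum>j\<in>UNIV. a j y * partial j f y)) (nhds x)"
  shows "\<exists>Q. Q \<noteq> 0 \<and> (\<forall>z. P z \<longrightarrow> poly Q z \<noteq> 0) \<and> (\<lambda>y. poly Q (f y) * w y) \<in> jacobian_ideal f"
proof -
  note J = pideal_jacobian_ideal[OF f]
  define C where "C = {x \<in> critical_points f. \<not> P (f x)}"
  define R where "R = (\<Prod>x\<in>C. [:- f x, 1:])"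
  have C: "finite C" using fin by (simp add: C_def)
  define I where "I = {a. polynomial_map a \<and> (\<lambda>y. a y * w y) \<in> jacobian_ideal f}"
  have I: "pideal I" unfolding pideal_def
  proof (intro conjI ballI allI impI)
    show "I \<subseteq> Collect polynomial_map" by (auto simp: I_def)
    show "(\<lambda>y. 0) \<in> I" using pidealD(2)[OF J] by (simp add: I_def polynomial_map_const)
  next
    fix a b assume "a \<in> I" "b \<in> I"
    then show "(\<lambda>y. a y + b y) \<in> I"
      using pidealD(3)[OF J, of "\<lambda>y. a y * w y" "\<lambda>y. b y * w y"] by (simp add: I_def polynomial_map_add distrib_right)
  next
    fix a b :: "'n aff \<Rightarrow> complex" assume "a \<in> I" "polynomial_map b"
    then show "(\<lambda>y. b y * a y) \<in> I"
      using pidealD(4)[OF J, of "\<lambda>y. a y * w y" b] by (simp add: I_def polynomial_map_mult mult.assoc)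
  qed
  have "\<exists>k. (\<lambda>y. poly R (f y) ^ k) \<in> I"
  proof (rule nullstellensatz[OF I])
    show "polynomial_map (\<lambda>y. poly R (f y))" by (rule polynomial_map_poly[OF f])
    fix y assume van: "\<And>a. a \<in> I \<Longrightarrow> a y = 0"
    have "partial i f \<in> I" for i
      using pidealD(4)[OF J partial_in_jacobian_ideal w] f
      by (simp add: I_def polynomial_map_partial mult.commute)
    then have y: "y \<in> critical_points f" using van by (simp add: critical_points_def)
    have "\<not> P (f y)"
    proof
      assume "P (f y)"
      then obtain a where "\<And>j. holomorphic_near y (a j)" "eventually (\<lambda>z. w z = (\<Sum>j\<in>UNIV. a j z * partial j f z)) (nhds y)"
        using loc[OF y] by blast
      from analytic_to_algebraic[OF f fin w this] obtain e where "e \<in> I" "e y \<noteq> 0" by (auto simp: I_def)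
      then show False using van by blast
    qed
    then have "y \<in> C" using y by (simp add: C_def)
    then show "poly R (f y) = 0" using C by (auto simp: R_def poly_prod)
  qed
  then obtain k where k: "(\<lambda>y. poly R (f y) ^ k) \<in> I" by blast
  \<comment> \<open>the roots of \<open>R\<close> are critical values at which \<open>P\<close> fails\<close>
  have "R \<noteq> 0" using C by (auto simp: R_def)
  moreover have "poly R z \<noteq> 0" if "P z" for z using that C by (auto simp: R_def poly_prod C_def)
  ultimately show ?thesis using k by (intro exI[of _ "R ^ k"]) (auto simp: I_def)
qed

section \<open>Quotient modules\<close>

lemma abelian_group_of_class:
  fixes M :: "('r, 'a::ab_group_add, 'm) module_scheme"
  assumes "add M = (+)" "ring.zero M = 0" "0 \<in> carrier M"
    "\<And>x y. x \<in> carrier M \<Longrightarrow> y \<in> carrier M \<Longrightarrow> x + y \<in> carrier M"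
    "\<And>x. x \<in> carrier M \<Longrightarrow> - x \<in> carrier M"
  shows "abelian_group M" "x \<in> carrier M \<Longrightarrow> \<ominus>\<^bsub>M\<^esub> x = - x"
proof -
  show *: "abelian_group M"
    by (rule abelian_groupI) (use assms in \<open>auto simp: algebra_simps intro: bexI[of _ "- _"]\<close>)
  interpret abelian_group M by (rule *)
  show "x \<in> carrier M \<Longrightarrow> \<ominus>\<^bsub>M\<^esub> x = - x"
    using minus_equality[of "- x" x] assms by simp
qed

lemma abelian_subgroup_of_class:
  fixes M :: "('r, 'a::ab_group_add, 'm) module_scheme"
  assumes M: "add M = (+)" "ring.zero M = 0" "0 \<in> carrier M"
    "\<And>x y. x \<in> carrier M \<Longrightarrow> y \<in> carrier M \<Longrightarrow> x + y \<in> carrier M"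
    "\<And>x. x \<in> carrier M \<Longrightarrow> - x \<in> carrier M"
   and H: "H \<subseteq> carrier M" "0 \<in> H" "\<And>x y. x \<in> H \<Longrightarrow> y \<in> H \<Longrightarrow> x + y \<in> H" "\<And>x. x \<in> H \<Longrightarrow> - x \<in> H"
  shows "abelian_subgroup H M"
proof -
  interpret abelian_group M by (rule abelian_group_of_class(1)[OF M])
  have "subgroup H (add_monoid M)"
  proof (rule add.subgroupI)
    show "\<ominus>\<^bsub>M\<^esub> x \<in> H" if "x \<in> H" for x
      using abelian_group_of_class(2)[OF M, of x] H that by auto
  qed (use H M in auto)
  then show ?thesis
    by (intro abelian_subgroupI3 additive_subgroupI abelian_group_axioms)
qed

locale module_quotient = abelian_subgroup H G
  for H and G :: "('r, 'a, 'm) module_scheme" (structure)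
begin

lemma quot_carrier: "carrier (quot_module G H) = (\<lambda>x. H +> x) ` carrier G"
  by (auto simp: quot_module_def A_RCOSETS_def')

lemma quot_add: "x \<in> carrier G \<Longrightarrow> y \<in> carrier G \<Longrightarrow>
    (H +> x) \<oplus>\<^bsub>quot_module G H\<^esub> (H +> y) = H +> (x \<oplus> y)"
  by (simp add: quot_module_def a_rcos_sum)

lemma quot_zero: "\<zero>\<^bsub>quot_module G H\<^esub> = H +> \<zero>"
  by (simp add: quot_module_def a_subset)

lemma quot_abelian_group: "abelian_group (quot_module G H)"
proof (rule abelian_groupI)
  show "\<exists>y\<in>carrier (quot_module G H). y \<oplus>\<^bsub>quot_module G H\<^esub> x = \<zero>\<^bsub>quot_module G H\<^esub>" if "x \<in> carrier (quot_module G H)" for x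
  proof -
    from that have "x \<in> (\<lambda>x. H +> x) ` carrier G" by (simp only: quot_carrier)
    then obtain x' where "x = H +> x'" "x' \<in> carrier G" by (rule imageE)
    then show ?thesis
      by (intro bexI[of _ "H +> (\<ominus> x')"]) (auto simp: quot_add quot_zero l_neg quot_carrier)
  qed
qed (auto simp: quot_carrier quot_add quot_zero a_ac)

lemma quot_eq: "x \<in> carrier G \<Longrightarrow> y \<in> carrier G \<Longrightarrow> H +> x = H +> y \<longleftrightarrow> x \<ominus> y \<in> H"
  using a_rcos_module[of y x] a_rcos_self[of x] a_repr_independence'[of x y]
  by (auto simp: a_minus_def)

lemma quot_mem: "x \<in> carrier G \<Longrightarrow> y \<in> H +> x \<longleftrightarrow> y \<in> carrier G \<and> H +> y = H +> x"
  using a_elemrcos_carrier[of x y] a_repr_independence'[of y x] a_rcos_self[of y] by auto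

text \<open>
  The union in the definition of the scalar multiplication is over equal cosets.
\<close>

lemma quot_smult:
  assumes cl: "\<And>x. x \<in> carrier G \<Longrightarrow> a \<odot>\<^bsub>G\<^esub> x \<in> carrier G"
    and H: "\<And>x y. x \<in> carrier G \<Longrightarrow> y \<in> carrier G \<Longrightarrow> H +> x = H +> y \<Longrightarrow> H +> (a \<odot>\<^bsub>G\<^esub> x) = H +> (a \<odot>\<^bsub>G\<^esub> y)"
    and x: "x \<in> carrier G"
  shows "a \<odot>\<^bsub>quot_module G H\<^esub> (H +> x) = H +> (a \<odot>\<^bsub>G\<^esub> x)"
proof -
  have "(\<Union>y\<in>H +> x. H +> (a \<odot>\<^bsub>G\<^esub> y)) = (\<Union>y\<in>H +> x. H +> (a \<odot>\<^bsub>G\<^esub> x))"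
    by (intro SUP_cong refl H x) (use quot_mem x in auto)
  also have "\<dots> = H +> (a \<odot>\<^bsub>G\<^esub> x)" using a_rcos_self[OF x] by auto
  finally show ?thesis by (simp add: quot_module_def)
qed

lemma quot_lift:
  assumes "x \<in> carrier G" "\<And>y. y \<in> carrier G \<Longrightarrow> H +> y = H +> x \<Longrightarrow> \<phi> y = \<phi> x"
  shows "the_elem (\<phi> ` (H +> x)) = \<phi> x"
proof -
  have "\<phi> y = \<phi> x" if "y \<in> H +> x" for y
    using that assms(2) quot_mem[OF assms(1)] by simp
  moreover have "x \<in> H +> x" by (rule a_rcos_self[OF assms(1)])
  ultimately have "\<phi> ` (H +> x) = {\<phi> x}" by blast
  then show ?thesis by simp
qed

end

section \<open>Base change of modules\<close>

lemma (in abelian_group) add_pow_int_simps: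
  "x \<in> carrier G \<Longrightarrow> [(0::int)] \<cdot> x = \<zero>" "x \<in> carrier G \<Longrightarrow> [(1::int)] \<cdot> x = x"
  "x \<in> carrier G \<Longrightarrow> [(a::int)] \<cdot> x \<in> carrier G"
  "x \<in> carrier G \<Longrightarrow> [(a + b::int)] \<cdot> x = [a] \<cdot> x \<oplus> [b] \<cdot> x"
  "x \<in> carrier G \<Longrightarrow> [(- a::int)] \<cdot> x = \<ominus> ([a] \<cdot> x)"
  "x \<in> carrier G \<Longrightarrow> y \<in> carrier G \<Longrightarrow> [(a::int)] \<cdot> (x \<oplus> y) = [a] \<cdot> x \<oplus> [a] \<cdot> y"
  using add.int_pow_closed[of x a] add.int_pow_mult[of x a b] add.int_pow_neg[of x a] add.int_pow_distrib[of x y a]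
    add.int_pow_1[of x] int_pow_0[of "add_monoid G" x] a_inv_def
  by (auto simp: add_pow_def)

locale base_change_data =
  fixes R :: "('r, 'k) ring_scheme" and B :: "('r, 'b) module" and M :: "('r, 'a) module"
  assumes B_add: "b \<in> carrier B \<Longrightarrow> b' \<in> carrier B \<Longrightarrow> b \<oplus>\<^bsub>B\<^esub> b' \<in> carrier B"
    and B_mult: "b \<in> carrier B \<Longrightarrow> b' \<in> carrier B \<Longrightarrow> b \<otimes>\<^bsub>B\<^esub> b' \<in> carrier B"
    and B_smult: "r \<in> carrier R \<Longrightarrow> b \<in> carrier B \<Longrightarrow> r \<odot>\<^bsub>B\<^esub> b \<in> carrier B"
    and B_distr: "a \<in> carrier B \<Longrightarrow> b \<in> carrier B \<Longrightarrow> b' \<in> carrier B \<Longrightarrow> a \<otimes>\<^bsub>B\<^esub> (b \<oplus>\<^bsub>B\<^esub> b') = a \<otimes>\<^bsub>B\<^esub> b \<oplus>\<^bsub>B\<^esub> a \<otimes>\<^bsub>B\<^esub> b'"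
    and B_distr': "a \<in> carrier B \<Longrightarrow> b \<in> carrier B \<Longrightarrow> b' \<in> carrier B \<Longrightarrow> (b \<oplus>\<^bsub>B\<^esub> b') \<otimes>\<^bsub>B\<^esub> a = b \<otimes>\<^bsub>B\<^esub> a \<oplus>\<^bsub>B\<^esub> b' \<otimes>\<^bsub>B\<^esub> a"
    and B_comm: "r \<in> carrier R \<Longrightarrow> a \<in> carrier B \<Longrightarrow> b \<in> carrier B \<Longrightarrow> a \<otimes>\<^bsub>B\<^esub> (r \<odot>\<^bsub>B\<^esub> b) = r \<odot>\<^bsub>B\<^esub> (a \<otimes>\<^bsub>B\<^esub> b)"
    and B_comm': "r \<in> carrier R \<Longrightarrow> a \<in> carrier B \<Longrightarrow> b \<in> carrier B \<Longrightarrow> (r \<odot>\<^bsub>B\<^esub> a) \<otimes>\<^bsub>B\<^esub> b = a \<otimes>\<^bsub>B\<^esub> (r \<odot>\<^bsub>B\<^esub> b)"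
    and M_add: "m \<in> carrier M \<Longrightarrow> m' \<in> carrier M \<Longrightarrow> m \<oplus>\<^bsub>M\<^esub> m' \<in> carrier M"
    and M_smult: "r \<in> carrier R \<Longrightarrow> m \<in> carrier M \<Longrightarrow> r \<odot>\<^bsub>M\<^esub> m \<in> carrier M"
begin

abbreviation "pairs \<equiv> carrier B \<times> carrier M"
abbreviation "FA \<equiv> free_Abelian_group pairs"
abbreviation "null \<equiv> tensor_null R B M"
abbreviation "cls \<equiv> tensor_class R B M"
abbreviation "BC \<equiv> base_change R B M"

definition gen :: "'b \<Rightarrow> 'a \<Rightarrow> ('b \<times> 'a \<Rightarrow>\<^sub>0 int) set" where "gen b m = cls (frag_of (b, m))"

lemma relations_cases [consumes 1, case_names left right scalar]:
  assumes "F \<in> tensor_relations R B M"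
  obtains b b' m where "F = frag_of (b \<oplus>\<^bsub>B\<^esub> b', m) - frag_of (b, m) - frag_of (b', m)"
      "b \<in> carrier B" "b' \<in> carrier B" "m \<in> carrier M"
  | b m m' where "F = frag_of (b, m \<oplus>\<^bsub>M\<^esub> m') - frag_of (b, m) - frag_of (b, m')"
      "b \<in> carrier B" "m \<in> carrier M" "m' \<in> carrier M"
  | r b m where "F = frag_of (r \<odot>\<^bsub>B\<^esub> b, m) - frag_of (b, r \<odot>\<^bsub>M\<^esub> m)"
      "r \<in> carrier R" "b \<in> carrier B" "m \<in> carrier M"
  using assms unfolding tensor_relations_def by (elim UnE CollectE exE conjE)

lemma relations_intros:
  "b \<in> carrier B \<Longrightarrow> b' \<in> carrier B \<Longrightarrow> m \<in> carrier M \<Longrightarrow>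
     frag_of (b \<oplus>\<^bsub>B\<^esub> b', m) - frag_of (b, m) - frag_of (b', m) \<in> tensor_relations R B M"
  "b \<in> carrier B \<Longrightarrow> m \<in> carrier M \<Longrightarrow> m' \<in> carrier M \<Longrightarrow>
     frag_of (b, m \<oplus>\<^bsub>M\<^esub> m') - frag_of (b, m) - frag_of (b, m') \<in> tensor_relations R B M"
  "r \<in> carrier R \<Longrightarrow> b \<in> carrier B \<Longrightarrow> m \<in> carrier M \<Longrightarrow>
     frag_of (r \<odot>\<^bsub>B\<^esub> b, m) - frag_of (b, r \<odot>\<^bsub>M\<^esub> m) \<in> tensor_relations R B M"
  unfolding tensor_relations_def by blast+

lemma relations_subset: "tensor_relations R B M \<subseteq> carrier FA"
proof -
  have "frag_of p - frag_of q \<in> carrier FA" if "p \<in> pairs" "q \<in> pairs" for p q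
    using that keys_diff[of "frag_of p" "frag_of q"] by (auto split: if_splits)
  moreover have "frag_of p - frag_of q - frag_of r \<in> carrier FA" if "p \<in> pairs" "q \<in> pairs" "r \<in> pairs" for p q r
    using that keys_diff[of "frag_of p - frag_of q" "frag_of r"] keys_diff[of "frag_of p" "frag_of q"] by (auto split: if_splits)
  moreover note B_add B_smult M_add M_smult
  ultimately show ?thesis
    unfolding tensor_relations_def
    by (intro subsetI, elim UnE CollectE exE conjE; simp only: mem_Sigma_iff SigmaI)
qed

lemma null_subgroup: "subgroup null FA"
  unfolding tensor_null_def by (rule group.generate_is_subgroup[OF _ relations_subset]) simp

lemma null_closed: "0 \<in> null" "F \<in> null \<Longrightarrow> G \<in> null \<Longrightarrow> F + G \<in> null" "F \<in> null \<Longrightarrow> - F \<in> null"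
  "F \<in> null \<Longrightarrow> F \<in> carrier FA" "F \<in> null \<Longrightarrow> G \<in> null \<Longrightarrow> F - G \<in> null"
proof -
  note s = null_subgroup
  show 1: "F \<in> carrier FA" if "F \<in> null" for F using subgroup.mem_carrier[OF s that] .
  show "0 \<in> null" using subgroup.one_closed[OF s] by simp
  show 2: "F + G \<in> null" if "F \<in> null" "G \<in> null" for F G using subgroup.m_closed[OF s that] by simp
  show 3: "- F \<in> null" if "F \<in> null" for F using subgroup.m_inv_closed[OF s that] 1[OF that] by simp
  show "F - G \<in> null" if "F \<in> null" "G \<in> null" using 2[OF that(1) 3[OF that(2)]] by simp
qed

lemma cls_image: "cls F = (\<lambda>h. h + F) ` null"
  by (auto simp: tensor_class_def r_coset_def)

lemma cls_mem: "G \<in> cls F \<longleftrightarrow> G - F \<in> null"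
  unfolding cls_image by (auto intro!: image_eqI[of _ _ "G - F"])

lemma cls_eq: "cls F = cls G \<longleftrightarrow> F - G \<in> null"
proof
  assume "cls F = cls G" then show "F - G \<in> null" using cls_mem[of F F] cls_mem[of F G] null_closed(1) by simp
next
  assume *: "F - G \<in> null"
  show "cls F = cls G"
  proof (intro equalityI subsetI)
    fix E assume "E \<in> cls F" then have "(E - F) + (F - G) \<in> null" using * cls_mem null_closed(2) by blast
    then show "E \<in> cls G" by (simp add: cls_mem)
  next
    fix E assume "E \<in> cls G" then have "(E - G) - (F - G) \<in> null" using * cls_mem null_closed(5) by blast
    then show "E \<in> cls F" by (simp add: cls_mem)
  qed
qed

lemma BC_carrier: "carrier BC = cls ` carrier FA"
  by (auto simp: base_change_def RCOSETS_def tensor_class_def)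

lemma BC_zero: "\<zero>\<^bsub>BC\<^esub> = cls 0"
  by (simp add: base_change_def cls_image)

lemma BC_add: "cls F \<oplus>\<^bsub>BC\<^esub> cls G = cls (F + G)"
proof -
  have "cls F \<oplus>\<^bsub>BC\<^esub> cls G = (\<Union>a\<in>cls F. \<Union>b\<in>cls G. {a + b})"
    by (simp add: base_change_def set_mult_def)
  also have "\<dots> = cls (F + G)"
  proof (intro equalityI subsetI)
    fix E assume "E \<in> (\<Union>a\<in>cls F. \<Union>b\<in>cls G. {a + b})"
    then obtain a b where ab: "a - F \<in> null" "b - G \<in> null" "E = a + b" by (auto simp: cls_mem)
    from null_closed(2)[OF ab(1,2)] show "E \<in> cls (F + G)" unfolding cls_mem ab(3) by (simp add: algebra_simps)
  next
    fix E assume "E \<in> cls (F + G)"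
    then have "E - G \<in> cls F" by (simp add: cls_mem algebra_simps)
    moreover have "G \<in> cls G" by (simp add: cls_mem null_closed)
    ultimately show "E \<in> (\<Union>a\<in>cls F. \<Union>b\<in>cls G. {a + b})" by (intro UN_I[of "E - G"] UN_I[of G]) auto
  qed
  finally show ?thesis .
qed

lemma FA_closed: "0 \<in> carrier FA" "F \<in> carrier FA \<Longrightarrow> G \<in> carrier FA \<Longrightarrow> F + G \<in> carrier FA"
  "F \<in> carrier FA \<Longrightarrow> - F \<in> carrier FA" "F \<in> carrier FA \<Longrightarrow> G \<in> carrier FA \<Longrightarrow> F - G \<in> carrier FA"
  using keys_add[of F G] keys_diff[of F G] by auto

lemma BC_abelian: "abelian_group BC"
proof (rule abelian_groupI)
  show "\<And>x. x \<in> carrier BC \<Longrightarrow> \<exists>y\<in>carrier BC. y \<oplus>\<^bsub>BC\<^esub> x = \<zero>\<^bsub>BC\<^esub>"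
  proof -
    fix x assume "x \<in> carrier BC"
    then obtain F where F: "x = cls F" "F \<in> carrier FA" unfolding BC_carrier by blast
    then show "\<exists>y\<in>carrier BC. y \<oplus>\<^bsub>BC\<^esub> x = \<zero>\<^bsub>BC\<^esub>"
      using FA_closed(3)[OF F(2)] by (intro bexI[of _ "cls (- F)"]) (auto simp: BC_add BC_zero BC_carrier)
  qed
qed (auto simp: BC_carrier BC_add BC_zero algebra_simps intro: FA_closed)

lemma cls_closed: "F \<in> carrier FA \<Longrightarrow> cls F \<in> carrier BC" by (auto simp: BC_carrier)

lemma gen_closed: "b \<in> carrier B \<Longrightarrow> m \<in> carrier M \<Longrightarrow> gen b m \<in> carrier BC"
  unfolding gen_def by (rule cls_closed) simp

lemma rel_null: "F \<in> tensor_relations R B M \<Longrightarrow> F \<in> null"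
  unfolding tensor_null_def by (rule generate.incl)

lemma gen_add_left: "b \<in> carrier B \<Longrightarrow> b' \<in> carrier B \<Longrightarrow> m \<in> carrier M \<Longrightarrow> gen (b \<oplus>\<^bsub>B\<^esub> b') m = gen b m \<oplus>\<^bsub>BC\<^esub> gen b' m"
  unfolding gen_def BC_add cls_eq by (rule rel_null) (auto simp: tensor_relations_def diff_diff_eq)

lemma gen_add_right: "b \<in> carrier B \<Longrightarrow> m \<in> carrier M \<Longrightarrow> m' \<in> carrier M \<Longrightarrow> gen b (m \<oplus>\<^bsub>M\<^esub> m') = gen b m \<oplus>\<^bsub>BC\<^esub> gen b m'"
  unfolding gen_def BC_add cls_eq by (rule rel_null) (auto simp: tensor_relations_def diff_diff_eq)

lemma gen_smult: "r \<in> carrier R \<Longrightarrow> b \<in> carrier B \<Longrightarrow> m \<in> carrier M \<Longrightarrow> gen (r \<odot>\<^bsub>B\<^esub> b) m = gen b (r \<odot>\<^bsub>M\<^esub> m)"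
  unfolding gen_def cls_eq by (rule rel_null) (auto simp: tensor_relations_def)

lemma BC_a_inv: "F \<in> carrier FA \<Longrightarrow> \<ominus>\<^bsub>BC\<^esub> (cls F) = cls (- F)"
  using abelian_group.minus_equality[OF BC_abelian, of "cls (- F)" "cls F"] FA_closed(3)
  by (auto simp: BC_carrier BC_add BC_zero)

lemma BC_induct [consumes 1, case_names zero gen diff]:
  assumes "u \<in> carrier BC" and "P \<zero>\<^bsub>BC\<^esub>"
    and "\<And>b m. b \<in> carrier B \<Longrightarrow> m \<in> carrier M \<Longrightarrow> P (gen b m)"
    and "\<And>u v. u \<in> carrier BC \<Longrightarrow> v \<in> carrier BC \<Longrightarrow> P u \<Longrightarrow> P v \<Longrightarrow> P (u \<ominus>\<^bsub>BC\<^esub> v)"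
  shows "P u"
proof -
  obtain F where F: "u = cls F" "Poly_Mapping.keys F \<subseteq> pairs" using assms(1) by (auto simp: BC_carrier)
  from F(2) have "P (cls F)"
  proof (rule free_Abelian_group_induct)
    show "P (cls 0)" using assms(2) by (simp add: BC_zero)
    show "P (cls (frag_of a))" if "a \<in> pairs" for a using that assms(3) by (auto simp: gen_def)
    fix x y assume xy: "Poly_Mapping.keys x \<subseteq> pairs" "Poly_Mapping.keys y \<subseteq> pairs" "P (cls x)" "P (cls y)"
    then have "P (cls x \<ominus>\<^bsub>BC\<^esub> cls y)" by (intro assms(4)) (auto simp: BC_carrier)
    then show "P (cls (x - y))" using xy by (simp add: a_minus_def BC_a_inv BC_add)
  qed
  then show ?thesis by (simp add: F)
qed

definition frag_mult :: "'b \<Rightarrow> ('b \<times> 'a \<Rightarrow>\<^sub>0 int) \<Rightarrow> ('b \<times> 'a \<Rightarrow>\<^sub>0 int)" where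
  "frag_mult b = frag_extend (\<lambda>(b', m). frag_of (b \<otimes>\<^bsub>B\<^esub> b', m))"

lemma frag_mult_simps: "frag_mult b (F - G) = frag_mult b F - frag_mult b G" "frag_mult b (F + G) = frag_mult b F + frag_mult b G"
   "frag_mult b (- F) = - frag_mult b F"
   "frag_mult b 0 = 0" "frag_mult b (frag_of (b', m)) = frag_of (b \<otimes>\<^bsub>B\<^esub> b', m)"
  by (simp_all add: frag_mult_def frag_extend_diff frag_extend_add frag_extend_minus)

lemma frag_mult_carrier:
  assumes b: "b \<in> carrier B" and F: "F \<in> carrier FA" shows "frag_mult b F \<in> carrier FA"
proof -
  from F have "Poly_Mapping.keys F \<subseteq> pairs" by simp
  then have "Poly_Mapping.keys (frag_mult b F) \<subseteq> pairs"
  proof (rule free_Abelian_group_induct)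
    fix x y assume "Poly_Mapping.keys (frag_mult b x) \<subseteq> pairs" "Poly_Mapping.keys (frag_mult b y) \<subseteq> pairs"
    then show "Poly_Mapping.keys (frag_mult b (x - y)) \<subseteq> pairs"
      using keys_diff[of "frag_mult b x" "frag_mult b y"] by (auto simp: frag_mult_simps)
  qed (use b B_mult in \<open>auto simp: frag_mult_simps\<close>)
  then show ?thesis by simp
qed

text \<open>
  Multiplication by \<open>b\<close> turns each defining relation of the tensor product into one of the same kind.
\<close>

lemma frag_mult_null:
  assumes b: "b \<in> carrier B" and F: "F \<in> null" shows "frag_mult b F \<in> null"
proof -
  have "tensor_relations R B M \<subseteq> {F \<in> carrier FA. frag_mult b F \<in> null}"
  proof
    fix F assume F: "F \<in> tensor_relations R B M"
    then have "frag_mult b F \<in> tensor_relations R B M"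
    proof (cases rule: relations_cases)
      case (left b1 b2 m)
      then show ?thesis using relations_intros(1)[of "b \<otimes>\<^bsub>B\<^esub> b1" "b \<otimes>\<^bsub>B\<^esub> b2" m] b
        by (simp add: frag_mult_simps B_distr B_mult)
    next
      case (right b1 m m')
      then show ?thesis using relations_intros(2)[of "b \<otimes>\<^bsub>B\<^esub> b1" m m'] b
        by (simp add: frag_mult_simps B_mult)
    next
      case (scalar r b1 m)
      then show ?thesis using relations_intros(3)[of r "b \<otimes>\<^bsub>B\<^esub> b1" m] b
        by (simp add: frag_mult_simps B_mult B_comm)
    qed
    then show "F \<in> {F \<in> carrier FA. frag_mult b F \<in> null}"
      using F relations_subset rel_null by blast
  qed
  moreover have "subgroup {F \<in> carrier FA. frag_mult b F \<in> null} FA"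
  proof (rule group.subgroupI[OF group_free_Abelian_group])
    show "{F \<in> carrier FA. frag_mult b F \<in> null} \<subseteq> carrier FA" by blast
    show "{F \<in> carrier FA. frag_mult b F \<in> null} \<noteq> {}"
      using null_closed(1) FA_closed(1) frag_mult_simps(4)[of b] by (auto intro: exI[of _ 0] simp del: carrier_free_Abelian_group_iff)
  next
    fix F assume F: "F \<in> {F \<in> carrier FA. frag_mult b F \<in> null}"
    then have "inv\<^bsub>FA\<^esub> F = - F" by simp
    then show "inv\<^bsub>FA\<^esub> F \<in> {F \<in> carrier FA. frag_mult b F \<in> null}"
      using F null_closed(3)[of "frag_mult b F"] FA_closed(3)[of F] by (simp add: frag_mult_simps del: carrier_free_Abelian_group_iff)
  next
    fix F G assume "F \<in> {F \<in> carrier FA. frag_mult b F \<in> null}" "G \<in> {F \<in> carrier FA. frag_mult b F \<in> null}"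
    then show "F \<otimes>\<^bsub>FA\<^esub> G \<in> {F \<in> carrier FA. frag_mult b F \<in> null}"
      using null_closed(2)[of "frag_mult b F" "frag_mult b G"] FA_closed(2)[of F G] by (simp add: frag_mult_simps del: carrier_free_Abelian_group_iff)
  qed
  ultimately have "null \<subseteq> {F \<in> carrier FA. frag_mult b F \<in> null}"
    unfolding tensor_null_def[of R B M] by (rule group.generate_subgroup_incl[OF group_free_Abelian_group])
  then show ?thesis using F by blast
qed

lemma BC_smult: "b \<in> carrier B \<Longrightarrow> F \<in> carrier FA \<Longrightarrow> b \<odot>\<^bsub>BC\<^esub> cls F = cls (frag_mult b F)"
proof -
  assume b: "b \<in> carrier B" and F: "F \<in> carrier FA"
  have "b \<odot>\<^bsub>BC\<^esub> cls F = (\<Union>G\<in>cls F. cls (frag_mult b G))" by (simp add: base_change_def frag_mult_def)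
  also have "\<dots> = (\<Union>G\<in>cls F. cls (frag_mult b F))"
    using frag_mult_null[OF b] by (intro SUP_cong refl) (simp add: cls_eq cls_mem frag_mult_simps[symmetric])
  also have "\<dots> = cls (frag_mult b F)" using cls_mem[of F F] null_closed(1) by auto
  finally show ?thesis .
qed

lemma BC_smult_gen: "b \<in> carrier B \<Longrightarrow> b' \<in> carrier B \<Longrightarrow> m \<in> carrier M \<Longrightarrow> b \<odot>\<^bsub>BC\<^esub> gen b' m = gen (b \<otimes>\<^bsub>B\<^esub> b') m"
  unfolding gen_def by (simp add: BC_smult frag_mult_simps)

lemma BC_smult_closed: "b \<in> carrier B \<Longrightarrow> u \<in> carrier BC \<Longrightarrow> b \<odot>\<^bsub>BC\<^esub> u \<in> carrier BC"
  unfolding BC_carrier using BC_smult frag_mult_carrier by auto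

lemma BC_smult_add: "b \<in> carrier B \<Longrightarrow> u \<in> carrier BC \<Longrightarrow> v \<in> carrier BC \<Longrightarrow> b \<odot>\<^bsub>BC\<^esub> (u \<oplus>\<^bsub>BC\<^esub> v) = b \<odot>\<^bsub>BC\<^esub> u \<oplus>\<^bsub>BC\<^esub> b \<odot>\<^bsub>BC\<^esub> v"
  unfolding BC_carrier by (auto simp: BC_add BC_smult FA_closed frag_mult_simps simp del: carrier_free_Abelian_group_iff)

end

locale base_change_map = base_change_data R B M + N: abelian_group N
  for R :: "('r, 'k) ring_scheme" and B :: "('r, 'b) module" and M :: "('r, 'a) module" and N :: "('b, 'c) module" +
  fixes \<phi> :: "'a \<Rightarrow> 'c"
  assumes N_smult: "b \<in> carrier B \<Longrightarrow> n \<in> carrier N \<Longrightarrow> b \<odot>\<^bsub>N\<^esub> n \<in> carrier N"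
    and N_smult_add: "b \<in> carrier B \<Longrightarrow> n \<in> carrier N \<Longrightarrow> n' \<in> carrier N \<Longrightarrow> b \<odot>\<^bsub>N\<^esub> (n \<oplus>\<^bsub>N\<^esub> n') = b \<odot>\<^bsub>N\<^esub> n \<oplus>\<^bsub>N\<^esub> b \<odot>\<^bsub>N\<^esub> n'"
    and \<phi>_closed: "m \<in> carrier M \<Longrightarrow> \<phi> m \<in> carrier N"
    and \<phi>_add: "m \<in> carrier M \<Longrightarrow> m' \<in> carrier M \<Longrightarrow> \<phi> (m \<oplus>\<^bsub>M\<^esub> m') = \<phi> m \<oplus>\<^bsub>N\<^esub> \<phi> m'"
    and \<phi>_distr: "b \<in> carrier B \<Longrightarrow> b' \<in> carrier B \<Longrightarrow> m \<in> carrier M \<Longrightarrow> (b \<oplus>\<^bsub>B\<^esub> b') \<odot>\<^bsub>N\<^esub> \<phi> m = b \<odot>\<^bsub>N\<^esub> \<phi> m \<oplus>\<^bsub>N\<^esub> b' \<odot>\<^bsub>N\<^esub> \<phi> m"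
    and \<phi>_smult: "r \<in> carrier R \<Longrightarrow> b \<in> carrier B \<Longrightarrow> m \<in> carrier M \<Longrightarrow> (r \<odot>\<^bsub>B\<^esub> b) \<odot>\<^bsub>N\<^esub> \<phi> m = b \<odot>\<^bsub>N\<^esub> \<phi> (r \<odot>\<^bsub>M\<^esub> m)"
begin

abbreviation "lift \<equiv> base_change_lift N \<phi>"

definition psi :: "'b \<times> 'a \<Rightarrow> 'c" where "psi p = fst p \<odot>\<^bsub>N\<^esub> \<phi> (snd p)"

definition frag_eval :: "('b \<times> 'a \<Rightarrow>\<^sub>0 int) \<Rightarrow> 'c" where
  "frag_eval F = (\<Oplus>\<^bsub>N\<^esub>p\<in>Poly_Mapping.keys F. [Poly_Mapping.lookup F p] \<cdot>\<^bsub>N\<^esub> psi p)"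

lemma psi_closed: "p \<in> pairs \<Longrightarrow> psi p \<in> carrier N"
  by (auto simp: psi_def N_smult \<phi>_closed)

lemma frag_eval_superset:
  assumes "finite T" "Poly_Mapping.keys F \<subseteq> T" "T \<subseteq> pairs"
  shows "frag_eval F = (\<Oplus>\<^bsub>N\<^esub>p\<in>T. [Poly_Mapping.lookup F p] \<cdot>\<^bsub>N\<^esub> psi p)"
  unfolding frag_eval_def
proof (rule N.add.finprod_mono_neutral_cong_left)
  show "[poly_mapping.lookup F i] \<cdot>\<^bsub>N\<^esub> psi i = \<zero>\<^bsub>N\<^esub>" if "i \<in> T - Poly_Mapping.keys F" for i
    using that assms psi_closed[of i] N.add_pow_int_simps(1)[of "psi i"] by (auto simp: in_keys_iff)
qed (use assms psi_closed N.add_pow_int_simps(3) in auto)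

lemma frag_eval_closed: "F \<in> carrier FA \<Longrightarrow> frag_eval F \<in> carrier N"
  unfolding frag_eval_def by (intro N.finsum_closed) (use psi_closed N.add_pow_int_simps(3) in auto)

lemma frag_eval_add:
  assumes "F \<in> carrier FA" "G \<in> carrier FA" shows "frag_eval (F + G) = frag_eval F \<oplus>\<^bsub>N\<^esub> frag_eval G"
proof -
  let ?T = "Poly_Mapping.keys F \<union> Poly_Mapping.keys G"
  have T: "finite ?T" "?T \<subseteq> pairs" using assms by auto
  have "frag_eval (F + G) = (\<Oplus>\<^bsub>N\<^esub>p\<in>?T. [Poly_Mapping.lookup F p] \<cdot>\<^bsub>N\<^esub> psi p \<oplus>\<^bsub>N\<^esub> [Poly_Mapping.lookup G p] \<cdot>\<^bsub>N\<^esub> psi p)"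
    unfolding frag_eval_superset[OF T(1) keys_add T(2)]
    by (intro N.finsum_cong') (use T psi_closed N.add_pow_int_simps in \<open>auto simp: lookup_add\<close>)
  also have "\<dots> = frag_eval F \<oplus>\<^bsub>N\<^esub> frag_eval G"
    unfolding frag_eval_superset[OF T(1) Un_upper1 T(2)] frag_eval_superset[OF T(1) Un_upper2 T(2)]
    by (intro N.finsum_addf) (use T psi_closed N.add_pow_int_simps(3) in auto)
  finally show ?thesis .
qed

lemma frag_eval_of: "p \<in> pairs \<Longrightarrow> frag_eval (frag_of p) = psi p"
  unfolding frag_eval_def using psi_closed[of p] N.add_pow_int_simps(2)[of "psi p"]
  by (simp add: N.finsum_insert)

lemma frag_eval_hom: "group_hom FA (add_monoid N) frag_eval"
  by (intro group_hom.intro group_hom_axioms.intro homI)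
     (auto simp: N.a_group frag_eval_add frag_eval_closed simp del: carrier_free_Abelian_group_iff)

lemma frag_eval_simps: "frag_eval 0 = \<zero>\<^bsub>N\<^esub>" "F \<in> carrier FA \<Longrightarrow> frag_eval (- F) = \<ominus>\<^bsub>N\<^esub> frag_eval F"
  "F \<in> carrier FA \<Longrightarrow> G \<in> carrier FA \<Longrightarrow> frag_eval (F - G) = frag_eval F \<ominus>\<^bsub>N\<^esub> frag_eval G"
proof -
  show "frag_eval 0 = \<zero>\<^bsub>N\<^esub>" using group_hom.hom_one[OF frag_eval_hom] by simp
  show *: "frag_eval (- F) = \<ominus>\<^bsub>N\<^esub> frag_eval F" if "F \<in> carrier FA" for F
    using group_hom.hom_inv[OF frag_eval_hom that] that by (simp add: a_inv_def)
  show "F \<in> carrier FA \<Longrightarrow> G \<in> carrier FA \<Longrightarrow> frag_eval (F - G) = frag_eval F \<ominus>\<^bsub>N\<^esub> frag_eval G"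
    using frag_eval_add[of F "- G"] FA_closed(3)[of G] *[of G] by (simp add: a_minus_def del: carrier_free_Abelian_group_iff)
qed

text \<open>
  The three groups of relations are sent to zero by the additivity of the action, the additivity of \<open>\<phi>\<close>
  and the linearity \<open>\<phi>_smult\<close>.
\<close>

lemma frag_eval_null: assumes "F \<in> null" shows "frag_eval F = \<zero>\<^bsub>N\<^esub>"
proof -
  have c: "frag_of p \<in> carrier FA" "frag_of p - frag_of q \<in> carrier FA" if "p \<in> pairs" "q \<in> pairs" for p q
    using that FA_closed(4)[of "frag_of p" "frag_of q"] by auto
  have "tensor_relations R B M \<subseteq> kernel FA (add_monoid N) frag_eval"
  proof
    fix F assume F: "F \<in> tensor_relations R B M"
    note s = frag_eval_simps(3) frag_eval_of c B_add M_add B_smult M_smult psi_def \<phi>_distr \<phi>_add \<phi>_smult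
      N_smult N_smult_add \<phi>_closed
    from F have "frag_eval F = \<zero>\<^bsub>N\<^esub>"
    proof (cases rule: relations_cases)
      case (left b b' m)
      then show ?thesis
        by (simp add: s N.r_neg N.a_ac a_minus_def N.r_neg1 N.r_neg2 del: carrier_free_Abelian_group_iff)
    next
      case (right b m m')
      then show ?thesis
        by (simp add: s N.r_neg N.a_ac a_minus_def N.r_neg1 N.r_neg2 del: carrier_free_Abelian_group_iff)
    next
      case (scalar r b m)
      then show ?thesis
        by (simp add: s N.r_neg a_minus_def del: carrier_free_Abelian_group_iff)
    qed
    then show "F \<in> kernel FA (add_monoid N) frag_eval"
      using subsetD[OF relations_subset F] by (simp add: kernel_def del: carrier_free_Abelian_group_iff)
  qed
  then have "null \<subseteq> kernel FA (add_monoid N) frag_eval"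
    unfolding tensor_null_def[of R B M]
    by (rule group.generate_subgroup_incl[OF group_free_Abelian_group _ group_hom.subgroup_kernel[OF frag_eval_hom]])
  then show ?thesis using assms by (auto simp: kernel_def)
qed

lemma lift_cls: assumes F: "F \<in> carrier FA" shows "lift (cls F) = frag_eval F"
proof -
  have "frag_eval ` cls F = {frag_eval F}"
  proof -
    have "frag_eval G = frag_eval F" if "G \<in> cls F" for G
    proof -
      have n: "G - F \<in> null" using that by (simp add: cls_mem)
      have "frag_eval ((G - F) + F) = frag_eval (G - F) \<oplus>\<^bsub>N\<^esub> frag_eval F"
        by (rule frag_eval_add[OF null_closed(4)[OF n] F])
      then show ?thesis using frag_eval_null[OF n] frag_eval_closed[OF F] by simp
    qed
    moreover have "F \<in> cls F" by (simp add: cls_mem null_closed)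
    ultimately show ?thesis by blast
  qed
  then show ?thesis unfolding base_change_lift_def frag_eval_def[abs_def] psi_def by simp
qed

lemma lift_gen: "b \<in> carrier B \<Longrightarrow> m \<in> carrier M \<Longrightarrow> lift (gen b m) = b \<odot>\<^bsub>N\<^esub> \<phi> m"
  unfolding gen_def by (simp add: lift_cls frag_eval_of psi_def)

lemma lift_closed: "u \<in> carrier BC \<Longrightarrow> lift u \<in> carrier N"
  unfolding BC_carrier by (auto simp: lift_cls frag_eval_closed simp del: carrier_free_Abelian_group_iff)

lemma lift_add: "u \<in> carrier BC \<Longrightarrow> v \<in> carrier BC \<Longrightarrow> lift (u \<oplus>\<^bsub>BC\<^esub> v) = lift u \<oplus>\<^bsub>N\<^esub> lift v"
  unfolding BC_carrier
  by (auto simp: BC_add lift_cls frag_eval_add FA_closed simp del: carrier_free_Abelian_group_iff)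

lemma lift_zero: "lift \<zero>\<^bsub>BC\<^esub> = \<zero>\<^bsub>N\<^esub>"
  unfolding BC_zero using lift_cls[OF FA_closed(1)] frag_eval_simps(1) by simp

lemma lift_diff: "u \<in> carrier BC \<Longrightarrow> v \<in> carrier BC \<Longrightarrow> lift (u \<ominus>\<^bsub>BC\<^esub> v) = lift u \<ominus>\<^bsub>N\<^esub> lift v"
  unfolding BC_carrier
  by (auto simp: a_minus_def BC_a_inv BC_add lift_cls frag_eval_add frag_eval_simps FA_closed simp del: carrier_free_Abelian_group_iff)

end

section \<open>Localization by an additive operator\<close>

text \<open>
  The last assumption is the commutation rule \<open>g \<partial>\<^sub>t\<^sup>-\<^sup>1 = \<partial>\<^sub>t\<^sup>-\<^sup>1 g + \<partial>\<^sub>t\<^sup>-\<^sup>1 g' \<partial>\<^sub>t\<^sup>-\<^sup>1\<close>, equivalent to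
  \<open>g \<partial>\<^sub>t = \<partial>\<^sub>t g - g'\<close>.
\<close>

locale dt_module = abelian_group M for M :: "(complex fps, 'a) module" (structure) +
  fixes s :: "'a \<Rightarrow> 'a" and S :: "complex fps set"
  assumes s_closed [intro, simp]: "m \<in> carrier M \<Longrightarrow> s m \<in> carrier M"
    and s_add: "m \<in> carrier M \<Longrightarrow> m' \<in> carrier M \<Longrightarrow> s (m \<oplus> m') = s m \<oplus> s m'"
    and s_inj: "m \<in> carrier M \<Longrightarrow> m' \<in> carrier M \<Longrightarrow> s m = s m' \<Longrightarrow> m = m'"
    and S_add: "g \<in> S \<Longrightarrow> h \<in> S \<Longrightarrow> g + h \<in> S" and S_mult: "g \<in> S \<Longrightarrow> h \<in> S \<Longrightarrow> g * h \<in> S"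
    and S_deriv: "g \<in> S \<Longrightarrow> fps_deriv g \<in> S"
    and smult_closed [intro, simp]: "g \<in> S \<Longrightarrow> m \<in> carrier M \<Longrightarrow> g \<odot> m \<in> carrier M"
    and smult_add: "g \<in> S \<Longrightarrow> m \<in> carrier M \<Longrightarrow> m' \<in> carrier M \<Longrightarrow> g \<odot> (m \<oplus> m') = g \<odot> m \<oplus> g \<odot> m'"
    and smult_add_left: "g \<in> S \<Longrightarrow> h \<in> S \<Longrightarrow> m \<in> carrier M \<Longrightarrow> (g + h) \<odot> m = g \<odot> m \<oplus> h \<odot> m"
    and smult_assoc: "g \<in> S \<Longrightarrow> h \<in> S \<Longrightarrow> m \<in> carrier M \<Longrightarrow> (g * h) \<odot> m = g \<odot> (h \<odot> m)"
    and smult_s: "g \<in> S \<Longrightarrow> m \<in> carrier M \<Longrightarrow> g \<odot> s m = s (g \<odot> m \<oplus> fps_deriv g \<odot> s m)"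
begin

lemma pow_closed [intro, simp]: "m \<in> carrier M \<Longrightarrow> (s ^^ k) m \<in> carrier M"
  by (induction k) auto

lemma pow_add: "m \<in> carrier M \<Longrightarrow> m' \<in> carrier M \<Longrightarrow> (s ^^ k) (m \<oplus> m') = (s ^^ k) m \<oplus> (s ^^ k) m'"
  by (induction k) (auto simp: s_add)

lemma pow_inj: "m \<in> carrier M \<Longrightarrow> m' \<in> carrier M \<Longrightarrow> (s ^^ k) m = (s ^^ k) m' \<Longrightarrow> m = m'"
  by (induction k) (auto dest: s_inj[rotated 2])

lemma pow_pow: "(s ^^ k) ((s ^^ l) m) = (s ^^ (k + l)) m"
  by (simp add: funpow_add)

lemma s_zero [simp]: "s \<zero> = \<zero>"
  using s_add[of \<zero> \<zero>] by simp

lemma s_uminus: "m \<in> carrier M \<Longrightarrow> s (\<ominus> m) = \<ominus> s m"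
  using s_add[of "\<ominus> m" m] minus_equality[of "s (\<ominus> m)" "s m"] by (simp add: l_neg)

lemma pow_zero [simp]: "(s ^^ k) \<zero> = \<zero>"
  by (induction k) auto

lemma smult_uminus: "g \<in> S \<Longrightarrow> m \<in> carrier M \<Longrightarrow> g \<odot> (\<ominus> m) = \<ominus> (g \<odot> m)"
proof -
  assume gm: "g \<in> S" "m \<in> carrier M"
  have "g \<odot> \<zero> = \<zero>" using smult_add[of g \<zero> \<zero>] gm by simp
  then show ?thesis
    using smult_add[of g "\<ominus> m" m] minus_equality[of "g \<odot> (\<ominus> m)" "g \<odot> m"] gm by (simp add: l_neg)
qed

text \<open>
  The operator with \<open>g \<partial>\<^sub>t\<^sup>k = \<partial>\<^sub>t\<^sup>k (act g k)\<close>, obtained by moving \<open>g\<close> past one \<open>\<partial>\<^sub>t\<close> at a time; \<open>act_eq_bsum\<close>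
  solves the recursion by a binomial sum.
\<close>

fun act :: "complex fps \<Rightarrow> nat \<Rightarrow> 'a \<Rightarrow> 'a" where
  "act g 0 m = g \<odot> m"
| "act g (Suc k) m = act g k m \<ominus> s (act (fps_deriv g) k m)"

lemma act_closed [intro, simp]: "g \<in> S \<Longrightarrow> m \<in> carrier M \<Longrightarrow> act g k m \<in> carrier M"
  by (induction k arbitrary: g) (auto simp: S_deriv)

lemma diff_add_diff:
  assumes "a \<in> carrier M" "b \<in> carrier M" "c \<in> carrier M" "d \<in> carrier M"
  shows "(a \<oplus> b) \<ominus> (c \<oplus> d) = (a \<ominus> c) \<oplus> (b \<ominus> d)"
  using assms by (simp add: a_minus_def minus_add a_ac)

lemma act_add: "g \<in> S \<Longrightarrow> m \<in> carrier M \<Longrightarrow> m' \<in> carrier M \<Longrightarrow> act g k (m \<oplus> m') = act g k m \<oplus> act g k m'"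
  by (induction k arbitrary: g) (auto simp: smult_add S_deriv s_add diff_add_diff)

lemma act_uminus: "g \<in> S \<Longrightarrow> m \<in> carrier M \<Longrightarrow> act g k (\<ominus> m) = \<ominus> act g k m"
  by (induction k arbitrary: g) (auto simp: smult_uminus S_deriv s_uminus a_minus_def minus_add)

lemma act_add_left: "g \<in> S \<Longrightarrow> h \<in> S \<Longrightarrow> m \<in> carrier M \<Longrightarrow> act (g + h) k m = act g k m \<oplus> act h k m"
  by (induction k arbitrary: g h) (auto simp: smult_add_left S_deriv s_add diff_add_diff)

text \<open>
  The fractions \<open>(m, k)\<close> and \<open>(s m, k + 1)\<close> are equal; this makes the action on fractions well defined.
\<close>

lemma act_Suc_s: "g \<in> S \<Longrightarrow> m \<in> carrier M \<Longrightarrow> act g (Suc k) (s m) = s (act g k m)"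
proof (induction k arbitrary: g)
  case 0
  then have "act g (Suc 0) (s m) = (s (g \<odot> m) \<oplus> s (fps_deriv g \<odot> s m)) \<ominus> s (fps_deriv g \<odot> s m)"
    by (simp add: smult_s[of g] s_add S_deriv)
  then show ?case using 0 by (simp add: a_minus_def a_assoc r_neg S_deriv)
next
  case (Suc k)
  then show ?case
    by (subst act.simps(2), subst (1 2) Suc.IH) (auto simp: S_deriv s_add s_uminus a_minus_def)
qed

lemma act_mult: "g \<in> S \<Longrightarrow> h \<in> S \<Longrightarrow> m \<in> carrier M \<Longrightarrow> act (g * h) k m = act g k (act h k m)"
proof (induction k arbitrary: g h)
  case 0
  then show ?case by (simp add: smult_assoc)
next
  case (Suc k)
  note c = S_deriv S_mult S_add Suc.prems
  have "act g (Suc k) (act h (Suc k) m) = act g (Suc k) (act h k m) \<oplus> \<ominus> act g (Suc k) (s (act (fps_deriv h) k m))"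
    unfolding act.simps(2)[of h] a_minus_def using c by (subst act_add) (auto simp: act_uminus simp del: act.simps)
  also have "\<dots> = (act g k (act h k m) \<ominus> s (act (fps_deriv g) k (act h k m))) \<oplus> \<ominus> s (act g k (act (fps_deriv h) k m))"
    using c by (simp only: act_Suc_s act_closed) simp
  also have "\<dots> = act (g * h) k m \<ominus> (s (act (fps_deriv g * h) k m) \<oplus> s (act (g * fps_deriv h) k m))"
    using c by (simp add: Suc.IH a_minus_def minus_add a_assoc)
  also have "\<dots> = act (g * h) k m \<ominus> s (act (fps_deriv (g * h)) k m)"
    using c by (simp add: act_add_left s_add a_comm)
  finally show ?case by simp
qed

lemma s_pow_int: "m \<in> carrier M \<Longrightarrow> s ([(a::int)] \<cdot> m) = [a] \<cdot> s m"
proof -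
  assume m: "m \<in> carrier M"
  have "s \<in> hom (add_monoid M) (add_monoid M)" by (auto simp: hom_def s_add)
  then interpret h: group_hom "add_monoid M" "add_monoid M" s
    using a_group by (auto simp: group_hom_def group_hom_axioms_def)
  show ?thesis using h.hom_int_pow[of m a] m by (simp add: add_pow_def)
qed

lemma s_finsum: "finite A \<Longrightarrow> f \<in> A \<rightarrow> carrier M \<Longrightarrow> s (finsum M f A) = finsum M (\<lambda>i. s (f i)) A"
  by (induction A rule: finite_induct) (auto simp: s_add Pi_def)

lemma add_pow_int:
  "x \<in> carrier M \<Longrightarrow> [(0::int)] \<cdot> x = \<zero>" "x \<in> carrier M \<Longrightarrow> [(1::int)] \<cdot> x = x"
  "x \<in> carrier M \<Longrightarrow> [(a::int)] \<cdot> x \<in> carrier M"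
  "x \<in> carrier M \<Longrightarrow> [(a + b::int)] \<cdot> x = [a] \<cdot> x \<oplus> [b] \<cdot> x"
  "x \<in> carrier M \<Longrightarrow> [(- a::int)] \<cdot> x = \<ominus> ([a] \<cdot> x)"
  using add.int_pow_closed[of x a] add.int_pow_mult[of x a b] add.int_pow_neg[of x a]
    add.int_pow_1[of x] int_pow_0[of "add_monoid M" x] a_inv_def
  by (auto simp: add_pow_def)

lemma finsum_uminus: "finite A \<Longrightarrow> f \<in> A \<rightarrow> carrier M \<Longrightarrow> finsum M (\<lambda>i. \<ominus> f i) A = \<ominus> finsum M f A"
  by (induction A rule: finite_induct) (auto simp: Pi_def minus_add minus_equality[of \<zero> \<zero>])

abbreviation bsum :: "nat \<Rightarrow> (nat \<Rightarrow> 'a) \<Rightarrow> 'a" where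
  "bsum k a \<equiv> (\<Oplus>i\<in>{..k}. [((- 1) ^ i * int (k choose i))] \<cdot> a i)"

lemma bsum_Suc:
  assumes a: "\<And>i. a i \<in> carrier M"
  shows "bsum (Suc k) a = bsum k a \<ominus> bsum k (\<lambda>i. a (Suc i))"
proof -
  define c where "c k i = (- 1) ^ i * int (k choose i)" for k i
  have cS: "c (Suc k) (Suc i) = c k (Suc i) + - c k i" for i by (simp add: c_def algebra_simps)
  have c0: "c (Suc k) 0 = c k 0" "c k (Suc k) = 0" by (auto simp: c_def)
  have cl: "[c k i] \<cdot> a j \<in> carrier M" for k i j using add_pow_int(3)[OF a] .
  have "(\<Oplus>i\<in>{..Suc k}. [c (Suc k) i] \<cdot> a i) = (\<Oplus>i\<in>{..k}. [c (Suc k) (Suc i)] \<cdot> a (Suc i)) \<oplus> [c (Suc k) 0] \<cdot> a 0"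
    by (rule finsum_Suc2) (use cl in auto)
  also have "(\<Oplus>i\<in>{..k}. [c (Suc k) (Suc i)] \<cdot> a (Suc i)) = (\<Oplus>i\<in>{..k}. [c k (Suc i)] \<cdot> a (Suc i) \<oplus> \<ominus> ([c k i] \<cdot> a (Suc i)))"
  proof (rule finsum_cong')
    show "[c (Suc k) (Suc i)] \<cdot> a (Suc i) = [c k (Suc i)] \<cdot> a (Suc i) \<oplus> \<ominus> ([c k i] \<cdot> a (Suc i))" for i
      unfolding cS by (simp only: add_pow_int[OF a])
  qed (use cl in auto)
  also have "\<dots> = (\<Oplus>i\<in>{..k}. [c k (Suc i)] \<cdot> a (Suc i)) \<oplus> \<ominus> (\<Oplus>i\<in>{..k}. [c k i] \<cdot> a (Suc i))"
    using cl by (subst finsum_addf) (auto simp: finsum_uminus)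
  finally have 1: "(\<Oplus>i\<in>{..Suc k}. [c (Suc k) i] \<cdot> a i) =
    (\<Oplus>i\<in>{..k}. [c k (Suc i)] \<cdot> a (Suc i)) \<oplus> \<ominus> (\<Oplus>i\<in>{..k}. [c k i] \<cdot> a (Suc i)) \<oplus> [c k 0] \<cdot> a 0" by (simp add: c0)
  have "(\<Oplus>i\<in>{..Suc k}. [c k i] \<cdot> a i) = (\<Oplus>i\<in>{..k}. [c k (Suc i)] \<cdot> a (Suc i)) \<oplus> [c k 0] \<cdot> a 0"
    by (rule finsum_Suc2) (use cl in auto)
  moreover have "(\<Oplus>i\<in>{..Suc k}. [c k i] \<cdot> a i) = [c k (Suc k)] \<cdot> a (Suc k) \<oplus> (\<Oplus>i\<in>{..k}. [c k i] \<cdot> a i)"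
    by (rule finsum_Suc) (use cl in auto)
  ultimately have 2: "(\<Oplus>i\<in>{..k}. [c k i] \<cdot> a i) = (\<Oplus>i\<in>{..k}. [c k (Suc i)] \<cdot> a (Suc i)) \<oplus> [c k 0] \<cdot> a 0"
    using cl a by (simp add: c0 add_pow_int)
  show ?thesis
    using 1 unfolding c_def[symmetric] 2 using cl by (simp add: a_minus_def a_ac finsum_closed Pi_def)
qed

lemma act_eq_bsum: "g \<in> S \<Longrightarrow> m \<in> carrier M \<Longrightarrow> act g k m = bsum k (\<lambda>i. (s ^^ i) ((fps_deriv ^^ i) g \<odot> m))"
proof (induction k arbitrary: g)
  case 0
  then show ?case by (simp add: add_pow_int)
next
  case (Suc k)
  have Sd: "(fps_deriv ^^ i) g \<in> S" for i using Suc.prems(1) by (induction i) (auto simp: S_deriv)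
  define a where "a = (\<lambda>i. (s ^^ i) ((fps_deriv ^^ i) g \<odot> m))"
  have ac: "a i \<in> carrier M" for i using Sd Suc.prems by (auto simp: a_def)
  have a': "a (Suc i) = s ((s ^^ i) ((fps_deriv ^^ i) (fps_deriv g) \<odot> m))" for i
    by (simp add: a_def funpow_swap1)
  have c: "(s ^^ i) ((fps_deriv ^^ i) (fps_deriv g) \<odot> m) \<in> carrier M" for i
    using Sd[of "Suc i"] Suc.prems by (auto simp: funpow_swap1)
  have "act g (Suc k) m = bsum k a \<ominus> s (bsum k (\<lambda>i. (s ^^ i) ((fps_deriv ^^ i) (fps_deriv g) \<odot> m)))"
    using Suc.IH[of g] Suc.IH[of "fps_deriv g"] Suc.prems by (simp add: S_deriv a_def)
  also have "s (bsum k (\<lambda>i. (s ^^ i) ((fps_deriv ^^ i) (fps_deriv g) \<odot> m))) = bsum k (\<lambda>i. a (Suc i))"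
    unfolding a' using c by (subst s_finsum) (auto simp: s_pow_int add_pow_int)
  finally show ?case using bsum_Suc[of a k, OF ac] by (simp only: a_def)
qed

abbreviation "L \<equiv> dt_localization M s"
abbreviation "cls \<equiv> dt_class M s"

text \<open>
  As \<open>s\<close> is injective, the powers of \<open>s\<close> common to both sides can be cancelled.
\<close>

lemma dt_rel_iff: "((m, k), (m', k')) \<in> dt_rel M s \<longleftrightarrow> m \<in> carrier M \<and> m' \<in> carrier M \<and> (s ^^ k') m = (s ^^ k) m'"
proof -
  have "(\<exists>l. (s ^^ (l + k')) m = (s ^^ (l + k)) m') \<longleftrightarrow> (s ^^ k') m = (s ^^ k) m'" if "m \<in> carrier M" "m' \<in> carrier M"
  proof
    assume "\<exists>l. (s ^^ (l + k')) m = (s ^^ (l + k)) m'"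
    then obtain l where "(s ^^ l) ((s ^^ k') m) = (s ^^ l) ((s ^^ k) m')" by (auto simp: funpow_add)
    then show "(s ^^ k') m = (s ^^ k) m'" by (rule pow_inj[rotated 2]) (use that in auto)
  qed (auto intro: exI[of _ 0])
  then show ?thesis unfolding dt_rel_def by auto
qed

lemma dt_rel_equiv: "equiv (carrier M \<times> UNIV) (dt_rel M s)"
proof (rule equivI)
  show "dt_rel M s \<subseteq> (carrier M \<times> UNIV) \<times> (carrier M \<times> UNIV)" by (auto simp: dt_rel_def)
  show "refl_on (carrier M \<times> UNIV) (dt_rel M s)" by (auto simp: refl_on_def dt_rel_iff)
  show "sym (dt_rel M s)" by (auto simp: sym_def dt_rel_iff)
  show "trans (dt_rel M s)"
  proof (rule transI)
    fix x y z assume "(x, y) \<in> dt_rel M s" "(y, z) \<in> dt_rel M s"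
    moreover obtain m k m' k' m'' k'' where "x = (m, k)" "y = (m', k')" "z = (m'', k'')" by (metis surj_pair)
    ultimately have *: "m \<in> carrier M" "m' \<in> carrier M" "m'' \<in> carrier M" "(s ^^ k') m = (s ^^ k) m'" "(s ^^ k'') m' = (s ^^ k') m''"
       and xyz: "x = (m, k)" "z = (m'', k'')"
      by (auto simp: dt_rel_iff)
    have "(s ^^ k') ((s ^^ k'') m) = (s ^^ k'') ((s ^^ k') m)" by (simp add: pow_pow add.commute)
    also have "\<dots> = (s ^^ k) ((s ^^ k'') m')" unfolding *(4) by (simp add: pow_pow add.commute)
    also have "\<dots> = (s ^^ k') ((s ^^ k) m'')" unfolding *(5) by (simp add: pow_pow add.commute)
    finally have "(s ^^ k'') m = (s ^^ k) m''" by (rule pow_inj[rotated 2]) (use * in auto)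
    then show "(x, z) \<in> dt_rel M s" using * xyz by (simp add: dt_rel_iff)
  qed
qed

lemma cls_eq: "m \<in> carrier M \<Longrightarrow> m' \<in> carrier M \<Longrightarrow> cls m k = cls m' k' \<longleftrightarrow> (s ^^ k') m = (s ^^ k) m'"
  unfolding dt_class_def using eq_equiv_class_iff[OF dt_rel_equiv, of "(m, k)" "(m', k')"] by (simp add: dt_rel_iff)

lemma cls_mem: "m \<in> carrier M \<Longrightarrow> (m', k') \<in> cls m k \<longleftrightarrow> m' \<in> carrier M \<and> cls m' k' = cls m k"
proof -
  assume m: "m \<in> carrier M"
  have 1: "(m', k') \<in> cls m k \<longleftrightarrow> ((m, k), (m', k')) \<in> dt_rel M s" by (simp add: dt_class_def)
  show ?thesis unfolding 1 dt_rel_iff using cls_eq[of m' m k' k] m by auto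
qed

lemma L_carrier: "carrier L = {cls m k |m k. m \<in> carrier M}"
  by (auto simp: dt_localization_def quotient_def dt_class_def)

lemma cls_closed: "m \<in> carrier M \<Longrightarrow> cls m k \<in> carrier L"
  unfolding L_carrier by blast

lemma L_zero: "\<zero>\<^bsub>L\<^esub> = cls \<zero> 0" by (simp add: dt_localization_def)

lemma cls_shift: "m \<in> carrier M \<Longrightarrow> cls ((s ^^ l) m) (l + k) = cls m k"
  by (subst cls_eq) (auto simp: pow_pow add.commute)

lemma cls_zero: "cls \<zero> k = \<zero>\<^bsub>L\<^esub>"
  unfolding L_zero by (subst cls_eq) auto

lemma cls_eq_zero: "m \<in> carrier M \<Longrightarrow> cls m k = \<zero>\<^bsub>L\<^esub> \<longleftrightarrow> m = \<zero>"
  unfolding L_zero by (subst cls_eq) auto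

lemma L_add_gen:
  assumes m: "m \<in> carrier M" "m' \<in> carrier M"
  shows "cls m k \<oplus>\<^bsub>L\<^esub> cls m' k' = cls ((s ^^ k') m \<oplus> (s ^^ k) m') (k + k')"
proof -
  have *: "cls ((s ^^ l') n \<oplus> (s ^^ l) n') (l + l') = cls ((s ^^ k') m \<oplus> (s ^^ k) m') (k + k')"
    if "(n, l) \<in> cls m k" "(n', l') \<in> cls m' k'" for n l n' l'
  proof -
    from that m have n: "n \<in> carrier M" "n' \<in> carrier M" "(s ^^ k) n = (s ^^ l) m" "(s ^^ k') n' = (s ^^ l') m'"
      by (auto simp: cls_mem cls_eq)
    have "(s ^^ (k + k')) ((s ^^ l') n) = (s ^^ (k' + l')) ((s ^^ k) n)"
      by (simp add: pow_pow algebra_simps)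
    also have "\<dots> = (s ^^ (l + l')) ((s ^^ k') m)" unfolding n(3) by (simp add: pow_pow algebra_simps)
    finally have 1: "(s ^^ (k + k')) ((s ^^ l') n) = (s ^^ (l + l')) ((s ^^ k') m)" .
    have "(s ^^ (k + k')) ((s ^^ l) n') = (s ^^ (k + l)) ((s ^^ k') n')"
      by (simp add: pow_pow algebra_simps)
    also have "\<dots> = (s ^^ (l + l')) ((s ^^ k) m')" unfolding n(4) by (simp add: pow_pow algebra_simps)
    finally have 2: "(s ^^ (k + k')) ((s ^^ l) n') = (s ^^ (l + l')) ((s ^^ k) m')" .
    show ?thesis using n m by (subst cls_eq) (auto simp: pow_add 1 2)
  qed
  have "cls m k \<oplus>\<^bsub>L\<^esub> cls m' k' = (\<Union>(n, l)\<in>cls m k. \<Union>(n', l')\<in>cls m' k'. cls ((s ^^ l') n \<oplus> (s ^^ l) n') (l + l'))"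
    by (simp add: dt_localization_def)
  also have "\<dots> = (\<Union>p\<in>cls m k. \<Union>p'\<in>cls m' k'. cls ((s ^^ k') m \<oplus> (s ^^ k) m') (k + k'))"
    by (intro SUP_cong refl) (auto simp: * split: prod.splits)
  also have "\<dots> = cls ((s ^^ k') m \<oplus> (s ^^ k) m') (k + k')"
    using cls_mem[OF m(1), of m k k] cls_mem[OF m(2), of m' k' k'] m by auto
  finally show ?thesis .
qed

lemma L_add: "m \<in> carrier M \<Longrightarrow> m' \<in> carrier M \<Longrightarrow> cls m k \<oplus>\<^bsub>L\<^esub> cls m' k = cls (m \<oplus> m') k"
  using cls_shift[of "m \<oplus> m'" k k] by (simp add: L_add_gen pow_add)

lemma L_common:
  assumes "x \<in> carrier L" "y \<in> carrier L" "z \<in> carrier L"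
  obtains m m' m'' k where "x = cls m k" "y = cls m' k" "z = cls m'' k" "m \<in> carrier M" "m' \<in> carrier M" "m'' \<in> carrier M"
proof -
  from assms obtain m k m' k' m'' k'' where x: "x = cls m k" "y = cls m' k'" "z = cls m'' k''" and c: "m \<in> carrier M" "m' \<in> carrier M" "m'' \<in> carrier M"
    unfolding L_carrier by blast
  have "x = cls ((s ^^ (k' + k'')) m) (k + k' + k'')" "y = cls ((s ^^ (k + k'')) m') (k + k' + k'')" "z = cls ((s ^^ (k + k')) m'') (k + k' + k'')"
    unfolding x using c by (auto simp: cls_eq pow_pow add_ac)
  then show ?thesis by (rule that) (use c in auto)
qed

lemma L_abelian: "abelian_group L"
proof (rule abelian_groupI)
  fix x y assume xy: "x \<in> carrier L" "y \<in> carrier L"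
  then obtain m m' k where *: "x = cls m k" "y = cls m' k" "m \<in> carrier M" "m' \<in> carrier M" by (metis L_common)
  show "x \<oplus>\<^bsub>L\<^esub> y \<in> carrier L" "x \<oplus>\<^bsub>L\<^esub> y = y \<oplus>\<^bsub>L\<^esub> x" using * by (auto simp: L_add cls_closed a_comm)
next
  fix x y z assume "x \<in> carrier L" "y \<in> carrier L" "z \<in> carrier L"
  then obtain m m' m'' k where *: "x = cls m k" "y = cls m' k" "z = cls m'' k" "m \<in> carrier M" "m' \<in> carrier M" "m'' \<in> carrier M"
    by (rule L_common)
  then show "x \<oplus>\<^bsub>L\<^esub> y \<oplus>\<^bsub>L\<^esub> z = x \<oplus>\<^bsub>L\<^esub> (y \<oplus>\<^bsub>L\<^esub> z)" by (simp add: L_add a_assoc)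
next
  show "\<zero>\<^bsub>L\<^esub> \<in> carrier L" by (simp add: L_zero cls_closed)
  fix x assume "x \<in> carrier L"
  then obtain m k where x: "x = cls m k" "m \<in> carrier M" unfolding L_carrier by blast
  show "\<zero>\<^bsub>L\<^esub> \<oplus>\<^bsub>L\<^esub> x = x" unfolding x cls_zero[of k, symmetric] using x by (simp add: L_add)
  show "\<exists>y\<in>carrier L. y \<oplus>\<^bsub>L\<^esub> x = \<zero>\<^bsub>L\<^esub>"
    using x by (intro bexI[of _ "cls (\<ominus> m) k"]) (auto simp: L_add l_neg cls_zero cls_closed)
qed

lemma act_shift: "g \<in> S \<Longrightarrow> m \<in> carrier M \<Longrightarrow> act g (l + k) ((s ^^ l) m) = (s ^^ l) (act g k m)"
  by (induction l) (auto simp: act_Suc_s simp del: act.simps)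

lemma L_smult:
  assumes g: "g \<in> S" and m: "m \<in> carrier M"
  shows "g \<odot>\<^bsub>L\<^esub> cls m k = cls (act g k m) k"
proof -
  have *: "cls (\<Oplus>i\<in>{..l}. [((- 1) ^ i * int (l choose i))] \<cdot> (s ^^ i) ((fps_deriv ^^ i) g \<odot> n)) l = cls (act g k m) k" if "(n, l) \<in> cls m k" for n l
  proof -
    from that m have n: "n \<in> carrier M" "(s ^^ k) n = (s ^^ l) m" by (auto simp: cls_mem cls_eq)
    have "(s ^^ k) (act g l n) = act g (k + l) ((s ^^ k) n)" by (rule act_shift[OF g n(1), symmetric])
    also have "\<dots> = (s ^^ l) (act g k m)" unfolding n(2) using act_shift[OF g m, of l k] by (simp add: add.commute)
    finally have "cls (act g l n) l = cls (act g k m) k" using g n m by (subst cls_eq) auto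
    then show ?thesis using act_eq_bsum[OF g n(1), of l] by simp
  qed
  have "g \<odot>\<^bsub>L\<^esub> cls m k = (\<Union>(n, l)\<in>cls m k. cls (\<Oplus>i\<in>{..l}. [((- 1) ^ i * int (l choose i))] \<cdot> (s ^^ i) ((fps_deriv ^^ i) g \<odot> n)) l)"
    by (simp add: dt_localization_def)
  also have "\<dots> = (\<Union>p\<in>cls m k. cls (act g k m) k)"
    by (intro SUP_cong refl) (auto simp: * split: prod.splits)
  also have "\<dots> = cls (act g k m) k" using cls_mem[OF m, of m k k] m by auto
  finally show ?thesis .
qed

lemma L_smult_closed: "g \<in> S \<Longrightarrow> x \<in> carrier L \<Longrightarrow> g \<odot>\<^bsub>L\<^esub> x \<in> carrier L"
  unfolding L_carrier by (auto simp: L_smult) (use act_closed in blast)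

lemma L_smult_add: "g \<in> S \<Longrightarrow> x \<in> carrier L \<Longrightarrow> y \<in> carrier L \<Longrightarrow> g \<odot>\<^bsub>L\<^esub> (x \<oplus>\<^bsub>L\<^esub> y) = g \<odot>\<^bsub>L\<^esub> x \<oplus>\<^bsub>L\<^esub> g \<odot>\<^bsub>L\<^esub> y"
  by (rule L_common[of x y y]) (auto simp: L_add L_smult act_add)

lemma L_smult_add_left: "g \<in> S \<Longrightarrow> h \<in> S \<Longrightarrow> x \<in> carrier L \<Longrightarrow> (g + h) \<odot>\<^bsub>L\<^esub> x = g \<odot>\<^bsub>L\<^esub> x \<oplus>\<^bsub>L\<^esub> h \<odot>\<^bsub>L\<^esub> x"
  unfolding L_carrier by (auto simp: L_add L_smult act_add_left S_add)

lemma L_smult_assoc: "g \<in> S \<Longrightarrow> h \<in> S \<Longrightarrow> x \<in> carrier L \<Longrightarrow> (g * h) \<odot>\<^bsub>L\<^esub> x = g \<odot>\<^bsub>L\<^esub> (h \<odot>\<^bsub>L\<^esub> x)"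
  unfolding L_carrier by (auto simp: L_smult act_mult S_mult)

end

section \<open>The local Brieskorn lattice\<close>

abbreviation conv_fps :: "complex fps set" where "conv_fps \<equiv> {g. fps_conv_radius g > 0}"

lemma conv_fps_closed:
  "g \<in> conv_fps \<Longrightarrow> h \<in> conv_fps \<Longrightarrow> g + h \<in> conv_fps"
  "g \<in> conv_fps \<Longrightarrow> h \<in> conv_fps \<Longrightarrow> g * h \<in> conv_fps"
  "g \<in> conv_fps \<Longrightarrow> fps_deriv g \<in> conv_fps"
  "fps_of_poly p \<in> conv_fps" "1 \<in> conv_fps" "0 \<in> conv_fps"
proof -
  assume g: "g \<in> conv_fps"
  then show "fps_deriv g \<in> conv_fps" using fps_conv_radius_deriv[of g] by (auto intro: less_le_trans)
  assume h: "h \<in> conv_fps"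
  have "0 < min (fps_conv_radius g) (fps_conv_radius h)" using g h by simp
  then show "g + h \<in> conv_fps" "g * h \<in> conv_fps"
    using less_le_trans[OF _ fps_conv_radius_add[of g h]] less_le_trans[OF _ fps_conv_radius_mult[of g h]] by auto
qed auto

text \<open>
  The pullback \<open>g(f - f x)\<close> of a power series in \<open>t - f x\<close>.
\<close>

definition pull :: "('n::finite aff \<Rightarrow> complex) \<Rightarrow> 'n aff \<Rightarrow> complex fps \<Rightarrow> 'n aff \<Rightarrow> complex" where
  "pull f x g y = eval_fps g (f y - f x)"

lemma eventually_in_radius:
  assumes f: "holomorphic_near x f" and r: "r > (0 :: ereal)"
  shows "eventually (\<lambda>y. ereal (norm (f y - f x)) < r) (nhds x)"
proof -
  obtain d where d: "d > 0" "holo_on (ball x d) f" using f holomorphic_near_iff by blast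
  then have "isCont f x" using holo_on_continuous[OF d(2)] by (simp add: continuous_on_eq_continuous_at)
  obtain e where e: "e > 0" "ereal e < r" using r by (metis ereal_dense2 ereal_less(2))
  have "eventually (\<lambda>y. dist (f y) (f x) < e) (nhds x)"
    using \<open>isCont f x\<close> e(1) unfolding continuous_at_eps_delta eventually_nhds_metric
    by (auto simp: isCont_def tendsto_iff eventually_nhds_conv_at)
  then show ?thesis
    by (rule eventually_mono) (use e in \<open>auto simp: dist_norm intro: less_trans[of "ereal _" "ereal e"]\<close>)
qed

lemma pull_props:
  assumes f: "holomorphic_near x f" and g: "g \<in> conv_fps"
  shows pull_near: "holomorphic_near x (pull f x g)"
    and pull_df_wedge: "germ_eq x (df_wedge (pull f x g) \<omega>) (fmul (pull f x (fps_deriv g)) (df_wedge f \<omega>))"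
    and pull_add: "h \<in> conv_fps \<Longrightarrow> eventually (\<lambda>y. pull f x (g + h) y = pull f x g y + pull f x h y) (nhds x)"
    and pull_mult: "h \<in> conv_fps \<Longrightarrow> eventually (\<lambda>y. pull f x (g * h) y = pull f x g y * pull f x h y) (nhds x)"
proof -
  have rg: "fps_conv_radius g > 0" using g by simp
  obtain r where r: "r > 0" "holo_on (ball x r) f" using f holomorphic_near_iff by blast
  obtain d where d: "d > 0" "\<And>y. y \<in> ball x d \<Longrightarrow> ereal (norm (f y - f x)) < fps_conv_radius g"
    using eventually_in_radius[OF f rg] unfolding eventually_nhds_metric by (auto simp: dist_commute)
  have gr: "has_grad (pull f x g) (\<lambda>i. pull f x (fps_deriv g) y * partial i f y) y" if "y \<in> ball x (min r d)" for y
  proof -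
    have "has_grad (\<lambda>y. f y - f x) (\<lambda>i. partial i f y) y"
      using has_grad_add[OF holo_onD[OF r(2)] has_grad_const[of "- f x"], of y] that by simp
    moreover have "(eval_fps g has_field_derivative eval_fps (fps_deriv g) (f y - f x)) (at (f y - f x))"
      using has_field_derivative_eval_fps[of "f y - f x" g] d(2)[of y] that by (simp add: has_field_derivative_at_within)
    ultimately show ?thesis unfolding pull_def[abs_def] by (rule has_grad_comp)
  qed
  show "holomorphic_near x (pull f x g)"
    unfolding holomorphic_near_iff using r d by (intro exI[of _ "min r d"] conjI holo_onI[OF open_ball gr]) auto
  show "germ_eq x (df_wedge (pull f x g) \<omega>) (fmul (pull f x (fps_deriv g)) (df_wedge f \<omega>))"
    by (rule germ_eq_onI[of "min r d"])
       (use r d has_grad_partial[OF gr] in \<open>auto simp: df_wedge_def sum_distrib_left mult_ac\<close>)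
  assume h: "h \<in> conv_fps"
  then have rh: "fps_conv_radius h > 0" by simp
  show "eventually (\<lambda>y. pull f x (g + h) y = pull f x g y + pull f x h y) (nhds x)"
    using eventually_in_radius[OF f rg] eventually_in_radius[OF f rh]
    by eventually_elim (simp add: pull_def eval_fps_add)
  show "eventually (\<lambda>y. pull f x (g * h) y = pull f x g y * pull f x h y) (nhds x)"
    using eventually_in_radius[OF f rg] eventually_in_radius[OF f rh]
    by eventually_elim (simp add: pull_def eval_fps_mult)
qed

lemma pull_poly: "pull f x (fps_of_poly (pcompose p [:f x, 1:])) y = poly p (f y)"
  by (simp add: pull_def poly_pcompose)

locale local_lattice =
  fixes f :: "'n::{finite,linorder} aff \<Rightarrow> complex" and x :: "'n aff"
  assumes dim: "CARD('n) \<ge> 2" and iso: "isolated_at f x"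
begin

lemma f_near: "holomorphic_near x f" using iso by (simp add: isolated_at_def)

abbreviation "AF \<equiv> an_forms CARD('n) x"
abbreviation "p \<equiv> pull f x"

lemma degs: "Suc (CARD('n) - 1) = CARD('n)" "Suc (CARD('n) - 2) = CARD('n) - 1" using dim by auto

lemma ext_d_top: "\<eta> \<in> an_forms (CARD('n) - 1) x \<Longrightarrow> ext_d \<eta> \<in> AF" and df_wedge_top: "\<eta> \<in> an_forms (CARD('n) - 1) x \<Longrightarrow> df_wedge f \<eta> \<in> AF"
  and ext_d_sub: "\<eta> \<in> an_forms (CARD('n) - 2) x \<Longrightarrow> ext_d \<eta> \<in> an_forms (CARD('n) - 1) x"
  and df_wedge_sub: "\<eta> \<in> an_forms (CARD('n) - 2) x \<Longrightarrow> df_wedge f \<eta> \<in> an_forms (CARD('n) - 1) x"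
  using an_forms_ext_d[of \<eta> "CARD('n) - 1" x] an_forms_df_wedge[of \<eta> "CARD('n) - 1" x f] f_near
    an_forms_ext_d[of \<eta> "CARD('n) - 2" x] an_forms_df_wedge[of \<eta> "CARD('n) - 2" x f] by (auto simp: degs)

lemma top_exact: "\<omega> \<in> AF \<Longrightarrow> \<exists>\<eta>\<in>an_forms (CARD('n) - 1) x. germ_eq x \<omega> (ext_d \<eta>)"
proof -
  assume w: "\<omega> \<in> AF"
  have "ext_d \<omega> J y = 0" for J y
  proof -
    have "\<omega> (J - {i}) = 0" if "i \<in> J" for i
    proof -
      have "card (J - {i}) < CARD('n)" by (rule psubset_card_mono) (use that in auto)
      then show ?thesis using w by (simp add: an_forms_def)
    qed
    then show ?thesis by (simp add: ext_d_def)
  qed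
  then have "germ_eq x (ext_d \<omega>) 0" by (simp add: germ_eq_def)
  from poincare_germ[OF w _ this] dim show ?thesis by (auto intro: germ_eq_sym)
qed

sublocale germs: module_quotient "null_forms x" "an_forms_module f x"
proof -
  have "abelian_subgroup (null_forms x) (an_forms_module f x)"
  proof (rule abelian_subgroup_of_class)
    fix \<omega> \<eta> assume "\<omega> \<in> null_forms x" "\<eta> \<in> null_forms x"
    then have w: "\<omega> \<in> AF" "\<eta> \<in> AF" "\<And>I. eventually (\<lambda>y. \<omega> I y = 0) (nhds x)" "\<And>I. eventually (\<lambda>y. \<eta> I y = 0) (nhds x)"
      by (auto simp: null_forms_def)
    have "eventually (\<lambda>y. \<omega> I y + \<eta> I y = 0) (nhds x)" for I
      using w(3)[of I] w(4)[of I] by eventually_elim simp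
    then show "\<omega> + \<eta> \<in> null_forms x" using w by (auto simp: null_forms_def intro: an_forms_add)
  qed (auto simp: an_forms_module_def null_forms_def intro: an_forms_add an_forms_uminus)
  then show "module_quotient (null_forms x) (an_forms_module f x)" by (simp add: module_quotient_def)
qed

lemma carrier_an: "carrier (an_forms_module f x) = AF" "\<omega> \<oplus>\<^bsub>an_forms_module f x\<^esub> \<eta> = \<omega> + \<eta>" "\<zero>\<^bsub>an_forms_module f x\<^esub> = 0"
  "g \<odot>\<^bsub>an_forms_module f x\<^esub> \<omega> = fmul (p g) \<omega>"
  by (auto simp: an_forms_module_def pull_def)

lemma an_minus: "\<omega> \<in> AF \<Longrightarrow> \<eta> \<in> AF \<Longrightarrow> \<omega> \<ominus>\<^bsub>an_forms_module f x\<^esub> \<eta> = \<omega> - \<eta>"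
  using abelian_group_of_class(2)[of "an_forms_module f x" \<eta>]
  by (simp add: a_minus_def an_forms_module_def an_forms_add an_forms_uminus)

lemma germ_eq_iff: assumes "\<omega> \<in> AF" "\<eta> \<in> AF" shows "germ f x \<omega> = germ f x \<eta> \<longleftrightarrow> germ_eq x \<omega> \<eta>"
proof -
  have "(\<forall>I. eventually (\<lambda>y. \<omega> I y - \<eta> I y = 0) (nhds x)) \<longleftrightarrow> germ_eq x \<omega> \<eta>"
    unfolding germ_eq_def by (auto simp: eventually_all_finite elim: eventually_mono)
  then show ?thesis unfolding germ_def using assms
    by (subst germs.quot_eq) (auto simp: carrier_an an_minus null_forms_def an_forms_diff)
qed

lemma FG_carrier: "carrier (form_germs f x) = germ f x ` AF"
  unfolding form_germs_def germs.quot_carrier by (simp add: germ_def carrier_an)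

lemma FG_add: "\<omega> \<in> AF \<Longrightarrow> \<eta> \<in> AF \<Longrightarrow> germ f x \<omega> \<oplus>\<^bsub>form_germs f x\<^esub> germ f x \<eta> = germ f x (\<omega> + \<eta>)"
  unfolding form_germs_def germ_def using germs.quot_add[of \<omega> \<eta>] by (simp add: carrier_an)

lemma FG_zero: "\<zero>\<^bsub>form_germs f x\<^esub> = germ f x 0"
  unfolding form_germs_def germ_def using germs.quot_zero by (simp add: carrier_an)

lemma FG_abelian: "abelian_group (form_germs f x)"
  unfolding form_germs_def by (rule germs.quot_abelian_group)

lemma FG_inv: "\<omega> \<in> AF \<Longrightarrow> \<ominus>\<^bsub>form_germs f x\<^esub> germ f x \<omega> = germ f x (- \<omega>)"
  by (rule abelian_group.minus_equality[OF FG_abelian]) (auto simp: FG_add FG_zero FG_carrier an_forms_uminus)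

lemma FG_smult: assumes g: "g \<in> conv_fps" and w: "\<omega> \<in> AF"
  shows "g \<odot>\<^bsub>form_germs f x\<^esub> germ f x \<omega> = germ f x (fmul (p g) \<omega>)"
proof -
  have c: "fmul (p g) \<omega> \<in> AF" if "\<omega> \<in> AF" for \<omega> by (rule an_forms_fmul[OF that pull_near[OF f_near g]])
  have "g \<odot>\<^bsub>form_germs f x\<^esub> germ f x \<omega> = null_forms x +>\<^bsub>an_forms_module f x\<^esub> (g \<odot>\<^bsub>an_forms_module f x\<^esub> \<omega>)"
    unfolding form_germs_def germ_def
  proof (rule germs.quot_smult)
    fix \<omega> \<eta> assume a: "\<omega> \<in> carrier (an_forms_module f x)" "\<eta> \<in> carrier (an_forms_module f x)"
      "null_forms x +>\<^bsub>an_forms_module f x\<^esub> \<omega> = null_forms x +>\<^bsub>an_forms_module f x\<^esub> \<eta>"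
    then have "germ_eq x \<omega> \<eta>" using germ_eq_iff[of \<omega> \<eta>] by (simp add: carrier_an germ_def)
    then have "germ_eq x (fmul (p g) \<omega>) (fmul (p g) \<eta>)" by (intro germ_eq_fmul) auto
    then show "null_forms x +>\<^bsub>an_forms_module f x\<^esub> (g \<odot>\<^bsub>an_forms_module f x\<^esub> \<omega>) = null_forms x +>\<^bsub>an_forms_module f x\<^esub> (g \<odot>\<^bsub>an_forms_module f x\<^esub> \<eta>)"
      using germ_eq_iff[of "fmul (p g) \<omega>" "fmul (p g) \<eta>"] a c by (simp add: carrier_an germ_def)
  qed (use c w in \<open>auto simp: carrier_an\<close>)
  then show ?thesis by (simp add: germ_def carrier_an)
qed

lemma relations_closed:
  assumes "\<eta> \<in> an_forms (CARD('n) - 2) x"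
  shows "df_wedge f (ext_d \<eta>) \<in> AF" by (intro df_wedge_top ext_d_sub assms)

lemma relation_add:
  assumes "\<eta> \<in> an_forms (CARD('n) - 2) x" "\<xi> \<in> an_forms (CARD('n) - 2) x"
  shows "germ_eq x (df_wedge f (ext_d (\<eta> + \<xi>))) (df_wedge f (ext_d \<eta>) + df_wedge f (ext_d \<xi>))"
proof -
  have "germ_eq x (df_wedge f (ext_d (\<eta> + \<xi>))) (df_wedge f (ext_d \<eta> + ext_d \<xi>))"
    by (rule germ_eq_df_wedge[OF germ_ext_d_add[OF assms]])
  also have "df_wedge f (ext_d \<eta> + ext_d \<xi>) = df_wedge f (ext_d \<eta>) + df_wedge f (ext_d \<xi>)"
    by (intro ext) (simp add: df_wedge_add)
  finally show ?thesis .
qed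

lemma df_wedge_uminus: "df_wedge f (- \<omega>) = - df_wedge f \<omega>"
  by (intro ext) (simp add: df_wedge_def sum_negf)

lemma relation_uminus:
  assumes "\<eta> \<in> an_forms (CARD('n) - 2) x"
  shows "germ_eq x (df_wedge f (ext_d (- \<eta>))) (- df_wedge f (ext_d \<eta>))"
  using germ_eq_df_wedge[OF germ_ext_d_uminus[OF assms], of f] by (simp add: df_wedge_uminus)

sublocale lb: module_quotient "local_brieskorn_relations f x" "form_germs f x"
proof -
  interpret FG: abelian_group "form_germs f x" by (rule FG_abelian)
  have "subgroup (local_brieskorn_relations f x) (add_monoid (form_germs f x))"
  proof (rule FG.add.subgroupI)
    show "local_brieskorn_relations f x \<subseteq> carrier (form_germs f x)"
      by (auto simp: local_brieskorn_relations_def FG_carrier relations_closed)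
    have "germ f x (df_wedge f (ext_d 0)) \<in> local_brieskorn_relations f x"
      unfolding local_brieskorn_relations_def by (intro CollectI exI[of _ 0] conjI refl an_forms_zero)
    then show "local_brieskorn_relations f x \<noteq> {}" by blast
    fix u assume "u \<in> local_brieskorn_relations f x"
    then obtain \<eta> where e: "u = germ f x (df_wedge f (ext_d \<eta>))" "\<eta> \<in> an_forms (CARD('n) - 2) x"
      by (auto simp: local_brieskorn_relations_def)
    have "\<ominus>\<^bsub>form_germs f x\<^esub> u = germ f x (- df_wedge f (ext_d \<eta>))" unfolding e by (rule FG_inv[OF relations_closed[OF e(2)]])
    also have "\<dots> = germ f x (df_wedge f (ext_d (- \<eta>)))"
      by (intro germ_eq_iff[THEN iffD2] an_forms_uminus relations_closed e(2) germ_eq_sym[OF relation_uminus[OF e(2)]])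
    finally show "\<ominus>\<^bsub>form_germs f x\<^esub> u \<in> local_brieskorn_relations f x"
      using an_forms_uminus[OF e(2)] by (auto simp: local_brieskorn_relations_def)
    fix v assume "v \<in> local_brieskorn_relations f x"
    then obtain \<xi> where x: "v = germ f x (df_wedge f (ext_d \<xi>))" "\<xi> \<in> an_forms (CARD('n) - 2) x"
      by (auto simp: local_brieskorn_relations_def)
    have "u \<oplus>\<^bsub>form_germs f x\<^esub> v = germ f x (df_wedge f (ext_d \<eta>) + df_wedge f (ext_d \<xi>))"
      unfolding e x by (rule FG_add[OF relations_closed[OF e(2)] relations_closed[OF x(2)]])
    also have "\<dots> = germ f x (df_wedge f (ext_d (\<eta> + \<xi>)))"
      by (intro germ_eq_iff[THEN iffD2] an_forms_add relations_closed e(2) x(2) germ_eq_sym[OF relation_add[OF e(2) x(2)]])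
    finally show "u \<oplus>\<^bsub>form_germs f x\<^esub> v \<in> local_brieskorn_relations f x"
      using an_forms_add[OF e(2) x(2)] by (auto simp: local_brieskorn_relations_def)
  qed
  then have "abelian_subgroup (local_brieskorn_relations f x) (form_germs f x)"
    by (intro abelian_subgroupI3 additive_subgroupI FG_abelian)
  then show "module_quotient (local_brieskorn_relations f x) (form_germs f x)" by (simp add: module_quotient_def)
qed

abbreviation "lc \<equiv> local_class f x"
abbreviation "LB \<equiv> local_brieskorn f x"
abbreviation "s \<equiv> local_dt_inv f x"

lemma lc_eq:
  assumes "\<omega> \<in> AF" "\<omega>' \<in> AF"
  shows "lc \<omega> = lc \<omega>' \<longleftrightarrow> (\<exists>\<eta>\<in>an_forms (CARD('n) - 2) x. germ_eq x \<omega> (\<omega>' + df_wedge f (ext_d \<eta>)))"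
proof -
  have g: "germ f x \<omega> \<in> carrier (form_germs f x)" "germ f x \<omega>' \<in> carrier (form_germs f x)" using assms by (auto simp: FG_carrier)
  have m: "germ f x \<omega> \<ominus>\<^bsub>form_germs f x\<^esub> germ f x \<omega>' = germ f x (\<omega> - \<omega>')"
    unfolding a_minus_def using assms by (simp add: FG_inv FG_add an_forms_uminus)
  have "germ f x (\<omega> - \<omega>') = germ f x (df_wedge f (ext_d \<eta>)) \<longleftrightarrow> germ_eq x \<omega> (\<omega>' + df_wedge f (ext_d \<eta>))"
    if "\<eta> \<in> an_forms (CARD('n) - 2) x" for \<eta>
    using germ_eq_iff[OF an_forms_diff[OF assms] relations_closed[OF that]]
    by (simp add: germ_eq_def algebra_simps)
  then show ?thesis
    unfolding local_class_def lb.quot_eq[OF g] m by (auto simp: local_brieskorn_relations_def)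
qed

lemma lc_cong: "\<omega> \<in> AF \<Longrightarrow> \<omega>' \<in> AF \<Longrightarrow> germ_eq x \<omega> \<omega>' \<Longrightarrow> lc \<omega> = lc \<omega>'"
  unfolding local_class_def by (intro arg_cong2[where f = "a_r_coset (form_germs f x)"] refl germ_eq_iff[THEN iffD2])

lemma LB_carrier: "carrier LB = lc ` AF"
  unfolding local_brieskorn_def lb.quot_carrier FG_carrier by (auto simp: local_class_def)

lemma LB_add: "\<omega> \<in> AF \<Longrightarrow> \<omega>' \<in> AF \<Longrightarrow> lc \<omega> \<oplus>\<^bsub>LB\<^esub> lc \<omega>' = lc (\<omega> + \<omega>')"
  unfolding local_brieskorn_def local_class_def
  by (subst lb.quot_add) (auto simp: FG_carrier FG_add)

lemma LB_zero: "\<zero>\<^bsub>LB\<^esub> = lc 0"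
  unfolding local_brieskorn_def local_class_def lb.quot_zero FG_zero ..

lemma LB_abelian: "abelian_group LB"
  unfolding local_brieskorn_def by (rule lb.quot_abelian_group)

lemma LB_inv: "\<omega> \<in> AF \<Longrightarrow> \<ominus>\<^bsub>LB\<^esub> lc \<omega> = lc (- \<omega>)"
  by (rule abelian_group.minus_equality[OF LB_abelian]) (auto simp: LB_add LB_zero LB_carrier an_forms_uminus)

lemma fmul_pull_closed: "g \<in> conv_fps \<Longrightarrow> \<omega> \<in> an_forms q x \<Longrightarrow> fmul (p g) \<omega> \<in> an_forms q x"
  by (rule an_forms_fmul[OF _ pull_near[OF f_near]])

lemma df_wedge_ext_d_fmul:
  assumes g: "g \<in> conv_fps" and e: "\<eta> \<in> an_forms q x"
  shows "germ_eq x (df_wedge f (ext_d (fmul (p g) \<eta>))) (fmul (p g) (df_wedge f (ext_d \<eta>)))"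
proof -
  have "germ_eq x (ext_d (fmul (p g) \<eta>)) (df_wedge (p g) \<eta> + fmul (p g) (ext_d \<eta>))"
    by (rule germ_ext_d_fmul[OF e pull_near[OF f_near g]])
  also have "germ_eq x \<dots> (fmul (p (fps_deriv g)) (df_wedge f \<eta>) + fmul (p g) (ext_d \<eta>))"
    by (intro germ_eq_add pull_df_wedge[OF f_near g] germ_eq_refl)
  finally have "germ_eq x (df_wedge f (ext_d (fmul (p g) \<eta>))) (df_wedge f (fmul (p (fps_deriv g)) (df_wedge f \<eta>) + fmul (p g) (ext_d \<eta>)))"
    by (rule germ_eq_df_wedge)
  also have "df_wedge f (fmul (p (fps_deriv g)) (df_wedge f \<eta>) + fmul (p g) (ext_d \<eta>)) = fmul (p g) (df_wedge f (ext_d \<eta>))"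
    by (intro ext) (simp add: df_wedge_add df_wedge_fmul df_wedge_df_wedge)
  finally show ?thesis .
qed

lemma LB_smult:
  assumes g: "g \<in> conv_fps" and w: "\<omega> \<in> AF" shows "g \<odot>\<^bsub>LB\<^esub> lc \<omega> = lc (fmul (p g) \<omega>)"
proof -
  have "g \<odot>\<^bsub>LB\<^esub> lc \<omega> = local_brieskorn_relations f x +>\<^bsub>form_germs f x\<^esub> (g \<odot>\<^bsub>form_germs f x\<^esub> germ f x \<omega>)"
    unfolding local_brieskorn_def local_class_def
  proof (rule lb.quot_smult)
    show "g \<odot>\<^bsub>form_germs f x\<^esub> u \<in> carrier (form_germs f x)" if "u \<in> carrier (form_germs f x)" for u
      using that by (auto simp: FG_carrier FG_smult[OF g] fmul_pull_closed[OF g])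
    fix u v assume "u \<in> carrier (form_germs f x)" "v \<in> carrier (form_germs f x)"
      and eq: "local_brieskorn_relations f x +>\<^bsub>form_germs f x\<^esub> u = local_brieskorn_relations f x +>\<^bsub>form_germs f x\<^esub> v"
    then obtain a b where ab: "u = germ f x a" "v = germ f x b" "a \<in> AF" "b \<in> AF" by (auto simp: FG_carrier)
    then have "lc a = lc b" using eq by (simp add: local_class_def)
    then obtain \<eta> where e: "\<eta> \<in> an_forms (CARD('n) - 2) x" "germ_eq x a (b + df_wedge f (ext_d \<eta>))"
      using lc_eq[OF ab(3,4)] by blast
    have "germ_eq x (fmul (p g) a) (fmul (p g) (b + df_wedge f (ext_d \<eta>)))"
      by (intro germ_eq_fmul e) auto
    also have "fmul (p g) (b + df_wedge f (ext_d \<eta>)) = fmul (p g) b + fmul (p g) (df_wedge f (ext_d \<eta>))"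
      by (auto simp: fun_eq_iff algebra_simps)
    also have "germ_eq x \<dots> (fmul (p g) b + df_wedge f (ext_d (fmul (p g) \<eta>)))"
      by (intro germ_eq_add germ_eq_refl germ_eq_sym[OF df_wedge_ext_d_fmul[OF g e(1)]])
    finally have "lc (fmul (p g) a) = lc (fmul (p g) b)"
      using lc_eq[OF fmul_pull_closed[OF g ab(3)] fmul_pull_closed[OF g ab(4)]] fmul_pull_closed[OF g e(1)] by blast
    then show "local_brieskorn_relations f x +>\<^bsub>form_germs f x\<^esub> (g \<odot>\<^bsub>form_germs f x\<^esub> u) = local_brieskorn_relations f x +>\<^bsub>form_germs f x\<^esub> (g \<odot>\<^bsub>form_germs f x\<^esub> v)"
      using ab by (simp add: FG_smult[OF g] local_class_def)
  qed (use w in \<open>auto simp: FG_carrier\<close>)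
  then show ?thesis by (simp add: FG_smult[OF g w] local_class_def)
qed

text \<open>
  If \<open>d\<eta> = d\<eta>' + df \<and> d\<xi>\<close>, then \<open>\<eta> - \<eta>' + df \<and> \<xi>\<close> is closed, hence of the form \<open>d\<theta>\<close>, and
  \<open>df \<and> \<eta> - df \<and> \<eta>' = df \<and> d\<theta>\<close> is a relation.
\<close>

lemma dt_inv_well_defined:
  assumes e: "\<eta> \<in> an_forms (CARD('n) - 1) x" "\<eta>' \<in> an_forms (CARD('n) - 1) x" and eq: "lc (ext_d \<eta>) = lc (ext_d \<eta>')"
  shows "lc (df_wedge f \<eta>) = lc (df_wedge f \<eta>')"
proof -
  obtain \<xi> where xi: "\<xi> \<in> an_forms (CARD('n) - 2) x" "germ_eq x (ext_d \<eta>) (ext_d \<eta>' + df_wedge f (ext_d \<xi>))"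
    using eq lc_eq[OF ext_d_top[OF e(1)] ext_d_top[OF e(2)]] by blast
  define \<zeta> where "\<zeta> = \<eta> + (- \<eta>' + df_wedge f \<xi>)"
  have z: "\<zeta> \<in> an_forms (CARD('n) - 1) x" unfolding \<zeta>_def by (intro an_forms_add an_forms_uminus e df_wedge_sub xi)
  have "germ_eq x (ext_d \<zeta>) (ext_d \<eta> + ext_d (- \<eta>' + df_wedge f \<xi>))"
    unfolding \<zeta>_def by (rule germ_ext_d_add[OF e(1) an_forms_add[OF an_forms_uminus[OF e(2)] df_wedge_sub[OF xi(1)]]])
  also have "germ_eq x \<dots> (ext_d \<eta> + (ext_d (- \<eta>') + ext_d (df_wedge f \<xi>)))"
    by (intro germ_eq_add germ_eq_refl germ_ext_d_add[OF an_forms_uminus[OF e(2)] df_wedge_sub[OF xi(1)]])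
  also have "germ_eq x \<dots> ((ext_d \<eta>' + df_wedge f (ext_d \<xi>)) + (- ext_d \<eta>' + - df_wedge f (ext_d \<xi>)))"
    by (intro germ_eq_add xi(2) germ_ext_d_uminus[OF e(2)] germ_ext_d_df_wedge[OF xi(1) f_near])
  finally have "germ_eq x (ext_d \<zeta>) 0" by simp
  moreover have "CARD('n) - 1 \<ge> 1" "CARD('n) - 1 - 1 = CARD('n) - 2" using dim by auto
  ultimately obtain \<theta> where t: "\<theta> \<in> an_forms (CARD('n) - 2) x" "germ_eq x (ext_d \<theta>) \<zeta>"
    using poincare_germ[OF z] by auto
  have "germ_eq x (df_wedge f (ext_d \<theta>)) (df_wedge f \<zeta>)" by (rule germ_eq_df_wedge[OF t(2)])
  also have "df_wedge f \<zeta> = df_wedge f \<eta> - df_wedge f \<eta>'"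
    unfolding \<zeta>_def by (intro ext) (simp add: df_wedge_add df_wedge_diff df_wedge_uminus df_wedge_df_wedge)
  finally have "germ_eq x (df_wedge f \<eta>) (df_wedge f \<eta>' + df_wedge f (ext_d \<theta>))"
    unfolding germ_eq_def by (rule eventually_mono) (simp add: algebra_simps)
  then show ?thesis using lc_eq[OF df_wedge_top[OF e(1)] df_wedge_top[OF e(2)]] t(1) by blast
qed

lemma dt_inv_eq: "\<eta> \<in> an_forms (CARD('n) - 1) x \<Longrightarrow> s (lc (ext_d \<eta>)) = lc (df_wedge f \<eta>)"
  unfolding local_dt_inv_def using dt_inv_well_defined by (intro the_equality) blast+

lemma LB_exact: "m \<in> carrier LB \<Longrightarrow> \<exists>\<eta>\<in>an_forms (CARD('n) - 1) x. m = lc (ext_d \<eta>)"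
  unfolding LB_carrier using top_exact lc_cong ext_d_top by blast

text \<open>
  If \<open>df \<and> \<eta> = df \<and> \<eta>' + df \<and> d\<xi>\<close>, then \<open>\<eta> - \<eta>' - d\<xi>\<close> is killed by \<open>df\<close>, hence of the form \<open>df \<and> \<theta>\<close>
  by \<open>koszul_exact\<close>, and \<open>d\<eta> - d\<eta>' = - df \<and> d\<theta>\<close> is a relation.
\<close>

lemma dt_inv_inj:
  assumes e: "\<eta> \<in> an_forms (CARD('n) - 1) x" "\<eta>' \<in> an_forms (CARD('n) - 1) x" and eq: "lc (df_wedge f \<eta>) = lc (df_wedge f \<eta>')"
  shows "lc (ext_d \<eta>) = lc (ext_d \<eta>')"
proof -
  obtain \<xi> where xi: "\<xi> \<in> an_forms (CARD('n) - 2) x" "germ_eq x (df_wedge f \<eta>) (df_wedge f \<eta>' + df_wedge f (ext_d \<xi>))"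
    using eq lc_eq[OF df_wedge_top[OF e(1)] df_wedge_top[OF e(2)]] by blast
  define \<zeta> where "\<zeta> = \<eta> - \<eta>' - ext_d \<xi>"
  have z: "\<zeta> \<in> an_forms (CARD('n) - 1) x" unfolding \<zeta>_def by (intro an_forms_diff e ext_d_sub xi)
  have "germ_eq x (df_wedge f \<zeta>) 0"
    using xi(2) unfolding germ_eq_def \<zeta>_def by (rule eventually_mono) (simp add: df_wedge_diff)
  from koszul_exact[OF iso dim z this] obtain \<theta> where t: "\<theta> \<in> an_forms (CARD('n) - 2) x" "germ_eq x \<zeta> (df_wedge f \<theta>)" by blast
  have "germ_eq x \<eta> (\<eta>' + (ext_d \<xi> + df_wedge f \<theta>))"
    using t(2) unfolding germ_eq_def by (rule eventually_mono) (simp add: \<zeta>_def algebra_simps)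
  then have "germ_eq x (ext_d \<eta>) (ext_d (\<eta>' + (ext_d \<xi> + df_wedge f \<theta>)))" by (rule germ_eq_ext_d[OF e(1)])
  also have "germ_eq x \<dots> (ext_d \<eta>' + ext_d (ext_d \<xi> + df_wedge f \<theta>))"
    by (rule germ_ext_d_add[OF e(2) an_forms_add[OF ext_d_sub[OF xi(1)] df_wedge_sub[OF t(1)]]])
  also have "germ_eq x \<dots> (ext_d \<eta>' + (ext_d (ext_d \<xi>) + ext_d (df_wedge f \<theta>)))"
    by (intro germ_eq_add germ_eq_refl germ_ext_d_add[OF ext_d_sub[OF xi(1)] df_wedge_sub[OF t(1)]])
  also have "germ_eq x \<dots> (ext_d \<eta>' + (0 + - df_wedge f (ext_d \<theta>)))"
    by (intro germ_eq_add germ_eq_refl germ_ext_d_ext_d[OF xi(1)] germ_ext_d_df_wedge[OF t(1) f_near])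
  also have "germ_eq x \<dots> (ext_d \<eta>' + df_wedge f (ext_d (- \<theta>)))"
    using relation_uminus[OF t(1)] by (intro germ_eq_add germ_eq_refl) (simp add: germ_eq_sym)
  finally show ?thesis using lc_eq[OF ext_d_top[OF e(1)] ext_d_top[OF e(2)]] an_forms_uminus[OF t(1)] by blast
qed

sublocale LB: dt_module LB s conv_fps
proof (intro dt_module.intro dt_module_axioms.intro LB_abelian)
  fix m m' assume mm: "m \<in> carrier LB" "m' \<in> carrier LB"
  from mm obtain \<eta> \<eta>' where e: "\<eta> \<in> an_forms (CARD('n) - 1) x" "\<eta>' \<in> an_forms (CARD('n) - 1) x" "m = lc (ext_d \<eta>)" "m' = lc (ext_d \<eta>')"
    using LB_exact by metis
  show "s m \<in> carrier LB" using e by (auto simp: dt_inv_eq LB_carrier df_wedge_top)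
  have "m \<oplus>\<^bsub>LB\<^esub> m' = lc (ext_d (\<eta> + \<eta>'))"
    unfolding e(3,4) LB_add[OF ext_d_top[OF e(1)] ext_d_top[OF e(2)]]
    by (rule lc_cong[OF an_forms_add[OF ext_d_top[OF e(1)] ext_d_top[OF e(2)]] ext_d_top[OF an_forms_add[OF e(1,2)]] germ_eq_sym[OF germ_ext_d_add[OF e(1,2)]]])
  then have "s (m \<oplus>\<^bsub>LB\<^esub> m') = lc (df_wedge f (\<eta> + \<eta>'))" using dt_inv_eq[OF an_forms_add[OF e(1,2)]] by simp
  also have "df_wedge f (\<eta> + \<eta>') = df_wedge f \<eta> + df_wedge f \<eta>'" by (intro ext) (simp add: df_wedge_add)
  finally show "s (m \<oplus>\<^bsub>LB\<^esub> m') = s m \<oplus>\<^bsub>LB\<^esub> s m'"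
    unfolding e(3,4) dt_inv_eq[OF e(1)] dt_inv_eq[OF e(2)] LB_add[OF df_wedge_top[OF e(1)] df_wedge_top[OF e(2)]] .
  show "m = m'" if "s m = s m'" using that dt_inv_inj[OF e(1,2)] unfolding e(3,4) dt_inv_eq[OF e(1)] dt_inv_eq[OF e(2)] by simp
next
  fix g :: "complex fps" and m assume g: "g \<in> conv_fps" and m: "m \<in> carrier LB"
  from m obtain \<omega> where w: "\<omega> \<in> AF" "m = lc \<omega>" by (auto simp: LB_carrier)
  show "g \<odot>\<^bsub>LB\<^esub> m \<in> carrier LB" using w by (auto simp: LB_smult[OF g] LB_carrier fmul_pull_closed[OF g])
  { fix m' assume "m' \<in> carrier LB"
    then obtain \<omega>' where w': "\<omega>' \<in> AF" "m' = lc \<omega>'" by (auto simp: LB_carrier)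
    have "fmul (p g) (\<omega> + \<omega>') = fmul (p g) \<omega> + fmul (p g) \<omega>'" by (auto simp: fun_eq_iff algebra_simps)
    then show "g \<odot>\<^bsub>LB\<^esub> (m \<oplus>\<^bsub>LB\<^esub> m') = g \<odot>\<^bsub>LB\<^esub> m \<oplus>\<^bsub>LB\<^esub> g \<odot>\<^bsub>LB\<^esub> m'"
      unfolding w w' using w w' by (simp add: LB_smult[OF g] LB_add an_forms_add fmul_pull_closed[OF g]) }
  { fix h :: "complex fps" assume h: "h \<in> conv_fps"
    note c = fmul_pull_closed[OF g w(1)] fmul_pull_closed[OF h w(1)] fmul_pull_closed[OF conv_fps_closed(1)[OF g h] w(1)]
       fmul_pull_closed[OF conv_fps_closed(2)[OF g h] w(1)] fmul_pull_closed[OF g fmul_pull_closed[OF h w(1)]]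
    have "germ_eq x (fmul (p (g + h)) \<omega>) (fmul (p g) \<omega> + fmul (p h) \<omega>)"
      unfolding germ_eq_def using pull_add[OF f_near g h] by (rule eventually_mono) (simp add: algebra_simps)
    then show "(g + h) \<odot>\<^bsub>LB\<^esub> m = g \<odot>\<^bsub>LB\<^esub> m \<oplus>\<^bsub>LB\<^esub> h \<odot>\<^bsub>LB\<^esub> m"
      unfolding w(2) LB_smult[OF g w(1)] LB_smult[OF h w(1)] LB_smult[OF conv_fps_closed(1)[OF g h] w(1)] LB_add[OF c(1,2)]
      by (rule lc_cong[OF c(3) an_forms_add[OF c(1,2)]])
    have "germ_eq x (fmul (p (g * h)) \<omega>) (fmul (p g) (fmul (p h) \<omega>))"
      unfolding germ_eq_def using pull_mult[OF f_near g h] by (rule eventually_mono) (simp add: algebra_simps)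
    then show "(g * h) \<odot>\<^bsub>LB\<^esub> m = g \<odot>\<^bsub>LB\<^esub> (h \<odot>\<^bsub>LB\<^esub> m)"
      unfolding w(2) LB_smult[OF h w(1)] LB_smult[OF g c(2)] LB_smult[OF conv_fps_closed(2)[OF g h] w(1)]
      by (rule lc_cong[OF c(4,5)]) }
  from LB_exact[OF m] obtain \<eta> where e: "\<eta> \<in> an_forms (CARD('n) - 1) x" "m = lc (ext_d \<eta>)" by blast
  note g' = conv_fps_closed(3)[OF g]
  note c = fmul_pull_closed[OF g e(1)] fmul_pull_closed[OF g ext_d_top[OF e(1)]] fmul_pull_closed[OF g' df_wedge_top[OF e(1)]]
  have "germ_eq x (ext_d (fmul (p g) \<eta>)) (df_wedge (p g) \<eta> + fmul (p g) (ext_d \<eta>))"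
    by (rule germ_ext_d_fmul[OF e(1) pull_near[OF f_near g]])
  also have "germ_eq x \<dots> (fmul (p (fps_deriv g)) (df_wedge f \<eta>) + fmul (p g) (ext_d \<eta>))"
    by (intro germ_eq_add pull_df_wedge[OF f_near g] germ_eq_refl)
  finally have "germ_eq x (ext_d (fmul (p g) \<eta>)) (fmul (p g) (ext_d \<eta>) + fmul (p (fps_deriv g)) (df_wedge f \<eta>))"
    by (simp add: add.commute)
  then have "lc (ext_d (fmul (p g) \<eta>)) = g \<odot>\<^bsub>LB\<^esub> m \<oplus>\<^bsub>LB\<^esub> fps_deriv g \<odot>\<^bsub>LB\<^esub> s m"
    unfolding e(2) dt_inv_eq[OF e(1)] LB_smult[OF g ext_d_top[OF e(1)]] LB_smult[OF g' df_wedge_top[OF e(1)]] LB_add[OF c(2,3)]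
    by (rule lc_cong[OF ext_d_top[OF c(1)] an_forms_add[OF c(2,3)]])
  then have "s (g \<odot>\<^bsub>LB\<^esub> m \<oplus>\<^bsub>LB\<^esub> fps_deriv g \<odot>\<^bsub>LB\<^esub> s m) = lc (df_wedge f (fmul (p g) \<eta>))"
    using dt_inv_eq[OF c(1)] by simp
  also have "df_wedge f (fmul (p g) \<eta>) = fmul (p g) (df_wedge f \<eta>)" by (intro ext) (simp add: df_wedge_fmul)
  also have "lc \<dots> = g \<odot>\<^bsub>LB\<^esub> s m" unfolding e(2) dt_inv_eq[OF e(1)] LB_smult[OF g df_wedge_top[OF e(1)]] ..
  finally show "g \<odot>\<^bsub>LB\<^esub> s m = s (g \<odot>\<^bsub>LB\<^esub> m \<oplus>\<^bsub>LB\<^esub> fps_deriv g \<odot>\<^bsub>LB\<^esub> s m)" by simp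
qed (use conv_fps_closed in auto)

end

section \<open>Algebraic forms\<close>

lemma alg_formsD: "\<omega> \<in> alg_forms p \<Longrightarrow> polynomial_map (\<omega> I)"
  by (simp add: alg_forms_def)

lemma alg_forms_subset_an_forms: "\<omega> \<in> alg_forms p \<Longrightarrow> \<omega> \<in> an_forms p x"
  by (auto simp: alg_forms_def an_forms_def intro: polynomial_map_near)

lemma alg_forms_on: "\<omega> \<in> alg_forms p \<Longrightarrow> \<omega> \<in> forms_on UNIV p"
  by (auto simp: alg_forms_def forms_on_def intro: polynomial_map_holo)

lemma alg_holo: "\<omega> \<in> alg_forms p \<Longrightarrow> holo_on UNIV (\<omega> I)"
  by (rule polynomial_map_holo[OF alg_formsD])

lemma alg_forms_zero [simp]: "0 \<in> alg_forms p"
  by (auto simp: alg_forms_def zero_fun_def intro: polynomial_map_const)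

lemma alg_forms_add: "\<omega> \<in> alg_forms p \<Longrightarrow> \<eta> \<in> alg_forms p \<Longrightarrow> \<omega> + \<eta> \<in> alg_forms p"
  by (auto simp: alg_forms_def plus_fun_def zero_fun_def intro: polynomial_map_add)

lemma alg_forms_uminus: "\<omega> \<in> alg_forms p \<Longrightarrow> - \<omega> \<in> alg_forms p"
  by (auto simp: alg_forms_def fun_Compl_def zero_fun_def intro: polynomial_map_uminus)

lemma alg_forms_diff: "\<omega> \<in> alg_forms p \<Longrightarrow> \<eta> \<in> alg_forms p \<Longrightarrow> \<omega> - \<eta> \<in> alg_forms p"
  by (auto simp: alg_forms_def fun_diff_def zero_fun_def intro: polynomial_map_diff)

lemma alg_forms_fmul: "\<omega> \<in> alg_forms p \<Longrightarrow> polynomial_map u \<Longrightarrow> fmul u \<omega> \<in> alg_forms p"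
  by (auto simp: alg_forms_def zero_fun_def intro: polynomial_map_mult)

lemma alg_forms_ext_d: assumes w: "\<omega> \<in> alg_forms p" shows "ext_d \<omega> \<in> alg_forms (Suc p)"
proof -
  have "polynomial_map (ext_d \<omega> J)" for J unfolding ext_d_def
    by (intro polynomial_map_sum polynomial_map_mult polynomial_map_const polynomial_map_partial alg_formsD[OF w]) auto
  then show ?thesis using ext_d_forms_on[OF alg_forms_on[OF w]] by (simp add: alg_forms_def forms_on_def)
qed

lemma alg_forms_df_wedge: assumes w: "\<omega> \<in> alg_forms p" and f: "polynomial_map f" shows "df_wedge f \<omega> \<in> alg_forms (Suc p)"
proof -
  have "polynomial_map (df_wedge f \<omega> J)" for J unfolding df_wedge_def
    by (intro polynomial_map_sum polynomial_map_mult polynomial_map_const polynomial_map_partial f alg_formsD[OF w]) auto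
  then show ?thesis using df_wedge_forms_on[OF alg_forms_on[OF w] polynomial_map_holo[OF f]] by (simp add: alg_forms_def forms_on_def)
qed

lemma alg_ext_d_add: "\<omega> \<in> alg_forms p \<Longrightarrow> \<eta> \<in> alg_forms q \<Longrightarrow> ext_d (\<omega> + \<eta>) = ext_d \<omega> + ext_d \<eta>"
proof -
  assume w: "\<omega> \<in> alg_forms p" and e: "\<eta> \<in> alg_forms q"
  show "ext_d (\<omega> + \<eta>) = ext_d \<omega> + ext_d \<eta>"
    by (intro ext) (simp add: ext_d_add[OF alg_holo[OF w] alg_holo[OF e] UNIV_I])
qed

lemma alg_ext_d_fmul: "\<omega> \<in> alg_forms p \<Longrightarrow> polynomial_map u \<Longrightarrow> ext_d (fmul u \<omega>) = df_wedge u \<omega> + fmul u (ext_d \<omega>)"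
proof -
  assume w: "\<omega> \<in> alg_forms p" and u: "polynomial_map u"
  show "ext_d (fmul u \<omega>) = df_wedge u \<omega> + fmul u (ext_d \<omega>)"
    by (intro ext) (simp add: ext_d_fmul[OF alg_holo[OF w] polynomial_map_holo[OF u] UNIV_I])
qed

lemma df_wedge_const: "df_wedge (\<lambda>y. a) \<omega> = 0"
  by (intro ext) (simp add: df_wedge_def)

lemma alg_ext_d_cmul: "\<omega> \<in> alg_forms p \<Longrightarrow> ext_d (fmul (\<lambda>y. a) \<omega>) = fmul (\<lambda>y. a) (ext_d \<omega>)"
  using alg_ext_d_fmul[of \<omega> p "\<lambda>y. a"] by (simp add: polynomial_map_const df_wedge_const)

lemma alg_ext_d_uminus: "\<omega> \<in> alg_forms p \<Longrightarrow> ext_d (- \<omega>) = - ext_d \<omega>"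
  using alg_ext_d_cmul[of \<omega> p "-1"] by (simp add: fun_Compl_def)

lemma alg_ext_d_diff: "\<omega> \<in> alg_forms p \<Longrightarrow> \<eta> \<in> alg_forms p \<Longrightarrow> ext_d (\<omega> - \<eta>) = ext_d \<omega> - ext_d \<eta>"
  using alg_ext_d_add[of \<omega> p "- \<eta>" p] alg_ext_d_uminus[of \<eta> p] alg_forms_uminus by auto

lemma alg_ext_d_df_wedge: "\<omega> \<in> alg_forms p \<Longrightarrow> polynomial_map f \<Longrightarrow> ext_d (df_wedge f \<omega>) = - df_wedge f (ext_d \<omega>)"
proof -
  assume w: "\<omega> \<in> alg_forms p" and u: "polynomial_map f"
  show "ext_d (df_wedge f \<omega>) = - df_wedge f (ext_d \<omega>)"
    by (intro ext) (simp add: ext_d_df_wedge[OF alg_holo[OF w] polynomial_map_holo[OF u] UNIV_I])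
qed

lemma ext_d_zero [simp]: "ext_d 0 = 0" and df_wedge_zero [simp]: "df_wedge f 0 = 0"
  by (intro ext, simp add: ext_d_def df_wedge_def)+

lemma df_wedge_fun:
  "df_wedge f (\<omega> + \<eta>) = df_wedge f \<omega> + df_wedge f \<eta>" "df_wedge f (\<omega> - \<eta>) = df_wedge f \<omega> - df_wedge f \<eta>"
  "df_wedge f (- \<omega>) = - df_wedge f \<omega>" "df_wedge f (fmul u \<omega>) = fmul u (df_wedge f \<omega>)"
  by (intro ext; simp add: df_wedge_add df_wedge_diff df_wedge_fmul; simp add: df_wedge_def sum_negf)+

section \<open>Polynomials in \<open>\<partial>\<^sub>t\<close> with forms as coefficients\<close>

abbreviation single :: "nat \<Rightarrow> 'n form \<Rightarrow> nat \<Rightarrow> 'n form" where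
  "single j \<omega> \<equiv> (\<lambda>i. if i = j then \<omega> else 0)"

lemma dt_formsD: "W \<in> dt_forms p \<Longrightarrow> W j \<in> alg_forms p" by (simp add: dt_forms_def)

lemma dt_forms_single: "\<omega> \<in> alg_forms p \<Longrightarrow> single j \<omega> \<in> dt_forms p"
  by (auto simp: dt_forms_def intro: finite_subset[of _ "{j}"])

lemma dt_forms_zero: "0 \<in> dt_forms p" by (simp add: dt_forms_def)

lemma dt_forms_add: "W \<in> dt_forms p \<Longrightarrow> W' \<in> dt_forms p \<Longrightarrow> W + W' \<in> dt_forms p"
  unfolding dt_forms_def
  by (auto intro: alg_forms_add finite_subset[of _ "{j. W j \<noteq> 0} \<union> {j. W' j \<noteq> 0}"])

lemma dt_forms_uminus: "W \<in> dt_forms p \<Longrightarrow> - W \<in> dt_forms p"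
  unfolding dt_forms_def by (auto intro: alg_forms_uminus)

lemma dt_forms_diff: "W \<in> dt_forms p \<Longrightarrow> W' \<in> dt_forms p \<Longrightarrow> W - W' \<in> dt_forms p"
  using dt_forms_add[of W p "- W'"] dt_forms_uminus[of W' p] by simp

lemma dt_forms_bound: "W \<in> dt_forms p \<Longrightarrow> \<exists>q. \<forall>j>q. W j = 0"
proof -
  assume "W \<in> dt_forms p"
  then have "finite {j. W j \<noteq> 0}" by (simp add: dt_forms_def)
  then obtain q where "\<forall>j\<in>{j. W j \<noteq> 0}. j \<le> q" using finite_nat_set_iff_bounded_le by blast
  then show ?thesis by (metis (mono_tags, lifting) leD mem_Collect_eq)
qed

lemma dt_forms_induct [consumes 1, case_names zero add]:
  assumes W: "W \<in> dt_forms p" and 0: "P 0"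
    and step: "\<And>W j \<omega>. W \<in> dt_forms p \<Longrightarrow> \<omega> \<in> alg_forms p \<Longrightarrow> P W \<Longrightarrow> P (W + single j \<omega>)"
  shows "P W"
proof -
  have "(\<forall>j\<ge>q. W j = 0) \<Longrightarrow> W \<in> dt_forms p \<Longrightarrow> P W" for q W
  proof (induction q arbitrary: W)
    case 0
    then have "W = 0" by (intro ext) simp
    with \<open>P 0\<close> show "P W" by simp
  next
    case (Suc q)
    define V where "V = W - single q (W q)"
    have V: "V \<in> dt_forms p" unfolding V_def by (intro dt_forms_diff dt_forms_single dt_formsD Suc.prems)
    have "P V"
    proof (rule Suc.IH[OF _ V], intro allI impI)
      fix j assume "j \<ge> q"
      then show "V j = 0" using Suc.prems(1) by (cases "j = q") (auto simp: V_def fun_eq_iff)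
    qed
    then have "P (V + single q (W q))" by (intro step V dt_formsD[OF Suc.prems(2)])
    moreover have "V + single q (W q) = W" by (simp add: V_def)
    ultimately show "P W" by (rule back_subst)
  qed
  moreover obtain q where "\<forall>j>q. W j = 0" using dt_forms_bound[OF W] by blast
  then have "\<forall>j\<ge>Suc q. W j = 0" by auto
  ultimately show ?thesis using W by blast
qed

text \<open>
  The action of a polynomial in \<open>t\<close>, in the form of the scalar multiplication of \<open>dt_forms_module\<close>.
\<close>

definition pact :: "('n::finite aff \<Rightarrow> complex) \<Rightarrow> complex poly \<Rightarrow> (nat \<Rightarrow> 'n form) \<Rightarrow> nat \<Rightarrow> 'n form" where
  "pact f p W = (\<Sum>k\<le>Polynomial.degree p. (\<lambda>j I y. poly.coeff p k * (t_mult f ^^ k) W j I y))"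

lemma t_mult_add: "t_mult f (W + W') = t_mult f W + t_mult f W'"
  by (intro ext) (simp add: t_mult_def algebra_simps)

lemma t_mult_zero: "t_mult f 0 = 0" by (intro ext) (simp add: t_mult_def)

lemma t_mult_sum: "t_mult f (\<Sum>k\<in>A. W k) = (\<Sum>k\<in>A. t_mult f (W k))"
proof (induction A rule: infinite_finite_induct)
  case (insert k A)
  have "t_mult f (\<Sum>k\<in>insert k A. W k) = t_mult f (W k + sum W A)" by (rule arg_cong[OF sum.insert[OF insert(1,2)], where f = "t_mult f"])
  also have "\<dots> = t_mult f (W k) + (\<Sum>k\<in>A. t_mult f (W k))" by (simp only: t_mult_add insert.IH)
  also have "\<dots> = (\<Sum>k\<in>insert k A. t_mult f (W k))" by (rule sum.insert[OF insert(1,2), symmetric])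
  finally show "t_mult f (\<Sum>k\<in>insert k A. W k) = (\<Sum>k\<in>insert k A. t_mult f (W k))" .
next
  case (infinite A)
  show "t_mult f (\<Sum>k\<in>A. W k) = (\<Sum>k\<in>A. t_mult f (W k))"
    unfolding sum.infinite[OF infinite] by (rule t_mult_zero)
next
  show "t_mult f (\<Sum>k\<in>{}. W k) = (\<Sum>k\<in>{}. t_mult f (W k))" by (simp only: sum.empty t_mult_zero)
qed

abbreviation scal :: "complex \<Rightarrow> (nat \<Rightarrow> 'n::finite form) \<Rightarrow> nat \<Rightarrow> 'n form" where
  "scal a W \<equiv> (\<lambda>j I y. a * W j I y)"

lemma t_mult_scal: "t_mult f (scal a W) = scal a (t_mult f W)"
  by (intro ext) (simp add: t_mult_def algebra_simps)

lemma pact_bound: "Polynomial.degree p \<le> d \<Longrightarrow> pact f p W = (\<Sum>k\<le>d. scal (poly.coeff p k) ((t_mult f ^^ k) W))"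
  unfolding pact_def by (rule sum.mono_neutral_left) (auto simp: coeff_eq_0 fun_eq_iff)

lemma pact_0 [simp]: "pact f 0 W = 0" by (auto simp: pact_def fun_eq_iff)

lemma pact_pCons: "pact f (pCons a p) W = scal a W + t_mult f (pact f p W)"
proof -
  have "pact f (pCons a p) W = (\<Sum>k\<le>Suc (Polynomial.degree p). scal (poly.coeff (pCons a p) k) ((t_mult f ^^ k) W))"
    by (rule pact_bound) (simp add: degree_pCons_le)
  also have "\<dots> = scal a W + (\<Sum>k\<le>Polynomial.degree p. scal (poly.coeff p k) (t_mult f ((t_mult f ^^ k) W)))"
    by (subst sum.atMost_Suc_shift) (simp add: o_def)
  also have "(\<Sum>k\<le>Polynomial.degree p. scal (poly.coeff p k) (t_mult f ((t_mult f ^^ k) W))) = t_mult f (pact f p W)"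
    unfolding pact_def by (simp only: t_mult_sum t_mult_scal)
  finally show ?thesis .
qed

lemma scal_closed: "W \<in> dt_forms q \<Longrightarrow> scal a W \<in> dt_forms q"
proof -
  assume W: "W \<in> dt_forms q"
  then have "fmul (\<lambda>y. a) (W j) \<in> alg_forms q" for j by (intro alg_forms_fmul polynomial_map_const dt_formsD)
  moreover have "finite {j. (\<lambda>I y. a * W j I y) \<noteq> 0}"
    by (rule finite_subset[of _ "{j. W j \<noteq> 0}"]) (use W in \<open>auto simp: dt_forms_def fun_eq_iff\<close>)
  ultimately show ?thesis by (simp add: dt_forms_def)
qed

lemma t_mult_nth: "t_mult f W j = fmul f (W j) - fmul (\<lambda>y. of_nat (Suc j)) (W (Suc j))"
  by (intro ext) (simp add: t_mult_def)

lemma t_mult_closed: "W \<in> dt_forms q \<Longrightarrow> polynomial_map f \<Longrightarrow> t_mult f W \<in> dt_forms q"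
proof -
  assume W: "W \<in> dt_forms q" and f: "polynomial_map f"
  have "t_mult f W j \<in> alg_forms q" for j unfolding t_mult_nth
    by (intro alg_forms_diff alg_forms_fmul f polynomial_map_const dt_formsD W)
  moreover obtain N where N: "\<forall>j>N. W j = 0" using dt_forms_bound[OF W] by blast
  have "t_mult f W j = 0" if "j > N" for j
  proof -
    have "W j = 0" "W (Suc j) = 0" using N that by auto
    then show ?thesis unfolding t_mult_nth by (intro ext) simp
  qed
  then have "{j. t_mult f W j \<noteq> 0} \<subseteq> {..N}" by (auto simp: not_less[symmetric])
  then have "finite {j. t_mult f W j \<noteq> 0}" by (rule finite_subset) simp
  ultimately show ?thesis by (simp add: dt_forms_def)
qed

lemma pact_closed: "W \<in> dt_forms q \<Longrightarrow> polynomial_map f \<Longrightarrow> pact f p W \<in> dt_forms q"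
proof (induction p)
  case (pCons a p)
  then show "pact f (pCons a p) W \<in> dt_forms q"
    unfolding pact_pCons by (intro dt_forms_add scal_closed t_mult_closed)
qed (simp add: dt_forms_zero)

lemma pact_add: "pact f p (W + W') = pact f p W + pact f p W'"
proof (induction p)
  case (pCons a p)
  have s: "scal a (W + W') = scal a W + scal a W'" by (intro ext) (simp add: algebra_simps)
  have "pact f (pCons a p) (W + W') = scal a (W + W') + t_mult f (pact f p W + pact f p W')"
    by (simp only: pact_pCons pCons.IH)
  also have "\<dots> = (scal a W + t_mult f (pact f p W)) + (scal a W' + t_mult f (pact f p W'))"
    unfolding s t_mult_add by (simp only: add_ac)
  finally show "pact f (pCons a p) (W + W') = pact f (pCons a p) W + pact f (pCons a p) W'"
    by (simp only: pact_pCons)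
qed simp

text \<open>
  The correction terms of the action of \<open>t\<close> have lower order, so that on the coefficient of highest order
  \<open>t\<close> acts as multiplication by \<open>f\<close>.
\<close>

lemma pact_top:
  assumes "\<forall>j>q. W j = 0"
  shows "j > q \<Longrightarrow> pact f p W j = 0" "pact f p W q = fmul (\<lambda>y. poly p (f y)) (W q)"
proof -
  have "(\<forall>j>q. pact f p W j = 0) \<and> pact f p W q = fmul (\<lambda>y. poly p (f y)) (W q)"
  proof (induction p)
    case (pCons a p)
    have "pact f (pCons a p) W j = 0" if "j > q" for j
    proof -
      have "pact f p W j = 0" using conjunct1[OF pCons.IH] that by blast
      moreover have "pact f p W (Suc j) = 0" using conjunct1[OF pCons.IH, rule_format, of "Suc j"] that by simp
      moreover have "W j = 0" using assms that by blast
      ultimately show ?thesis unfolding pact_pCons plus_fun_apply t_mult_nth by (intro ext) simp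
    qed
    moreover have "pact f (pCons a p) W q = fmul (\<lambda>y. poly (pCons a p) (f y)) (W q)"
    proof -
      have "pact f p W (Suc q) = 0" using conjunct1[OF pCons.IH, rule_format, of "Suc q"] by simp
      moreover have "pact f p W q = fmul (\<lambda>y. poly p (f y)) (W q)" by (rule conjunct2[OF pCons.IH])
      ultimately show ?thesis unfolding pact_pCons plus_fun_apply t_mult_nth by (intro ext) (simp add: algebra_simps)
    qed
    ultimately show "(\<forall>j>q. pact f (pCons a p) W j = 0) \<and> pact f (pCons a p) W q = fmul (\<lambda>y. poly (pCons a p) (f y)) (W q)" by blast
  next
    case 0
    show "(\<forall>j>q. pact f 0 W j = 0) \<and> pact f 0 W q = fmul (\<lambda>y. poly 0 (f y)) (W q)" by (auto simp: fun_eq_iff)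
  qed
  then show "j > q \<Longrightarrow> pact f p W j = 0" "pact f p W q = fmul (\<lambda>y. poly p (f y)) (W q)" by auto
qed

section \<open>The Gauss-Manin system and the Brieskorn module\<close>

text \<open>
  The relation \<open>dH - \<partial>\<^sub>t (df \<and> H)\<close>.
\<close>

definition gm_rel :: "('n::{finite,linorder} aff \<Rightarrow> complex) \<Rightarrow> (nat \<Rightarrow> 'n form) \<Rightarrow> nat \<Rightarrow> 'n form" where
  "gm_rel f H = (\<lambda>j. ext_d (H j)) - dt_mult (\<lambda>j. df_wedge f (H j))"

lemma gm_rel_nth: "gm_rel f H 0 = ext_d (H 0)" "gm_rel f H (Suc j) = ext_d (H (Suc j)) - df_wedge f (H j)"
  by (simp_all add: gm_rel_def dt_mult_def)

lemma eq_by_nat_cases: "g 0 = h 0 \<Longrightarrow> (\<And>j. g (Suc j) = h (Suc j)) \<Longrightarrow> g = h"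
  by (rule ext) (metis not0_implies_Suc)

lemma gm_rel_add: "H \<in> dt_forms q \<Longrightarrow> H' \<in> dt_forms q \<Longrightarrow> gm_rel f (H + H') = gm_rel f H + gm_rel f H'"
  by (rule eq_by_nat_cases) (simp_all add: gm_rel_nth alg_ext_d_add[OF dt_formsD dt_formsD] df_wedge_fun)

lemma gm_rel_uminus: "H \<in> dt_forms q \<Longrightarrow> gm_rel f (- H) = - gm_rel f H"
  by (rule eq_by_nat_cases) (simp_all add: gm_rel_nth alg_ext_d_uminus[OF dt_formsD] df_wedge_fun)

lemma gm_rel_scal: "H \<in> dt_forms q \<Longrightarrow> gm_rel f (scal a H) = scal a (gm_rel f H)"
  by (rule eq_by_nat_cases) (simp_all add: gm_rel_nth alg_ext_d_cmul[OF dt_formsD] df_wedge_fun fun_eq_iff algebra_simps)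

lemma gm_rel_zero [simp]: "gm_rel f 0 = 0"
  by (rule eq_by_nat_cases) (simp_all add: gm_rel_nth)

lemma gm_rel_single: "gm_rel f (single j \<omega>) = single j (ext_d \<omega>) - single (Suc j) (df_wedge f \<omega>)"
  by (rule eq_by_nat_cases) (auto simp: gm_rel_nth fun_eq_iff)

text \<open>
  The product rule for \<open>d(f H)\<close> compensates for the commutator of \<open>t\<close> and \<open>\<partial>\<^sub>t\<close>: the relations form a
  \<open>\<complex>[t]\<close>-submodule.
\<close>

lemma gm_rel_t_mult:
  assumes H: "H \<in> dt_forms q" and f: "polynomial_map f"
  shows "gm_rel f (t_mult f H) = t_mult f (gm_rel f H)"
proof -
  have e: "ext_d (t_mult f H j) = (df_wedge f (H j) + fmul f (ext_d (H j))) - fmul (\<lambda>y. of_nat (Suc j)) (ext_d (H (Suc j)))" for j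
    unfolding t_mult_nth
    using alg_ext_d_diff[OF alg_forms_fmul[OF dt_formsD[OF H] f] alg_forms_fmul[OF dt_formsD[OF H] polynomial_map_const]]
      alg_ext_d_fmul[OF dt_formsD[OF H] f] alg_ext_d_cmul[OF dt_formsD[OF H]] by simp
  show ?thesis
  proof (rule eq_by_nat_cases)
    have "gm_rel f (t_mult f H) 0 = ext_d (t_mult f H 0)" by (rule gm_rel_nth(1))
    also note e[of 0]
    also have "(df_wedge f (H 0) + fmul f (ext_d (H 0))) - fmul (\<lambda>y. of_nat (Suc 0)) (ext_d (H (Suc 0))) = t_mult f (gm_rel f H) 0"
      unfolding t_mult_nth gm_rel_nth by (intro ext) (simp add: algebra_simps)
    finally show "gm_rel f (t_mult f H) 0 = t_mult f (gm_rel f H) 0" .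
    fix j
    have "gm_rel f (t_mult f H) (Suc j) = ext_d (t_mult f H (Suc j)) - df_wedge f (t_mult f H j)" by (rule gm_rel_nth(2))
    also note e[of "Suc j"]
    also have "(df_wedge f (H (Suc j)) + fmul f (ext_d (H (Suc j)))) - fmul (\<lambda>y. of_nat (Suc (Suc j))) (ext_d (H (Suc (Suc j)))) - df_wedge f (t_mult f H j) = t_mult f (gm_rel f H) (Suc j)"
      unfolding t_mult_nth gm_rel_nth df_wedge_fun by (intro ext) (simp add: algebra_simps)
    finally show "gm_rel f (t_mult f H) (Suc j) = t_mult f (gm_rel f H) (Suc j)" .
  qed
qed

lemma gm_rel_pact:
  assumes H: "H \<in> dt_forms q" and f: "polynomial_map f"
  shows "gm_rel f (pact f p H) = pact f p (gm_rel f H)"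
proof (induction p)
  case (pCons a p)
  have "gm_rel f (pact f (pCons a p) H) = gm_rel f (scal a H) + gm_rel f (t_mult f (pact f p H))"
    unfolding pact_pCons by (rule gm_rel_add[OF scal_closed[OF H] t_mult_closed[OF pact_closed[OF H f] f]])
  also have "\<dots> = pact f (pCons a p) (gm_rel f H)"
    unfolding pact_pCons gm_rel_t_mult[OF pact_closed[OF H f] f] gm_rel_scal[OF H] pCons.IH ..
  finally show "gm_rel f (pact f (pCons a p) H) = pact f (pCons a p) (gm_rel f H)" .
next
  case 0
  show "gm_rel f (pact f 0 H) = pact f 0 (gm_rel f H)" by (simp only: pact_0 gm_rel_zero)
qed

locale global_setting =
  fixes f :: "'n::{finite,linorder} aff \<Rightarrow> complex"
  assumes dim: "CARD('n) \<ge> 2" and f_poly: "polynomial_map f"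
begin

lemma degs: "Suc (CARD('n) - 1) = CARD('n)" "Suc (CARD('n) - 2) = CARD('n) - 1" using dim by auto

abbreviation "DT \<equiv> dt_forms CARD('n) :: (nat \<Rightarrow> 'n form) set"
abbreviation "DT1 \<equiv> dt_forms (CARD('n) - 1) :: (nat \<Rightarrow> 'n form) set"
abbreviation "GM \<equiv> gauss_manin f"
abbreviation "BR \<equiv> brieskorn f"
abbreviation "rels \<equiv> gauss_manin_relations f"

lemma rels_eq: "rels = gm_rel f ` DT1"
  unfolding gauss_manin_relations_def gm_rel_def by blast

lemma alg_ext_d_top: "\<eta> \<in> alg_forms (CARD('n) - 1) \<Longrightarrow> ext_d \<eta> \<in> alg_forms CARD('n)"
  and alg_df_wedge_top: "\<eta> \<in> alg_forms (CARD('n) - 1) \<Longrightarrow> df_wedge f \<eta> \<in> alg_forms CARD('n)"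
  and alg_ext_d_sub: "\<eta> \<in> alg_forms (CARD('n) - 2) \<Longrightarrow> ext_d \<eta> \<in> alg_forms (CARD('n) - 1)"
  and alg_df_wedge_sub: "\<eta> \<in> alg_forms (CARD('n) - 2) \<Longrightarrow> df_wedge f \<eta> \<in> alg_forms (CARD('n) - 1)"
  using alg_forms_ext_d[of \<eta> "CARD('n) - 1"] alg_forms_df_wedge[of \<eta> "CARD('n) - 1" f] f_poly
    alg_forms_ext_d[of \<eta> "CARD('n) - 2"] alg_forms_df_wedge[of \<eta> "CARD('n) - 2" f] by (auto simp: degs)

lemma gm_rel_closed: "H \<in> DT1 \<Longrightarrow> gm_rel f H \<in> DT"
proof (induction H rule: dt_forms_induct)
  case zero
  show "gm_rel f 0 \<in> DT" unfolding gm_rel_zero by (rule dt_forms_zero)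
next
  case (add W j \<omega>)
  show "gm_rel f (W + single j \<omega>) \<in> DT"
    unfolding gm_rel_add[OF add(1) dt_forms_single[OF add(2)]] gm_rel_single
    by (intro dt_forms_add dt_forms_diff dt_forms_single alg_ext_d_top alg_df_wedge_top add)
qed

lemma dt_module_simps: "carrier (dt_forms_module f) = DT" "W \<oplus>\<^bsub>dt_forms_module f\<^esub> W' = W + W'"
  "\<zero>\<^bsub>dt_forms_module f\<^esub> = 0" "p \<odot>\<^bsub>dt_forms_module f\<^esub> W = pact f p W"
  by (auto simp: dt_forms_module_def pact_def)

sublocale gmq: module_quotient rels "dt_forms_module f"
proof -
  have "abelian_subgroup rels (dt_forms_module f)"
  proof (rule abelian_subgroup_of_class)
    show "rels \<subseteq> carrier (dt_forms_module f)" using gm_rel_closed by (auto simp: rels_eq dt_module_simps)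
    show "0 \<in> rels" unfolding rels_eq using dt_forms_zero gm_rel_zero by (metis image_eqI)
    show "x + y \<in> rels" if "x \<in> rels" "y \<in> rels" for x y
      using that gm_rel_add[symmetric] dt_forms_add unfolding rels_eq by (auto simp del: plus_fun_apply intro!: image_eqI)
    show "- x \<in> rels" if "x \<in> rels" for x
      using that gm_rel_uminus[symmetric] dt_forms_uminus unfolding rels_eq by (auto intro!: image_eqI)
  qed (auto simp: dt_forms_module_def dt_forms_zero dt_forms_add dt_forms_uminus)
  then show "module_quotient rels (dt_forms_module f)" by (simp add: module_quotient_def)
qed

definition gm :: "(nat \<Rightarrow> 'n form) \<Rightarrow> (nat \<Rightarrow> 'n form) set" where
  "gm W = rels +>\<^bsub>dt_forms_module f\<^esub> W"

lemma dt_minus: "W \<in> DT \<Longrightarrow> W' \<in> DT \<Longrightarrow> W \<ominus>\<^bsub>dt_forms_module f\<^esub> W' = W - W'"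
  using abelian_group_of_class(2)[of "dt_forms_module f" W']
  by (simp add: a_minus_def dt_forms_module_def dt_forms_zero dt_forms_add dt_forms_uminus)

lemma gm_eq: "W \<in> DT \<Longrightarrow> W' \<in> DT \<Longrightarrow> gm W = gm W' \<longleftrightarrow> (\<exists>H\<in>DT1. W - W' = gm_rel f H)"
  unfolding gm_def by (subst gmq.quot_eq) (auto simp: dt_module_simps dt_minus rels_eq)

lemma GM_carrier: "carrier GM = gm ` DT"
  unfolding gauss_manin_def gmq.quot_carrier by (simp add: gm_def dt_module_simps)

lemma GM_add: "W \<in> DT \<Longrightarrow> W' \<in> DT \<Longrightarrow> gm W \<oplus>\<^bsub>GM\<^esub> gm W' = gm (W + W')"
  unfolding gauss_manin_def gm_def using gmq.quot_add[of W W'] by (simp add: dt_module_simps)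

lemma GM_abelian: "abelian_group GM"
  unfolding gauss_manin_def by (rule gmq.quot_abelian_group)

lemma pact_diff: "pact f p (W - W') = pact f p W - pact f p W'"
  using pact_add[of f p "W - W'" W'] by (simp add: algebra_simps)

lemma GM_smult: "W \<in> DT \<Longrightarrow> p \<odot>\<^bsub>GM\<^esub> gm W = gm (pact f p W)"
proof -
  assume W: "W \<in> DT"
  have "p \<odot>\<^bsub>GM\<^esub> gm W = rels +>\<^bsub>dt_forms_module f\<^esub> (p \<odot>\<^bsub>dt_forms_module f\<^esub> W)"
    unfolding gauss_manin_def gm_def
  proof (rule gmq.quot_smult)
    fix W W' assume a: "W \<in> carrier (dt_forms_module f)" "W' \<in> carrier (dt_forms_module f)"
      "rels +>\<^bsub>dt_forms_module f\<^esub> W = rels +>\<^bsub>dt_forms_module f\<^esub> W'"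
    then have W: "W \<in> DT" "W' \<in> DT" by (auto simp: dt_module_simps)
    then obtain H where H: "H \<in> DT1" "W - W' = gm_rel f H" using a(3) gm_eq[of W W'] by (auto simp: gm_def)
    have "pact f p W - pact f p W' = gm_rel f (pact f p H)"
      using H(2) gm_rel_pact[OF H(1) f_poly, of p] by (simp add: pact_diff[symmetric])
    then have "gm (pact f p W) = gm (pact f p W')"
      using gm_eq[OF pact_closed[OF W(1) f_poly] pact_closed[OF W(2) f_poly]] pact_closed[OF H(1) f_poly] by blast
    then show "rels +>\<^bsub>dt_forms_module f\<^esub> (p \<odot>\<^bsub>dt_forms_module f\<^esub> W) = rels +>\<^bsub>dt_forms_module f\<^esub> (p \<odot>\<^bsub>dt_forms_module f\<^esub> W')"
      by (simp add: gm_def dt_module_simps)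
  qed (use W pact_closed f_poly in \<open>auto simp: dt_module_simps\<close>)
  then show ?thesis by (simp add: gm_def dt_module_simps)
qed

lemma gm_lower: "\<eta> \<in> alg_forms (CARD('n) - 1) \<Longrightarrow> gm (single (Suc j) (df_wedge f \<eta>)) = gm (single j (ext_d \<eta>))"
proof -
  assume e: "\<eta> \<in> alg_forms (CARD('n) - 1)"
  have "gm (single j (ext_d \<eta>)) = gm (single (Suc j) (df_wedge f \<eta>))"
    unfolding gm_eq[OF dt_forms_single[OF alg_ext_d_top[OF e]] dt_forms_single[OF alg_df_wedge_top[OF e]]]
    using gm_rel_single[of f j \<eta>] dt_forms_single[OF e] by metis
  then show ?thesis by simp
qed

abbreviation "brels \<equiv> {df_wedge f (ext_d \<eta>) |\<eta>. \<eta> \<in> alg_forms (CARD('n) - 2)}"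

lemma alg_module_simps: "carrier (alg_forms_module f) = alg_forms CARD('n)" "\<omega> \<oplus>\<^bsub>alg_forms_module f\<^esub> \<omega>' = \<omega> + \<omega>'"
  "\<zero>\<^bsub>alg_forms_module f\<^esub> = 0" "p \<odot>\<^bsub>alg_forms_module f\<^esub> \<omega> = fmul (\<lambda>y. poly p (f y)) \<omega>"
  by (auto simp: alg_forms_module_def)

sublocale brq: module_quotient brels "alg_forms_module f"
proof -
  have "abelian_subgroup brels (alg_forms_module f)"
  proof (rule abelian_subgroup_of_class)
    show "brels \<subseteq> carrier (alg_forms_module f)" by (auto simp: alg_module_simps intro: alg_df_wedge_top alg_ext_d_sub)
    show "0 \<in> brels" by (intro CollectI exI[of _ 0]) simp
    show "x + y \<in> brels" if xy: "x \<in> brels" "y \<in> brels" for x y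
    proof -
      obtain \<eta> \<xi> where e: "x = df_wedge f (ext_d \<eta>)" "y = df_wedge f (ext_d \<xi>)" "\<eta> \<in> alg_forms (CARD('n) - 2)" "\<xi> \<in> alg_forms (CARD('n) - 2)"
        using xy by blast
      then have "x + y = df_wedge f (ext_d (\<eta> + \<xi>))" by (simp add: alg_ext_d_add[OF e(3,4)] df_wedge_fun)
      then show ?thesis using alg_forms_add[OF e(3,4)] by blast
    qed
    show "- x \<in> brels" if x: "x \<in> brels" for x
    proof -
      obtain \<eta> where e: "x = df_wedge f (ext_d \<eta>)" "\<eta> \<in> alg_forms (CARD('n) - 2)" using x by blast
      then have "- x = df_wedge f (ext_d (- \<eta>))" by (simp add: alg_ext_d_uminus[OF e(2)] df_wedge_fun)
      then show ?thesis using alg_forms_uminus[OF e(2)] by blast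
    qed
  qed (auto simp: alg_forms_module_def alg_forms_add alg_forms_uminus)
  then show "module_quotient brels (alg_forms_module f)" by (simp add: module_quotient_def)
qed

definition br :: "'n form \<Rightarrow> 'n form set" where "br \<omega> = brels +>\<^bsub>alg_forms_module f\<^esub> \<omega>"

lemma alg_minus: "\<omega> \<in> alg_forms CARD('n) \<Longrightarrow> \<omega>' \<in> alg_forms CARD('n) \<Longrightarrow> \<omega> \<ominus>\<^bsub>alg_forms_module f\<^esub> \<omega>' = \<omega> - \<omega>'"
  using abelian_group_of_class(2)[of "alg_forms_module f" \<omega>']
  by (simp add: a_minus_def alg_forms_module_def alg_forms_add alg_forms_uminus)

lemma br_eq: "\<omega> \<in> alg_forms CARD('n) \<Longrightarrow> \<omega>' \<in> alg_forms CARD('n) \<Longrightarrow>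
   br \<omega> = br \<omega>' \<longleftrightarrow> (\<exists>\<eta>\<in>alg_forms (CARD('n) - 2). \<omega> - \<omega>' = df_wedge f (ext_d \<eta>))"
  unfolding br_def by (subst brq.quot_eq) (auto simp: alg_module_simps alg_minus)

lemma BR_carrier: "carrier BR = br ` alg_forms CARD('n)"
  unfolding brieskorn_def brq.quot_carrier by (simp add: br_def alg_module_simps)

lemma BR_add: "\<omega> \<in> alg_forms CARD('n) \<Longrightarrow> \<omega>' \<in> alg_forms CARD('n) \<Longrightarrow> br \<omega> \<oplus>\<^bsub>BR\<^esub> br \<omega>' = br (\<omega> + \<omega>')"
  unfolding brieskorn_def br_def using brq.quot_add[of \<omega> \<omega>'] by (simp add: alg_module_simps)

lemma BR_abelian: "abelian_group BR"
  unfolding brieskorn_def by (rule brq.quot_abelian_group)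

lemma poly_f: "polynomial_map (\<lambda>y. poly p (f y))" by (rule polynomial_map_poly[OF f_poly])

lemma BR_smult: "\<omega> \<in> alg_forms CARD('n) \<Longrightarrow> p \<odot>\<^bsub>BR\<^esub> br \<omega> = br (fmul (\<lambda>y. poly p (f y)) \<omega>)"
proof -
  assume w: "\<omega> \<in> alg_forms CARD('n)"
  have "p \<odot>\<^bsub>BR\<^esub> br \<omega> = brels +>\<^bsub>alg_forms_module f\<^esub> (p \<odot>\<^bsub>alg_forms_module f\<^esub> \<omega>)"
    unfolding brieskorn_def br_def
  proof (rule brq.quot_smult)
    fix \<omega> \<omega>' assume a: "\<omega> \<in> carrier (alg_forms_module f)" "\<omega>' \<in> carrier (alg_forms_module f)"
      "brels +>\<^bsub>alg_forms_module f\<^esub> \<omega> = brels +>\<^bsub>alg_forms_module f\<^esub> \<omega>'"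
    then have w: "\<omega> \<in> alg_forms CARD('n)" "\<omega>' \<in> alg_forms CARD('n)" by (auto simp: alg_module_simps)
    then obtain \<eta> where e: "\<eta> \<in> alg_forms (CARD('n) - 2)" "\<omega> - \<omega>' = df_wedge f (ext_d \<eta>)"
      using a(3) br_eq[of \<omega> \<omega>'] by (auto simp: br_def)
    define u where "u = (\<lambda>y. poly p (f y))"
    have u: "polynomial_map u" unfolding u_def by (rule poly_f)
    have du: "df_wedge u \<eta> = fmul (\<lambda>y. poly (pderiv p) (f y)) (df_wedge f \<eta>)"
    proof -
      have "has_grad u (\<lambda>i. poly (pderiv p) (f y) * partial i f y) y" for y
        unfolding u_def by (rule has_grad_comp[OF holo_onD[OF polynomial_map_holo[OF f_poly] UNIV_I] poly_DERIV])
      then have "partial i u y = poly (pderiv p) (f y) * partial i f y" for i y by (rule has_grad_partial)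
      then show ?thesis by (intro ext) (simp add: df_wedge_def sum_distrib_left mult_ac)
    qed
    have "df_wedge f (ext_d (fmul u \<eta>)) = df_wedge f (df_wedge u \<eta> + fmul u (ext_d \<eta>))"
      by (simp add: alg_ext_d_fmul[OF e(1) u])
    also have "\<dots> = fmul u (df_wedge f (ext_d \<eta>))"
      unfolding df_wedge_fun du by (simp add: fun_eq_iff)
    also have "\<dots> = fmul u \<omega> - fmul u \<omega>'" unfolding e(2)[symmetric] by (simp add: fun_eq_iff algebra_simps)
    finally have "br (fmul u \<omega>) = br (fmul u \<omega>')"
      using br_eq[OF alg_forms_fmul[OF w(1) u] alg_forms_fmul[OF w(2) u]] alg_forms_fmul[OF e(1) u] by metis
    then show "brels +>\<^bsub>alg_forms_module f\<^esub> (p \<odot>\<^bsub>alg_forms_module f\<^esub> \<omega>) = brels +>\<^bsub>alg_forms_module f\<^esub> (p \<odot>\<^bsub>alg_forms_module f\<^esub> \<omega>')"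
      by (simp add: br_def alg_module_simps u_def)
  qed (use w poly_f alg_forms_fmul in \<open>auto simp: alg_module_simps\<close>)
  then show ?thesis by (simp add: br_def alg_module_simps)
qed

text \<open>
  A relation \<open>df \<and> d\<eta>\<close> of the Brieskorn module is the relation \<open>d\<zeta> - \<partial>\<^sub>t (df \<and> \<zeta>)\<close> for \<open>\<zeta> = - df \<and> \<eta>\<close>, as
  \<open>df \<and> \<zeta> = 0\<close>.
\<close>

lemma b2g: "\<omega> \<in> alg_forms CARD('n) \<Longrightarrow> brieskorn_to_gauss_manin f (br \<omega>) = gm (single 0 \<omega>)"
proof -
  assume w: "\<omega> \<in> alg_forms CARD('n)"
  have "the_elem ((\<lambda>\<omega>. gm (single 0 \<omega>)) ` br \<omega>) = gm (single 0 \<omega>)"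
    unfolding br_def
  proof (rule brq.quot_lift)
    show "\<omega> \<in> carrier (alg_forms_module f)" using w by (simp add: alg_module_simps)
    fix \<omega>' assume a: "\<omega>' \<in> carrier (alg_forms_module f)" "brels +>\<^bsub>alg_forms_module f\<^esub> \<omega>' = brels +>\<^bsub>alg_forms_module f\<^esub> \<omega>"
    then have w': "\<omega>' \<in> alg_forms CARD('n)" by (simp add: alg_module_simps)
    then obtain \<eta> where e: "\<eta> \<in> alg_forms (CARD('n) - 2)" "\<omega>' - \<omega> = df_wedge f (ext_d \<eta>)"
      using a(2) br_eq[OF w' w] by (auto simp: br_def)
    have "ext_d (df_wedge f (- \<eta>)) = - df_wedge f (ext_d (- \<eta>))"
      by (rule alg_ext_d_df_wedge[OF alg_forms_uminus[OF e(1)] f_poly])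
    also have "\<dots> = df_wedge f (ext_d \<eta>)" by (simp add: alg_ext_d_uminus[OF e(1)] df_wedge_fun)
    also have "\<dots> = \<omega>' - \<omega>" by (rule e(2)[symmetric])
    finally have "ext_d (df_wedge f (- \<eta>)) = \<omega>' - \<omega>" .
    then have "gm_rel f (single 0 (df_wedge f (- \<eta>))) = single 0 (\<omega>' - \<omega>) - single (Suc 0) 0"
      unfolding gm_rel_single df_wedge_df_wedge_fun by (simp only:)
    also have "\<dots> = single 0 \<omega>' - single 0 \<omega>" by (intro ext) simp
    finally have "single 0 \<omega>' - single 0 \<omega> = gm_rel f (single 0 (df_wedge f (- \<eta>)))" by (rule sym)
    then show "gm (single 0 \<omega>') = gm (single 0 \<omega>)"
      using gm_eq[OF dt_forms_single[OF w'] dt_forms_single[OF w]] dt_forms_single[OF alg_df_wedge_sub[OF alg_forms_uminus[OF e(1)]]] by blast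
  qed
  then show ?thesis by (simp add: brieskorn_to_gauss_manin_def gm_def)
qed

lemma pact_single0: "pact f p (single 0 \<omega>) = single 0 (fmul (\<lambda>y. poly p (f y)) \<omega>)"
  using pact_top[where q = 0 and W = "single 0 \<omega>" and f = f and p = p] by (intro eq_by_nat_cases) simp_all

end

lemma conv_base_change_data:
  assumes "abelian_group M" "\<And>p m. m \<in> carrier M \<Longrightarrow> p \<odot>\<^bsub>M\<^esub> m \<in> carrier M"
  shows "base_change_data Ct (conv_series c) M"
proof -
  interpret abelian_group M by fact
  have S: "carrier (conv_series c) = conv_fps" by (simp add: conv_series_def)
  show ?thesis
    by unfold_locales (use assms(2) conv_fps_closed in \<open>auto simp: S, auto simp: conv_series_def algebra_simps Ct_def\<close>)
qed

section \<open>Comparison with the local objects\<close>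

abbreviation expand :: "complex \<Rightarrow> complex poly \<Rightarrow> complex fps" where
  "expand c p \<equiv> fps_of_poly (pcompose p [:c, 1:])"

locale point_setting = global_setting f + loc: local_lattice f x
  for f :: "'n::{finite,linorder} aff \<Rightarrow> complex" and x
begin

abbreviation "AN \<equiv> alg_forms CARD('n) :: 'n form set"
abbreviation "LG \<equiv> dt_localization (local_brieskorn f x) (local_dt_inv f x)"
abbreviation "lcls \<equiv> dt_class (local_brieskorn f x) (local_dt_inv f x)"

sublocale LG: abelian_group "dt_localization (local_brieskorn f x) (local_dt_inv f x)" by (rule loc.LB.L_abelian)

lemma alg_AF: "\<omega> \<in> AN \<Longrightarrow> \<omega> \<in> an_forms CARD('n) x" by (rule alg_forms_subset_an_forms)

lemma lc_closed: "\<omega> \<in> AN \<Longrightarrow> loc.lc \<omega> \<in> carrier loc.LB"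
  using alg_AF by (auto simp: loc.LB_carrier)

lemma lc_add: "\<omega> \<in> AN \<Longrightarrow> \<omega>' \<in> AN \<Longrightarrow> loc.lc (\<omega> + \<omega>') = loc.lc \<omega> \<oplus>\<^bsub>loc.LB\<^esub> loc.lc \<omega>'"
  by (simp add: loc.LB_add alg_AF)

lemma br_local: assumes w: "\<omega> \<in> AN" shows "brieskorn_to_local f x (br \<omega>) = loc.lc \<omega>"
proof -
  have "the_elem (loc.lc ` br \<omega>) = loc.lc \<omega>"
    unfolding br_def
  proof (rule brq.quot_lift)
    show "\<omega> \<in> carrier (alg_forms_module f)" using w by (simp add: alg_module_simps)
    fix \<omega>' assume a: "\<omega>' \<in> carrier (alg_forms_module f)" "brels +>\<^bsub>alg_forms_module f\<^esub> \<omega>' = brels +>\<^bsub>alg_forms_module f\<^esub> \<omega>"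
    then have w': "\<omega>' \<in> AN" by (simp add: alg_module_simps)
    then obtain \<eta> where e: "\<eta> \<in> alg_forms (CARD('n) - 2)" "\<omega>' - \<omega> = df_wedge f (ext_d \<eta>)"
      using a(2) br_eq[OF w' w] by (auto simp: br_def)
    from e(2) have "\<omega>' = \<omega> + df_wedge f (ext_d \<eta>)" by (simp add: algebra_simps)
    then have "germ_eq x \<omega>' (\<omega> + df_wedge f (ext_d \<eta>))" by (simp only: germ_eq_refl)
    then show "loc.lc \<omega>' = loc.lc \<omega>"
      using loc.lc_eq[OF alg_AF[OF w'] alg_AF[OF w]] alg_forms_subset_an_forms[OF e(1)] by blast
  qed
  then show ?thesis by (simp add: brieskorn_to_local_def)
qed

text \<open>
  The local image of a representative.
\<close>

definition Phi :: "(nat \<Rightarrow> 'n form) \<Rightarrow> ('n form set set \<times> nat) set" where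
  "Phi W = (\<Oplus>\<^bsub>LG\<^esub>j\<in>{j. W j \<noteq> 0}. lcls (loc.lc (W j)) j)"

lemma term_closed: "W \<in> DT \<Longrightarrow> lcls (loc.lc (W j)) j \<in> carrier LG"
  by (intro loc.LB.cls_closed lc_closed dt_formsD)

lemma lc_zero: "lcls (loc.lc 0) j = \<zero>\<^bsub>LG\<^esub>"
  using loc.LB.cls_zero[of j] by (simp add: loc.LB_zero)

lemma Phi_superset:
  assumes W: "W \<in> DT" and A: "finite A" "{j. W j \<noteq> 0} \<subseteq> A"
  shows "Phi W = (\<Oplus>\<^bsub>LG\<^esub>j\<in>A. lcls (loc.lc (W j)) j)"
  unfolding Phi_def
proof (rule LG.add.finprod_mono_neutral_cong_left[OF A])
  show "lcls (loc.lc (W j)) j = \<zero>\<^bsub>LG\<^esub>" if "j \<in> A - {j. W j \<noteq> 0}" for j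
  proof -
    from that have "W j = 0" by blast
    then show ?thesis by (simp only: lc_zero)
  qed
qed (use term_closed[OF W] in auto)

lemma Phi_closed: "W \<in> DT \<Longrightarrow> Phi W \<in> carrier LG"
  unfolding Phi_def using term_closed by (intro LG.finsum_closed) auto

lemma Phi_add: assumes W: "W \<in> DT" "W' \<in> DT" shows "Phi (W + W') = Phi W \<oplus>\<^bsub>LG\<^esub> Phi W'"
proof -
  let ?A = "{j. W j \<noteq> 0} \<union> {j. W' j \<noteq> 0}"
  have A: "finite ?A" using W by (simp add: dt_forms_def)
  have s: "{j. (W + W') j \<noteq> 0} \<subseteq> ?A" by auto
  have "Phi (W + W') = (\<Oplus>\<^bsub>LG\<^esub>j\<in>?A. lcls (loc.lc (W j)) j \<oplus>\<^bsub>LG\<^esub> lcls (loc.lc (W' j)) j)"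
    unfolding Phi_superset[OF dt_forms_add[OF W] A s]
  proof (rule LG.finsum_cong'[OF refl])
    fix j
    show "lcls (loc.lc ((W + W') j)) j = lcls (loc.lc (W j)) j \<oplus>\<^bsub>LG\<^esub> lcls (loc.lc (W' j)) j"
      unfolding plus_fun_apply lc_add[OF dt_formsD[OF W(1)] dt_formsD[OF W(2)]]
      by (rule loc.LB.L_add[symmetric]) (intro lc_closed dt_formsD W)+
  qed (use term_closed[OF W(1)] term_closed[OF W(2)] in auto)
  also have "\<dots> = Phi W \<oplus>\<^bsub>LG\<^esub> Phi W'"
    unfolding Phi_superset[OF W(1) A Un_upper1] Phi_superset[OF W(2) A Un_upper2]
    by (rule LG.finsum_addf) (use term_closed[OF W(1)] term_closed[OF W(2)] in auto)
  finally show ?thesis .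
qed

lemma Phi_zero: "Phi 0 = \<zero>\<^bsub>LG\<^esub>"
  by (simp add: Phi_def)

lemma Phi_single: assumes w: "\<omega> \<in> AN" shows "Phi (single j \<omega>) = lcls (loc.lc \<omega>) j"
proof -
  have "Phi (single j \<omega>) = (\<Oplus>\<^bsub>LG\<^esub>i\<in>{j}. lcls (loc.lc (single j \<omega> i)) i)"
    by (rule Phi_superset[OF dt_forms_single[OF w]]) auto
  also have "\<dots> = lcls (loc.lc \<omega>) j"
    using loc.LB.cls_closed[OF lc_closed[OF w], of j] by simp
  finally show ?thesis .
qed

lemma cls_dt: "\<eta> \<in> an_forms (CARD('n) - 1) x \<Longrightarrow> lcls (loc.lc (ext_d \<eta>)) j = lcls (loc.lc (df_wedge f \<eta>)) (Suc j)"
proof -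
  assume e: "\<eta> \<in> an_forms (CARD('n) - 1) x"
  have "loc.lc (ext_d \<eta>) \<in> carrier loc.LB" using loc.ext_d_top[OF e] by (simp add: loc.LB_carrier)
  from loc.LB.cls_shift[OF this, of 1 j] show ?thesis by (simp add: loc.dt_inv_eq[OF e])
qed

text \<open>
  The two terms of the relation \<open>d\<eta> \<partial>\<^sub>t\<^sup>j - df \<and> \<eta> \<partial>\<^sub>t\<^bsup>j+1\<^esup>\<close> have the same local image by the definition of
  the local \<open>\<partial>\<^sub>t\<^sup>-\<^sup>1\<close>.
\<close>

lemma Phi_rel: "H \<in> DT1 \<Longrightarrow> Phi (gm_rel f H) = \<zero>\<^bsub>LG\<^esub>"
proof (induction H rule: dt_forms_induct)
  case zero
  show "Phi (gm_rel f 0) = \<zero>\<^bsub>LG\<^esub>" unfolding gm_rel_zero by (rule Phi_zero)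
next
  case (add W j \<eta>)
  note e = alg_ext_d_top[OF add(2)] alg_df_wedge_top[OF add(2)]
  note e' = alg_forms_uminus[OF e(2)]
  have "gm_rel f (W + single j \<eta>) = gm_rel f W + (single j (ext_d \<eta>) + single (Suc j) (- df_wedge f \<eta>))"
    unfolding gm_rel_add[OF add(1) dt_forms_single[OF add(2)]] gm_rel_single
    by (intro arg_cong2[where f = "(+)"] refl ext) auto
  then have "Phi (gm_rel f (W + single j \<eta>)) = Phi (gm_rel f W) \<oplus>\<^bsub>LG\<^esub> (Phi (single j (ext_d \<eta>)) \<oplus>\<^bsub>LG\<^esub> Phi (single (Suc j) (- df_wedge f \<eta>)))"
    by (simp only: Phi_add[OF gm_rel_closed[OF add(1)] dt_forms_add[OF dt_forms_single[OF e(1)] dt_forms_single[OF e']]]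
       Phi_add[OF dt_forms_single[OF e(1)] dt_forms_single[OF e']])
  also have "Phi (single j (ext_d \<eta>)) = lcls (loc.lc (df_wedge f \<eta>)) (Suc j)"
    unfolding Phi_single[OF e(1)] by (rule cls_dt[OF alg_forms_subset_an_forms[OF add(2)]])
  also have "lcls (loc.lc (df_wedge f \<eta>)) (Suc j) \<oplus>\<^bsub>LG\<^esub> Phi (single (Suc j) (- df_wedge f \<eta>)) = lcls (loc.lc (df_wedge f \<eta> + - df_wedge f \<eta>)) (Suc j)"
    unfolding Phi_single[OF e'] lc_add[OF e(2) e'] by (rule loc.LB.L_add[OF lc_closed[OF e(2)] lc_closed[OF e']])
  also have "\<dots> = \<zero>\<^bsub>LG\<^esub>" by (simp add: lc_zero)
  also have "Phi (gm_rel f W) \<oplus>\<^bsub>LG\<^esub> \<zero>\<^bsub>LG\<^esub> = \<zero>\<^bsub>LG\<^esub>" by (simp add: add.IH)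
  finally show "Phi (gm_rel f (W + single j \<eta>)) = \<zero>\<^bsub>LG\<^esub>" .
qed

lemma gm_local: assumes W: "W \<in> DT" shows "gauss_manin_to_local f x (gm W) = Phi W"
proof -
  have "the_elem (Phi ` gm W) = Phi W"
    unfolding gm_def
  proof (rule gmq.quot_lift)
    show "W \<in> carrier (dt_forms_module f)" using W by (simp add: dt_module_simps)
    fix W' assume a: "W' \<in> carrier (dt_forms_module f)" "rels +>\<^bsub>dt_forms_module f\<^esub> W' = rels +>\<^bsub>dt_forms_module f\<^esub> W"
    then have W': "W' \<in> DT" by (simp add: dt_module_simps)
    then obtain H where H: "H \<in> DT1" "W' - W = gm_rel f H" using a(2) gm_eq[OF W' W] by (auto simp: gm_def)
    then have "W' = W + gm_rel f H" by (simp add: algebra_simps)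
    then have "Phi W' = Phi W \<oplus>\<^bsub>LG\<^esub> Phi (gm_rel f H)" by (simp only: Phi_add[OF W gm_rel_closed[OF H(1)]])
    then show "Phi W' = Phi W" using Phi_rel[OF H(1)] Phi_closed[OF W] by simp
  qed
  then show ?thesis by (simp add: gauss_manin_to_local_def local_gauss_manin_def Phi_def[abs_def])
qed

lemma L_smult_zero: "g \<in> conv_fps \<Longrightarrow> g \<odot>\<^bsub>LG\<^esub> \<zero>\<^bsub>LG\<^esub> = \<zero>\<^bsub>LG\<^esub>"
proof -
  assume g: "g \<in> conv_fps"
  have "g \<odot>\<^bsub>LG\<^esub> \<zero>\<^bsub>LG\<^esub> \<oplus>\<^bsub>LG\<^esub> g \<odot>\<^bsub>LG\<^esub> \<zero>\<^bsub>LG\<^esub> = g \<odot>\<^bsub>LG\<^esub> \<zero>\<^bsub>LG\<^esub>"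
    using loc.LB.L_smult_add[OF g LG.zero_closed LG.zero_closed] by simp
  then show ?thesis using loc.LB.L_smult_closed[OF g LG.zero_closed] by simp
qed

lemma act_zero: "m \<in> carrier loc.LB \<Longrightarrow> loc.LB.act 0 k m = \<zero>\<^bsub>loc.LB\<^esub>"
  using loc.LB.act_add_left[of 0 0 m k] loc.LB.act_closed[of 0 m k] conv_fps_closed(6) by simp

lemma zero_smult: "u \<in> carrier LG \<Longrightarrow> 0 \<odot>\<^bsub>LG\<^esub> u = \<zero>\<^bsub>LG\<^esub>"
proof -
  assume u: "u \<in> carrier LG"
  have "0 \<odot>\<^bsub>LG\<^esub> u \<oplus>\<^bsub>LG\<^esub> 0 \<odot>\<^bsub>LG\<^esub> u = 0 \<odot>\<^bsub>LG\<^esub> u"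
    using loc.LB.L_smult_add_left[OF conv_fps_closed(6) conv_fps_closed(6) u] by simp
  then show ?thesis using loc.LB.L_smult_closed[OF conv_fps_closed(6) u] by simp
qed

lemma const_conv: "fps_const a \<in> conv_fps" by simp

lemma cmul_closed: "\<omega> \<in> AN \<Longrightarrow> fmul (\<lambda>y. a) \<omega> \<in> AN" by (intro alg_forms_fmul polynomial_map_const)

lemma LB_const: "\<omega> \<in> AN \<Longrightarrow> fps_const a \<odot>\<^bsub>loc.LB\<^esub> loc.lc \<omega> = loc.lc (fmul (\<lambda>y. a) \<omega>)"
  using loc.LB_smult[OF const_conv alg_AF, of \<omega> a] by (simp add: pull_def)

lemma act_const: assumes w: "\<omega> \<in> AN" shows "loc.LB.act (fps_const a) k (loc.lc \<omega>) = loc.lc (fmul (\<lambda>y. a) \<omega>)"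
proof (induction k)
  case (Suc k)
  show ?case
    unfolding loc.LB.act.simps Suc fps_deriv_const act_zero[OF lc_closed[OF w]] loc.LB.s_zero
    using lc_closed[OF cmul_closed[OF w]] by (simp add: a_minus_def)
qed (simp add: LB_const[OF w])

lemma act_one': assumes w: "\<omega> \<in> AN" shows "loc.LB.act 1 k (loc.lc \<omega>) = loc.lc \<omega>"
  using act_const[OF w, of 1 k] by simp

abbreviation "T \<equiv> fps_of_poly [:f x, 1:]"

text \<open>
  The rule \<open>t \<partial>\<^sub>t\<^sup>k = \<partial>\<^sub>t\<^sup>k t - k \<partial>\<^sub>t\<^bsup>k-1\<^esup>\<close> of the algebraic system, for the local action of power series.  In the
  formal variable \<open>t - f x\<close> the function \<open>t\<close> is the series \<open>T\<close>.
\<close>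

lemma act_T:
  assumes w: "\<omega> \<in> AN"
  shows "loc.LB.act T k (loc.lc \<omega>) = loc.lc (fmul f \<omega>) \<oplus>\<^bsub>loc.LB\<^esub> loc.s (loc.lc (fmul (\<lambda>y. - of_nat k) \<omega>))"
proof (induction k)
  case 0
  have "pull f x T y = f y" for y using pull_poly[of f x "[:0, 1:]" y] by (simp add: pcompose_pCons)
  then have "T \<odot>\<^bsub>loc.LB\<^esub> loc.lc \<omega> = loc.lc (fmul f \<omega>)"
    using loc.LB_smult[OF conv_fps_closed(4) alg_AF[OF w], of "[:f x, 1:]"] by simp
  moreover have "loc.s (loc.lc (fmul (\<lambda>y. - of_nat 0) \<omega>)) = \<zero>\<^bsub>loc.LB\<^esub>"
    using loc.LB.s_zero by (simp add: loc.LB_zero zero_fun_def)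
  ultimately show ?case using lc_closed[OF alg_forms_fmul[OF w f_poly]] by simp
next
  case (Suc k)
  note A = lc_closed[OF alg_forms_fmul[OF w f_poly]]
  note B = lc_closed[OF cmul_closed[OF w, of "- of_nat k"]]
  note C = lc_closed[OF w] lc_closed[OF alg_forms_uminus[OF w]]
  have e: "fmul (\<lambda>y. - of_nat k) \<omega> + - \<omega> = fmul (\<lambda>y. - of_nat (Suc k)) \<omega>" by (auto simp: fun_eq_iff algebra_simps)
  have d: "fps_deriv T = 1" by (simp add: fps_of_poly_pCons)
  have "loc.LB.act T (Suc k) (loc.lc \<omega>) = (loc.lc (fmul f \<omega>) \<oplus>\<^bsub>loc.LB\<^esub> loc.s (loc.lc (fmul (\<lambda>y. - of_nat k) \<omega>))) \<ominus>\<^bsub>loc.LB\<^esub> loc.s (loc.lc \<omega>)"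
    unfolding loc.LB.act.simps Suc d act_one'[OF w] ..
  also have "\<dots> = loc.lc (fmul f \<omega>) \<oplus>\<^bsub>loc.LB\<^esub> (loc.s (loc.lc (fmul (\<lambda>y. - of_nat k) \<omega>)) \<oplus>\<^bsub>loc.LB\<^esub> loc.s (loc.lc (- \<omega>)))"
    using A B C by (simp add: a_minus_def loc.LB.s_uminus[symmetric] loc.LB_inv[OF alg_AF[OF w]] loc.LB.a_assoc)
  also have "loc.s (loc.lc (fmul (\<lambda>y. - of_nat k) \<omega>)) \<oplus>\<^bsub>loc.LB\<^esub> loc.s (loc.lc (- \<omega>)) = loc.s (loc.lc (fmul (\<lambda>y. - of_nat (Suc k)) \<omega>))"
    unfolding loc.LB.s_add[OF B C(2), symmetric] lc_add[OF cmul_closed[OF w] alg_forms_uminus[OF w], symmetric] e ..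
  finally show ?case .
qed

lemma Phi_scal: "W \<in> DT \<Longrightarrow> Phi (scal a W) = fps_const a \<odot>\<^bsub>LG\<^esub> Phi W"
proof (induction W rule: dt_forms_induct)
  case zero
  have "scal a (0 :: nat \<Rightarrow> 'n form) = 0" by (intro ext) simp
  then show "Phi (scal a 0) = fps_const a \<odot>\<^bsub>LG\<^esub> Phi 0" by (simp only: Phi_zero L_smult_zero[OF const_conv])
next
  case (add W j \<omega>)
  note s = dt_forms_single[OF add(2), of j] dt_forms_single[OF cmul_closed[OF add(2), of a], of j]
  have "scal a (W + single j \<omega>) = scal a W + single j (fmul (\<lambda>y. a) \<omega>)" by (intro ext) (simp add: algebra_simps)
  then have "Phi (scal a (W + single j \<omega>)) = Phi (scal a W) \<oplus>\<^bsub>LG\<^esub> Phi (single j (fmul (\<lambda>y. a) \<omega>))"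
    by (simp only: Phi_add[OF scal_closed[OF add(1)] s(2)])
  also have "Phi (single j (fmul (\<lambda>y. a) \<omega>)) = fps_const a \<odot>\<^bsub>LG\<^esub> Phi (single j \<omega>)"
    unfolding Phi_single[OF add(2)] Phi_single[OF cmul_closed[OF add(2)]] loc.LB.L_smult[OF const_conv lc_closed[OF add(2)]] act_const[OF add(2)] ..
  finally show "Phi (scal a (W + single j \<omega>)) = fps_const a \<odot>\<^bsub>LG\<^esub> Phi (W + single j \<omega>)"
    unfolding add.IH Phi_add[OF add(1) s(1)] loc.LB.L_smult_add[OF const_conv Phi_closed[OF add(1)] Phi_closed[OF s(1)]] .
qed

lemma Phi_t_mult: "W \<in> DT \<Longrightarrow> Phi (t_mult f W) = T \<odot>\<^bsub>LG\<^esub> Phi W"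
proof (induction W rule: dt_forms_induct)
  case zero
  show "Phi (t_mult f 0) = T \<odot>\<^bsub>LG\<^esub> Phi 0" by (simp only: t_mult_zero Phi_zero L_smult_zero[OF conv_fps_closed(4)])
next
  case (add W j \<omega>)
  define a where "a = fmul f \<omega>"
  define b where "b = fmul (\<lambda>y. - of_nat j :: complex) \<omega>"
  have ab: "a \<in> AN" "b \<in> AN" unfolding a_def b_def by (intro alg_forms_fmul cmul_closed f_poly add(2))+
  note s = dt_forms_single[OF add(2), of j] dt_forms_single[OF ab(1), of j] dt_forms_single[OF ab(2), of "j - 1"]
  have "t_mult f (single j \<omega>) = single j a + single (j - 1) b"
    by (intro ext) (auto simp: t_mult_def a_def b_def)
  then have "Phi (t_mult f (single j \<omega>)) = lcls (loc.lc a) j \<oplus>\<^bsub>LG\<^esub> lcls (loc.lc b) (j - 1)"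
    by (simp only: Phi_add[OF s(2,3)] Phi_single[OF ab(1)] Phi_single[OF ab(2)])
  also have "lcls (loc.lc b) (j - 1) = lcls (loc.s (loc.lc b)) j"
  proof (cases j)
    case 0
    then have "b = 0" by (intro ext) (simp add: b_def)
    then show ?thesis using loc.LB.cls_zero loc.LB.s_zero by (simp add: loc.LB_zero)
  next
    case (Suc i)
    then show ?thesis using loc.LB.cls_shift[OF lc_closed[OF ab(2)], of 1 i] by simp
  qed
  also have "lcls (loc.lc a) j \<oplus>\<^bsub>LG\<^esub> lcls (loc.s (loc.lc b)) j = T \<odot>\<^bsub>LG\<^esub> Phi (single j \<omega>)"
    unfolding Phi_single[OF add(2)] loc.LB.L_smult[OF conv_fps_closed(4) lc_closed[OF add(2)]] act_T[OF add(2)] a_def[symmetric] b_def[symmetric]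
    by (rule loc.LB.L_add[OF lc_closed[OF ab(1)] loc.LB.s_closed[OF lc_closed[OF ab(2)]]])
  finally have e: "Phi (t_mult f (single j \<omega>)) = T \<odot>\<^bsub>LG\<^esub> Phi (single j \<omega>)" .
  show "Phi (t_mult f (W + single j \<omega>)) = T \<odot>\<^bsub>LG\<^esub> Phi (W + single j \<omega>)"
    unfolding t_mult_add Phi_add[OF t_mult_closed[OF add(1) f_poly] t_mult_closed[OF s(1) f_poly]] add.IH e Phi_add[OF add(1) s(1)]
    by (rule loc.LB.L_smult_add[OF conv_fps_closed(4) Phi_closed[OF add(1)] Phi_closed[OF s(1)], symmetric])
qed

lemma Phi_pact: assumes W: "W \<in> DT" shows "Phi (pact f p W) = expand (f x) p \<odot>\<^bsub>LG\<^esub> Phi W"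
proof (induction p)
  case 0
  show "Phi (pact f 0 W) = expand (f x) 0 \<odot>\<^bsub>LG\<^esub> Phi W"
    using zero_smult[OF Phi_closed[OF W]] by (simp only: pact_0 Phi_zero) simp
next
  case (pCons a p)
  note P = pact_closed[OF W f_poly, of p]
  have h: "expand (f x) (pCons a p) = fps_const a + T * expand (f x) p"
    by (simp add: pcompose_pCons fps_of_poly_add fps_of_poly_mult fps_of_poly_const)
  have c: "T * expand (f x) p \<in> conv_fps" by (intro conv_fps_closed(2) conv_fps_closed(4))
  have "Phi (pact f (pCons a p) W) = fps_const a \<odot>\<^bsub>LG\<^esub> Phi W \<oplus>\<^bsub>LG\<^esub> T \<odot>\<^bsub>LG\<^esub> (expand (f x) p \<odot>\<^bsub>LG\<^esub> Phi W)"
    unfolding pact_pCons Phi_add[OF scal_closed[OF W] t_mult_closed[OF P f_poly]] Phi_scal[OF W] Phi_t_mult[OF P] pCons.IH ..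
  also have "\<dots> = expand (f x) (pCons a p) \<odot>\<^bsub>LG\<^esub> Phi W"
    unfolding h loc.LB.L_smult_add_left[OF const_conv c Phi_closed[OF W]]
      loc.LB.L_smult_assoc[OF conv_fps_closed(4) conv_fps_closed(4) Phi_closed[OF W]] ..
  finally show "Phi (pact f (pCons a p) W) = expand (f x) (pCons a p) \<odot>\<^bsub>LG\<^esub> Phi W" .
qed

lemma L_diff: "m \<in> carrier loc.LB \<Longrightarrow> m' \<in> carrier loc.LB \<Longrightarrow> lcls m k \<ominus>\<^bsub>LG\<^esub> lcls m' k = lcls (m \<ominus>\<^bsub>loc.LB\<^esub> m') k"
proof -
  assume m: "m \<in> carrier loc.LB" "m' \<in> carrier loc.LB"
  have "\<ominus>\<^bsub>LG\<^esub> lcls m' k = lcls (\<ominus>\<^bsub>loc.LB\<^esub> m') k"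
    by (rule LG.minus_equality) (use m in \<open>auto simp: loc.LB.L_add loc.LB.l_neg loc.LB.cls_zero intro: loc.LB.cls_closed\<close>)
  then show ?thesis using m by (simp add: a_minus_def loc.LB.L_add)
qed

lemma Phi_bound: "W \<in> DT \<Longrightarrow> \<forall>j>k. W j = 0 \<Longrightarrow> \<exists>m\<in>carrier loc.LB. Phi W = lcls m k"
proof (induction k arbitrary: W)
  case 0
  then have "W = single 0 (W 0)" by (intro eq_by_nat_cases) (auto simp: fun_eq_iff)
  then have "Phi W = Phi (single 0 (W 0))" by (rule arg_cong)
  then show "\<exists>m\<in>carrier loc.LB. Phi W = lcls m 0"
    using Phi_single[OF dt_formsD[OF 0(1)], of 0 0] lc_closed[OF dt_formsD[OF 0(1), of 0]] by metis
next
  case (Suc k)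
  define V where "V = W - single (Suc k) (W (Suc k))"
  note S = dt_forms_single[OF dt_formsD[OF Suc.prems(1), of "Suc k"], of "Suc k"]
  have V: "V \<in> DT" unfolding V_def by (intro dt_forms_diff S Suc.prems)
  have "\<forall>j>k. V j = 0"
  proof (intro allI impI)
    fix j assume "k < j"
    then show "V j = 0" using Suc.prems(2) by (cases "j = Suc k") (auto simp: V_def fun_eq_iff)
  qed
  then obtain m where m: "m \<in> carrier loc.LB" "Phi V = lcls m k" using Suc.IH[OF V] by blast
  have "W = V + single (Suc k) (W (Suc k))" by (simp add: V_def)
  then have "Phi W = Phi V \<oplus>\<^bsub>LG\<^esub> Phi (single (Suc k) (W (Suc k)))" using Phi_add[OF V S] by metis
  also have "Phi V = lcls (loc.s m) (Suc k)" using m loc.LB.cls_shift[OF m(1), of 1 k] by simp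
  also have "lcls (loc.s m) (Suc k) \<oplus>\<^bsub>LG\<^esub> Phi (single (Suc k) (W (Suc k))) = lcls (loc.s m \<oplus>\<^bsub>loc.LB\<^esub> loc.lc (W (Suc k))) (Suc k)"
    unfolding Phi_single[OF dt_formsD[OF Suc.prems(1)]]
    by (rule loc.LB.L_add[OF loc.LB.s_closed[OF m(1)] lc_closed[OF dt_formsD[OF Suc.prems(1)]]])
  finally show "\<exists>m\<in>carrier loc.LB. Phi W = lcls m (Suc k)"
    using m(1) lc_closed[OF dt_formsD[OF Suc.prems(1)], of "Suc k"] by blast
qed

lemma BR_local_map: "base_change_map Ct (conv_series (f x)) BR (local_brieskorn f x) (brieskorn_to_local f x)"
proof -
  have S: "carrier (conv_series (f x)) = conv_fps" by (simp add: conv_series_def)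
  have m: "m \<in> carrier BR \<longleftrightarrow> (\<exists>\<omega>\<in>AN. m = br \<omega>)" for m by (auto simp: BR_carrier)
  have cl: "p \<odot>\<^bsub>BR\<^esub> m \<in> carrier BR" if "m \<in> carrier BR" for p m
    using that alg_forms_fmul[OF _ poly_f] by (auto simp: BR_carrier BR_smult)
  show ?thesis
  proof (intro base_change_map.intro base_change_map_axioms.intro conv_base_change_data[OF BR_abelian cl] loc.LB_abelian)
    fix b n n' assume bn: "b \<in> carrier (conv_series (f x))" "n \<in> carrier (local_brieskorn f x)"
    show "b \<odot>\<^bsub>local_brieskorn f x\<^esub> n \<in> carrier (local_brieskorn f x)"
      using bn unfolding S by (rule loc.LB.smult_closed)
    show "b \<odot>\<^bsub>local_brieskorn f x\<^esub> (n \<oplus>\<^bsub>local_brieskorn f x\<^esub> n') = b \<odot>\<^bsub>local_brieskorn f x\<^esub> n \<oplus>\<^bsub>local_brieskorn f x\<^esub> b \<odot>\<^bsub>local_brieskorn f x\<^esub> n'"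
      if "n' \<in> carrier (local_brieskorn f x)" using bn that unfolding S by (rule loc.LB.smult_add)
  next
    fix m assume "m \<in> carrier BR"
    then obtain \<omega> where w: "\<omega> \<in> AN" "m = br \<omega>" using m by blast
    then show "brieskorn_to_local f x m \<in> carrier (local_brieskorn f x)" using lc_closed by (simp add: br_local)
    { fix m' assume "m' \<in> carrier BR"
      then obtain \<omega>' where w': "\<omega>' \<in> AN" "m' = br \<omega>'" using m by blast
      show "brieskorn_to_local f x (m \<oplus>\<^bsub>BR\<^esub> m') = brieskorn_to_local f x m \<oplus>\<^bsub>local_brieskorn f x\<^esub> brieskorn_to_local f x m'"
        unfolding w w' BR_add[OF w(1) w'(1)] br_local[OF w(1)] br_local[OF w'(1)] br_local[OF alg_forms_add[OF w(1) w'(1)]] lc_add[OF w(1) w'(1)] .. }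
    fix b b' assume b: "b \<in> carrier (conv_series (f x))"
    show "(b \<oplus>\<^bsub>conv_series (f x)\<^esub> b') \<odot>\<^bsub>local_brieskorn f x\<^esub> brieskorn_to_local f x m = b \<odot>\<^bsub>local_brieskorn f x\<^esub> brieskorn_to_local f x m \<oplus>\<^bsub>local_brieskorn f x\<^esub> b' \<odot>\<^bsub>local_brieskorn f x\<^esub> brieskorn_to_local f x m"
      if b': "b' \<in> carrier (conv_series (f x))"
      using loc.LB.smult_add_left[OF b[unfolded S] b'[unfolded S] lc_closed[OF w(1)]]
      by (simp add: w(2) br_local[OF w(1)] conv_series_def)
    fix r :: "complex poly"
    have "expand (f x) r \<odot>\<^bsub>loc.LB\<^esub> loc.lc \<omega> = loc.lc (fmul (\<lambda>y. poly r (f y)) \<omega>)"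
      using loc.LB_smult[OF conv_fps_closed(4) alg_AF[OF w(1)], of "pcompose r [:f x, 1:]"] by (simp only: pull_poly)
    then show "(r \<odot>\<^bsub>conv_series (f x)\<^esub> b) \<odot>\<^bsub>local_brieskorn f x\<^esub> brieskorn_to_local f x m = b \<odot>\<^bsub>local_brieskorn f x\<^esub> brieskorn_to_local f x (r \<odot>\<^bsub>BR\<^esub> m)"
      using loc.LB.smult_assoc[OF b[unfolded S] conv_fps_closed(4) lc_closed[OF w(1)], of "pcompose r [:f x, 1:]", unfolded mult.commute[of b]]
      by (simp add: w(2) br_local[OF w(1)] BR_smult[OF w(1)] br_local[OF alg_forms_fmul[OF w(1) poly_f]] conv_series_def)
  qed
qed

lemma GM_local_map: "base_change_map Ct (conv_series (f x)) GM LG (gauss_manin_to_local f x)"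
proof -
  have S: "carrier (conv_series (f x)) = conv_fps" by (simp add: conv_series_def)
  have m: "m \<in> carrier GM \<longleftrightarrow> (\<exists>W\<in>DT. m = gm W)" for m by (auto simp: GM_carrier)
  have cl: "p \<odot>\<^bsub>GM\<^esub> m \<in> carrier GM" if "m \<in> carrier GM" for p m
    using that pact_closed[OF _ f_poly] by (auto simp: GM_carrier GM_smult)
  show ?thesis
  proof (intro base_change_map.intro base_change_map_axioms.intro conv_base_change_data[OF GM_abelian cl] loc.LB.L_abelian)
    fix b n n' assume bn: "b \<in> carrier (conv_series (f x))" "n \<in> carrier LG"
    show "b \<odot>\<^bsub>LG\<^esub> n \<in> carrier LG" using bn unfolding S by (rule loc.LB.L_smult_closed)
    show "b \<odot>\<^bsub>LG\<^esub> (n \<oplus>\<^bsub>LG\<^esub> n') = b \<odot>\<^bsub>LG\<^esub> n \<oplus>\<^bsub>LG\<^esub> b \<odot>\<^bsub>LG\<^esub> n'"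
      if "n' \<in> carrier LG" using bn that unfolding S by (rule loc.LB.L_smult_add)
  next
    fix m assume "m \<in> carrier GM"
    then obtain W where w: "W \<in> DT" "m = gm W" using m by blast
    then show "gauss_manin_to_local f x m \<in> carrier LG" using Phi_closed by (simp add: gm_local)
    { fix m' assume "m' \<in> carrier GM"
      then obtain W' where w': "W' \<in> DT" "m' = gm W'" using m by blast
      show "gauss_manin_to_local f x (m \<oplus>\<^bsub>GM\<^esub> m') = gauss_manin_to_local f x m \<oplus>\<^bsub>LG\<^esub> gauss_manin_to_local f x m'"
        unfolding w w' GM_add[OF w(1) w'(1)] gm_local[OF w(1)] gm_local[OF w'(1)] gm_local[OF dt_forms_add[OF w(1) w'(1)]] Phi_add[OF w(1) w'(1)] .. }
    fix b b' assume b: "b \<in> carrier (conv_series (f x))"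
    show "(b \<oplus>\<^bsub>conv_series (f x)\<^esub> b') \<odot>\<^bsub>LG\<^esub> gauss_manin_to_local f x m = b \<odot>\<^bsub>LG\<^esub> gauss_manin_to_local f x m \<oplus>\<^bsub>LG\<^esub> b' \<odot>\<^bsub>LG\<^esub> gauss_manin_to_local f x m"
      if b': "b' \<in> carrier (conv_series (f x))"
      using loc.LB.L_smult_add_left[OF b[unfolded S] b'[unfolded S] Phi_closed[OF w(1)]]
      by (simp add: w(2) gm_local[OF w(1)] conv_series_def)
    fix r :: "complex poly"
    show "(r \<odot>\<^bsub>conv_series (f x)\<^esub> b) \<odot>\<^bsub>LG\<^esub> gauss_manin_to_local f x m = b \<odot>\<^bsub>LG\<^esub> gauss_manin_to_local f x (r \<odot>\<^bsub>GM\<^esub> m)"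
      using loc.LB.L_smult_assoc[OF b[unfolded S] conv_fps_closed(4) Phi_closed[OF w(1)], of "pcompose r [:f x, 1:]", unfolded mult.commute[of b]]
      by (simp add: w(2) gm_local[OF w(1)] GM_smult[OF w(1)] gm_local[OF pact_closed[OF w(1) f_poly]] Phi_pact[OF w(1)] conv_series_def)
  qed
qed

end

section \<open>Division of power series by a polynomial\<close>

lemma fps_split_X_power:
  fixes b :: "complex fps"
  assumes "b \<in> conv_fps" shows "\<exists>P h. h \<in> conv_fps \<and> b = fps_of_poly P + fps_X ^ N * h"
proof (induction N)
  case 0
  show ?case by (intro exI[of _ 0] exI[of _ b]) (use assms in simp)
next
  case (Suc N)
  then obtain P h where h: "h \<in> conv_fps" "b = fps_of_poly P + fps_X ^ N * h" by blast
  have "h = fps_const (fps_nth h 0) + fps_X * fps_shift 1 h"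
    by (rule fps_ext) (simp add: fps_X_mult_nth)
  then have "b = fps_of_poly P + fps_X ^ N * (fps_const (fps_nth h 0) + fps_X * fps_shift 1 h)" using h(2) by simp
  also have "\<dots> = fps_of_poly (P + monom (fps_nth h 0) N) + fps_X ^ Suc N * fps_shift 1 h"
    by (simp add: fps_of_poly_add fps_of_poly_monom algebra_simps)
  finally show ?case using h(1) by (intro exI[of _ "P + monom (fps_nth h 0) N"] exI[of _ "fps_shift 1 h"]) simp
qed

lemma expand_surj: "\<exists>P'. expand c P' = fps_of_poly P"
proof
  have "pcompose (pcompose P [:- c, 1:]) [:c, 1:] = pcompose P (pcompose [:- c, 1:] [:c, 1:])" by (rule pcompose_assoc[symmetric])
  also have "pcompose [:- c, 1:] [:c, 1:] = [:0, 1:]" by (simp add: pcompose_pCons)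
  finally show "expand c (pcompose P [:- c, 1:]) = fps_of_poly P" by simp
qed

lemma expand_unit:
  assumes "poly Q c \<noteq> 0" shows "inverse (expand c Q) \<in> conv_fps" "expand c Q * inverse (expand c Q) = 1"
proof -
  have n: "fps_nth (expand c Q) 0 \<noteq> 0" using assms by (simp add: poly_0_coeff_0[symmetric] poly_pcompose)
  then show "inverse (expand c Q) \<in> conv_fps" using fps_conv_radius_inverse_pos[OF n] by simp
  show "expand c Q * inverse (expand c Q) = 1" by (rule inverse_mult_eq_1'[OF n])
qed

text \<open>
  Up to a unit of \<open>\<complex>{t-c}\<close> the polynomial \<open>Q\<close> is a power of \<open>t - c\<close>, and modulo this power every series is
  a polynomial.
\<close>

lemma fps_split:
  assumes Q: "Q \<noteq> 0" and b: "b \<in> conv_fps"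
  shows "\<exists>P h. h \<in> conv_fps \<and> b = expand c P + expand c Q * h"
proof -
  obtain N q where q: "Q = [:- c, 1:] ^ N * q" "\<not> [:- c, 1:] dvd q" using order_decomp[OF Q] by blast
  from q(2) have "poly q c \<noteq> 0" by (simp add: poly_eq_0_iff_dvd)
  note u = expand_unit[OF this]
  have "pcompose [:- c, 1:] [:c, 1:] = [:0, 1:]" by (simp add: pcompose_pCons)
  then have "pcompose ([:- c, 1:] ^ N) [:c, 1:] = [:0, 1:] ^ N"
    by (induction N) (simp_all only: power_0 power_Suc pcompose_1 pcompose_mult)
  then have e: "expand c Q = fps_X ^ N * expand c q"
    by (simp add: q(1) pcompose_mult fps_of_poly_mult fps_of_poly_power fps_of_poly_pCons)
  obtain P h where h: "h \<in> conv_fps" "b = fps_of_poly P + fps_X ^ N * h" using fps_split_X_power[OF b] by blast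
  obtain P' where P': "expand c P' = fps_of_poly P" using expand_surj by blast
  have "expand c Q * (inverse (expand c q) * h) = fps_X ^ N * (expand c q * inverse (expand c q)) * h"
    by (simp only: e mult.assoc)
  also have "\<dots> = fps_X ^ N * h" unfolding u(2) by simp
  finally have "b = expand c P' + expand c Q * (inverse (expand c q) * h)" unfolding P' using h(2) by (simp only:)
  then show ?thesis using conv_fps_closed(2)[OF u(1) h(1)] by blast
qed

section \<open>Top forms and the Jacobian ideal\<close>

lemma df_wedge_UNIV: "df_wedge f \<theta> UNIV y = (\<Sum>i\<in>UNIV. (dx_sign i UNIV * \<theta> (UNIV - {i}) y) * partial i f y)"
  unfolding df_wedge_def by (intro sum.cong refl) (simp add: mult_ac)

lemma top_form_eq_0: "\<omega> \<in> alg_forms CARD('n) \<Longrightarrow> I \<noteq> UNIV \<Longrightarrow> \<omega> (I :: 'n::finite set) = 0"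
  using card_subset_eq[of UNIV I] by (auto simp: alg_forms_def)

text \<open>
  The sets with \<open>n - 1\<close> elements are the \<open>UNIV - {i}\<close>, so that an \<open>(n-1)\<close>-form amounts to a family of
  functions indexed by the missing element, which \<open>k\<close> recovers.
\<close>

lemma jacobian_ideal_imp_df_wedge:
  fixes \<omega> :: "'n::{finite,linorder} form"
  assumes w: "\<omega> \<in> alg_forms CARD('n)" and J: "\<omega> UNIV \<in> jacobian_ideal f"
  shows "\<exists>\<eta>\<in>alg_forms (CARD('n) - 1). \<omega> = df_wedge f \<eta>"
proof -
  obtain a where a: "\<And>i. polynomial_map (a i)" "\<omega> UNIV = (\<lambda>y. \<Sum>i\<in>UNIV. a i y * partial i f y)"
    using J unfolding jacobian_ideal_def by blast
  define k :: "'n set \<Rightarrow> 'n" where "k I = (THE i. I = UNIV - {i})" for I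
  have k: "k (UNIV - {i}) = i" for i unfolding k_def by (rule the_equality) auto
  define \<eta> :: "'n form" where "\<eta> I = (if card I = CARD('n) - 1 then (\<lambda>y. dx_sign (k I) UNIV * a (k I) y) else 0)" for I
  have "\<eta> \<in> alg_forms (CARD('n) - 1)"
    by (auto simp: alg_forms_def \<eta>_def zero_fun_def intro!: polynomial_map_mult polynomial_map_const a)
  moreover have "\<omega> = df_wedge f \<eta>"
  proof (intro ext)
    fix I y
    have c: "card (UNIV - {i} :: 'n set) = CARD('n) - 1" for i by (simp add: card_Diff_subset)
    show "\<omega> I y = df_wedge f \<eta> I y"
    proof (cases "I = UNIV")
      case True
      have "df_wedge f \<eta> UNIV y = (\<Sum>i\<in>UNIV. (dx_sign i UNIV * dx_sign i UNIV) * (a i y * partial i f y))"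
        unfolding df_wedge_UNIV by (intro sum.cong refl) (simp add: \<eta>_def c k mult_ac)
      then show ?thesis using True a(2) by simp
    next
      case False
      then have "card I \<noteq> CARD('n)" using card_subset_eq[of UNIV I] by auto
      have "\<eta> (I - {i}) = 0" if "i \<in> I" for i
      proof -
        have "card I > 0" "CARD('n) > 0" using that by (auto simp: card_gt_0_iff)
        then have "card (I - {i}) \<noteq> CARD('n) - 1"
          using \<open>card I \<noteq> CARD('n)\<close> unfolding card_Diff_singleton[OF that] by linarith
        then show ?thesis by (simp add: \<eta>_def)
      qed
      then show ?thesis using top_form_eq_0[OF w False] by (simp add: df_wedge_def)
    qed
  qed
  ultimately show ?thesis by blast
qed

lemma restrict_eq_iff: "restrict g A = restrict h A \<longleftrightarrow> (\<forall>x\<in>A. g x = h x)"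
  by (auto simp: restrict_def fun_eq_iff)

section \<open>Lowering the order of an element of the kernel\<close>

locale stalk_setting = global_setting f for f :: "'n::{finite,linorder} aff \<Rightarrow> complex" +
  fixes c :: complex
  assumes fin: "finite (critical_points f)"
begin

abbreviation "AN \<equiv> alg_forms CARD('n) :: 'n form set"
abbreviation "B \<equiv> conv_series c"

lemma B_simps: "carrier B = conv_fps" "b \<oplus>\<^bsub>B\<^esub> b' = b + b'" "b \<otimes>\<^bsub>B\<^esub> b' = b * b'" "\<one>\<^bsub>B\<^esub> = 1" "p \<odot>\<^bsub>B\<^esub> b = expand c p * b"
  by (auto simp: conv_series_def)

lemma Ct_carrier: "p \<in> carrier Ct" by (simp add: Ct_def)

sublocale G: base_change_data Ct "conv_series c" "gauss_manin f"
  by (rule conv_base_change_data[OF GM_abelian]) (auto simp: GM_carrier GM_smult pact_closed f_poly)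

sublocale GA: abelian_group "base_change Ct (conv_series c) (gauss_manin f)" by (rule G.BC_abelian)

lemma gm_closed: "W \<in> DT \<Longrightarrow> gm W \<in> carrier GM" by (auto simp: GM_carrier)
lemma br_closed: "\<omega> \<in> AN \<Longrightarrow> br \<omega> \<in> carrier BR" by (auto simp: BR_carrier)

abbreviation "ten b W \<equiv> G.gen b (gm W)"

lemma ten_closed: "b \<in> conv_fps \<Longrightarrow> W \<in> DT \<Longrightarrow> ten b W \<in> carrier G.BC"
  by (intro G.gen_closed gm_closed) (simp_all add: B_simps)

lemma ten_add: "b \<in> conv_fps \<Longrightarrow> W \<in> DT \<Longrightarrow> W' \<in> DT \<Longrightarrow> ten b (W + W') = ten b W \<oplus>\<^bsub>G.BC\<^esub> ten b W'"
  using G.gen_add_right[of b "gm W" "gm W'"] by (simp add: B_simps gm_closed GM_add)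

lemma ten_add_left: "b \<in> conv_fps \<Longrightarrow> b' \<in> conv_fps \<Longrightarrow> W \<in> DT \<Longrightarrow> ten (b + b') W = ten b W \<oplus>\<^bsub>G.BC\<^esub> ten b' W"
  using G.gen_add_left[of b b' "gm W"] by (simp add: B_simps gm_closed)

lemma ten_pact: "b \<in> conv_fps \<Longrightarrow> W \<in> DT \<Longrightarrow> ten (expand c p * b) W = ten b (pact f p W)"
  using G.gen_smult[OF Ct_carrier, of b "gm W" p] by (simp add: B_simps gm_closed GM_smult)

lemma ten_zero: assumes b: "b \<in> conv_fps" shows "ten b 0 = \<zero>\<^bsub>G.BC\<^esub>"
  using ten_add[OF b dt_forms_zero dt_forms_zero] ten_closed[OF b dt_forms_zero] by (simp del: plus_fun_apply)

lemma ten_minus: "b \<in> conv_fps \<Longrightarrow> W \<in> DT \<Longrightarrow> W' \<in> DT \<Longrightarrow> ten b (W - W') = ten b W \<ominus>\<^bsub>G.BC\<^esub> ten b W'"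
proof -
  assume b: "b \<in> conv_fps" and W: "W \<in> DT" "W' \<in> DT"
  note D = dt_forms_diff[OF W]
  have "ten b W = ten b (W - W') \<oplus>\<^bsub>G.BC\<^esub> ten b W'" using ten_add[OF b D W(2)] by simp
  then show ?thesis using ten_closed[OF b D] ten_closed[OF b W(2)] by (simp add: a_minus_def GA.a_assoc GA.r_neg)
qed

text \<open>
  The filtration of the Gauss-Manin stalk by the order in \<open>\<partial>\<^sub>t\<close>.  Closure under differences makes the
  members of the filtration subgroups, in accordance with \<open>BC_induct\<close>.
\<close>

inductive_set filt :: "nat \<Rightarrow> (complex fps \<times> (nat \<Rightarrow> 'n form) set \<Rightarrow>\<^sub>0 int) set set" for k where
  zero: "\<zero>\<^bsub>G.BC\<^esub> \<in> filt k"
| ten: "b \<in> conv_fps \<Longrightarrow> W \<in> DT \<Longrightarrow> \<forall>j>k. W j = 0 \<Longrightarrow> ten b W \<in> filt k"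
| diff: "u \<in> filt k \<Longrightarrow> v \<in> filt k \<Longrightarrow> u \<ominus>\<^bsub>G.BC\<^esub> v \<in> filt k"

lemma filt_carrier: "u \<in> filt k \<Longrightarrow> u \<in> carrier G.BC"
  by (induction rule: filt.induct) (auto intro: ten_closed)

lemma filt_add: assumes "u \<in> filt k" "v \<in> filt k" shows "u \<oplus>\<^bsub>G.BC\<^esub> v \<in> filt k"
proof -
  have "u \<ominus>\<^bsub>G.BC\<^esub> (\<zero>\<^bsub>G.BC\<^esub> \<ominus>\<^bsub>G.BC\<^esub> v) \<in> filt k" by (intro filt.diff filt.zero assms)
  then show ?thesis using assms[THEN filt_carrier] by (simp add: a_minus_def)
qed

lemma filt_mono: "u \<in> filt k \<Longrightarrow> k \<le> l \<Longrightarrow> u \<in> filt l"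
  by (induction rule: filt.induct) (auto intro: filt.intros)

lemma filt_exhaustive: "u \<in> carrier G.BC \<Longrightarrow> \<exists>k. u \<in> filt k"
proof (induction rule: G.BC_induct)
  case (gen b m)
  then obtain W where W: "W \<in> DT" "m = gm W" "b \<in> conv_fps" by (auto simp: GM_carrier B_simps)
  then show ?case using dt_forms_bound[OF W(1)] filt.ten by blast
next
  case (diff u v)
  then obtain k l where "u \<in> filt k" "v \<in> filt l" by blast
  then have "u \<in> filt (max k l)" "v \<in> filt (max k l)" by (auto intro: filt_mono)
  then show ?case using filt.diff by blast
qed (use filt.zero in blast)

lemma split_top:
  assumes W: "W \<in> DT" "\<forall>j>Suc k. W j = 0"
  obtains V where "V \<in> DT" "\<forall>j>k. V j = 0" "W = V + single (Suc k) (W (Suc k))"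
proof
  let ?V = "W - single (Suc k) (W (Suc k))"
  show "?V \<in> DT" by (intro dt_forms_diff dt_forms_single dt_formsD W)
  show "\<forall>j>k. ?V j = 0"
  proof (intro allI impI)
    fix j assume "k < j"
    then show "?V j = 0" using W(2) by (cases "j = Suc k") (auto simp: fun_eq_iff)
  qed
qed simp

text \<open>
  If the coefficient of highest order is \<open>df \<and> \<eta>\<close>, then it may be replaced by \<open>d\<eta>\<close> in the next lower
  order.
\<close>

lemma filt_lower:
  assumes b: "b \<in> conv_fps" and W: "W \<in> DT" "\<forall>j>Suc k. W j = 0" and J: "W (Suc k) UNIV \<in> jacobian_ideal f"
  shows "ten b W \<in> filt k"
proof -
  obtain \<eta> where e: "\<eta> \<in> alg_forms (CARD('n) - 1)" "W (Suc k) = df_wedge f \<eta>"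
    using jacobian_ideal_imp_df_wedge[OF dt_formsD[OF W(1)] J] by blast
  obtain V where V: "V \<in> DT" "\<forall>j>k. V j = 0" "W = V + single (Suc k) (W (Suc k))" by (rule split_top[OF W])
  note S = dt_forms_single[OF alg_df_wedge_top[OF e(1)], of "Suc k"] dt_forms_single[OF alg_ext_d_top[OF e(1)], of k]
  have "gm W = gm V \<oplus>\<^bsub>GM\<^esub> gm (single (Suc k) (df_wedge f \<eta>))" using V(3) e(2) GM_add[OF V(1) S(1)] by metis
  also have "\<dots> = gm (V + single k (ext_d \<eta>))" unfolding gm_lower[OF e(1)] by (rule GM_add[OF V(1) S(2)])
  finally have "ten b W = ten b (V + single k (ext_d \<eta>))" by simp
  also have "\<dots> \<in> filt k" by (rule filt.ten[OF _ dt_forms_add[OF V(1) S(2)]]) (use b V(2) in \<open>auto simp: fun_eq_iff\<close>)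
  finally show ?thesis .
qed

lemma critical_annihilator: obtains Q where "Q \<noteq> 0" "(\<lambda>y. poly Q (f y)) \<in> jacobian_ideal f"
  using critical_value_annihilator[OF f_poly fin polynomial_map_const[of 1], of "\<lambda>_. False"] by auto

text \<open>
  A polynomial coefficient can be moved into the second factor, and a coefficient divisible by a polynomial
  \<open>Q\<close> with \<open>Q(f)\<close> in the Jacobian ideal lowers the order.  By \<open>fps_split\<close> every power series is a sum of
  these two kinds.
\<close>

lemma filt_top:
  "u \<in> filt (Suc k) \<Longrightarrow> \<exists>\<omega>\<in>AN. \<exists>v\<in>filt k. u = ten 1 (single (Suc k) \<omega>) \<oplus>\<^bsub>G.BC\<^esub> v"
proof (induction rule: filt.induct)
  case zero
  have "single (Suc k) (0 :: 'n form) = 0" by (intro ext) simp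
  then have "ten 1 (single (Suc k) 0) = \<zero>\<^bsub>G.BC\<^esub>" using ten_zero[OF conv_fps_closed(5)] by (simp only:)
  then have "\<zero>\<^bsub>G.BC\<^esub> = ten 1 (single (Suc k) 0) \<oplus>\<^bsub>G.BC\<^esub> \<zero>\<^bsub>G.BC\<^esub>" by (simp only: GA.l_zero GA.zero_closed)
  then show "\<exists>\<omega>\<in>AN. \<exists>v\<in>filt k. \<zero>\<^bsub>G.BC\<^esub> = ten 1 (single (Suc k) \<omega>) \<oplus>\<^bsub>G.BC\<^esub> v" using filt.zero alg_forms_zero by blast
next
  case (ten b W)
  obtain Q where Q: "Q \<noteq> 0" "(\<lambda>y. poly Q (f y)) \<in> jacobian_ideal f" by (rule critical_annihilator)
  have b: "b \<in> conv_fps" using ten(1) by simp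
  obtain P h where h: "h \<in> conv_fps" "b = expand c P + expand c Q * h" using fps_split[OF Q(1) b] by blast
  note cl = pact_closed[OF ten(2) f_poly]
  define \<omega> where "\<omega> = pact f P W (Suc k)"
  have w: "\<omega> \<in> AN" unfolding \<omega>_def by (rule dt_formsD[OF cl])
  note one = conv_fps_closed(5)
  have "\<forall>j>Suc k. pact f P W j = 0" using pact_top(1)[OF ten(3)] by blast
  then obtain V where V: "V \<in> DT" "\<forall>j>k. V j = 0" "pact f P W = V + single (Suc k) \<omega>"
    unfolding \<omega>_def by (rule split_top[OF cl])
  have "expand c Q * h \<in> conv_fps" by (rule conv_fps_closed(2)[OF conv_fps_closed(4) h(1)])
  then have "ten b W = ten (expand c P * 1) W \<oplus>\<^bsub>G.BC\<^esub> ten (expand c Q * h) W"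
    using ten_add_left[OF conv_fps_closed(4) _ ten(2), of "expand c Q * h" "pcompose P [:c, 1:]"] h(2) by simp
  also have "\<dots> = ten 1 (pact f P W) \<oplus>\<^bsub>G.BC\<^esub> ten h (pact f Q W)"
    unfolding ten_pact[OF one ten(2)] ten_pact[OF h(1) ten(2)] ..
  also have "ten 1 (pact f P W) = ten 1 (single (Suc k) \<omega>) \<oplus>\<^bsub>G.BC\<^esub> ten 1 V"
    unfolding V(3) ten_add[OF one V(1) dt_forms_single[OF w]]
    by (rule GA.a_comm) (intro ten_closed one V(1) dt_forms_single w)+
  also have "\<dots> \<oplus>\<^bsub>G.BC\<^esub> ten h (pact f Q W) = ten 1 (single (Suc k) \<omega>) \<oplus>\<^bsub>G.BC\<^esub> (ten 1 V \<oplus>\<^bsub>G.BC\<^esub> ten h (pact f Q W))"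
    by (rule GA.a_assoc) (intro ten_closed one V(1) dt_forms_single w h(1) cl)+
  finally have eq: "ten b W = ten 1 (single (Suc k) \<omega>) \<oplus>\<^bsub>G.BC\<^esub> (ten 1 V \<oplus>\<^bsub>G.BC\<^esub> ten h (pact f Q W))" .
  have "ten h (pact f Q W) \<in> filt k"
  proof (rule filt_lower[OF h(1) cl])
    show "\<forall>j>Suc k. pact f Q W j = 0" using pact_top(1)[OF ten(3)] by blast
    have "(\<lambda>y. W (Suc k) UNIV y * poly Q (f y)) \<in> jacobian_ideal f"
      by (rule pidealD(4)[OF pideal_jacobian_ideal[OF f_poly] Q(2) alg_formsD[OF dt_formsD[OF ten(2)]]])
    then show "pact f Q W (Suc k) UNIV \<in> jacobian_ideal f"
      unfolding pact_top(2)[OF ten(3)] by (simp add: mult.commute)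
  qed
  moreover have "ten 1 V \<in> filt k" using V(1,2) by (intro filt.ten) simp_all
  ultimately have "ten 1 V \<oplus>\<^bsub>G.BC\<^esub> ten h (pact f Q W) \<in> filt k" by (intro filt_add)
  then show ?case using eq w by blast
next
  case (diff u v)
  then obtain \<omega> \<omega>' u' v' where d: "\<omega> \<in> AN" "\<omega>' \<in> AN" "u' \<in> filt k" "v' \<in> filt k"
    "u = ten 1 (single (Suc k) \<omega>) \<oplus>\<^bsub>G.BC\<^esub> u'" "v = ten 1 (single (Suc k) \<omega>') \<oplus>\<^bsub>G.BC\<^esub> v'" by blast
  note one = conv_fps_closed(5)
  note S = dt_forms_single[OF d(1), of "Suc k"] dt_forms_single[OF d(2), of "Suc k"]
  have e: "single (Suc k) (\<omega> - \<omega>') = single (Suc k) \<omega> - single (Suc k) \<omega>'" by (intro ext) simp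
  have "u \<ominus>\<^bsub>G.BC\<^esub> v = ten 1 (single (Suc k) (\<omega> - \<omega>')) \<oplus>\<^bsub>G.BC\<^esub> (u' \<ominus>\<^bsub>G.BC\<^esub> v')"
    unfolding d(5,6) e ten_minus[OF one S]
    using ten_closed[OF one S(1)] ten_closed[OF one S(2)] filt_carrier[OF d(3)] filt_carrier[OF d(4)]
    by (simp add: a_minus_def GA.minus_add GA.a_ac)
  then show ?case using alg_forms_diff[OF d(1,2)] filt.diff[OF d(3,4)] by blast
qed

lemma point: "f x = c \<Longrightarrow> point_setting f x"
  by (intro point_setting.intro local_lattice.intro global_setting_axioms dim isolated_at_polynomial[OF f_poly fin])

abbreviation "vanishes u \<equiv> \<forall>x. f x = c \<longrightarrow> base_change_lift (local_gauss_manin f x) (gauss_manin_to_local f x) u = \<zero>\<^bsub>local_gauss_manin f x\<^esub>"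

text \<open>
  Elements of order at most \<open>k\<close> become fractions with denominator \<open>\<partial>\<^sub>t\<^sup>-\<^sup>k\<close>.
\<close>

lemma lift_filt:
  assumes x: "f x = c" and u: "u \<in> filt k"
  shows "\<exists>m\<in>carrier (local_brieskorn f x). base_change_lift (local_gauss_manin f x) (gauss_manin_to_local f x) u = dt_class (local_brieskorn f x) (local_dt_inv f x) m k"
proof -
  interpret P: point_setting f x by (rule point[OF x])
  note M = P.GM_local_map[unfolded x]
  note L = base_change_map.lift_gen[OF M] base_change_map.lift_diff[OF M] base_change_map.lift_zero[OF M]
  from u show ?thesis
    unfolding local_gauss_manin_def
  proof (induction rule: filt.induct)
    case zero
    show ?case unfolding L(3) using P.loc.LB.cls_zero[of k] P.loc.LB.zero_closed by metis
  next
    case (ten b W)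
    have b: "b \<in> conv_fps" using ten(1) by simp
    obtain m where m: "m \<in> carrier (local_brieskorn f x)" "P.Phi W = P.lcls m k" using P.Phi_bound[OF ten(2,3)] by blast
    have "base_change_lift P.LG (gauss_manin_to_local f x) (ten b W) = b \<odot>\<^bsub>P.LG\<^esub> P.lcls m k"
      using L(1)[of b "gm W"] ten(1,2) by (simp add: B_simps gm_closed P.gm_local m(2))
    also have "\<dots> = P.lcls (P.loc.LB.act b k m) k" by (rule P.loc.LB.L_smult[OF b m(1)])
    finally show ?case using P.loc.LB.act_closed[OF b m(1)] by blast
  next
    case (diff u v)
    then show ?case using L(2)[OF filt_carrier[OF diff(1)] filt_carrier[OF diff(2)]] P.L_diff P.loc.LB.minus_closed by metis
  qed
qed

text \<open>
  At a point \<open>x\<close> over \<open>c\<close> the vanishing of \<open>u\<close> says \<open>[\<omega>] + \<partial>\<^sub>t\<^sup>-\<^sup>1 m = 0\<close> in the local lattice, where \<open>\<partial>\<^sub>t\<^sup>k m\<close> is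
  the image of \<open>v\<close>.  Hence \<open>\<omega> = df \<and> \<theta>\<close> near \<open>x\<close>.  A polynomial \<open>Q\<close> with \<open>Q(c) \<noteq> 0\<close> then moves the
  coefficient of \<open>\<omega>\<close> into the Jacobian ideal, and \<open>Q\<close> can be divided out again in \<open>\<complex>{t-c}\<close>.
\<close>

lemma filt_descend:
  assumes u: "u \<in> filt (Suc k)" and van: "vanishes u"
  shows "u \<in> filt k"
proof -
  obtain \<omega> v where wv: "\<omega> \<in> AN" "v \<in> filt k" "u = ten 1 (single (Suc k) \<omega>) \<oplus>\<^bsub>G.BC\<^esub> v" using filt_top[OF u] by blast
  note one = conv_fps_closed(5)
  note S = dt_forms_single[OF wv(1), of "Suc k"]
  have top: "\<forall>j>Suc k. single (Suc k) \<omega> j = 0" by simp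
  have "\<exists>a. (\<forall>j. holomorphic_near x (a j)) \<and> eventually (\<lambda>y. \<omega> UNIV y = (\<Sum>j\<in>UNIV. a j y * partial j f y)) (nhds x)"
    if x: "f x = c" for x
  proof -
    interpret P: point_setting f x by (rule point[OF x])
    note M = P.GM_local_map[unfolded x]
    obtain m where m: "m \<in> carrier (local_brieskorn f x)" "base_change_lift P.LG (gauss_manin_to_local f x) v = P.lcls m k"
      using lift_filt[OF x wv(2)] by (auto simp: local_gauss_manin_def)
    note lw = P.lc_closed[OF wv(1)]
    have one_lw: "1 \<odot>\<^bsub>P.LG\<^esub> P.Phi (single (Suc k) \<omega>) = P.lcls (P.loc.lc \<omega>) (Suc k)"
      unfolding P.Phi_single[OF wv(1)] P.loc.LB.L_smult[OF one lw] P.act_one'[OF wv(1)] ..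
    have "\<zero>\<^bsub>P.LG\<^esub> = base_change_lift P.LG (gauss_manin_to_local f x) (ten 1 (single (Suc k) \<omega>) \<oplus>\<^bsub>G.BC\<^esub> v)"
      using van x wv(3) by (simp add: local_gauss_manin_def)
    also have "\<dots> = base_change_lift P.LG (gauss_manin_to_local f x) (ten 1 (single (Suc k) \<omega>)) \<oplus>\<^bsub>P.LG\<^esub> P.lcls m k"
      unfolding m(2)[symmetric] by (rule base_change_map.lift_add[OF M ten_closed[OF one S] filt_carrier[OF wv(2)]])
    also have "base_change_lift P.LG (gauss_manin_to_local f x) (ten 1 (single (Suc k) \<omega>)) = P.lcls (P.loc.lc \<omega>) (Suc k)"
      using base_change_map.lift_gen[OF M, of 1 "gm (single (Suc k) \<omega>)"] one gm_closed[OF S]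
      by (simp only: B_simps P.gm_local[OF S] one_lw)
    also have "P.lcls m k = P.lcls (P.loc.s m) (Suc k)" using P.loc.LB.cls_shift[OF m(1), of 1 k] by simp
    also have "P.lcls (P.loc.lc \<omega>) (Suc k) \<oplus>\<^bsub>P.LG\<^esub> P.lcls (P.loc.s m) (Suc k) = P.lcls (P.loc.lc \<omega> \<oplus>\<^bsub>local_brieskorn f x\<^esub> P.loc.s m) (Suc k)"
      by (rule P.loc.LB.L_add[OF lw P.loc.LB.s_closed[OF m(1)]])
    finally have z: "P.loc.lc \<omega> \<oplus>\<^bsub>local_brieskorn f x\<^esub> P.loc.s m = \<zero>\<^bsub>local_brieskorn f x\<^esub>"
      using P.loc.LB.cls_eq_zero[OF P.loc.LB.a_closed[OF lw P.loc.LB.s_closed[OF m(1)]], of "Suc k"] by simp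
    obtain \<eta> where e: "\<eta> \<in> an_forms (CARD('n) - 1) x" "m = P.loc.lc (ext_d \<eta>)" using P.loc.LB_exact[OF m(1)] by blast
    note A = P.alg_AF[OF wv(1)] P.loc.df_wedge_top[OF e(1)]
    have "P.loc.lc (\<omega> + df_wedge f \<eta>) = P.loc.lc 0"
      using z unfolding e(2) P.loc.dt_inv_eq[OF e(1)] P.loc.LB_add[OF A] P.loc.LB_zero .
    then obtain \<xi> where xi: "\<xi> \<in> an_forms (CARD('n) - 2) x" "germ_eq x (\<omega> + df_wedge f \<eta>) (0 + df_wedge f (ext_d \<xi>))"
      using P.loc.lc_eq[OF an_forms_add[OF A] an_forms_zero] by blast
    define \<theta> where "\<theta> = ext_d \<xi> - \<eta>"
    have t: "\<theta> \<in> an_forms (CARD('n) - 1) x" unfolding \<theta>_def by (intro an_forms_diff P.loc.ext_d_sub xi e)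
    have "eventually (\<lambda>y. \<omega> UNIV y = df_wedge f \<theta> UNIV y) (nhds x)"
      using xi(2) unfolding germ_eq_def \<theta>_def
      by (rule eventually_mono) (simp add: df_wedge_diff algebra_simps)
    then show ?thesis unfolding df_wedge_UNIV
      by (intro exI[of _ "\<lambda>j y. dx_sign j UNIV * \<theta> (UNIV - {j}) y"] conjI allI holomorphic_near_mult holomorphic_near_const)
         (use t in \<open>auto simp: an_forms_def\<close>)
  qed
  then obtain Q where Q: "poly Q c \<noteq> 0" "(\<lambda>y. poly Q (f y) * \<omega> UNIV y) \<in> jacobian_ideal f"
    using critical_value_annihilator[OF f_poly fin alg_formsD[OF wv(1)], of "\<lambda>z. z = c"] by blast
  note inv = expand_unit[OF Q(1)]
  have "ten 1 (single (Suc k) \<omega>) = ten (inverse (expand c Q)) (pact f Q (single (Suc k) \<omega>))"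
    using ten_pact[OF inv(1) S, of Q] unfolding inv(2) .
  also have "\<dots> \<in> filt k"
  proof (rule filt_lower[OF inv(1) pact_closed[OF S f_poly]])
    show "\<forall>j>Suc k. pact f Q (single (Suc k) \<omega>) j = 0" using pact_top(1)[OF top] by blast
    show "pact f Q (single (Suc k) \<omega>) (Suc k) UNIV \<in> jacobian_ideal f" unfolding pact_top(2)[OF top] using Q(2) by simp
  qed
  finally show ?thesis unfolding wv(3) by (rule filt_add[OF _ wv(2)])
qed

lemma filt_0: "u \<in> filt k \<Longrightarrow> vanishes u \<Longrightarrow> u \<in> filt 0"
  by (induction k) (auto intro: filt_descend)


lemma incl_map: "base_change_map Ct B BR (gauss_manin_an f c)
  (\<lambda>m. tensor_class Ct B GM (frag_of (\<one>\<^bsub>B\<^esub>, brieskorn_to_gauss_manin f m)))"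
proof -
  let ?\<phi> = "\<lambda>m. G.gen 1 (brieskorn_to_gauss_manin f m)"
  have phi: "?\<phi> (br \<omega>) = ten 1 (single 0 \<omega>)" if "\<omega> \<in> AN" for \<omega> by (simp add: b2g[OF that])
  have m: "m \<in> carrier BR \<longleftrightarrow> (\<exists>\<omega>\<in>AN. m = br \<omega>)" for m by (auto simp: BR_carrier)
  have cl: "p \<odot>\<^bsub>BR\<^esub> m \<in> carrier BR" if "m \<in> carrier BR" for p m
    using that alg_forms_fmul[OF _ poly_f] by (auto simp: BR_carrier BR_smult)
  note one = conv_fps_closed(5)
  have sm: "b \<odot>\<^bsub>G.BC\<^esub> ten 1 W = ten b W" if "b \<in> conv_fps" "W \<in> DT" for b W
    using G.BC_smult_gen[of b 1 "gm W"] that by (simp add: B_simps gm_closed)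
  have "base_change_map Ct B BR G.BC ?\<phi>"
  proof (intro base_change_map.intro base_change_map_axioms.intro conv_base_change_data[OF BR_abelian cl] G.BC_abelian)
    fix b n n' assume bn: "b \<in> carrier B" "n \<in> carrier G.BC"
    show "b \<odot>\<^bsub>G.BC\<^esub> n \<in> carrier G.BC" using bn by (rule G.BC_smult_closed)
    show "b \<odot>\<^bsub>G.BC\<^esub> (n \<oplus>\<^bsub>G.BC\<^esub> n') = b \<odot>\<^bsub>G.BC\<^esub> n \<oplus>\<^bsub>G.BC\<^esub> b \<odot>\<^bsub>G.BC\<^esub> n'" if "n' \<in> carrier G.BC"
      using bn that by (rule G.BC_smult_add)
  next
    fix m assume "m \<in> carrier BR"
    then obtain \<omega> where w: "\<omega> \<in> AN" "m = br \<omega>" using m by blast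
    note S = dt_forms_single[OF w(1), of 0]
    show "?\<phi> m \<in> carrier G.BC" unfolding w(2) phi[OF w(1)] by (rule ten_closed[OF one S])
    { fix m' assume "m' \<in> carrier BR"
      then obtain \<omega>' where w': "\<omega>' \<in> AN" "m' = br \<omega>'" using m by blast
      have "single 0 (\<omega> + \<omega>') = single 0 \<omega> + single 0 \<omega>'" by (intro ext) simp
      then show "?\<phi> (m \<oplus>\<^bsub>BR\<^esub> m') = ?\<phi> m \<oplus>\<^bsub>G.BC\<^esub> ?\<phi> m'"
        unfolding w w' BR_add[OF w(1) w'(1)] phi[OF w(1)] phi[OF w'(1)] phi[OF alg_forms_add[OF w(1) w'(1)]]
        by (simp only: ten_add[OF one S dt_forms_single[OF w'(1)]]) }
    fix b b' assume b: "b \<in> carrier B"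
    show "(b \<oplus>\<^bsub>B\<^esub> b') \<odot>\<^bsub>G.BC\<^esub> ?\<phi> m = b \<odot>\<^bsub>G.BC\<^esub> ?\<phi> m \<oplus>\<^bsub>G.BC\<^esub> b' \<odot>\<^bsub>G.BC\<^esub> ?\<phi> m" if b': "b' \<in> carrier B"
      unfolding w(2) phi[OF w(1)] B_simps(2)
      using ten_add_left[OF b[unfolded B_simps] b'[unfolded B_simps] S] conv_fps_closed(1)[OF b[unfolded B_simps] b'[unfolded B_simps]] b b'
      by (simp only: sm S B_simps)
    fix r :: "complex poly"
    have "expand c r * b \<in> conv_fps" using b by (intro conv_fps_closed(2) conv_fps_closed(4)) (simp only: B_simps)
    then show "(r \<odot>\<^bsub>B\<^esub> b) \<odot>\<^bsub>G.BC\<^esub> ?\<phi> m = b \<odot>\<^bsub>G.BC\<^esub> ?\<phi> (r \<odot>\<^bsub>BR\<^esub> m)"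
      unfolding w(2) BR_smult[OF w(1)] phi[OF w(1)] phi[OF alg_forms_fmul[OF w(1) poly_f]] B_simps(5)
      using ten_pact[OF b[unfolded B_simps] S, of r] b
      by (simp only: sm S B_simps pact_single0 dt_forms_single[OF alg_forms_fmul[OF w(1) poly_f]])
  qed
  then show ?thesis by (simp add: G.gen_def[abs_def] gauss_manin_an_def B_simps)
qed

lemma incl_ten:
  assumes b: "b \<in> conv_fps" and w: "\<omega> \<in> AN"
  shows "brieskorn_an_incl f c (base_change_data.gen Ct B BR b (br \<omega>)) = ten b (single 0 \<omega>)"
proof -
  note S = dt_forms_single[OF w, of 0]
  have "brieskorn_an_incl f c (base_change_data.gen Ct B BR b (br \<omega>)) = b \<odot>\<^bsub>G.BC\<^esub> ten 1 (single 0 \<omega>)"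
    using base_change_map.lift_gen[OF incl_map, of b "br \<omega>"] b br_closed[OF w] b2g[OF w]
    by (simp add: brieskorn_an_incl_def B_simps gauss_manin_an_def G.gen_def)
  also have "\<dots> = ten b (single 0 \<omega>)"
    using G.BC_smult_gen[of b 1 "gm (single 0 \<omega>)"] b gm_closed[OF S] by (simp add: B_simps)
  finally show ?thesis .
qed

lemma incl_diff: "u \<in> carrier (brieskorn_an f c) \<Longrightarrow> v \<in> carrier (brieskorn_an f c) \<Longrightarrow>
   brieskorn_an_incl f c (u \<ominus>\<^bsub>brieskorn_an f c\<^esub> v) = brieskorn_an_incl f c u \<ominus>\<^bsub>G.BC\<^esub> brieskorn_an_incl f c v"
  using base_change_map.lift_diff[OF incl_map, of u v]
  by (simp add: brieskorn_an_def brieskorn_an_incl_def gauss_manin_an_def)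

lemma incl_zero: "brieskorn_an_incl f c \<zero>\<^bsub>brieskorn_an f c\<^esub> = \<zero>\<^bsub>G.BC\<^esub>"
  using base_change_map.lift_zero[OF incl_map]
  by (simp add: brieskorn_an_def brieskorn_an_incl_def gauss_manin_an_def)

lemma incl_closed: "u \<in> carrier (brieskorn_an f c) \<Longrightarrow> brieskorn_an_incl f c u \<in> carrier G.BC"
  using base_change_map.lift_closed[OF incl_map, of u]
  by (simp add: brieskorn_an_def brieskorn_an_incl_def gauss_manin_an_def)

lemma BR_data: "base_change_data Ct B BR"
  using incl_map by (rule base_change_map.axioms)

lemma filt_0_incl: "u \<in> filt 0 \<Longrightarrow> u \<in> brieskorn_an_incl f c ` carrier (brieskorn_an f c)"
proof (induction rule: filt.induct)
  case zero
  have "\<zero>\<^bsub>brieskorn_an f c\<^esub> \<in> carrier (brieskorn_an f c)"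
    unfolding brieskorn_an_def by (rule abelian_monoid.zero_closed[OF abelian_group.axioms(1)[OF base_change_data.BC_abelian[OF BR_data]]])
  then show ?case using incl_zero by (metis image_eqI)
next
  case (ten b W)
  have b: "b \<in> conv_fps" using ten(1) by simp
  have W: "W = single 0 (W 0)" using ten(3) by (intro eq_by_nat_cases) (auto simp: fun_eq_iff)
  note w = dt_formsD[OF ten(2), of 0]
  have "base_change_data.gen Ct B BR b (br (W 0)) \<in> carrier (brieskorn_an f c)"
    unfolding brieskorn_an_def using b br_closed[OF w] by (intro base_change_data.gen_closed[OF BR_data]) (simp_all add: B_simps)
  moreover have "ten b W = brieskorn_an_incl f c (base_change_data.gen Ct B BR b (br (W 0)))"
    using incl_ten[OF b w] W by simp
  ultimately show ?case by blast
next
  case (diff u v)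
  then obtain u' v' where uv: "u' \<in> carrier (brieskorn_an f c)" "v' \<in> carrier (brieskorn_an f c)"
    "u = brieskorn_an_incl f c u'" "v = brieskorn_an_incl f c v'" by blast
  have "u' \<ominus>\<^bsub>brieskorn_an f c\<^esub> v' \<in> carrier (brieskorn_an f c)"
    using uv(1,2) unfolding brieskorn_an_def by (rule abelian_group.minus_closed[OF base_change_data.BC_abelian[OF BR_data]])
  then show ?case using incl_diff[OF uv(1,2)] uv(3,4) by (metis image_eqI)
qed

text \<open>
  On generators both sides are \<open>\<partial>\<^sub>t\<^sup>0\<close> of the local class, multiplied by the same power series.
\<close>

lemma lift_incl:
  assumes x: "f x = c" and u: "u \<in> carrier (brieskorn_an f c)"
  shows "base_change_lift (local_gauss_manin f x) (gauss_manin_to_local f x) (brieskorn_an_incl f c u) =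
      dt_class (local_brieskorn f x) (local_dt_inv f x) (base_change_lift (local_brieskorn f x) (brieskorn_to_local f x) u) 0"
    and "base_change_lift (local_brieskorn f x) (brieskorn_to_local f x) u \<in> carrier (local_brieskorn f x)"
proof -
  interpret P: point_setting f x by (rule point[OF x])
  note M = P.GM_local_map[unfolded x] and N = P.BR_local_map[unfolded x]
  from u show "base_change_lift (local_brieskorn f x) (brieskorn_to_local f x) u \<in> carrier (local_brieskorn f x)"
    unfolding brieskorn_an_def by (rule base_change_map.lift_closed[OF N])
  let ?L = "base_change_lift P.LG (gauss_manin_to_local f x)" and ?l = "base_change_lift (local_brieskorn f x) (brieskorn_to_local f x)"
  have "?L (brieskorn_an_incl f c u) = P.lcls (?l u) 0"
    using u unfolding brieskorn_an_def
  proof (induction rule: base_change_data.BC_induct[OF BR_data, consumes 1, case_names zero gen diff])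
    case zero
    show ?case unfolding base_change_map.lift_zero[OF N] P.loc.LB.cls_zero
      using incl_zero base_change_map.lift_zero[OF M] by (simp add: brieskorn_an_def)
  next
    case (gen b m)
    then obtain \<omega> where w: "\<omega> \<in> AN" "m = br \<omega>" by (auto simp: BR_carrier)
    have b: "b \<in> conv_fps" using gen(1) by (simp only: B_simps)
    note S = dt_forms_single[OF w(1), of 0]
    have "?L (brieskorn_an_incl f c (base_change_data.gen Ct B BR b m)) = b \<odot>\<^bsub>P.LG\<^esub> P.Phi (single 0 \<omega>)"
      unfolding w(2) incl_ten[OF b w(1)] P.gm_local[OF S, symmetric]
      by (rule base_change_map.lift_gen[OF M gen(1) gm_closed[OF S]])
    also have "\<dots> = P.lcls (b \<odot>\<^bsub>local_brieskorn f x\<^esub> P.loc.lc \<omega>) 0"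
      unfolding P.Phi_single[OF w(1)] using P.loc.LB.L_smult[OF b P.lc_closed[OF w(1)], of 0] by simp
    also have "b \<odot>\<^bsub>local_brieskorn f x\<^esub> P.loc.lc \<omega> = ?l (base_change_data.gen Ct B BR b m)"
      using base_change_map.lift_gen[OF N gen(1,2)] by (simp add: w(2) P.br_local[OF w(1)])
    finally show ?case .
  next
    case (diff u v)
    note uv = diff(1,2)[folded brieskorn_an_def]
    note c = base_change_map.lift_closed[OF N diff(1)] base_change_map.lift_closed[OF N diff(2)]
    show ?case
      unfolding base_change_map.lift_diff[OF N diff(1,2)] incl_diff[OF uv, unfolded brieskorn_an_def]
        base_change_map.lift_diff[OF M incl_closed[OF uv(1)] incl_closed[OF uv(2)]] diff(3,4)
      by (rule P.L_diff[OF c])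
  qed
  then show "base_change_lift (local_gauss_manin f x) (gauss_manin_to_local f x) (brieskorn_an_incl f c u) = P.lcls (?l u) 0"
    by (simp only: local_gauss_manin_def)
qed

lemma incl_vanishes:
  assumes x: "f x = c" and u: "u \<in> carrier (brieskorn_an f c)"
  shows "base_change_lift (local_gauss_manin f x) (gauss_manin_to_local f x) (brieskorn_an_incl f c u) = \<zero>\<^bsub>local_gauss_manin f x\<^esub>
    \<longleftrightarrow> base_change_lift (local_brieskorn f x) (brieskorn_to_local f x) u = \<zero>\<^bsub>local_brieskorn f x\<^esub>"
proof -
  interpret P: point_setting f x by (rule point[OF x])
  show ?thesis unfolding local_gauss_manin_def
    unfolding lift_incl(1)[OF x u, unfolded local_gauss_manin_def] by (rule P.loc.LB.cls_eq_zero[OF lift_incl(2)[OF x u]])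
qed

lemma incl_image_kernel:
  "brieskorn_an_incl f c ` brieskorn_kernel f c =
    kernel (add_monoid (gauss_manin_an f c))
      (sum_group {x. f x = c} (\<lambda>x. add_monoid (local_gauss_manin f x)))
      (gauss_manin_an_to_locals f c)"
proof -
  have K: "u \<in> brieskorn_kernel f c \<longleftrightarrow> u \<in> carrier (brieskorn_an f c) \<and>
     (\<forall>x. f x = c \<longrightarrow> base_change_lift (local_brieskorn f x) (brieskorn_to_local f x) u = \<zero>\<^bsub>local_brieskorn f x\<^esub>)" for u
    by (simp add: brieskorn_kernel_def kernel_def brieskorn_an_to_locals_def restrict_eq_iff)
  have K': "u \<in> kernel (add_monoid (gauss_manin_an f c)) (sum_group {x. f x = c} (\<lambda>x. add_monoid (local_gauss_manin f x)))
      (gauss_manin_an_to_locals f c) \<longleftrightarrow> u \<in> carrier G.BC \<and> vanishes u" for u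
    by (simp add: kernel_def gauss_manin_an_to_locals_def restrict_eq_iff gauss_manin_an_def)
  have I: "u \<in> brieskorn_an_incl f c ` brieskorn_kernel f c \<longleftrightarrow> u \<in> carrier G.BC \<and> vanishes u" for u
  proof
    assume "u \<in> brieskorn_an_incl f c ` brieskorn_kernel f c"
    then obtain v where v: "v \<in> brieskorn_kernel f c" "u = brieskorn_an_incl f c v" by (rule imageE)
    then show "u \<in> carrier G.BC \<and> vanishes u" using incl_closed[of v] incl_vanishes[of _ v] unfolding K by simp
  next
    assume u: "u \<in> carrier G.BC \<and> vanishes u"
    then obtain k where "u \<in> filt k" using filt_exhaustive by blast
    then have "u \<in> filt 0" using u filt_0 by blast
    then obtain v where v: "v \<in> carrier (brieskorn_an f c)" "u = brieskorn_an_incl f c v" using filt_0_incl by blast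
    have "v \<in> brieskorn_kernel f c" unfolding K using u v incl_vanishes[OF _ v(1)] by simp
    with v(2) show "u \<in> brieskorn_an_incl f c ` brieskorn_kernel f c" by (rule image_eqI)
  qed
  show ?thesis by (rule Set.set_eqI) (rule trans[OF I K'[symmetric]])
qed

end

theorem corollary0p4:
  fixes f :: "complex ^ 'n::{finite,linorder} \<Rightarrow> complex" and c :: complex
  assumes "CARD('n) \<ge> 2"
    and "polynomial_map f"
    and "\<not> f constant_on UNIV"
    and "finite (critical_points f)"
  shows "brieskorn_an_incl f c ` brieskorn_kernel f c =
    kernel (add_monoid (gauss_manin_an f c))
      (sum_group {x. f x = c} (\<lambda>x. add_monoid (local_gauss_manin f x)))
      (gauss_manin_an_to_locals f c)"
  using stalk_setting.incl_image_kernel[of f c] assms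
  by (simp add: stalk_setting_def stalk_setting_axioms_def global_setting_def)

end
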